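(* Let $G$ be a finite group such that $sd^*(G)>23/25$. Then $G$ is solvable.
   Context: For a finite group $G$, $L(G)$ denotes the lattice of all subgroups of $G$. The subgroup commutativity degree of $G$ is $$sd(G)=\frac{1}{|L(G)|^2}\,\left|\{(H,K)\in L(G)^2 \mid HK=KH\}\right|.$$ Define $sd^*(G)=\min\{sd(S)\mid S \text{ is a section of } G\}$, where a section of $G$ is a quotient $H/N$ with $N\trianglelefteq H\le G$. *)

theory Defs
  imports "HOL-Algebra.Algebra" Complex_Main
begin

definition subgroups_of :: "('a, 'b) monoid_scheme \<Rightarrow> 'a set set" where
  "subgroups_of G = {H. subgroup H G}"

definition sd :: "('a, 'b) monoid_scheme \<Rightarrow> real" where
  "sd G = real (card {(H, K). H \<in> subgroups_of G \<and> K \<in> subgroups_of G \<and>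
                        H <#>\<^bsub>G\<^esub> K = K <#>\<^bsub>G\<^esub> H})
          / (real (card (subgroups_of G)))^2"

definition sections :: "('a, 'b) monoid_scheme \<Rightarrow> 'a set monoid set" where
  "sections G = {(G\<lparr>carrier := H\<rparr>) Mod N | H N. subgroup H G \<and> N \<lhd> (G\<lparr>carrier := H\<rparr>)}"

definition sd_star :: "('a, 'b) monoid_scheme \<Rightarrow> real" where
  "sd_star G = Min (sd ` sections G)"

end

theory Submission
 imports Defs "HOL-Combinatorics.Perm"
begin

text \<open>Call a group good if all its sections have subgroup commutativity degree above 23/25, and let \<open>G\<close>
 be a minimal insoluble good group. The bound excludes small sections such as a non-trivial irreducible
 action of a group of prime order on an elementary abelian group of order \<open>p\<close> or \<open>p\<^sup>2\<close>. This gives the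
 proper subgroups \<open>p\<close>-length one, and by transfer the Sylow subgroups of \<open>G\<close> are abelian, of rank
 at least three. Signalizer arguments (transitivity on maximal invariant \<open>q\<close>-subgroups, then uniqueness) put
 every Sylow subgroup \<open>P\<close> in a unique maximal subgroup, which contains the normalizers of all non-trivial
 subgroups of \<open>P\<close>. Hence two proper subgroups rarely permute with each other's conjugates, and
 averaging over \<open>G\<close> shows that too few pairs of subgroups of \<open>G\<close> itself permute.\<close>

hide_const (open) Divisibility.prime

section \<open>Finite groups inside a type\<close>

text \<open>The constant is the degree of the dihedral group of order 8: among its 100 ordered pairs
  of subgroups exactly 8 fail to permute. The strict bound excludes this group as a section, and the
  same count excludes its analogues of order p^3, generated by two elements of order p whose
  commutator is central. Together with the irreducible actions this is all that is extracted from
  the hypothesis before the final count. It is needed in subgroups, quotients and quotients of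
  subgroups alike, which is why all sections are involved. The obstacle is that a minimal
  counterexample offers little beyond simplicity and solvable proper subgroups. The excluded
  sections overcome it: dihedral configurations force odd order by an elementary argument on
  involutions, and p-length one with abelian Sylow subgroups replaces the deep local analysis of
  groups of odd order. In the final count at least one third of the pairs of proper non-trivial
  subgroups do not permute, far more than the 2/25 allowed.\<close>

class group_mult = monoid_mult + inverse +
 assumes left_inv [simp]: "inverse a * a = 1"
begin

lemma inv_mult_cancel [simp]: "inverse a * (a * b) = b"
 by (simp flip: mult.assoc)

lemma right_inv [simp]: "a * inverse a = 1"
proof -
 have "a * inverse a = inverse (inverse a) * (inverse a * (a * inverse a))"
  by (metis inv_mult_cancel)
 also have "\<dots> = 1" by simp
 finally show ?thesis .
qed

lemma mult_inv_cancel [simp]: "a * (inverse a * b) = b"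
 by (simp flip: mult.assoc)

lemma inv_inv [simp]: "inverse (inverse a) = a"
 by (metis inv_mult_cancel left_inv mult_1_right)

lemma inv_one [simp]: "inverse 1 = 1"
 by (metis left_inv mult_1_right)

lemma inv_mult: "inverse (a * b) = inverse b * inverse a"
proof -
 have "inverse (a * b) = inverse (a * b) * (a * b) * (inverse b * inverse a)"
  by (simp only: mult.assoc mult_inv_cancel right_inv mult_1_right)
 thus ?thesis by simp
qed

lemma inv_eq_one_iff [simp]: "inverse a = 1 \<longleftrightarrow> a = 1"
 by (metis inv_inv inv_one)

lemma left_cancel [simp]: "a * b = a * c \<longleftrightarrow> b = c"
 by (metis inv_mult_cancel)

lemma right_cancel [simp]: "b * a = c * a \<longleftrightarrow> b = c"
 by (metis mult.assoc mult_1_right right_inv)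

lemma inv_inject [simp]: "inverse a = inverse b \<longleftrightarrow> a = b"
 by (metis inv_inv)

lemma mult_eq_one_iff: "a * b = 1 \<longleftrightarrow> b = inverse a"
 by (metis inv_mult_cancel mult_1_right right_inv)

lemma mult_inv_eq_iff: "a * inverse b = c \<longleftrightarrow> a = c * b"
proof
 assume "a * inverse b = c"
 hence "a * inverse b * b = c * b" by simp
 thus "a = c * b" by (simp add: mult.assoc)
qed (simp add: mult.assoc)

lemma inv_unique: "a * b = 1 \<Longrightarrow> inverse a = b"
 by (simp add: mult_eq_one_iff)

end

lemmas gsimps = mult.assoc inv_mult

instance perm :: (type) group_mult
 by standard simp

definition cj :: "'a::group_mult \<Rightarrow> 'a \<Rightarrow> 'a" where
 "cj g x = g * x * inverse g"

definition cm :: "'a::group_mult \<Rightarrow> 'a \<Rightarrow> 'a" where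
 "cm x y = x * y * inverse x * inverse y"

text \<open>Finiteness is part of the notion, so that orders can be compared without side
  conditions.\<close>

definition grp :: "'a::group_mult set \<Rightarrow> bool" where
 "grp H \<longleftrightarrow> finite H \<and> 1 \<in> H \<and> (\<forall>x\<in>H. \<forall>y\<in>H. x * y \<in> H) \<and> (\<forall>x\<in>H. inverse x \<in> H)"

text \<open>Only finite groups enter the intersection. If no finite group contains \<open>A\<close>,
  the family is empty and the result is the whole type; hence the ambient group \<open>L\<close>
  with \<open>A \<subseteq> L\<close> in the lemmas on \<open>gen\<close>.\<close>

definition gen :: "'a::group_mult set \<Rightarrow> 'a set" where
 "gen A = \<Inter>{H. grp H \<and> A \<subseteq> H}"

definition prd :: "'a::group_mult set \<Rightarrow> 'a set \<Rightarrow> 'a set" where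
 "prd A B = (\<lambda>(a, b). a * b) ` (A \<times> B)"

definition nz :: "'a::group_mult set \<Rightarrow> 'a set \<Rightarrow> 'a set" where
 "nz L A = {g \<in> L. cj g ` A = A}"

definition cz :: "'a::group_mult set \<Rightarrow> 'a set \<Rightarrow> 'a set" where
 "cz L A = {g \<in> L. \<forall>a\<in>A. g * a = a * g}"

definition nml :: "'a::group_mult set \<Rightarrow> 'a set \<Rightarrow> bool" where
 "nml N L \<longleftrightarrow> grp N \<and> grp L \<and> N \<subseteq> L \<and> (\<forall>g\<in>L. \<forall>n\<in>N. cj g n \<in> N)"

lemma cj_one [simp]: "cj 1 x = x" "cj g 1 = 1"
 by (simp_all add: cj_def)

lemma cj_mult: "cj g (x * y) = cj g x * cj g y"
 by (simp add: cj_def gsimps)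

lemma cj_inv: "cj g (inverse x) = inverse (cj g x)"
 by (simp add: cj_def gsimps)

lemma cj_cj: "cj g (cj h x) = cj (g * h) x"
 by (simp add: cj_def gsimps)

lemma cj_inv_cancel [simp]: "cj (inverse g) (cj g x) = x" "cj g (cj (inverse g) x) = x"
 by (simp_all add: cj_cj)

lemma cj_inject [simp]: "cj g x = cj g y \<longleftrightarrow> x = y"
 by (simp add: cj_def)

lemma inj_cj: "inj_on (cj g) A"
 by (simp add: inj_on_def)

lemma cj_eq_one [simp]: "cj g x = 1 \<longleftrightarrow> x = 1"
 by (metis cj_one(2) cj_inject)

lemma cj_pow: "cj g (x ^ n) = cj g x ^ n"
 by (induction n) (simp_all add: cj_mult)

lemma cj_eq_iff: "cj g x = x \<longleftrightarrow> g * x = x * g"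
 by (simp add: cj_def mult_inv_eq_iff)

lemma cj_cm: "cj g x = cm g x * x"
 by (simp add: cj_def cm_def gsimps)

lemma cj_cm_distrib: "cj g (cm x y) = cm (cj g x) (cj g y)"
 by (simp add: cj_def cm_def gsimps)

lemma cm_eq_one: "cm x y = 1 \<longleftrightarrow> x * y = y * x"
 by (simp add: cm_def mult_inv_eq_iff)

lemma cm_inverse: "inverse (cm x y) = cm y x"
 by (simp add: cm_def gsimps)

lemma cj_img_comp: "cj g ` (cj h ` A) = cj (g * h) ` A"
 by (simp add: image_image cj_cj)

lemma cj_img_one [simp]: "cj 1 ` A = A"
 by (simp add: image_def)

lemma cj_img_cancel [simp]: "cj (inverse g) ` (cj g ` A) = A" "cj g ` (cj (inverse g) ` A) = A"
 by (simp_all add: image_image)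

lemma card_cj [simp]: "card (cj g ` A) = card A"
 by (simp add: card_image inj_cj)

lemma pow_inv: "inverse x ^ n = inverse (x ^ n)" for x :: "'a::group_mult"
 by (induction n) (simp_all add: power_commutes flip: inv_mult)

lemma power_diff_group: "m \<le> n \<Longrightarrow> x ^ (n - m) = x ^ n * inverse (x ^ m)" for x :: "'a::group_mult"
 by (metis le_add_diff_inverse2 mult.assoc mult_1_right power_add right_inv)

section \<open>Subgroups, normalizers and centralizers\<close>

lemma grpD:
 assumes "grp H"
 shows "finite H" "1 \<in> H" "x \<in> H \<Longrightarrow> y \<in> H \<Longrightarrow> x * y \<in> H" "x \<in> H \<Longrightarrow> inverse x \<in> H"
  "x \<in> H \<Longrightarrow> x ^ n \<in> H" "x \<in> H \<Longrightarrow> y \<in> H \<Longrightarrow> cj x y \<in> H" "x \<in> H \<Longrightarrow> y \<in> H \<Longrightarrow> cm x y \<in> H"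
  "card H > 0" "H \<noteq> {}"
proof -
 show 0: "finite H" "1 \<in> H" "x \<in> H \<Longrightarrow> y \<in> H \<Longrightarrow> x * y \<in> H" "x \<in> H \<Longrightarrow> inverse x \<in> H" for x y
  using assms by (auto simp: grp_def)
 show "x \<in> H \<Longrightarrow> x ^ n \<in> H" by (induction n) (auto simp: 0)
 show "x \<in> H \<Longrightarrow> y \<in> H \<Longrightarrow> cj x y \<in> H" "x \<in> H \<Longrightarrow> y \<in> H \<Longrightarrow> cm x y \<in> H"
  by (auto simp: cj_def cm_def 0)
 show "card H > 0" "H \<noteq> {}" using 0(1,2) by (auto simp: card_gt_0_iff)
qed

lemma grp_cancel:
 assumes "grp H" "x \<in> H"
 shows "x * y \<in> H \<longleftrightarrow> y \<in> H" "y * x \<in> H \<longleftrightarrow> y \<in> H"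
proof -
 have i: "inverse x \<in> H" using assms grpD(4) by blast
 show "x * y \<in> H \<longleftrightarrow> y \<in> H"
  using grpD(3)[OF assms(1) i, of "x * y"] grpD(3)[OF assms, of y] by auto
 have "(y * x) * inverse x = y" by (simp add: mult.assoc)
 thus "y * x \<in> H \<longleftrightarrow> y \<in> H"
  using grpD(3)[OF assms(1) _ i, of "y * x"] grpD(3)[OF assms(1) _ assms(2), of y] by auto
qed

lemma grp_inv_iff: "grp H \<Longrightarrow> inverse x \<in> H \<longleftrightarrow> x \<in> H"
 by (metis grpD(4) inv_inv)

lemma grpI:
 assumes "finite H" "1 \<in> H" "\<And>x y. x \<in> H \<Longrightarrow> y \<in> H \<Longrightarrow> x * y \<in> H" "\<And>x. x \<in> H \<Longrightarrow> inverse x \<in> H"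
 shows "grp H"
 using assms by (auto simp: grp_def)

lemma grp_one [simp]: "grp {1}"
 by (auto simp: grp_def)

lemma grp_Int: "grp H \<Longrightarrow> grp K \<Longrightarrow> grp (H \<inter> K)"
 by (auto simp: grp_def)

lemma grp_cj: "grp H \<Longrightarrow> grp (cj g ` H)"
 by (auto simp: grp_def simp flip: cj_mult cj_inv)

lemma grp_cz: "grp L \<Longrightarrow> grp (cz L A)"
proof (rule grpI, goal_cases)
 case 1 thus ?case by (auto simp: cz_def grpD)
next
 case 2 thus ?case by (auto simp: cz_def grpD)
next
 case (3 x y) thus ?case by (auto simp: cz_def grpD) (metis mult.assoc)
next
 case (4 x)
 have "inverse x * a = a * inverse x" if "a \<in> A" for a
 proof -
  have "x * a = a * x" using 4 that by (auto simp: cz_def)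
  hence "inverse x * (x * a) * inverse x = inverse x * (a * x) * inverse x" by simp
  thus ?thesis by (simp add: gsimps)
 qed
 thus ?case using 4 by (auto simp: cz_def grpD)
qed

lemma grp_nz: "grp L \<Longrightarrow> grp (nz L A)"
proof (rule grpI, goal_cases)
 case (3 x y)
 hence "x * y \<in> L" "cj (x * y) ` A = A" by (auto simp: nz_def grpD simp flip: cj_img_comp)
 thus ?case by (simp add: nz_def)
next
 case (4 x)
 hence "inverse x \<in> L" "cj (inverse x) ` A = A"
  by (auto simp: nz_def grpD) (metis cj_img_cancel(1) image_eqI, metis cj_img_cancel(1) image_eqI)
 thus ?case by (simp add: nz_def)
qed (auto simp: nz_def grpD)

lemma nz_sub: "nz L A \<subseteq> L" and cz_sub: "cz L A \<subseteq> L"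
 by (auto simp: nz_def cz_def)

lemma nzI:
 assumes "finite A" "g \<in> L" "\<And>a. a \<in> A \<Longrightarrow> cj g a \<in> A"
 shows "g \<in> nz L A"
proof -
 have "cj g ` A = A"
  by (rule card_subset_eq) (use assms in auto)
 thus ?thesis using assms by (simp add: nz_def)
qed

lemma nz_self: "grp H \<Longrightarrow> H \<subseteq> L \<Longrightarrow> H \<subseteq> nz L H"
 by (intro subsetI nzI) (auto simp: grpD)

lemma cz_sub_nz: "cz L A \<subseteq> nz L A"
proof
 fix g assume g: "g \<in> cz L A"
 hence "cj g a = a" if "a \<in> A" for a using that by (simp add: cz_def cj_eq_iff)
 thus "g \<in> nz L A" using g by (simp add: nz_def cz_def)
qed

lemma nz_D: "g \<in> nz L A \<Longrightarrow> a \<in> A \<Longrightarrow> cj g a \<in> A"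
 using imageI[of a A "cj g"] by (simp add: nz_def)

lemma cz_mono: "L \<subseteq> Y \<Longrightarrow> B \<subseteq> A \<Longrightarrow> cz L A \<subseteq> cz Y B"
 by (auto simp: cz_def)

lemma nmlD:
 assumes "nml N L"
 shows "grp N" "grp L" "N \<subseteq> L" "g \<in> L \<Longrightarrow> n \<in> N \<Longrightarrow> cj g n \<in> N" "g \<in> L \<Longrightarrow> cj g ` N = N"
proof -
 show 0: "grp N" "grp L" "N \<subseteq> L" "g \<in> L \<Longrightarrow> n \<in> N \<Longrightarrow> cj g n \<in> N" for n
  using assms by (auto simp: nml_def)
 show "cj g ` N = N" if g: "g \<in> L"
 proof (rule card_subset_eq)
  show "finite N" using 0(1) grpD(1) by blast
  show "cj g ` N \<subseteq> N" using 0(4)[OF g] by blast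
 qed simp
qed

lemma nml_nz: "grp A \<Longrightarrow> grp L \<Longrightarrow> A \<subseteq> L \<Longrightarrow> nml A (nz L A)"
 unfolding nml_def by (intro conjI ballI grp_nz nz_self) (auto intro: nz_D)

lemma nml_iff_nz: "grp A \<Longrightarrow> grp L \<Longrightarrow> A \<subseteq> L \<Longrightarrow> nml A L \<longleftrightarrow> nz L A = L"
proof
 assume "nml A L"
 thus "nz L A = L" using nmlD(5)[of A L] unfolding nz_def by blast
next
 assume "grp A" "grp L" "A \<subseteq> L" "nz L A = L"
 thus "nml A L" using nml_nz[of A L] by simp
qed

lemma nml_Int: "nml N L \<Longrightarrow> grp Y \<Longrightarrow> Y \<subseteq> L \<Longrightarrow> nml (N \<inter> Y) Y"
 by (auto simp: nml_def grp_Int grpD)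

lemma nml_refl: "grp L \<Longrightarrow> nml L L" and nml_one: "grp L \<Longrightarrow> nml {1} L"
 by (auto simp: nml_def grpD)

lemma nml_cz: "nml A L \<Longrightarrow> nml (cz L A) L"
proof -
 assume A: "nml A L"
 have "cj g n \<in> cz L A" if g: "g \<in> L" and n: "n \<in> cz L A" for g n
 proof -
  have "cj g n * a = a * cj g n" if a: "a \<in> A" for a
  proof -
   have "cj (inverse g) a \<in> A" using A g a by (meson grpD(4) nmlD(2,4))
   hence "n * cj (inverse g) a = cj (inverse g) a * n" using n by (auto simp: cz_def)
   hence "cj g (n * cj (inverse g) a) = cj g (cj (inverse g) a * n)" by simp
   thus ?thesis by (simp add: cj_mult)
  qed
  thus ?thesis using g n nmlD(2)[OF A] by (auto simp: cz_def grpD)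
 qed
 thus ?thesis using A by (auto simp: nml_def grp_cz cz_sub[THEN subsetD])
qed

lemma cj_nml: "nml N L \<Longrightarrow> nml (cj g ` N) (cj g ` L)"
 unfolding nml_def
 by (auto simp: grp_cj) (metis cj_def cj_inv cj_mult image_eqI)

lemma cj_cz: "cj g ` cz L A = cz (cj g ` L) (cj g ` A)"
 by (auto simp: cz_def simp flip: cj_mult)

section \<open>Generated subgroups\<close>

lemma gen_sub: "A \<subseteq> H \<Longrightarrow> grp H \<Longrightarrow> gen A \<subseteq> H"
 by (auto simp: gen_def)

lemma gen_inc: "A \<subseteq> gen A"
 by (auto simp: gen_def)

lemma grp_gen:
 assumes A: "A \<subseteq> L" "grp L"
 shows "grp (gen A)"
proof (rule grpI)
 have "gen A \<subseteq> L" using A by (rule gen_sub)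
 thus "finite (gen A)" using A(2) grpD(1) finite_subset by blast
 show "1 \<in> gen A" unfolding gen_def using grpD(2) by blast
 show "x * y \<in> gen A" if "x \<in> gen A" "y \<in> gen A" for x y
  using that unfolding gen_def using grpD(3) by blast
 show "inverse x \<in> gen A" if "x \<in> gen A" for x
  using that unfolding gen_def using grpD(4) by blast
qed

lemma gen_cj_closed:
 assumes "A \<subseteq> L" "grp L" "\<And>a. a \<in> A \<Longrightarrow> cj g a \<in> gen A" "x \<in> gen A"
 shows "cj g x \<in> gen A"
proof -
 have "gen A \<subseteq> cj (inverse g) ` gen A"
 proof (rule gen_sub)
  show "A \<subseteq> cj (inverse g) ` gen A"
   using assms(3) by (metis cj_inv_cancel(1) image_eqI subsetI)
 qed (use assms grp_gen grp_cj in blast)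
 thus ?thesis using assms(4) by auto
qed

lemma gen_nml:
 assumes "A \<subseteq> L" "grp L" "\<And>a g. a \<in> A \<Longrightarrow> g \<in> L \<Longrightarrow> cj g a \<in> gen A"
 shows "nml (gen A) L"
 unfolding nml_def
proof (intro conjI ballI)
 show "grp (gen A)" "grp L" "gen A \<subseteq> L" using assms(1,2) by (auto intro: grp_gen dest: gen_sub)
 show "cj g n \<in> gen A" if "g \<in> L" "n \<in> gen A" for g n
  by (rule gen_cj_closed[OF assms(1,2) _ that(2)]) (use assms(3) that in blast)
qed

lemma gen_comm:
 assumes "A \<subseteq> L" "grp L" "\<And>a b. a \<in> A \<Longrightarrow> b \<in> B \<Longrightarrow> a * b = b * a" "x \<in> gen A" "b \<in> B"
 shows "x * b = b * x"
proof -
 have "A \<subseteq> cz L B" using assms by (auto simp: cz_def)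
 hence "gen A \<subseteq> cz L B" using gen_sub grp_cz assms(2) by blast
 thus ?thesis using assms(4,5) by (auto simp: cz_def)
qed

lemma gen_abelian:
 assumes "A \<subseteq> L" "grp L" "\<And>a b. a \<in> A \<Longrightarrow> b \<in> A \<Longrightarrow> a * b = b * a" "x \<in> gen A" "y \<in> gen A"
 shows "x * y = y * x"
proof (rule gen_comm[OF assms(1,2) _ assms(4,5)])
 fix a b assume "a \<in> A" "b \<in> gen A"
 thus "a * b = b * a" using gen_comm[of A L A b a] assms by metis
qed

section \<open>Products of subgroups and permutability\<close>

lemma prd_iff: "x \<in> prd A B \<longleftrightarrow> (\<exists>a\<in>A. \<exists>b\<in>B. x = a * b)"
 by (auto simp: prd_def)

lemma prdI: "a \<in> A \<Longrightarrow> b \<in> B \<Longrightarrow> a * b \<in> prd A B"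
 by (auto simp: prd_def)

lemma finite_prd: "finite A \<Longrightarrow> finite B \<Longrightarrow> finite (prd A B)"
 by (simp add: prd_def)

lemma prd_sub1: "grp A \<Longrightarrow> grp B \<Longrightarrow> A \<subseteq> prd A B" and prd_sub2: "grp A \<Longrightarrow> grp B \<Longrightarrow> B \<subseteq> prd A B"
 by (auto simp: prd_iff) (metis grpD(2) mult_1_right, metis grpD(2) mult_1_left)

lemma prd_least: "A \<subseteq> H \<Longrightarrow> B \<subseteq> H \<Longrightarrow> grp H \<Longrightarrow> prd A B \<subseteq> H"
 using grpD(3) by (fastforce simp: prd_iff)

text \<open>The bridge from permutability to subgroups: once \<open>prd A B\<close> is known to be a
  group, its order is governed by Lagrange's theorem and \<open>card_prd\<close>, and this is how
  pairs are shown not to permute.\<close>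

lemma grp_prd_iff:
 assumes "grp A" "grp B"
 shows "grp (prd A B) \<longleftrightarrow> prd A B = prd B A"
proof
 assume g: "grp (prd A B)"
 have "x \<in> prd B A" if "x \<in> prd A B" for x
 proof -
  have "inverse x \<in> prd A B" using g that grpD(4) by blast
  then obtain a b where "a \<in> A" "b \<in> B" "inverse x = a * b" by (auto simp: prd_iff)
  hence "x = inverse b * inverse a" by (metis inv_inv inv_mult)
  thus ?thesis using \<open>a \<in> A\<close> \<open>b \<in> B\<close> assms by (simp add: prdI grpD)
 qed
 moreover have "x \<in> prd A B" if x: "x \<in> prd B A" for x
 proof -
  obtain b a where "b \<in> B" "a \<in> A" "x = b * a" using x by (auto simp: prd_iff)
  thus ?thesis using prd_sub1[OF assms] prd_sub2[OF assms] g grpD(3) by blast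
 qed
 ultimately show "prd A B = prd B A" by auto
next
 assume e: "prd A B = prd B A"
 show "grp (prd A B)"
 proof (rule grpI)
  show "finite (prd A B)" using assms by (simp add: finite_prd grpD)
  show "1 \<in> prd A B" using assms by (metis grpD(2) mult_1_right prdI)
  fix x assume "x \<in> prd A B"
  then obtain a b where x: "a \<in> A" "b \<in> B" "x = a * b" by (auto simp: prd_iff)
  have "inverse x \<in> prd B A" using x assms by (simp add: inv_mult prdI grpD)
  thus "inverse x \<in> prd A B" using e by simp
  fix y assume "y \<in> prd A B"
  then obtain c d where y: "c \<in> A" "d \<in> B" "y = c * d" by (auto simp: prd_iff)
  have "b * c \<in> prd A B" using x y e by (simp add: prdI)
  then obtain c' b' where "c' \<in> A" "b' \<in> B" "b * c = c' * b'" by (auto simp: prd_iff)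
  have "x * y = a * (b * c) * d" using x y by (simp add: mult.assoc)
  also have "\<dots> = (a * c') * (b' * d)" using \<open>b * c = c' * b'\<close> by (simp add: mult.assoc)
  finally show "x * y \<in> prd A B"
   using x y \<open>c' \<in> A\<close> \<open>b' \<in> B\<close> assms by (simp add: prdI grpD)
 qed
qed

lemma prd_commute:
 assumes "grp N" "grp K" "\<And>k n. k \<in> K \<Longrightarrow> n \<in> N \<Longrightarrow> cj k n \<in> N"
 shows "prd N K = prd K N"
proof -
 have 1: "n * k = k * cj (inverse k) n" "k * n = cj k n * k" for n k :: 'a
  by (simp_all add: cj_def gsimps)
 show ?thesis
 proof (intro equalityI subsetI)
  fix x assume "x \<in> prd N K"
  then obtain n k where "n \<in> N" "k \<in> K" "x = n * k" by (auto simp: prd_iff)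
  thus "x \<in> prd K N" using 1(1)[of n k] assms grpD(4)[OF assms(2)] by (metis prdI)
 next
  fix x assume "x \<in> prd K N"
  then obtain n k where "n \<in> N" "k \<in> K" "x = k * n" by (auto simp: prd_iff)
  thus "x \<in> prd N K" using 1(2)[of k n] assms by (metis prdI)
 qed
qed

lemma grp_prd:
 assumes "grp N" "grp K" "\<And>k n. k \<in> K \<Longrightarrow> n \<in> N \<Longrightarrow> cj k n \<in> N"
 shows "grp (prd N K)"
 using prd_commute[OF assms] grp_prd_iff assms(1,2) by blast

lemma grp_prd_nml: "nml N L \<Longrightarrow> grp K \<Longrightarrow> K \<subseteq> L \<Longrightarrow> grp (prd N K)"
 by (meson grp_prd nmlD(1,4) subsetD)

lemma prd_sub_nml: "nml N L \<Longrightarrow> K \<subseteq> L \<Longrightarrow> prd N K \<subseteq> L"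
 by (meson nmlD(2,3) prd_least)

text \<open>The commutator of a and b is a product of two elements of \<open>B\<close> and also a
  product of two elements of \<open>A\<close>, so it lies in the trivial intersection.\<close>

lemma nml_commute:
 assumes "nml A L" "nml B L" "A \<inter> B = {1}" "a \<in> A" "b \<in> B" shows "a * b = b * a"
proof -
 have L: "a \<in> L" "b \<in> L" using assms nmlD(3) by blast+
 have e: "cm a b = cj a b * inverse b" "cm a b = a * cj b (inverse a)" by (simp_all add: cm_def cj_def mult.assoc)
 have "cm a b \<in> B" unfolding e(1)
  by (rule grpD(3)[OF nmlD(1)[OF assms(2)] nmlD(4)[OF assms(2) L(1) assms(5)] grpD(4)[OF nmlD(1)[OF assms(2)] assms(5)]])
 moreover have "cm a b \<in> A" unfolding e(2)
  by (rule grpD(3)[OF nmlD(1)[OF assms(1)] assms(4) nmlD(4)[OF assms(1) L(2) grpD(4)[OF nmlD(1)[OF assms(1)] assms(4)]]])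
 ultimately have "cm a b = 1" using assms(3) by blast
 thus ?thesis by (simp add: cm_eq_one)
qed

lemma nml_prd_left:
 assumes "grp N" "grp K" "\<And>k n. k \<in> K \<Longrightarrow> n \<in> N \<Longrightarrow> cj k n \<in> N" shows "nml N (prd N K)"
 unfolding nml_def
proof (intro conjI ballI assms(1) grp_prd[OF assms] prd_sub1[OF assms(1,2)])
 fix h n assume h: "h \<in> prd N K" and n: "n \<in> N"
 then obtain w j where "w \<in> N" "j \<in> K" "h = w * j" by (auto simp: prd_iff)
 thus "cj h n \<in> N" using assms(3)[of j n] n grpD(6)[OF assms(1)] by (simp flip: cj_cj)
qed

lemma grp_prd_comm:
 assumes "grp A" "grp B" "\<And>a b. a \<in> A \<Longrightarrow> b \<in> B \<Longrightarrow> a * b = b * a" shows "grp (prd A B)"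
 by (rule grp_prd[OF assms(1,2)]) (use assms(3) in "simp add: cj_eq_iff[THEN iffD2]")

subsection \<open>Counting\<close>

lemma card_fibres:
 assumes "finite A" "\<And>b. b \<in> f ` A \<Longrightarrow> card {a \<in> A. f a = b} = k"
 shows "card A = card (f ` A) * k"
proof -
 have "(\<Sum>a\<in>A. 1) = (\<Sum>b\<in>f ` A. \<Sum>a | a \<in> A \<and> f a = b. 1::nat)"
  by (rule sum.image_gen[OF assms(1)])
 hence "card A = (\<Sum>b\<in>f ` A. card {a \<in> A. f a = b})" by simp
 thus ?thesis using assms(2) by simp
qed

definition lcs :: "'a::group_mult set \<Rightarrow> 'a set \<Rightarrow> 'a set set" where
 "lcs L H = (\<lambda>x. (*) x ` H) ` L"

lemma coset_eq_iff:
 assumes "grp H"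
 shows "(*) x ` H = (*) y ` H \<longleftrightarrow> inverse x * y \<in> H"
proof
 assume "(*) x ` H = (*) y ` H"
 hence "y \<in> (*) x ` H" using grpD(2)[OF assms] by (metis image_eqI mult_1_right)
 thus "inverse x * y \<in> H" by auto
next
 assume h: "inverse x * y \<in> H"
 have "(*) y ` H = (*) x ` (*) (inverse x * y) ` H" by (simp add: image_image gsimps)
 also have "(*) (inverse x * y) ` H = H"
 proof (rule card_subset_eq)
  show "card ((*) (inverse x * y) ` H) = card H" by (rule card_image) (simp add: inj_on_def)
  show "finite H" using assms by (rule grpD)
  show "(*) (inverse x * y) ` H \<subseteq> H" using grpD(3)[OF assms h] by blast
 qed
 finally show "(*) x ` H = (*) y ` H" by simp
qed

lemma card_coset [simp]: "card ((*) x ` H) = card H" for x :: "'a::group_mult"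
 by (rule card_image) (simp add: inj_on_def)

lemma lcs_closed: assumes "grp L" "g \<in> L" "s \<in> lcs L H" shows "(*) g ` s \<in> lcs L H"
proof -
 obtain x where x: "x \<in> L" "s = (*) x ` H" using assms(3) by (auto simp: lcs_def)
 hence "(*) g ` s = (*) (g * x) ` H" by (simp add: image_image mult.assoc)
 thus ?thesis using grpD(3)[OF assms(1,2) x(1)] by (simp add: lcs_def)
qed

lemma lagrange:
 assumes "grp L" "grp H" "H \<subseteq> L"
 shows "card L = card (lcs L H) * card H"
 unfolding lcs_def
proof (rule card_fibres)
 fix c assume "c \<in> (\<lambda>x. (*) x ` H) ` L"
 then obtain x where x: "x \<in> L" "c = (*) x ` H" by auto
 have "{a \<in> L. (*) a ` H = c} = c"
 proof -
  have e: "(*) a ` H = c \<longleftrightarrow> inverse x * a \<in> H" for a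
   unfolding x(2) using coset_eq_iff[OF assms(2), of x a] by metis
  have "a \<in> c \<longleftrightarrow> inverse x * a \<in> H" for a
   unfolding x(2) by (metis image_iff inv_mult_cancel mult_inv_cancel)
  moreover have "c \<subseteq> L" unfolding x(2) using x(1) assms grpD(3) by blast
  ultimately show ?thesis unfolding e by blast
 qed
 thus "card {a \<in> L. (*) a ` H = c} = card H" using x by simp
qed (simp add: assms grpD(1))

lemma lagrange_dvd: "grp L \<Longrightarrow> grp H \<Longrightarrow> H \<subseteq> L \<Longrightarrow> card H dvd card L"
 using lagrange by (metis dvd_triv_right)

text \<open>The fibre of multiplication over h k consists of the pairs (h d, d^-1 k) with d in
  \<open>H \<inter> K\<close>.\<close>

lemma card_prd:
 assumes "grp H" "grp K"
 shows "card (prd H K) * card (H \<inter> K) = card H * card K"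
proof -
 have "card (H \<times> K) = card (prd H K) * card (H \<inter> K)"
  unfolding prd_def
 proof (rule card_fibres)
  fix b assume "b \<in> (\<lambda>(a, b). a * b) ` (H \<times> K)"
  then obtain h k where hk: "h \<in> H" "k \<in> K" "b = h * k" by auto
  have "bij_betw (\<lambda>d. (h * d, inverse d * k)) (H \<inter> K) {a \<in> H \<times> K. (case a of (a, b) \<Rightarrow> a * b) = b}"
   unfolding bij_betw_def
  proof
   show "inj_on (\<lambda>d. (h * d, inverse d * k)) (H \<inter> K)" by (auto simp: inj_on_def)
   have "(a, c) \<in> (\<lambda>d. (h * d, inverse d * k)) ` (H \<inter> K)" if "a \<in> H" "c \<in> K" "a * c = h * k" for a c
   proof (rule image_eqI)
    have e: "inverse h * a = k * inverse c"
     using that(3) by (metis mult.assoc inv_mult_cancel mult_1_right right_inv)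
    have "inverse (inverse h * a) * k = c" unfolding e by (simp add: gsimps)
    thus "(a, c) = (h * (inverse h * a), inverse (inverse h * a) * k)"
     by (simp only: mult_inv_cancel)
    show "inverse h * a \<in> H \<inter> K" using that hk assms e by (metis IntI grpD(3,4))
   qed
   thus "(\<lambda>d. (h * d, inverse d * k)) ` (H \<inter> K) = {a \<in> H \<times> K. (case a of (a, b) \<Rightarrow> a * b) = b}"
    using hk assms by (auto simp: gsimps grpD)
  qed
  thus "card {a \<in> H \<times> K. (case a of (a, b) \<Rightarrow> a * b) = b} = card (H \<inter> K)"
   using bij_betw_same_card by fastforce
 qed (simp add: assms grpD(1))
 thus ?thesis by (simp add: card_cartesian_product)
qed

lemma subgroup_eq_card: "grp L \<Longrightarrow> H \<subseteq> L \<Longrightarrow> card L \<le> card H \<Longrightarrow> H = L"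
 by (simp add: card_seteq grpD(1))

text \<open>For x in \<open>H\<close> and y outside \<open>H\<close> the product x y lies outside
  \<open>H\<close>, and x is recovered from x y and y. Used to extend a property from generic
  elements to a whole group.\<close>

lemma grp_complement_gen:
 assumes "grp L" "grp H" "H \<subset> L" "grp K" "L - H \<subseteq> K"
 shows "L \<subseteq> K"
proof
 fix x assume x: "x \<in> L"
 obtain y where y: "y \<in> L" "y \<notin> H" using assms(3) by auto
 show "x \<in> K"
 proof (cases "x \<in> H")
  case True
  hence "x * y \<in> L - H" using x y assms by (auto simp: grpD grp_cancel)
  hence "x * y \<in> K" "y \<in> K" using assms y by auto
  thus ?thesis using grp_cancel assms by blast
 qed (use x assms in auto)
qed

subsection \<open>Powers and cyclic subgroups\<close>

text \<open>Natural exponents suffice: in a finite group inverses are powers, so this is the cyclic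
  subgroup generated by x.\<close>

definition cyc :: "'a::group_mult \<Rightarrow> 'a set" where
 "cyc x = range (\<lambda>n::nat. x ^ n)"

lemma pow_finite_order:
 assumes "grp L" "x \<in> L"
 shows "\<exists>n>0. x ^ n = 1"
proof -
 have "\<not> inj (\<lambda>n::nat. x ^ n)"
 proof
  assume i: "inj (\<lambda>n::nat. x ^ n)"
  have "range (\<lambda>n::nat. x ^ n) \<subseteq> L" using grpD(5)[OF assms] by blast
  hence "finite (range (\<lambda>n::nat. x ^ n))" using grpD(1)[OF assms(1)] finite_subset by blast
  thus False using i finite_imageD infinite_UNIV_nat by blast
 qed
 then obtain m n :: nat where "m < n" "x ^ m = x ^ n"
  by (metis injI linorder_neqE_nat)
 hence "x ^ (n - m) = 1" by (simp add: power_diff_group)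
 thus ?thesis using \<open>m < n\<close> by (meson zero_less_diff)
qed

lemma grp_cyc: assumes "grp L" "x \<in> L" shows "grp (cyc x)" "cyc x \<subseteq> L" "gen {x} = cyc x"
proof -
 show s: "cyc x \<subseteq> L" using grpD(5)[OF assms] by (auto simp: cyc_def)
 show g: "grp (cyc x)"
 proof (rule grpI)
  show "finite (cyc x)" using s grpD(1)[OF assms(1)] finite_subset by blast
  show "1 \<in> cyc x" unfolding cyc_def using power_0[of x] by (metis rangeI)
  show "a * b \<in> cyc x" if ab: "a \<in> cyc x" "b \<in> cyc x" for a b
  proof -
   obtain m n where "a = x ^ m" "b = x ^ n" using ab by (auto simp: cyc_def)
   hence "a * b = x ^ (m + n)" by (simp add: power_add)
   thus ?thesis by (simp add: cyc_def)
  qed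
  show "inverse a \<in> cyc x" if a: "a \<in> cyc x" for a
  proof -
   obtain n where n: "n > 0" "a ^ n = 1" using pow_finite_order assms s a by blast
   have "inverse a = a ^ (n - 1)"
    using n by (intro inv_unique) (metis Suc_diff_1 power_Suc)
   moreover obtain m where "a = x ^ m" using a by (auto simp: cyc_def)
   ultimately have "inverse a = x ^ (m * (n - 1))" by (simp add: power_mult)
   thus ?thesis by (simp add: cyc_def)
  qed
 qed
 have "cyc x \<subseteq> H" if "grp H" "x \<in> H" for H using grpD(5)[OF that(1)] that(2) by (auto simp: cyc_def)
 moreover have "x \<in> cyc x" unfolding cyc_def using power_one_right[of x] by (metis rangeI)
 ultimately show "gen {x} = cyc x" using g by (auto simp: gen_def)
qed

lemma cyc_self [simp]: "x \<in> cyc x"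
 unfolding cyc_def using power_one_right[of x] by (metis rangeI)

lemma pow_in_cyc [simp]: "x ^ n \<in> cyc x"
 by (simp add: cyc_def)

lemma cyc_abelian: "a \<in> cyc x \<Longrightarrow> b \<in> cyc x \<Longrightarrow> a * b = b * a"
 by (auto simp: cyc_def simp flip: power_add) (simp add: add.commute)

lemma cyc_least: "grp H \<Longrightarrow> x \<in> H \<Longrightarrow> cyc x \<subseteq> H"
 using grpD(5)[of H x] by (auto simp: cyc_def)

definition od :: "'a::group_mult \<Rightarrow> nat" where
 "od x = (LEAST n. n > 0 \<and> x ^ n = 1)"

lemma od:
 assumes "grp L" "x \<in> L"
 shows "od x > 0" "x ^ od x = 1" "x ^ n = 1 \<longleftrightarrow> od x dvd n" "card (cyc x) = od x"
proof -
 have "od x > 0 \<and> x ^ od x = 1"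
  unfolding od_def using LeastI_ex[OF pow_finite_order[OF assms]] .
 thus 1: "od x > 0" "x ^ od x = 1" by auto
 have least: "od x \<le> n" if "n > 0" "x ^ n = 1" for n
  unfolding od_def using that by (intro Least_le) auto
 have md: "x ^ n = x ^ (n mod od x)" for n
 proof -
  have "x ^ n = x ^ (od x * (n div od x) + n mod od x)" by simp
  also have "\<dots> = x ^ (n mod od x)" by (simp only: power_add power_mult 1 power_one mult_1_left)
  finally show ?thesis .
 qed
 show "x ^ n = 1 \<longleftrightarrow> od x dvd n" for n
 proof
  assume "x ^ n = 1"
  hence "x ^ (n mod od x) = 1" using md by metis
  hence "n mod od x = 0" using least[of "n mod od x"] 1(1)
   by (metis linorder_not_less mod_less_divisor neq0_conv)
  thus "od x dvd n" by auto
 next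
  assume "od x dvd n"
  thus "x ^ n = 1" using md[of n] by simp
 qed
 have "cyc x = (\<lambda>n. x ^ n) ` {..<od x}"
  using md 1(1) by (auto simp: cyc_def) (metis image_eqI lessThan_iff mod_less_divisor)
 moreover have "inj_on (\<lambda>n. x ^ n) {..<od x}"
 proof -
  have "m = n" if "m \<le> n" "n < od x" "x ^ m = x ^ n" for m n
  proof (rule ccontr)
   assume "m \<noteq> n"
   hence "x ^ (n - m) = 1" "n - m > 0" using that by (simp_all add: power_diff_group)
   thus False using least[of "n - m"] that by simp
  qed
  thus ?thesis by (auto simp: inj_on_def) (metis nat_le_linear)
 qed
 ultimately show "card (cyc x) = od x" by (simp add: card_image)
qed

lemma pow_card:
 assumes "grp L" "x \<in> L"
 shows "x ^ card L = 1" "od x dvd card L"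
proof -
 show "od x dvd card L"
  using lagrange_dvd[OF assms(1) grp_cyc(1,2)[OF assms]] od(4)[OF assms] by simp
 thus "x ^ card L = 1" using od(3)[OF assms] by simp
qed

lemma od_eq_one: "grp L \<Longrightarrow> x \<in> L \<Longrightarrow> od x = 1 \<longleftrightarrow> x = 1"
 using od(3)[of L x 1] by simp

lemma od_prime:
 assumes "grp L" "x \<in> L" "x \<noteq> 1" "x ^ p = 1" "prime p"
 shows "od x = p"
proof -
 have "od x dvd p" "od x \<noteq> 1" using od(3)[OF assms(1,2), of p] od_eq_one assms by blast+
 thus ?thesis using assms(5) by (auto simp: prime_nat_iff)
qed

lemma pow_coprime_one:
 assumes "grp L" "x \<in> L" "x ^ m = 1" "x ^ n = 1" "coprime m n"
 shows "x = 1"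
proof -
 have "od x dvd m" "od x dvd n" using od(3)[OF assms(1,2)] assms by blast+
 hence "od x = 1" using assms(5) by (metis coprime_common_divisor_nat)
 thus ?thesis using od_eq_one assms by blast
qed

lemma pow_coprime_mem:
 assumes "grp L" "x \<in> L" "grp H" "x ^ m \<in> H" "coprime m (od x)"
 shows "x \<in> H"
proof -
 show ?thesis
 proof (cases "m = 0")
  case True
  hence "od x = 1" using assms(5) by simp
  hence "x = 1" using od_eq_one assms(1,2) by blast
  thus ?thesis using grpD(2)[OF assms(3)] by simp
 next
  case False
  then obtain a b where ab: "m * a = od x * b + 1"
   using bezout_nat[of m "od x"] assms(5) by auto
  have "(x ^ m) ^ a = (x ^ od x) ^ b * x"
   by (simp add: ab power_commutes flip: power_mult)
  also have "\<dots> = x" by (simp add: od(2)[OF assms(1,2)])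
  finally show ?thesis using grpD(5)[OF assms(3,4), of a] by simp
 qed
qed

subsection \<open>Actions of p-groups\<close>

text \<open>A cyclic group has at most one subgroup of order p, the one generated by the displayed
  power.\<close>

lemma cyc_order_p:
 assumes L: "grp L" "x \<in> L" and p: "prime p" "p dvd od x" and d: "d \<in> cyc x" "d ^ p = 1"
 shows "d \<in> cyc (x ^ (od x div p))"
proof -
 obtain i where i: "d = x ^ i" using d(1) by (auto simp: cyc_def)
 obtain m where m: "od x = p * m" using p(2) by blast
 have "p * m dvd i * p" using od(3)[OF L, of "i * p"] d(2) i m by (simp add: power_mult)
 hence "m dvd i" using prime_gt_0_nat[OF p(1)] by (simp add: mult.commute)
 then obtain j where "i = m * j" by blast
 thus ?thesis using i m prime_gt_0_nat[OF p(1)] by (simp add: power_mult)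
qed

definition pgr :: "nat \<Rightarrow> 'a::group_mult set \<Rightarrow> bool" where
 "pgr p P \<longleftrightarrow> grp P \<and> (\<exists>n. card P = p ^ n)"

text \<open>Points that are moved fall into orbits whose size divides a power of p and exceeds
  1.\<close>

lemma pgr_fix_cong:
 fixes act :: "'a::group_mult \<Rightarrow> 'b \<Rightarrow> 'b"
 assumes "pgr p P" "prime p" "finite S"
  and one: "\<And>s. s \<in> S \<Longrightarrow> act 1 s = s"
  and mul: "\<And>g h s. g \<in> P \<Longrightarrow> h \<in> P \<Longrightarrow> s \<in> S \<Longrightarrow> act (g * h) s = act g (act h s)"
  and clo: "\<And>g s. g \<in> P \<Longrightarrow> s \<in> S \<Longrightarrow> act g s \<in> S"
 shows "p dvd card {s \<in> S. \<exists>g\<in>P. act g s \<noteq> s}"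
proof -
 have P: "grp P" using assms(1) by (simp add: pgr_def)
 define orb where "orb s = (\<lambda>g. act g s) ` P" for s
 define M where "M = {s \<in> S. \<exists>g\<in>P. act g s \<noteq> s}"
 have act_inv: "act (inverse g) (act g s) = s" if "g \<in> P" "s \<in> S" for g s
  using mul[of "inverse g" g s] one that P by (simp add: grpD)
 have orb_eq: "orb t = orb s" if "t \<in> orb s" "s \<in> S" for s t
 proof -
  obtain g where g: "g \<in> P" "t = act g s" using \<open>t \<in> orb s\<close> by (auto simp: orb_def)
  have "orb t \<subseteq> orb s"
  proof
   fix u assume "u \<in> orb t"
   then obtain h where h: "h \<in> P" "u = act h (act g s)" using g by (auto simp: orb_def)
   hence "u = act (h * g) s" using mul[of h g s] g that by simp
   thus "u \<in> orb s" using g h P by (auto simp: orb_def grpD)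
  qed
  moreover have "orb s \<subseteq> orb t"
  proof
   fix u assume "u \<in> orb s"
   then obtain h where h: "h \<in> P" "u = act h s" by (auto simp: orb_def)
   have "act (h * inverse g) t = u"
    using mul[of "h * inverse g" g s] g h that P by (simp add: gsimps grpD)
   moreover have "h * inverse g \<in> P" using g h P by (simp add: grpD)
   ultimately show "u \<in> orb t" unfolding orb_def by blast
  qed
  ultimately show ?thesis by auto
 qed
 have orb_sub: "orb s \<subseteq> S" if "s \<in> S" for s using that clo by (auto simp: orb_def)
 have self: "s \<in> orb s" if "s \<in> S" for s
  unfolding orb_def using one[OF that] grpD(2)[OF P] by (metis image_eqI)
 have orb_card: "p dvd card (orb s)" if s: "s \<in> M" for s
 proof -
  have sS: "s \<in> S" using s by (simp add: M_def)
  define st where "st = {g \<in> P. act g s = s}"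
  have "card P = card (orb s) * card st"
   unfolding orb_def
  proof (rule card_fibres)
   fix t assume "t \<in> (\<lambda>g. act g s) ` P"
   then obtain h where h: "h \<in> P" "t = act h s" by auto
   have "{a \<in> P. act a s = t} = (*) h ` st"
   proof
    show "{a \<in> P. act a s = t} \<subseteq> (*) h ` st"
    proof
     fix a assume a: "a \<in> {a \<in> P. act a s = t}"
     have "act (inverse h * a) s = s"
      using mul[of "inverse h" a s] act_inv a h sS P by (auto simp: grpD)
     hence "inverse h * a \<in> st" using a h P by (auto simp: st_def grpD)
     thus "a \<in> (*) h ` st" by (metis image_eqI mult_inv_cancel)
    qed
    show "(*) h ` st \<subseteq> {a \<in> P. act a s = t}"
     using h sS P mul by (auto simp: st_def grpD)
   qed
   thus "card {a \<in> P. act a s = t} = card st" by simp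
  qed (simp add: P grpD(1))
  moreover obtain n where "card P = p ^ n" using assms(1) by (auto simp: pgr_def)
  ultimately have "card (orb s) dvd p ^ n" by (metis dvd_triv_left)
  then obtain k where k: "card (orb s) = p ^ k" using assms(2) by (metis divides_primepow_nat)
  have "k \<noteq> 0"
  proof
   assume "k = 0"
   hence "card (orb s) = 1" using k by simp
   hence "orb s = {s}" using self[OF sS] by (metis card_1_singletonE singletonD)
   thus False using s by (auto simp: M_def orb_def)
  qed
  thus ?thesis using k by simp
 qed
 have Mfin: "finite M" using assms(3) by (simp add: M_def)
 have orbM: "orb s \<subseteq> M" if s: "s \<in> M" for s
 proof
  fix t assume t: "t \<in> orb s"
  have sS: "s \<in> S" using s by (simp add: M_def)
  have "t \<in> S" using orb_sub[OF sS] t by auto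
  moreover have "\<exists>g\<in>P. act g t \<noteq> t"
  proof (rule ccontr)
   assume "\<not> ?thesis"
   hence "orb t \<subseteq> {t}" by (auto simp: orb_def)
   hence "orb s \<subseteq> {t}" "s = t" using orb_eq[OF t sS] self[OF sS] by auto
   thus False using s by (auto simp: M_def orb_def)
  qed
  ultimately show "t \<in> M" by (simp add: M_def)
 qed
 have "p dvd card (\<Union>(orb ` M))"
 proof (rule dvd_partition)
  show "\<forall>c\<in>orb ` M. p dvd card c" using orb_card by auto
  show "\<forall>c1\<in>orb ` M. \<forall>c2\<in>orb ` M. c1 \<noteq> c2 \<longrightarrow> c1 \<inter> c2 = {}"
   using orb_eq by (auto simp: M_def) (metis (no_types, lifting))+
 qed (use Mfin orbM finite_subset in blast)
 moreover have "\<Union>(orb ` M) = M" using orbM self by (auto simp: M_def)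
 ultimately show ?thesis by (simp add: M_def)
qed

lemma pgr_fix_card:
 fixes act :: "'a::group_mult \<Rightarrow> 'b \<Rightarrow> 'b"
 assumes "pgr p P" "prime p" "finite S"
  and "\<And>s. s \<in> S \<Longrightarrow> act 1 s = s"
  and "\<And>g h s. g \<in> P \<Longrightarrow> h \<in> P \<Longrightarrow> s \<in> S \<Longrightarrow> act (g * h) s = act g (act h s)"
  and "\<And>g s. g \<in> P \<Longrightarrow> s \<in> S \<Longrightarrow> act g s \<in> S"
 shows "p dvd card S \<longleftrightarrow> p dvd card {s \<in> S. \<forall>g\<in>P. act g s = s}"
proof -
 have d: "p dvd card {s \<in> S. \<exists>g\<in>P. act g s \<noteq> s}"
  using pgr_fix_cong[of p P S act] assms by blast
 have "card S = card {s \<in> S. \<exists>g\<in>P. act g s \<noteq> s} + card {s \<in> S. \<forall>g\<in>P. act g s = s}"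
  using assms(3) by (subst card_Un_disjoint[symmetric]) (auto intro: arg_cong[where f=card])
 thus ?thesis using d by (simp add: dvd_add_right_iff)
qed

lemma pgr_fixpoint:
 fixes act :: "'a::group_mult \<Rightarrow> 'b \<Rightarrow> 'b"
 assumes "pgr p P" "prime p" "finite S"
  and "\<And>s. s \<in> S \<Longrightarrow> act 1 s = s"
  and "\<And>g h s. g \<in> P \<Longrightarrow> h \<in> P \<Longrightarrow> s \<in> S \<Longrightarrow> act (g * h) s = act g (act h s)"
  and "\<And>g s. g \<in> P \<Longrightarrow> s \<in> S \<Longrightarrow> act g s \<in> S"
  and nd: "\<not> p dvd card S"
 shows "\<exists>s\<in>S. \<forall>g\<in>P. act g s = s"
proof (rule ccontr)
 assume "\<not> ?thesis"
 hence e: "{s \<in> S. \<forall>g\<in>P. act g s = s} = {}" by blast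
 moreover have "p dvd card S \<longleftrightarrow> p dvd card {s \<in> S. \<forall>g\<in>P. act g s = s}"
  using pgr_fix_card[of p P S act] assms by blast
 ultimately show False using nd unfolding e by simp
qed

lemma pgr_grp: "pgr p P \<Longrightarrow> grp P"
 by (simp add: pgr_def)

lemma pgr_sub: "pgr p P \<Longrightarrow> prime p \<Longrightarrow> grp A \<Longrightarrow> A \<subseteq> P \<Longrightarrow> pgr p A"
 unfolding pgr_def using lagrange_dvd[of P A] divides_primepow_nat by metis

lemma pgr_cj: "pgr p P \<Longrightarrow> pgr p (cj g ` P)"
 by (simp add: pgr_def grp_cj)

lemma pgr_one [simp]: "pgr p {1}"
 by (auto simp: pgr_def intro: exI[of _ 0])

lemma pgr_dvd: "pgr p P \<Longrightarrow> P \<noteq> {1} \<Longrightarrow> p dvd card P"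
proof -
 assume P: "pgr p P" "P \<noteq> {1}"
 then obtain n where n: "card P = p ^ n" by (auto simp: pgr_def)
 have "card P \<noteq> 1"
  using P grpD(2)[of P] card_1_singletonE unfolding pgr_def by (metis singletonD)
 thus ?thesis using n by (cases n) auto
qed

lemma grp_card_one: "grp H \<Longrightarrow> card H = 1 \<longleftrightarrow> H = {1}"
 by (metis card_1_singletonE grpD(2) is_singletonI is_singleton_altdef singletonD)

lemma pgr_od:
 assumes "pgr p P" "prime p" "x \<in> P"
 obtains k where "od x = p ^ k"
proof -
 obtain n where "card P = p ^ n" using assms(1) by (auto simp: pgr_def)
 hence "od x dvd p ^ n" using pow_card(2)[of P x] assms by (auto simp: pgr_def)
 thus thesis using that divides_primepow_nat assms(2) by metis
qed

lemma pgr_order_p: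
 assumes "pgr p P" "prime p" "P \<noteq> {1}"
 shows "\<exists>x\<in>P. x \<noteq> 1 \<and> x ^ p = 1"
proof -
 have P: "grp P" using assms(1) by (rule pgr_grp)
 obtain x where x: "x \<in> P" "x \<noteq> 1" using assms(3) grpD(2)[OF P] by auto
 obtain k where k: "od x = p ^ k" using pgr_od assms(1,2) x(1) by blast
 have "k \<noteq> 0" using k x od_eq_one[OF P x(1)] by (cases k) auto
 define y where "y = x ^ (p ^ (k - 1))"
 have "y ^ p = x ^ (p ^ k)" using \<open>k \<noteq> 0\<close>
  by (simp add: y_def flip: power_mult power_Suc2)
 hence "y ^ p = 1" using od(2)[OF P x(1)] k by simp
 moreover have "y \<noteq> 1"
 proof
  assume "y = 1"
  hence "p ^ k dvd p ^ (k - 1)" using od(3)[OF P x(1)] k by (simp add: y_def)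
  thus False using \<open>k \<noteq> 0\<close> assms(2) by (auto dest: power_dvd_imp_le prime_gt_1_nat)
 qed
 ultimately show ?thesis using x(1) grpD(5)[OF P] y_def by blast
qed

lemma pgr_cyc:
 assumes "grp L" "x \<in> L" "x ^ (p ^ n) = 1" "prime p"
 shows "pgr p (cyc x)"
proof -
 have "od x dvd p ^ n" using od(3)[OF assms(1,2)] assms(3) by simp
 thus ?thesis using od(4)[OF assms(1,2)] grp_cyc(1)[OF assms(1,2)] divides_primepow_nat[OF assms(4)]
  by (auto simp: pgr_def)
qed

lemma card_cyc_prime: "grp L \<Longrightarrow> x \<in> L \<Longrightarrow> x \<noteq> 1 \<Longrightarrow> x ^ p = 1 \<Longrightarrow> prime p \<Longrightarrow> card (cyc x) = p"
 by (simp add: od(4) od_prime)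

lemma prime_card_cyc:
 assumes "grp L" "card L = p" "prime p" "x \<in> L" "x \<noteq> 1"
 shows "L = cyc x" "x ^ p = 1"
proof -
 show "x ^ p = 1" using pow_card(1)[OF assms(1,4)] assms(2) by simp
 hence "card (cyc x) = p" using card_cyc_prime assms by blast
 thus "L = cyc x" using subgroup_eq_card[OF assms(1) grp_cyc(2)[OF assms(1,4)]] assms(2) by simp
qed

subsection \<open>Groups whose order involves only given primes\<close>

definition pig :: "nat set \<Rightarrow> 'a::group_mult set \<Rightarrow> bool" where
 "pig \<pi> K \<longleftrightarrow> grp K \<and> (\<forall>r. prime r \<longrightarrow> r dvd card K \<longrightarrow> r \<in> \<pi>)"

lemma pig_grp: "pig \<pi> K \<Longrightarrow> grp K"
 by (simp add: pig_def)

lemma pig_sub: "pig \<pi> K \<Longrightarrow> grp A \<Longrightarrow> A \<subseteq> K \<Longrightarrow> pig \<pi> A"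
 unfolding pig_def using lagrange_dvd[of K A] dvd_trans by blast

lemma pig_mono: "pig \<pi> K \<Longrightarrow> \<pi> \<subseteq> \<sigma> \<Longrightarrow> pig \<sigma> K"
 by (auto simp: pig_def)

lemma pig_cj: "pig \<pi> K \<Longrightarrow> pig \<pi> (cj g ` K)"
 by (simp add: pig_def grp_cj)

lemma pig_one [simp]: "pig \<pi> {1}"
 by (auto simp: pig_def)

lemma pgr_iff_pig:
 assumes "prime p"
 shows "pgr p P \<longleftrightarrow> pig {p} P"
proof
 assume "pgr p P"
 then obtain n where "grp P" "card P = p ^ n" by (auto simp: pgr_def)
 moreover have "r = p" if "prime r" "r dvd p ^ n" for r
  using prime_dvd_power[OF that] primes_dvd_imp_eq that(1) assms by blast
 ultimately show "pig {p} P" by (simp add: pig_def)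
next
 assume P: "pig {p} P"
 hence g: "grp P" by (rule pig_grp)
 define n where "n = multiplicity p (card P)"
 have "card P \<noteq> 0" using grpD(8)[OF g] by simp
 then obtain m where m: "card P = p ^ n * m" "\<not> p dvd m"
  unfolding n_def using multiplicity_decompose'[of "card P" p] assms by (metis not_prime_unit)
 have "m = 1"
 proof (rule ccontr)
  assume "m \<noteq> 1"
  then obtain r where r: "prime r" "r dvd m" using prime_factor_nat by blast
  hence "r dvd card P" using m by simp
  hence "r = p" using P r by (auto simp: pig_def)
  thus False using r m by simp
 qed
 thus "pgr p P" using m g by (auto simp: pgr_def)
qed

lemma pig_compl: "pig (- {p}) K \<longleftrightarrow> grp K \<and> \<not> (prime p \<and> p dvd card K)"
 by (auto simp: pig_def)

lemma pig_prd:
 assumes "pig \<pi> N" "pig \<pi> K" "grp (prd N K)"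
 shows "pig \<pi> (prd N K)"
 unfolding pig_def
proof (intro conjI allI impI)
 fix r :: nat assume r: "prime r" "r dvd card (prd N K)"
 hence "r dvd card N * card K"
  using card_prd[of N K] assms(1,2) by (metis dvd_mult2 pig_grp)
 hence "r dvd card N \<or> r dvd card K" using r(1) by (simp add: prime_dvd_mult_iff)
 thus "r \<in> \<pi>" using assms(1,2) r(1) by (auto simp: pig_def)
qed (rule assms)

lemma pig_Int:
 assumes "pig \<pi> A" "pig \<sigma> B" "\<pi> \<inter> \<sigma> = {}"
 shows "A \<inter> B = {1}"
proof -
 have g: "grp (A \<inter> B)" using assms by (simp add: grp_Int pig_grp)
 have a: "pig \<pi> (A \<inter> B)" "pig \<sigma> (A \<inter> B)" using assms pig_sub g by (metis Int_lower1, metis Int_lower2)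
 hence "card (A \<inter> B) = 1" using assms(3) prime_factor_nat[of "card (A \<inter> B)"] unfolding pig_def by blast
 thus ?thesis using grp_card_one g by blast
qed

lemma pgr_pig_Int: "pgr p A \<Longrightarrow> prime p \<Longrightarrow> pig (- {p}) B \<Longrightarrow> A \<inter> B = {1}"
 using pig_Int[of "{p}" A "- {p}" B] by (simp add: pgr_iff_pig)

subsection \<open>Sylow subgroups\<close>

text \<open>The passage to groups with a carrier; through it Sylow's theorem, factor groups and
  products over finite index sets become available for \<open>grp\<close>.\<close>

definition rec :: "'a::group_mult set \<Rightarrow> 'a monoid" where
 "rec L = \<lparr>carrier = L, monoid.mult = (*), one = 1\<rparr>"

lemma rec_simps [simp]: "carrier (rec L) = L" "x \<otimes>\<^bsub>rec L\<^esub> y = x * y" "\<one>\<^bsub>rec L\<^esub> = 1"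
 by (simp_all add: rec_def)

lemma group_rec: assumes "grp L" shows "group (rec L)"
proof (rule groupI)
 show "\<exists>y\<in>carrier (rec L). y \<otimes>\<^bsub>rec L\<^esub> x = \<one>\<^bsub>rec L\<^esub>" if "x \<in> carrier (rec L)" for x
 proof -
  have "inverse x \<in> L" "inverse x * x = 1" using that grpD(4)[OF assms] by simp_all
  thus ?thesis by (metis rec_simps)
 qed
qed (use grpD(2,3)[OF assms] in "auto simp: mult.assoc")

lemma inv_rec: "grp L \<Longrightarrow> x \<in> L \<Longrightarrow> inv\<^bsub>rec L\<^esub> x = inverse x"
 by (rule group.inv_equality) (auto simp: group_rec grpD)

lemma subgroup_rec: assumes L: "grp L" shows "subgroup H (rec L) \<longleftrightarrow> grp H \<and> H \<subseteq> L"
proof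
 assume H: "subgroup H (rec L)"
 hence s: "H \<subseteq> L" using subgroup.subset by fastforce
 have "grp H"
 proof (rule grpI)
  show "finite H" using s grpD(1)[OF L] finite_subset by blast
  show "1 \<in> H" using subgroup.one_closed[OF H] by simp
  show "x * y \<in> H" if "x \<in> H" "y \<in> H" for x y using subgroup.m_closed[OF H that] by simp
  show "inverse x \<in> H" if "x \<in> H" for x using subgroup.m_inv_closed[OF H that] inv_rec[OF L, of x] s that by auto
 qed
 thus "grp H \<and> H \<subseteq> L" using s by simp
next
 assume H: "grp H \<and> H \<subseteq> L"
 show "subgroup H (rec L)"
  by (rule subgroup.intro) (use H inv_rec[OF L] grpD[of H] in "auto simp: subset_iff")
qed

text \<open>Stated by the index rather than by a maximal power of p: this form passes directly to
  intermediate subgroups and to images, since indices multiply.\<close>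

definition syl :: "nat \<Rightarrow> 'a::group_mult set \<Rightarrow> 'a set \<Rightarrow> bool" where
 "syl p P L \<longleftrightarrow> grp L \<and> pgr p P \<and> P \<subseteq> L \<and> \<not> p dvd card (lcs L P)"

lemma sylD: assumes "syl p P L" shows "grp L" "pgr p P" "grp P" "P \<subseteq> L" "\<not> p dvd card (lcs L P)"
 using assms by (auto simp: syl_def pgr_def)

lemma syl_exists:
 assumes "grp L" "prime p"
 shows "\<exists>P. syl p P L"
proof -
 have "card L \<noteq> 0" using grpD(8)[OF assms(1)] by simp
 then obtain m where m: "card L = p ^ multiplicity p (card L) * m" "\<not> p dvd m"
  using multiplicity_decompose'[of "card L" p] assms(2) by (metis not_prime_unit)
 then obtain P where P: "subgroup P (rec L)" "card P = p ^ multiplicity p (card L)"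
  using sylow_thm[of p "rec L" "multiplicity p (card L)" m] assms group_rec[of L] grpD(1)[of L]
  by (auto simp: Coset.order_def)
 hence s: "grp P" "P \<subseteq> L" using subgroup_rec assms(1) by auto
 have "card (lcs L P) = m"
 proof -
  have "card (lcs L P) * card P = m * card P"
   using lagrange[OF assms(1) s] P(2) m(1) by (metis mult.commute)
  thus ?thesis using grpD(8)[OF s(1)] by simp
 qed
 thus ?thesis using s P(2) m(2) assms(1) by (auto simp: syl_def pgr_def)
qed

lemma finite_lcs: "grp L \<Longrightarrow> finite (lcs L H)"
 by (simp add: lcs_def grpD(1))

text \<open>\<open>A\<close> acts on the left cosets of \<open>P\<close> by translation. Their
  number is prime to p, so some coset x P is fixed, which says that \<open>A\<close> lies in the
  conjugate of \<open>P\<close> by x.\<close>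

lemma syl_contains_conj:
 assumes "syl p P L" "prime p" "pgr p A" "A \<subseteq> L"
 shows "\<exists>x\<in>L. A \<subseteq> cj x ` P"
proof -
 note P = sylD[OF assms(1)]
 have "\<exists>s\<in>lcs L P. \<forall>a\<in>A. (*) a ` s = s"
 proof (rule pgr_fixpoint[OF assms(3,2)])
  show "finite (lcs L P)" using P by (simp add: finite_lcs)
  show "(*) 1 ` s = s" for s :: "'a set" by simp
  show "(*) (g * h) ` s = (*) g ` (*) h ` s" for g h and s :: "'a set"
   by (simp add: image_image mult.assoc)
  show "(*) g ` s \<in> lcs L P" if "g \<in> A" "s \<in> lcs L P" for g s using lcs_closed[OF P(1) _ that(2)] that(1) assms(4) by blast
 qed (rule P(5))
 then obtain x where x: "x \<in> L" "\<And>a. a \<in> A \<Longrightarrow> (*) a ` (*) x ` P = (*) x ` P" by (auto simp: lcs_def)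
 have "A \<subseteq> cj x ` P"
 proof
  fix a assume a: "a \<in> A"
  have "(*) x ` P = (*) (a * x) ` P" using x(2)[OF a] by (simp add: image_image mult.assoc)
  hence "inverse x * (a * x) \<in> P" using coset_eq_iff[OF P(3)] by blast
  moreover have "a = cj x (inverse x * (a * x))" by (simp add: cj_def gsimps)
  ultimately show "a \<in> cj x ` P" by blast
 qed
 thus ?thesis using x(1) by blast
qed

lemma cj_img_grp: "grp L \<Longrightarrow> x \<in> L \<Longrightarrow> cj x ` L = L"
 using nmlD(5)[OF nml_refl] by blast

lemma lcs_cj: "card (lcs (cj x ` L) (cj x ` P)) = card (lcs L P)"
proof -
 have "lcs (cj x ` L) (cj x ` P) = (`) (cj x) ` lcs L P"
  unfolding lcs_def image_image by (simp add: cj_mult)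
 moreover have "inj_on ((`) (cj x)) (lcs L P)"
  by (rule inj_onI) (metis cj_img_cancel(1))
 ultimately show ?thesis by (simp add: card_image)
qed

lemma syl_cj: "syl p P L \<Longrightarrow> syl p (cj x ` P) (cj x ` L)"
 unfolding syl_def using lcs_cj by (metis grp_cj image_mono pgr_cj)

lemma syl_cj_in: "syl p P L \<Longrightarrow> x \<in> L \<Longrightarrow> syl p (cj x ` P) L"
 using syl_cj[of p P L x] cj_img_grp[of L x] by (simp add: syl_def)

lemma syl_max:
 assumes "syl p P L" "prime p" "pgr p A" "P \<subseteq> A" "A \<subseteq> L"
 shows "A = P"
proof -
 obtain x where "A \<subseteq> cj x ` P" using syl_contains_conj assms by blast
 hence "card A \<le> card P" using sylD(3)[OF assms(1)] grpD(1) card_mono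
  by (metis card_cj finite_imageI)
 thus ?thesis using subgroup_eq_card[of A P] assms by (metis pgr_grp)
qed

lemma syl_conj:
 assumes "syl p P L" "syl p P' L" "prime p"
 shows "\<exists>x\<in>L. P' = cj x ` P"
proof -
 obtain x where x: "x \<in> L" "P' \<subseteq> cj x ` P"
  using syl_contains_conj[OF assms(1,3)] sylD[OF assms(2)] by blast
 have "cj x ` P = P'"
  by (rule syl_max[OF assms(2,3)]) (use x syl_cj_in[OF assms(1)] sylD in "blast+")
 thus ?thesis using x(1) by blast
qed

lemma syl_extends:
 assumes "grp L" "prime p" "pgr p A" "A \<subseteq> L"
 shows "\<exists>P. syl p P L \<and> A \<subseteq> P"
 using syl_exists[OF assms(1,2)] syl_contains_conj[OF _ assms(2-4)] syl_cj_in by metis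

lemma card_lcs_mult:
 assumes "grp L" "grp H" "grp P" "P \<subseteq> H" "H \<subseteq> L"
 shows "card (lcs L P) = card (lcs L H) * card (lcs H P)"
proof -
 have "card (lcs L P) * card P = (card (lcs L H) * card (lcs H P)) * card P"
  using lagrange[of L P] lagrange[of L H] lagrange[of H P] assms by (metis mult.assoc order_trans)
 thus ?thesis using grpD(8)[OF assms(3)] by simp
qed

lemma syl_sub: "syl p P L \<Longrightarrow> grp H \<Longrightarrow> P \<subseteq> H \<Longrightarrow> H \<subseteq> L \<Longrightarrow> syl p P H"
 unfolding syl_def using card_lcs_mult[of L H P] pgr_grp by (metis dvd_mult)

lemma syl_card: "syl p P L \<Longrightarrow> prime p \<Longrightarrow> card P = p ^ multiplicity p (card L)"
proof -
 assume P: "syl p P L" "prime p"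
 then obtain n where n: "card P = p ^ n" by (auto simp: syl_def pgr_def)
 have "card L = card (lcs L P) * p ^ n" using lagrange sylD[OF P(1)] n by metis
 moreover have "p > 0" using P(2) by (rule prime_gt_0_nat)
 ultimately have "p ^ n dvd card L" "\<not> p ^ Suc n dvd card L"
  using sylD(5)[OF P(1)] by auto
 hence "multiplicity p (card L) = n" by (rule multiplicity_eqI)
 thus ?thesis using n by simp
qed

lemma syl_nontriv:
 assumes "syl p P L" "prime p" "p dvd card L" shows "P \<noteq> {1}"
proof
 assume "P = {1}"
 thus False using assms lagrange[of L P] sylD[OF assms(1)] by simp
qed

lemma cauchy:
 assumes "grp L" "prime p" "p dvd card L"
 shows "\<exists>x\<in>L. x \<noteq> 1 \<and> x ^ p = 1"
 using syl_exists[OF assms(1,2)] syl_nontriv[OF _ assms(2,3)] pgr_order_p[OF _ assms(2)] sylD(2,4) by blast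

text \<open>Otherwise a prime r divides the index of \<open>K\<close>, hence also the index of a
  Sylow r-subgroup contained in \<open>K\<close>. This reduces equality with \<open>L\<close> to one
  Sylow subgroup for each prime.\<close>

lemma all_sylow:
 assumes "grp L" "grp K" "K \<subseteq> L" "\<And>p. prime p \<Longrightarrow> \<exists>P. syl p P L \<and> P \<subseteq> K"
 shows "K = L"
proof -
 have "card (lcs L K) = 1"
 proof (rule ccontr)
  assume "card (lcs L K) \<noteq> 1"
  then obtain r where r: "prime r" "r dvd card (lcs L K)" using prime_factor_nat by blast
  then obtain P where P: "syl r P L" "P \<subseteq> K" using assms(4) by blast
  have "card (lcs L P) = card (lcs L K) * card (lcs K P)"
   by (rule card_lcs_mult[OF assms(1,2) sylD(3)[OF P(1)] P(2) assms(3)])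
  thus False using r(2) sylD(5)[OF P(1)] by simp
 qed
 hence "card L = card K" using lagrange[OF assms(1-3)] by simp
 thus ?thesis using subgroup_eq_card[OF assms(1,3)] by simp
qed

lemma frattini:
 assumes "nml N L" "syl p P N" "prime p"
 shows "L = prd N (nz L P)"
proof
 show "prd N (nz L P) \<subseteq> L"
  using prd_least[OF nmlD(3)[OF assms(1)] nz_sub nmlD(2)[OF assms(1)]] .
 show "L \<subseteq> prd N (nz L P)"
 proof
  fix x assume x: "x \<in> L"
  have "syl p (cj x ` P) N" using syl_cj[OF assms(2), of x] nmlD(5)[OF assms(1) x] by simp
  then obtain n where n: "n \<in> N" "cj x ` P = cj n ` P" using syl_conj[OF assms(2) _ assms(3)] by blast
  hence "cj (inverse n * x) ` P = P" by (metis cj_img_comp cj_img_cancel(1))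
  moreover have "inverse n * x \<in> L"
   using n(1) x nmlD(3)[OF assms(1)] grpD(3,4)[OF nmlD(2)[OF assms(1)]] by (simp add: subset_iff)
  ultimately have "inverse n * x \<in> nz L P" by (simp add: nz_def)
  thus "x \<in> prd N (nz L P)" using n(1) by (metis mult_inv_cancel prdI)
 qed
qed

text \<open>\<open>D\<close> acts by translation on its cosets in \<open>P\<close>. The number of
  fixed cosets is divisible by p and \<open>D\<close> is one of them, so another coset x D is fixed,
  and then x^-1 normalizes \<open>D\<close>.\<close>

lemma pgr_nz_grows:
 assumes "pgr p P" "prime p" "grp D" "D \<subset> P"
 shows "D \<subset> nz P D"
proof -
 have P: "grp P" using assms(1) by (rule pgr_grp)
 define F where "F = {s \<in> lcs P D. \<forall>a\<in>D. (*) a ` s = s}"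
 have "p dvd card (lcs P D) \<longleftrightarrow> p dvd card F"
  unfolding F_def
 proof (rule pgr_fix_card[OF pgr_sub[OF assms(1,2,3) psubset_imp_subset[OF assms(4)]] assms(2)])
  show "finite (lcs P D)" using P by (simp add: finite_lcs)
  show "(*) 1 ` s = s" for s :: "'a set" by simp
  show "(*) (g * h) ` s = (*) g ` (*) h ` s" for g h and s :: "'a set"
   by (simp add: image_image mult.assoc)
  show "(*) g ` s \<in> lcs P D" if "g \<in> D" "s \<in> lcs P D" for g s using lcs_closed[OF P _ that(2)] that(1) assms(4) by blast
 qed
 moreover have "p dvd card (lcs P D)"
 proof -
  obtain n where n: "card P = p ^ n" using assms(1) by (auto simp: pgr_def)
  have l: "card P = card (lcs P D) * card D" using lagrange P assms by blast
  hence "card (lcs P D) dvd p ^ n" using n by (metis dvd_triv_left)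
  then obtain k where k: "card (lcs P D) = p ^ k" using divides_primepow_nat assms(2) by blast
  have "k \<noteq> 0"
  proof
   assume "k = 0"
   hence "card P = card D" using l k by simp
   thus False using assms(4) P grpD(1) by (metis card_subset_eq psubset_imp_subset less_irrefl)
  qed
  thus ?thesis using k by simp
 qed
 ultimately have "p dvd card F" by simp
 moreover have D: "D \<in> F"
 proof -
  have "(*) 1 ` D \<in> lcs P D" unfolding lcs_def using grpD(2)[OF P] by blast
  moreover have "(*) a ` D = D" if "a \<in> D" for a
   using coset_eq_iff[OF assms(3), of 1 a] that by simp
  ultimately show ?thesis by (simp add: F_def)
 qed
 ultimately have "F \<noteq> {D}" using assms(2) by (auto dest: prime_gt_1_nat)
 then obtain s where s: "s \<in> F" "s \<noteq> D" using D by blast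
 then obtain x where x: "x \<in> P" "s = (*) x ` D" by (auto simp: F_def lcs_def)
 have "x \<notin> D" using s x coset_eq_iff[OF assms(3), of 1 x] by auto
 moreover have "inverse x \<in> nz P D"
 proof (rule nzI)
  show "cj (inverse x) a \<in> D" if a: "a \<in> D" for a
  proof -
   have "(*) (a * x) ` D = (*) x ` D" using s(1) a x by (auto simp: F_def image_image mult.assoc)
  hence "inverse x * (a * x) \<in> D" using coset_eq_iff[OF assms(3), of x "a * x"] by simp
   thus ?thesis by (simp add: cj_def gsimps)
  qed
  show "finite D" by (rule grpD(1)[OF assms(3)])
  show "inverse x \<in> P" by (rule grpD(4)[OF P x(1)])
 qed
 moreover have "inverse x \<notin> D" using \<open>x \<notin> D\<close> grp_inv_iff[OF assms(3)] by simp
 ultimately show ?thesis using nz_self[OF assms(3), of P] assms(4) by blast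
qed

lemma pgr_normal_meets_center:
 assumes "pgr p P" "prime p" "nml N P" "N \<noteq> {1}"
 shows "\<exists>z\<in>N. z \<noteq> 1 \<and> (\<forall>g\<in>P. g * z = z * g)"
proof -
 note N = nmlD[OF assms(3)]
 define F where "F = {s \<in> N. \<forall>a\<in>P. cj a s = s}"
 have "p dvd card N \<longleftrightarrow> p dvd card F"
  unfolding F_def
  by (rule pgr_fix_card[OF assms(1,2)]) (simp_all add: cj_cj N(4) grpD(1)[OF N(1)])
 moreover have "p dvd card N" using pgr_dvd[OF pgr_sub[OF assms(1,2) N(1,3)] assms(4)] .
 ultimately have "p dvd card F" by simp
 moreover have "1 \<in> F" using grpD(2)[OF N(1)] by (simp add: F_def)
 ultimately have "F \<noteq> {1}" using assms(2) by (auto dest: prime_gt_1_nat)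
 then obtain z where "z \<in> F" "z \<noteq> 1" using \<open>1 \<in> F\<close> by blast
 thus ?thesis by (auto simp: F_def cj_eq_iff)
qed

text \<open>\<open>B\<close> permutes the coset y N by conjugation and p does not divide its size.
  This is the form in which coprime action is used throughout: an invariant coset of a p'-group
  contains an element centralized by \<open>B\<close>, so fixed points of quotients lift.\<close>

lemma coset_fixpoint:
 assumes "pgr p B" "prime p" "grp N" "\<not> p dvd card N"
  and nz: "\<And>b n. b \<in> B \<Longrightarrow> n \<in> N \<Longrightarrow> cj b n \<in> N"
  and y: "\<And>b. b \<in> B \<Longrightarrow> inverse y * cj b y \<in> N"
 shows "\<exists>n\<in>N. \<forall>b\<in>B. b * (y * n) = (y * n) * b"
proof -
 have "\<exists>s\<in>(*) y ` N. \<forall>b\<in>B. cj b s = s"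
 proof (rule pgr_fixpoint[OF assms(1,2)])
  show "finite ((*) y ` N)" using grpD(1)[OF assms(3)] by simp
  show "cj b s \<in> (*) y ` N" if b: "b \<in> B" and s: "s \<in> (*) y ` N" for b s
  proof -
   obtain n where n: "n \<in> N" "s = y * n" using s by auto
   have "cj b s = y * ((inverse y * cj b y) * cj b n)" by (simp add: n cj_mult gsimps)
   moreover have "(inverse y * cj b y) * cj b n \<in> N" using y nz b n grpD(3)[OF assms(3)] by blast
   ultimately show ?thesis by blast
  qed
 qed (simp_all add: cj_cj assms(4))
 thus ?thesis by (auto simp: cj_eq_iff)
qed

subsection \<open>Cores\<close>

text \<open>The largest normal \<pi>-subgroup O_\<pi>(L). A single prime is given as
  \<open>{p}\<close>, the set of all other primes as \<open>- {p}\<close>.\<close>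

definition core :: "nat set \<Rightarrow> 'a::group_mult set \<Rightarrow> 'a set" where
 "core \<pi> L = \<Union>{N. nml N L \<and> pig \<pi> N}"

lemma nml_prd: "nml N L \<Longrightarrow> nml K L \<Longrightarrow> nml (prd N K) L"
proof -
 assume a: "nml N L" "nml K L"
 have g: "grp (prd N K)" using grp_prd_nml[OF a(1)] nmlD[OF a(2)] by blast
 have "cj g x \<in> prd N K" if gx: "g \<in> L" "x \<in> prd N K" for g x
 proof -
  obtain n k where "n \<in> N" "k \<in> K" "x = n * k" using gx(2) by (auto simp: prd_iff)
  thus ?thesis
   using nmlD(4)[OF a(1) gx(1)] nmlD(4)[OF a(2) gx(1)] by (simp add: cj_mult prdI)
 qed
 thus ?thesis using g prd_sub_nml[OF a(1)] nmlD[OF a(2)] by (auto simp: nml_def)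
qed

text \<open>A normal \<pi>-subgroup M of largest order absorbs every other one N, because M N is
  again a normal \<pi>-subgroup.\<close>

lemma core:
 assumes "grp L"
 shows "nml (core \<pi> L) L" "pig \<pi> (core \<pi> L)" "nml N L \<Longrightarrow> pig \<pi> N \<Longrightarrow> N \<subseteq> core \<pi> L"
proof -
 show "nml N L \<Longrightarrow> pig \<pi> N \<Longrightarrow> N \<subseteq> core \<pi> L" for N by (auto simp: core_def)
 define S where "S = {N. nml N L \<and> pig \<pi> N}"
 have "S \<subseteq> Pow L" by (auto simp: S_def dest: nmlD(3))
 hence "finite S" using grpD(1)[OF assms] finite_subset by blast
 moreover have "{1} \<in> S" by (simp add: S_def nml_one assms)
 ultimately have "Max (card ` S) \<in> card ` S" "\<And>N. N \<in> S \<Longrightarrow> card N \<le> Max (card ` S)"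
  by (auto intro: Max_in)
 then obtain M where M: "M \<in> S" "\<And>N. N \<in> S \<Longrightarrow> card N \<le> card M" by (metis imageE)
 have "N \<subseteq> M" if N: "N \<in> S" for N
 proof -
  have g: "grp M" "grp N" using M N by (auto simp: S_def pig_grp)
  have n: "nml (prd M N) L" using nml_prd M(1) N by (auto simp: S_def)
  hence "pig \<pi> (prd M N)" using pig_prd M(1) N by (auto simp: S_def dest: nmlD(1))
  hence "prd M N \<in> S" using n by (simp add: S_def)
  hence "card (prd M N) \<le> card M" using M(2) by blast
  hence "M = prd M N"
   using subgroup_eq_card[OF nmlD(1)[OF n] prd_sub1[OF g]] by blast
  thus ?thesis using prd_sub2[OF g] by simp
 qed
 hence "core \<pi> L = M" using M(1) unfolding core_def S_def by blast
 thus "nml (core \<pi> L) L" "pig \<pi> (core \<pi> L)" using M(1) by (simp_all add: S_def)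
qed

lemma core_sub: "grp L \<Longrightarrow> core \<pi> L \<subseteq> L"
 using core(1) nmlD(3) by blast

lemma grp_core: "grp L \<Longrightarrow> grp (core \<pi> L)"
 using core(1) nmlD(1) by blast

lemma cj_core: "cj g ` core \<pi> L = core \<pi> (cj g ` L)"
proof -
 have 1: "cj g ` core \<pi> L \<subseteq> core \<pi> (cj g ` L)" for g and L :: "'a set"
  unfolding core_def using cj_nml[of _ L g] pig_cj[of \<pi> _ g] by blast
 have "core \<pi> (cj g ` L) = cj g ` cj (inverse g) ` core \<pi> (cj g ` L)" by simp
 also have "\<dots> \<subseteq> cj g ` core \<pi> L"
  using 1[of "inverse g" "cj g ` L"] by (intro image_mono) simp
 finally show ?thesis using 1 by blast
qed

lemma nml_core_nml:
 assumes "nml N L"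
 shows "nml (core \<pi> N) L"
 unfolding nml_def
proof (intro conjI ballI)
 note N = nmlD[OF assms]
 show "grp (core \<pi> N)" "grp L" "core \<pi> N \<subseteq> L" using N core_sub grp_core by blast+
 fix g n assume "g \<in> L" "n \<in> core \<pi> N"
 thus "cj g n \<in> core \<pi> N" using cj_core[of g \<pi> N] N(5)[of g] imageI[of n "core \<pi> N" "cj g"] by simp
qed

lemma core_nml_sub:
 assumes "nml N L" shows "core \<pi> N \<subseteq> core \<pi> L"
 using nml_core_nml[OF assms] core(2,3) nmlD[OF assms] by blast

section \<open>Homomorphisms, quotients and solvable groups\<close>

text \<open>Only the values on \<open>L\<close> matter, so the same function serves as a
  homomorphism on every subgroup of \<open>L\<close>.\<close>

definition ghom :: "('a::group_mult \<Rightarrow> 'b::group_mult) \<Rightarrow> 'a set \<Rightarrow> bool" where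
 "ghom f L \<longleftrightarrow> grp L \<and> (\<forall>x\<in>L. \<forall>y\<in>L. f (x * y) = f x * f y)"

definition ker :: "('a::group_mult \<Rightarrow> 'b::group_mult) \<Rightarrow> 'a set \<Rightarrow> 'a set" where
 "ker f L = {x \<in> L. f x = 1}"

definition pre :: "('a \<Rightarrow> 'b) \<Rightarrow> 'a set \<Rightarrow> 'b set \<Rightarrow> 'a set" where
 "pre f L K = {x \<in> L. f x \<in> K}"

lemma ghomD:
 assumes "ghom f L"
 shows "grp L" "x \<in> L \<Longrightarrow> y \<in> L \<Longrightarrow> f (x * y) = f x * f y" "f 1 = 1"
  "x \<in> L \<Longrightarrow> f (inverse x) = inverse (f x)" "x \<in> L \<Longrightarrow> f (x ^ n) = f x ^ n"
  "x \<in> L \<Longrightarrow> y \<in> L \<Longrightarrow> f (cj x y) = cj (f x) (f y)"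
  "x \<in> L \<Longrightarrow> y \<in> L \<Longrightarrow> f (cm x y) = cm (f x) (f y)"
proof -
 show L: "grp L" and m: "x \<in> L \<Longrightarrow> y \<in> L \<Longrightarrow> f (x * y) = f x * f y" for x y
  using assms by (auto simp: ghom_def)
 have "f 1 * f 1 = f 1 * 1" using m[of 1 1] grpD(2)[OF L] by simp
 thus o: "f 1 = 1" by (simp only: left_cancel)
 show i: "f (inverse x) = inverse (f x)" if "x \<in> L" for x
  using m[of x "inverse x"] grpD(4)[OF L that] that o by (simp add: mult_eq_one_iff)
 show "x \<in> L \<Longrightarrow> f (x ^ n) = f x ^ n"
  by (induction n) (auto simp: o m grpD(5)[OF L])
 show "f (cj x y) = cj (f x) (f y)" if "x \<in> L" "y \<in> L"
  using that grpD(3,4)[OF L] by (simp add: cj_def m i)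
 show "f (cm x y) = cm (f x) (f y)" if "x \<in> L" "y \<in> L"
  using that grpD(3,4)[OF L] by (simp add: cm_def m i)
qed

lemma ghom_sub: "ghom f L \<Longrightarrow> grp H \<Longrightarrow> H \<subseteq> L \<Longrightarrow> ghom f H"
 by (auto simp: ghom_def)

lemma ghom_comp: "ghom f L \<Longrightarrow> ghom g K \<Longrightarrow> f ` L \<subseteq> K \<Longrightarrow> ghom (g \<circ> f) L"
 unfolding ghom_def by (simp add: image_subset_iff)

lemma grp_img: "ghom f L \<Longrightarrow> grp (f ` L)"
proof (rule grpI)
 assume f: "ghom f L"
 note D = ghomD[OF f]
 show "finite (f ` L)" using grpD(1)[OF D(1)] by simp
 show "1 \<in> f ` L" using grpD(2)[OF D(1)] D(3) by force
 show "x * y \<in> f ` L" if xy: "x \<in> f ` L" "y \<in> f ` L" for x y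
 proof -
  obtain a b where "a \<in> L" "b \<in> L" "x = f a" "y = f b" using xy by auto
  thus ?thesis using D(2)[of a b] grpD(3)[OF D(1), of a b] by (metis imageI)
 qed
 show "inverse x \<in> f ` L" if x: "x \<in> f ` L" for x
 proof -
  obtain a where "a \<in> L" "x = f a" using x by auto
  thus ?thesis using D(4)[of a] grpD(4)[OF D(1), of a] by (metis imageI)
 qed
qed

lemma grp_img_sub: "ghom f L \<Longrightarrow> grp H \<Longrightarrow> H \<subseteq> L \<Longrightarrow> grp (f ` H)"
 using grp_img ghom_sub by blast

lemma grp_pre:
 assumes f: "ghom f L" and K: "grp K" shows "grp (pre f L K)"
proof (rule grpI)
 note D = ghomD[OF f]
 show "finite (pre f L K)" using grpD(1)[OF D(1)] by (simp add: pre_def)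
 show "1 \<in> pre f L K" using grpD(2)[OF D(1)] D(3) grpD(2)[OF K] by (simp add: pre_def)
 show "x * y \<in> pre f L K" if "x \<in> pre f L K" "y \<in> pre f L K" for x y
  using that D(2) grpD(3)[OF K] grpD(3)[OF D(1)] by (simp add: pre_def)
 show "inverse x \<in> pre f L K" if "x \<in> pre f L K" for x
  using that D(4) grpD(4)[OF K] grpD(4)[OF D(1)] by (simp add: pre_def)
qed

lemma pre_sub: "pre f L K \<subseteq> L"
 by (auto simp: pre_def)

lemma img_pre: "K \<subseteq> f ` L \<Longrightarrow> f ` pre f L K = K"
 by (auto simp: pre_def)

lemma ker_eq_pre: "ker f L = pre f L {1}"
 by (auto simp: ker_def pre_def)

lemma nml_pre:
 assumes f: "ghom f L" and K: "nml K (f ` L)" shows "nml (pre f L K) L"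
 unfolding nml_def
proof (intro conjI ballI)
 note D = ghomD[OF f]
 show "grp (pre f L K)" using grp_pre f nmlD(1)[OF K] by blast
 show "grp L" by (rule D(1))
 show "pre f L K \<subseteq> L" by (rule pre_sub)
 show "cj g n \<in> pre f L K" if "g \<in> L" "n \<in> pre f L K" for g n
  using that D(6)[of g n] grpD(6)[OF D(1), of g n] nmlD(4)[OF K, of "f g" "f n"] by (simp add: pre_def)
qed

lemma nml_ker: "ghom f L \<Longrightarrow> nml (ker f L) L"
 unfolding ker_eq_pre using nml_pre nml_one grp_img by blast

lemma nml_img:
 assumes f: "ghom f L" and N: "nml N L" shows "nml (f ` N) (f ` L)"
 unfolding nml_def
proof (intro conjI ballI)
 note D = ghomD[OF f]
 show "grp (f ` N)" using grp_img_sub f nmlD(1,3)[OF N] by blast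
 show "grp (f ` L)" using grp_img f by blast
 show "f ` N \<subseteq> f ` L" using nmlD(3)[OF N] by blast
 fix g n assume "g \<in> f ` L" "n \<in> f ` N"
 then obtain a b where ab: "a \<in> L" "b \<in> N" "g = f a" "n = f b" by auto
 hence "f (cj a b) = cj g n" using D(6)[of a b] nmlD(3)[OF N] by blast
 thus "cj g n \<in> f ` N" using nmlD(4)[OF N ab(1,2)] by (metis imageI)
qed

lemma ghom_eq_iff:
 assumes "ghom f L" "x \<in> L" "y \<in> L"
 shows "f x = f y \<longleftrightarrow> inverse x * y \<in> ker f L"
proof -
 note D = ghomD[OF assms(1)]
 have "inverse x \<in> L" using grpD(4)[OF D(1)] assms(2) by simp
 hence "f (inverse x * y) = inverse (f x) * f y" "inverse x * y \<in> L"
  using D(2,4) assms grpD(3)[OF D(1)] by simp_all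
 thus ?thesis by (auto simp: ker_def mult_eq_one_iff)
qed

lemma card_img:
 assumes "ghom f L" "grp H" "H \<subseteq> L"
 shows "card H = card (f ` H) * card (H \<inter> ker f L)"
proof (rule card_fibres)
 show "finite H" using grpD(1) assms(2) by blast
 fix b assume "b \<in> f ` H"
 then obtain h where h: "h \<in> H" "b = f h" by auto
 have "{a \<in> H. f a = b} = (*) h ` (H \<inter> ker f L)"
 proof (intro equalityI subsetI)
  fix a assume a: "a \<in> {a \<in> H. f a = b}"
  hence "inverse h * a \<in> ker f L" using ghom_eq_iff[OF assms(1), of h a] h assms(3) by auto
  moreover have "inverse h * a \<in> H" using a h grpD(3,4)[OF assms(2)] by simp
  ultimately show "a \<in> (*) h ` (H \<inter> ker f L)" by (metis IntI image_eqI mult_inv_cancel)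
 next
  fix a assume "a \<in> (*) h ` (H \<inter> ker f L)"
  then obtain k where k: "k \<in> H" "k \<in> ker f L" "a = h * k" by auto
  hence "a \<in> H" "f a = f h * f k"
   using h grpD(3)[OF assms(2)] ghomD(2)[OF assms(1), of h k] assms(3) by auto
  thus "a \<in> {a \<in> H. f a = b}" using h k by (simp add: ker_def)
 qed
 thus "card {a \<in> H. f a = b} = card (H \<inter> ker f L)" by simp
qed

lemma pig_img: assumes "ghom f L" "pig \<pi> H" "H \<subseteq> L" shows "pig \<pi> (f ` H)"
proof -
 have "card (f ` H) dvd card H" using card_img assms pig_grp by (metis dvd_triv_left)
 moreover have "grp (f ` H)" using assms grp_img_sub pig_grp by blast
 ultimately show ?thesis using assms(2) dvd_trans unfolding pig_def by blast
qed

lemma pgr_img: "ghom f L \<Longrightarrow> pgr p H \<Longrightarrow> prime p \<Longrightarrow> H \<subseteq> L \<Longrightarrow> pgr p (f ` H)"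
 using pig_img[of f L "{p}" H] by (simp add: pgr_iff_pig)

lemma pig_pre:
 assumes "ghom f L" "pig \<pi> K" "K \<subseteq> f ` L" "pig \<pi> (ker f L)"
 shows "pig \<pi> (pre f L K)"
 unfolding pig_def
proof (intro conjI allI impI)
 show g: "grp (pre f L K)" using grp_pre assms(1) pig_grp[OF assms(2)] by blast
 fix r :: nat assume r: "prime r" "r dvd card (pre f L K)"
 have "ker f L \<subseteq> pre f L K" using grpD(2)[OF pig_grp[OF assms(2)]] by (auto simp: ker_def pre_def)
 hence "card (pre f L K) = card K * card (ker f L)"
  using card_img[OF assms(1) g pre_sub] img_pre[OF assms(3)] by (simp add: Int_absorb1)
 thus "r \<in> \<pi>" using r assms(2,4) by (auto simp: pig_def prime_dvd_mult_iff)
qed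

text \<open>With K the full preimage of f(P), the index of f(P) in f(L) equals that of K in L, which
  is a factor of the index of P.\<close>

lemma lcs_img_dvd:
 assumes "ghom f L" "grp P" "P \<subseteq> L"
 shows "card (lcs (f ` L) (f ` P)) dvd card (lcs L P)"
proof -
 note D = ghomD[OF assms(1)]
 define K where "K = pre f L (f ` P)"
 have g: "grp (f ` P)" "f ` P \<subseteq> f ` L" using grp_img_sub assms by blast+
 have K: "grp K" "P \<subseteq> K" "K \<subseteq> L" "f ` K = f ` P"
  unfolding K_def using grp_pre[OF assms(1) g(1)] img_pre[OF g(2)] pre_sub assms(3)
  by (auto simp: pre_def)
 have k: "ker f L \<subseteq> K" using grpD(2)[OF g(1)] by (auto simp: K_def ker_def pre_def)
 have "card L = card (f ` L) * card (ker f L)" "card K = card (f ` P) * card (ker f L)"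
  using card_img[OF assms(1) D(1) order_refl] card_img[OF assms(1) K(1,3)] k K(3,4)
  by (simp_all add: Int_absorb1)
 moreover have "card L = card (lcs L K) * card K" "card (f ` L) = card (lcs (f ` L) (f ` P)) * card (f ` P)"
  using lagrange D(1) K(1,3) grp_img[OF assms(1)] g by blast+
 ultimately have "card (lcs (f ` L) (f ` P)) * card K = card (lcs L K) * card K"
  by (metis mult.assoc)
 hence "card (lcs (f ` L) (f ` P)) = card (lcs L K)" using grpD(8)[OF K(1)] by simp
 thus ?thesis using card_lcs_mult[OF D(1) K(1) assms(2) K(2,3)] by simp
qed

lemma syl_img: assumes "ghom f L" "syl p P L" "prime p" shows "syl p (f ` P) (f ` L)"
 unfolding syl_def
proof (intro conjI)
 note P = sylD[OF assms(2)]
 show "grp (f ` L)" "pgr p (f ` P)" "f ` P \<subseteq> f ` L"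
  using grp_img[OF assms(1)] pgr_img[OF assms(1) P(2) assms(3) P(4)] P(4) by auto
 show "\<not> p dvd card (lcs (f ` L) (f ` P))"
  using lcs_img_dvd[OF assms(1) P(3,4)] P(5) dvd_trans by blast
qed

text \<open>The regular representation, carried to {0..<n} along an enumeration and extended by the
  identity, so that only finitely many numbers are moved.\<close>

lemma cayley:
 assumes "group A" "finite (carrier A)"
 shows "\<exists>\<iota>::'a \<Rightarrow> nat perm. inj_on \<iota> (carrier A) \<and>
  (\<forall>x\<in>carrier A. \<forall>y\<in>carrier A. \<iota> (x \<otimes>\<^bsub>A\<^esub> y) = \<iota> x * \<iota> y)"
proof -
 interpret A: group A by (rule assms(1))
 define n where "n = card (carrier A)"
 obtain e where e: "bij_betw e (carrier A) {0..<n}"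
  using ex_bij_betw_finite_nat[OF assms(2)] n_def by blast
 define d where "d = inv_into (carrier A) e"
 have d: "d i \<in> carrier A" "e (d i) = i" if "i < n" for i
  using that e unfolding d_def bij_betw_def by (auto intro: inv_into_into f_inv_into_f)
 have de: "d (e x) = x" "e x < n" if "x \<in> carrier A" for x
  using that e unfolding d_def bij_betw_def by auto
 define F where "F x i = (if i < n then e (x \<otimes>\<^bsub>A\<^esub> d i) else i)" for x i
 have FF: "F x (F y i) = F (x \<otimes>\<^bsub>A\<^esub> y) i" if "x \<in> carrier A" "y \<in> carrier A" for x y i
  using that d de by (simp add: F_def A.m_assoc)
 have F1: "F \<one>\<^bsub>A\<^esub> i = i" for i using d by (simp add: F_def)
 have bij: "bij (F x)" if "x \<in> carrier A" for x
  by (rule o_bij[of "F (inv\<^bsub>A\<^esub> x)"]) (use that FF F1 in "auto simp: fun_eq_iff")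
 have fin: "finite {i. F x i \<noteq> i}" for x
  by (rule finite_subset[of _ "{..<n}"]) (auto simp: F_def split: if_splits)
 define \<iota> where "\<iota> x = Perm (F x)" for x
 have ap: "Perm.apply (\<iota> x) = F x" if "x \<in> carrier A" for x
  unfolding \<iota>_def using bij[OF that] fin by (subst Perm_inverse) auto
 have "\<iota> (x \<otimes>\<^bsub>A\<^esub> y) = \<iota> x * \<iota> y" if "x \<in> carrier A" "y \<in> carrier A" for x y
  by (rule perm_eqI) (use that FF in "simp add: ap apply_times")
 moreover have "inj_on \<iota> (carrier A)"
 proof (rule inj_onI)
  fix x y assume xy: "x \<in> carrier A" "y \<in> carrier A" "\<iota> x = \<iota> y"
  hence "F x (e \<one>\<^bsub>A\<^esub>) = F y (e \<one>\<^bsub>A\<^esub>)" using ap by metis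
  hence "e x = e y" using xy de by (simp add: F_def)
  thus "x = y" using xy de by metis
 qed
 ultimately show ?thesis by blast
qed

text \<open>Realizing factor groups by permutations again keeps every section inside the single type
  \<open>nat perm\<close>; passing to a quotient then needs no change of type.\<close>

lemma quotient_exists:
 fixes L :: "'a::group_mult set"
 assumes "nml N L"
 shows "\<exists>f::'a \<Rightarrow> nat perm. ghom f L \<and> ker f L = N"
proof -
 note N = nmlD[OF assms]
 have sg: "subgroup N (rec L)" using N subgroup_rec by blast
 interpret G: group "rec L" using group_rec N(2) by blast
 have nN: "N \<lhd> rec L"
 proof (rule G.normal_invI[OF sg])
  fix x h assume "x \<in> carrier (rec L)" "h \<in> N"
  thus "x \<otimes>\<^bsub>rec L\<^esub> h \<otimes>\<^bsub>rec L\<^esub> inv\<^bsub>rec L\<^esub> x \<in> N"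
   using N(4)[of x h] inv_rec[OF N(2), of x] by (simp add: cj_def)
 qed
 interpret N: normal N "rec L" by (rule nN)
 have fin: "finite (carrier (rec L Mod N))"
  using grpD(1)[OF N(2)] by (simp add: carrier_FactGroup)
 obtain \<iota> :: "'a set \<Rightarrow> nat perm" where i: "inj_on \<iota> (carrier (rec L Mod N))"
  "\<And>x y. x \<in> carrier (rec L Mod N) \<Longrightarrow> y \<in> carrier (rec L Mod N) \<Longrightarrow>
   \<iota> (x \<otimes>\<^bsub>rec L Mod N\<^esub> y) = \<iota> x * \<iota> y"
  using cayley[OF N.factorgroup_is_group fin] by blast
 define q where "q x = N #>\<^bsub>rec L\<^esub> x" for x
 have qc: "q x \<in> carrier (rec L Mod N)" if "x \<in> L" for x
  using that by (auto simp: q_def carrier_FactGroup)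
 have qm: "q (x * y) = q x \<otimes>\<^bsub>rec L Mod N\<^esub> q y" if "x \<in> L" "y \<in> L" for x y
  using N.rcos_sum[of x y] that by (simp add: q_def)
 define f where "f = \<iota> \<circ> q"
 have f: "ghom f L" using N(2) qm qc i(2) by (auto simp: ghom_def f_def)
 have "ker f L = N"
 proof -
  have "f x = 1 \<longleftrightarrow> x \<in> N" if x: "x \<in> L" for x
  proof -
   have 1: "1 \<in> L" using grpD(2)[OF N(2)] .
   have "f x = 1 \<longleftrightarrow> f x = f 1" using ghomD(3)[OF f] by simp
   also have "\<dots> \<longleftrightarrow> q x = q 1" using i(1) qc[OF x] qc[OF 1] by (auto simp: f_def inj_on_def)
   also have "q 1 = N" using G.coset_mult_one[of N] N(3) by (simp add: q_def)
   also have "q x = N \<longleftrightarrow> x \<in> N"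
    using G.coset_join1[of N x] G.coset_join2[of x N] sg x N(3) by (auto simp: q_def)
   finally show ?thesis .
  qed
  thus ?thesis using N(3) by (auto simp: ker_def)
 qed
 thus ?thesis using f by blast
qed

subsection \<open>Derived subgroups and solvability\<close>

definition ab :: "'a::group_mult set \<Rightarrow> bool" where
 "ab A \<longleftrightarrow> (\<forall>x\<in>A. \<forall>y\<in>A. x * y = y * x)"

definition der :: "'a::group_mult set \<Rightarrow> 'a set" where
 "der K = gen ((\<lambda>(x, y). cm x y) ` (K \<times> K))"

text \<open>Solvability of a finite group as the absence of non-trivial perfect subgroups. It passes
  to subgroups at once, and a failure supplies a perfect subgroup to work with.\<close>

definition solv :: "'a::group_mult set \<Rightarrow> bool" where
 "solv H \<longleftrightarrow> grp H \<and> (\<forall>K. grp K \<longrightarrow> K \<subseteq> H \<longrightarrow> der K = K \<longrightarrow> K = {1})"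

lemma abD: "ab A \<Longrightarrow> x \<in> A \<Longrightarrow> y \<in> A \<Longrightarrow> x * y = y * x"
 by (simp add: ab_def)

lemma ab_sub: "ab A \<Longrightarrow> B \<subseteq> A \<Longrightarrow> ab B"
 by (auto simp: ab_def)

lemma ab_cyc: "ab (cyc x)"
 unfolding ab_def using cyc_abelian by blast

lemma ab_img: "ghom f L \<Longrightarrow> ab A \<Longrightarrow> A \<subseteq> L \<Longrightarrow> ab (f ` A)"
proof -
 assume a: "ghom f L" "ab A" "A \<subseteq> L"
 have "f x * f y = f y * f x" if "x \<in> A" "y \<in> A" for x y
  using ghomD(2)[OF a(1), of x y] ghomD(2)[OF a(1), of y x] abD[OF a(2) that] that a(3)
  by (metis subsetD)
 thus ?thesis by (auto simp: ab_def)
qed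

lemma cm_in_der: "x \<in> K \<Longrightarrow> y \<in> K \<Longrightarrow> cm x y \<in> der K"
proof -
 assume "x \<in> K" "y \<in> K"
 hence "cm x y \<in> (\<lambda>(x, y). cm x y) ` (K \<times> K)" by auto
 thus ?thesis unfolding der_def by (rule gen_inc[THEN subsetD])
qed

lemma der_least: "grp H \<Longrightarrow> (\<And>x y. x \<in> K \<Longrightarrow> y \<in> K \<Longrightarrow> cm x y \<in> H) \<Longrightarrow> der K \<subseteq> H"
 unfolding der_def by (rule gen_sub) auto

lemma grp_der: "grp K \<Longrightarrow> grp (der K)" and der_sub: "grp K \<Longrightarrow> der K \<subseteq> K"
proof -
 assume K: "grp K"
 have s: "(\<lambda>(x, y). cm x y) ` (K \<times> K) \<subseteq> K" using grpD(7)[OF K] by auto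
 show "grp (der K)" unfolding der_def by (rule grp_gen[OF s K])
 show "der K \<subseteq> K" using der_least[OF K] grpD(7)[OF K] by blast
qed

lemma nml_der: assumes "nml K L" shows "nml (der K) L"
 unfolding nml_def
proof (intro conjI ballI)
 note K = nmlD[OF assms]
 show "grp (der K)" "grp L" "der K \<subseteq> L" using grp_der der_sub K by blast+
 fix g n assume g: "g \<in> L" "n \<in> der K"
 show "cj g n \<in> der K"
  using g(2) unfolding der_def
 proof (rule gen_cj_closed[rotated 3])
  show "(\<lambda>(x, y). cm x y) ` (K \<times> K) \<subseteq> K" using grpD(7)[OF K(1)] by auto
  fix a assume "a \<in> (\<lambda>(x, y). cm x y) ` (K \<times> K)"
  then obtain x y where "x \<in> K" "y \<in> K" "cj g a = cm (cj g x) (cj g y)" by (auto simp: cj_cm_distrib)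
  thus "cj g a \<in> gen ((\<lambda>(x, y). cm x y) ` (K \<times> K))"
   using K(4)[OF g(1)] cm_in_der[of "cj g x" K "cj g y"] by (simp add: der_def)
 qed (rule K(1))
qed

lemma der_one: assumes "der A = {1}" shows "ab A"
 unfolding ab_def using cm_in_der[of _ A] assms cm_eq_one by blast

lemma der_ab: "grp A \<Longrightarrow> ab A \<Longrightarrow> der A = {1}"
proof -
 assume A: "grp A" "ab A"
 have "der A \<subseteq> {1}" by (rule der_least) (use A(2) in "auto simp: cm_eq_one ab_def")
 thus ?thesis using grpD(2)[OF grp_der[OF A(1)]] by blast
qed

lemma der_img: assumes "ghom f L" "grp K" "K \<subseteq> L" shows "der (f ` K) = f ` der K"
proof
 have d: "der K \<subseteq> K" using der_sub assms(2) by blast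
 show "der (f ` K) \<subseteq> f ` der K"
 proof (rule der_least)
  show "grp (f ` der K)" using grp_img_sub[OF assms(1) grp_der[OF assms(2)]] d assms(3) by blast
  fix x y assume "x \<in> f ` K" "y \<in> f ` K"
  then obtain a b where ab: "a \<in> K" "b \<in> K" "x = f a" "y = f b" by auto
  hence "cm x y = f (cm a b)" using ghomD(7)[OF assms(1), of a b] assms(3) by (metis subsetD)
  thus "cm x y \<in> f ` der K" using cm_in_der ab by blast
 qed
 have "der K \<subseteq> pre f K (der (f ` K))"
 proof (rule der_least)
  have g: "ghom f K" using ghom_sub assms by blast
  show "grp (pre f K (der (f ` K)))" using grp_pre[OF g] grp_der[OF grp_img[OF g]] by blast
  show "cm x y \<in> pre f K (der (f ` K))" if "x \<in> K" "y \<in> K" for x y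
   using that ghomD(7)[OF g that] cm_in_der[of "f x" "f ` K" "f y"] grpD(7)[OF assms(2) that]
   by (simp add: pre_def)
 qed
 thus "f ` der K \<subseteq> der (f ` K)" by (auto simp: pre_def)
qed

lemma solv_grp: "solv H \<Longrightarrow> grp H"
 by (simp add: solv_def)

lemma solv_sub: "solv H \<Longrightarrow> grp K \<Longrightarrow> K \<subseteq> H \<Longrightarrow> solv K"
 by (auto simp: solv_def)

lemma solv_der: "solv H \<Longrightarrow> grp K \<Longrightarrow> K \<subseteq> H \<Longrightarrow> K \<noteq> {1} \<Longrightarrow> der K \<subset> K"
 using der_sub by (auto simp: solv_def)

lemma min_card_obtain:
 assumes "P A" obtains B where "P B" "\<And>C. P C \<Longrightarrow> card B \<le> card C"
 using ex_has_least_nat[of P A card] assms by blast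

text \<open>The kernel is a maximal subgroup containing \<open>C\<close>. It is normal because
  normalizers grow in p-groups, and by maximality the quotient is generated by any of its elements
  of order p.\<close>

lemma pgr_elementary_quotient:
 fixes U :: "'a::group_mult set"
 assumes "pgr p U" "prime p" "grp C" "C \<subset> U"
 obtains f :: "'a \<Rightarrow> nat perm" where "ghom f U" "ab (f ` U)" "\<And>x. x \<in> U \<Longrightarrow> f (x ^ p) = 1" "C \<subseteq> ker f U" "ker f U \<noteq> U"
proof -
 have U: "grp U" using assms(1) pgr_grp by blast
 define S where "S = {M. grp M \<and> M \<subset> U}"
 have "C \<in> S" using assms(3,4) by (simp add: S_def)
 moreover have "finite S"
  by (rule finite_subset[of _ "Pow U"]) (use grpD(1)[OF U] in "auto simp: S_def")
 ultimately obtain M where "M \<in> S" "C \<subseteq> M" and mxS: "\<forall>B\<in>S. M \<le> B \<longrightarrow> M = B"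
  using finite_has_maximal2[of S C] by blast
 hence M: "grp M" "M \<subset> U" and mx: "\<And>B. grp B \<Longrightarrow> B \<subset> U \<Longrightarrow> M \<subseteq> B \<Longrightarrow> B = M"
  by (auto simp: S_def)
 have "M \<subset> nz U M" using pgr_nz_grows[OF assms(1,2) M] .
 hence "nz U M = U" using mx[OF grp_nz[OF U]] nz_sub[of U M] by blast
 hence nM: "nml M U" using nml_nz[OF M(1) U] M(2) by auto
 obtain f :: "'a \<Rightarrow> nat perm" where f: "ghom f U" "ker f U = M" using quotient_exists[OF nM] by blast
 have gf: "grp (f ` U)" using grp_img f(1) by blast
 have "f ` U \<noteq> {1}" using f M(2) by (auto simp: ker_def)
 then obtain z where z: "z \<in> f ` U" "z \<noteq> 1" "z ^ p = 1"
  using pgr_order_p[OF pgr_img[OF f(1) assms(1,2) order_refl] assms(2)] by blast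
 define B where "B = pre f U (cyc z)"
 have gB: "grp B" unfolding B_def by (rule grp_pre[OF f(1) grp_cyc(1)[OF gf z(1)]])
 have "M \<subseteq> B" using grpD(2)[OF grp_cyc(1)[OF gf z(1)]] f(2) by (auto simp: B_def ker_def pre_def)
 moreover have "B \<noteq> M"
 proof
  assume "B = M"
  obtain k where "k \<in> U" "f k = z" using z(1) by auto
  hence "k \<in> B" by (simp add: B_def pre_def)
  thus False using \<open>B = M\<close> \<open>f k = z\<close> f(2) z(2) by (auto simp: ker_def)
 qed
 ultimately have "B = U" using mx[OF gB] pre_sub[of f U "cyc z"] unfolding B_def by blast
 hence s: "f ` U \<subseteq> cyc z" by (auto simp: B_def pre_def)
 have "f (x ^ p) = 1" if xU: "x \<in> U" for x
 proof -
  have "f x \<in> cyc z" using s xU by blast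
  then obtain i where "f x = z ^ i" by (auto simp: cyc_def)
  hence "f (x ^ p) = (z ^ p) ^ i"
   using ghomD(5)[OF f(1) xU, of p] by (simp add: mult.commute flip: power_mult)
  thus ?thesis using z(3) by simp
 qed
 thus thesis using that f ab_sub[OF ab_cyc s] \<open>C \<subseteq> M\<close> M(2) by blast
qed

lemma pgr_solv: assumes "pgr p P" "prime p" shows "solv P"
 unfolding solv_def
proof (intro conjI allI impI)
 show "grp P" using assms pgr_grp by blast
 fix K assume K: "grp K" "K \<subseteq> P" "der K = K"
 show "K = {1}"
 proof (rule ccontr)
  assume "K \<noteq> {1}"
  hence "{1} \<subset> K" using grpD(2)[OF K(1)] by blast
  then obtain f :: "'a \<Rightarrow> nat perm" where f: "ghom f K" "ab (f ` K)" "ker f K \<noteq> K"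
   by (rule pgr_elementary_quotient[OF pgr_sub[OF assms K(1,2)] assms(2) grp_one])
  have "f ` K = {1}" using der_img[OF f(1) K(1) order_refl] der_ab[OF grp_img[OF f(1)] f(2)] K(3) by simp
  thus False using f(3) by (auto simp: ker_def)
 qed
qed

text \<open>Given a perfect subgroup of the image, take a subgroup H of least order mapping onto it.
  The derived subgroup of H also maps onto it, so H is perfect and therefore trivial.\<close>

lemma solv_img:
 assumes "ghom f L" "solv L" shows "solv (f ` L)"
 unfolding solv_def
proof (intro conjI allI impI)
 show "grp (f ` L)" using grp_img assms(1) by blast
 fix K assume K: "grp K" "K \<subseteq> f ` L" "der K = K"
 have e: "grp (pre f L K) \<and> pre f L K \<subseteq> L \<and> f ` pre f L K = K"
  using grp_pre[OF assms(1) K(1)] pre_sub[of f L K] img_pre[OF K(2)] by simp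
 obtain H where H: "grp H \<and> H \<subseteq> L \<and> f ` H = K"
  and m: "\<And>B. grp B \<and> B \<subseteq> L \<and> f ` B = K \<Longrightarrow> card H \<le> card B"
  by (rule min_card_obtain[where P="\<lambda>H. grp H \<and> H \<subseteq> L \<and> f ` H = K", OF e]) (rule that)
 have d: "grp (der H) \<and> der H \<subseteq> L \<and> f ` der H = K"
  using H grp_der[of H] der_sub[of H] der_img[OF assms(1), of H] K(3) by auto
 have "der H = H" using m[OF d] subgroup_eq_card[of H "der H"] H der_sub[of H] by blast
 hence "H = {1}" using assms(2) H by (auto simp: solv_def)
 thus "K = {1}" using H ghomD(3)[OF assms(1)] by auto
qed

lemma ab_solv: "grp A \<Longrightarrow> ab A \<Longrightarrow> solv A"
 unfolding solv_def using der_ab ab_sub by metis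

lemma syl_normal_unique:
 assumes "syl p P L" "nml P L" "prime p" "syl p P' L" shows "P' = P"
 using syl_conj[OF assms(1,4,3)] nmlD(5)[OF assms(2)] by blast

lemma syl_normal_char:
 assumes "syl p P N" "nml P N" "prime p" "nml N L" shows "nml P L"
 unfolding nml_def
proof (intro conjI ballI)
 note N = nmlD[OF assms(4)]
 show "grp P" "grp L" "P \<subseteq> L" using sylD[OF assms(1)] N by auto
 fix g n assume g: "g \<in> L" "n \<in> P"
 have "syl p (cj g ` P) N" using syl_cj[OF assms(1), of g] N(5)[OF g(1)] by simp
 hence "cj g ` P = P" using syl_normal_unique assms(1-3) by blast
 thus "cj g n \<in> P" using g(2) by blast
qed

lemma syl_normal_elem:
 assumes "syl p P L" "nml P L" "prime p" "x \<in> L" "x ^ (p ^ n) = 1" shows "x \<in> P"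
proof -
 have "pgr p (cyc x)" "cyc x \<subseteq> L" using pgr_cyc[OF sylD(1)[OF assms(1)] assms(4,5,3)]
  grp_cyc(2)[OF sylD(1)[OF assms(1)] assms(4)] by auto
 then obtain g where "g \<in> L" "cyc x \<subseteq> cj g ` P" using syl_contains_conj[OF assms(1,3)] by blast
 thus ?thesis using nmlD(5)[OF assms(2)] cyc_self by blast
qed

lemma ab_nml: "ab A \<Longrightarrow> grp A \<Longrightarrow> grp B \<Longrightarrow> B \<subseteq> A \<Longrightarrow> nml B A"
proof -
 assume a: "ab A" "grp A" "grp B" "B \<subseteq> A"
 have "cj g n = n" if "g \<in> A" "n \<in> B" for g n
  using a that abD[of A g n] by (auto simp: cj_eq_iff)
 thus ?thesis using a by (simp add: nml_def)
qed

text \<open>The Sylow p-subgroup of an abelian normal subgroup is characteristic in it, hence normal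
  in \<open>L\<close>.\<close>

lemma ab_syl_core:
 assumes "nml A L" "ab A" "prime p" "x \<in> A" "x ^ (p ^ n) = 1"
 shows "x \<in> core {p} L"
proof -
 note A = nmlD[OF assms(1)]
 obtain P where P: "syl p P A" using syl_exists A(1) assms(3) by blast
 have n: "nml P A" using ab_nml assms(2) sylD[OF P] by blast
 have "x \<in> P" using syl_normal_elem[OF P n assms(3-5)] .
 moreover have "P \<subseteq> core {p} L"
  using core(3)[OF A(2) syl_normal_char[OF P n assms(3,1)]] sylD(2)[OF P] assms(3) pgr_iff_pig by blast
 ultimately show ?thesis by blast
qed

text \<open>The centralizer of the Fitting subgroup, which for a finite group is the product of the
  subgroups \<open>core {p} L\<close>.\<close>

abbreviation "cz_cores L \<equiv> {x \<in> L. \<forall>p. prime p \<longrightarrow> (\<forall>y\<in>core {p} L. x * y = y * x)}"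

text \<open>In a solvable group the centralizer D of the Fitting subgroup lies inside it. If D were
  not abelian, let B be a smallest normal subgroup of \<open>L\<close> in D that is not contained in
  Z(D). By minimality the derived subgroup of B is central in D, so for a Sylow subgroup S of B the
  product of S with B \<inter> Z(D) is normal in B and has S as a normal Sylow subgroup. Hence S is
  normal in \<open>L\<close>, lies in a core and is centralized by D. As this holds for every prime,
  B is central in D.\<close>

lemma fitting:
 fixes L :: "'a::group_mult set"
 assumes "solv L"
 defines "D \<equiv> cz_cores L"
 shows "nml D L" "ab D" "prime p \<Longrightarrow> x \<in> D \<Longrightarrow> x ^ (p ^ n) = 1 \<Longrightarrow> x \<in> core {p} L"
proof -
 have L: "grp L" using assms(1) solv_grp by blast
 have De: "D = cz L (\<Union>p\<in>{p. prime p}. core {p} L)" by (auto simp: D_def cz_def)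
 have gD: "grp D" unfolding De by (rule grp_cz[OF L])
 have DL: "D \<subseteq> L" by (auto simp: D_def)
 have Dp: "D = (\<Inter>p\<in>{p. prime p}. cz L (core {p} L)) \<inter> L" by (auto simp: D_def cz_def)
 show nD: "nml D L"
  unfolding nml_def
 proof (intro conjI ballI gD L DL)
  fix g x assume g: "g \<in> L" "x \<in> D"
  have "cj g x \<in> cz L (core {p} L)" if p: "prime p" for p
  proof -
   have "x \<in> cz L (core {p} L)" using g(2) p Dp by blast
   thus ?thesis using nmlD(4)[OF nml_cz[OF core(1)[OF L]] g(1)] by blast
  qed
  moreover have "cj g x \<in> L" using g DL grpD(6)[OF L] by blast
  ultimately show "cj g x \<in> D" using Dp by blast
 qed
 show abD: "ab D"
 proof (rule ccontr)
  assume "\<not> ab D"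
  define Z where "Z = cz D D"
  have "D \<subseteq> Z \<Longrightarrow> ab D" by (auto simp: Z_def cz_def ab_def)
  hence e: "nml D L \<and> D \<subseteq> D \<and> \<not> D \<subseteq> Z" using \<open>\<not> ab D\<close> nD by blast
  obtain B where B': "nml B L \<and> B \<subseteq> D \<and> \<not> B \<subseteq> Z"
   and mB: "\<And>C. nml C L \<and> C \<subseteq> D \<and> \<not> C \<subseteq> Z \<Longrightarrow> card B \<le> card C"
   by (rule min_card_obtain[where P="\<lambda>B. nml B L \<and> B \<subseteq> D \<and> \<not> B \<subseteq> Z", OF e]) (rule that)
  hence B: "nml B L" "B \<subseteq> D" "\<not> B \<subseteq> Z" by auto
  note Bn = nmlD[OF B(1)]
  have gZ: "grp Z" unfolding Z_def by (rule grp_cz[OF gD])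
  have "B \<noteq> {1}" using B(3) grpD(2)[OF gZ] by blast
  hence dB: "der B \<subset> B" using solv_der[OF assms(1) Bn(1,3)] by blast
  have "der B \<subseteq> Z"
  proof (rule ccontr)
   assume "\<not> der B \<subseteq> Z"
   hence "card B \<le> card (der B)" using mB[of "der B"] nml_der[OF B(1)] dB B(2) by blast
   thus False using psubset_card_mono[OF grpD(1)[OF Bn(1)] dB] by simp
  qed
  define Z0 where "Z0 = B \<inter> Z"
  have gZ0: "grp Z0" unfolding Z0_def using grp_Int Bn(1) gZ by blast
  have Zc: "z * x = x * z" if "z \<in> Z" "x \<in> D" for z x using that by (auto simp: Z_def cz_def)
  have "Z0 = B"
  proof (rule all_sylow[OF Bn(1) gZ0])
   show "Z0 \<subseteq> B" by (simp add: Z0_def)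
   fix t :: nat assume t: "prime t"
   obtain S where S: "syl t S B" using syl_exists Bn(1) t by blast
   note Sd = sylD[OF S]
   define E where "E = prd Z0 S"
   have cE: "cj k n = n" if "k \<in> S" "n \<in> Z0" for k n
    using that Zc[of n k] Sd(4) B(2) by (auto simp: cj_eq_iff Z0_def)
   have gE: "grp E" unfolding E_def by (rule grp_prd[OF gZ0 Sd(3)]) (simp add: cE)
   have EB: "E \<subseteq> B" unfolding E_def by (rule prd_least[OF _ Sd(4) Bn(1)]) (simp add: Z0_def)
   have SE: "S \<subseteq> E" "Z0 \<subseteq> E" unfolding E_def using prd_sub1 prd_sub2 gZ0 Sd(3) by blast+
   have nE: "nml E B"
    unfolding nml_def
   proof (intro conjI ballI gE Bn(1) EB)
    fix b e assume b: "b \<in> B" "e \<in> E"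
    have "cm b e \<in> Z0" using cm_in_der[of b B e] b EB \<open>der B \<subseteq> Z\<close> dB by (auto simp: Z0_def)
    hence "cm b e * e \<in> E" using SE(2) b(2) grpD(3)[OF gE] by blast
    thus "cj b e \<in> E" by (simp add: cj_cm)
   qed
   have nS: "nml S E"
    unfolding nml_def
   proof (intro conjI ballI gE Sd(3) SE(1))
    fix e s assume e: "e \<in> E" and s: "s \<in> S"
    obtain z u where zu: "z \<in> Z0" "u \<in> S" "e = z * u" using e by (auto simp: E_def prd_iff)
    have us: "cj u s \<in> S" using grpD(6)[OF Sd(3) zu(2) s] .
    have "cj z (cj u s) = cj u s"
     using Zc[of z "cj u s"] zu(1) us Sd(4) B(2) by (auto simp: cj_eq_iff Z0_def)
    thus "cj e s \<in> S" using us zu(3) by (simp add: cj_cj)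
   qed
   have "nml S L"
    using syl_normal_char[OF S syl_normal_char[OF syl_sub[OF S gE SE(1) EB] nS t nE] t B(1)] .
   hence "S \<subseteq> core {t} L" using core(3)[OF L] Sd(2) t pgr_iff_pig by blast
   hence "S \<subseteq> Z" using Sd(4) B(2) t by (auto simp: Z_def cz_def D_def)
   thus "\<exists>P. syl t P B \<and> P \<subseteq> Z0" using S Sd(4) by (auto simp: Z0_def)
  qed
  thus False using B(3) by (auto simp: Z0_def)
 qed
 show "x \<in> core {p} L" if "prime p" "x \<in> D" "x ^ (p ^ n) = 1"
  using ab_syl_core[OF nD abD that] .
qed

text \<open>If all these cores are trivial, \<open>cz_cores L\<close> is \<open>L\<close>, which is
  then abelian, and an element of prime order p lies in \<open>core {p} L\<close> after all.\<close>

lemma core_nontriv: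
 assumes "solv L" "L \<noteq> {1}" shows "\<exists>p. prime p \<and> core {p} L \<noteq> {1}"
proof (rule ccontr)
 assume "\<not> ?thesis"
 hence t: "core {p} L = {1}" if "prime p" for p using that by blast
 have L: "grp L" using assms(1) solv_grp by blast
 have e: "cz_cores L = L" using t by auto
 have a: "ab L" using fitting(2)[OF assms(1)] e by simp
 have "card L \<noteq> 1" using grp_card_one L assms(2) by blast
 then obtain p where p: "prime p" "p dvd card L" using prime_factor_nat by blast
 then obtain x where x: "x \<in> L" "x \<noteq> 1" "x ^ p = 1" using cauchy L by blast
 have "x \<in> core {p} L" using ab_syl_core[OF nml_refl[OF L] a p(1) x(1), of 1] x(3) by simp
 thus False using t p(1) x(2) by blast
qed

lemma core_mono: "\<pi> \<subseteq> \<sigma> \<Longrightarrow> core \<pi> L \<subseteq> core \<sigma> L"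
 unfolding core_def using pig_mono by blast

text \<open>Hall and Higman's Lemma 1.2.3.\<close>

lemma hall_higman:
 assumes "solv L" "prime p" "core (- {p}) L = {1}"
 shows "cz L (core {p} L) \<subseteq> core {p} L"
proof -
 have L: "grp L" using assms(1) solv_grp by blast
 define D where "D = cz_cores L"
 note D = fitting[OF assms(1), folded D_def]
 have t: "core {t} L = {1}" if "t \<noteq> p" for t
  using core_mono[of "{t}" "- {p}" L] that assms(3) grpD(2)[OF grp_core[OF L, of "{t}"]] by auto
 have e: "cz L (core {p} L) = D"
 proof -
  have "(\<forall>q. prime q \<longrightarrow> (\<forall>y\<in>core {q} L. x * y = y * x)) \<longleftrightarrow> (\<forall>y\<in>core {p} L. x * y = y * x)" for x
   using t assms(2) by (metis mult_1_left mult_1_right singletonD)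
  thus ?thesis by (simp add: D_def cz_def)
 qed
 have "pig {p} D"
  unfolding pig_def
 proof (intro conjI allI impI)
  show "grp D" using D(1) nmlD(1) by blast
  fix r :: nat assume r: "prime r" "r dvd card D"
  then obtain x where x: "x \<in> D" "x \<noteq> 1" "x ^ r = 1" using cauchy nmlD(1)[OF D(1)] by blast
  hence "x \<in> core {r} L" using D(3)[OF r(1) x(1), of 1] by simp
  thus "r \<in> {p}" using t x(2) by blast
 qed
 thus ?thesis using e core(3)[OF L D(1)] by simp
qed

lemma core_quotient:
 assumes "ghom f L" "ker f L = core \<pi> L" shows "core \<pi> (f ` L) = {1}"
proof -
 have L: "grp L" using ghomD(1) assms(1) by blast
 have g: "grp (f ` L)" using grp_img assms(1) by blast
 have "pre f L (core \<pi> (f ` L)) \<subseteq> core \<pi> L"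
  using core(3)[OF L nml_pre[OF assms(1) core(1)[OF g]]]
   pig_pre[OF assms(1) core(2)[OF g] core_sub[OF g]] assms(2) core(2)[OF L] by metis
 hence "core \<pi> (f ` L) \<subseteq> f ` ker f L" using img_pre[OF core_sub[OF g]] assms(2) by (metis image_mono)
 hence "core \<pi> (f ` L) \<subseteq> {1}" by (auto simp: ker_def)
 thus ?thesis using grpD(2)[OF grp_core[OF g, of \<pi>]] by blast
qed

section \<open>Groups all of whose sections have many permuting pairs\<close>

definition subs :: "'a::group_mult set \<Rightarrow> 'a set set" where
 "subs L = {H. grp H \<and> H \<subseteq> L}"

definition pp :: "'a::group_mult set \<Rightarrow> ('a set \<times> 'a set) set" where
 "pp L = {(A, B). A \<in> subs L \<and> B \<in> subs L \<and> prd A B = prd B A}"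

text \<open>The inequality sd > 23/25 with denominators cleared; all estimates are then made in
  natural numbers.\<close>

definition dense :: "'a::group_mult set \<Rightarrow> bool" where
 "dense L \<longleftrightarrow> 23 * (card (subs L))\<^sup>2 < 25 * card (pp L)"

type_synonym gp = "nat perm"

text \<open>Every section of a finite group is isomorphic to a group inside the type
 \<^typ>\<open>nat perm\<close>, so sections appear here as homomorphic images of subgroups.\<close>

definition Good :: "gp set \<Rightarrow> bool" where
 "Good L \<longleftrightarrow> grp L \<and> (\<forall>H f. grp H \<longrightarrow> H \<subseteq> L \<longrightarrow> ghom (f :: gp \<Rightarrow> gp) H \<longrightarrow> dense (f ` H))"

lemma Good_grp: "Good L \<Longrightarrow> grp L"
 by (simp add: Good_def)

lemma Good_sub: "Good L \<Longrightarrow> grp H \<Longrightarrow> H \<subseteq> L \<Longrightarrow> Good H"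
 by (auto simp: Good_def)

lemma Good_img: assumes "Good L" "ghom f L" shows "Good (f ` L)"
 unfolding Good_def
proof (intro conjI allI impI)
 show "grp (f ` L)" using grp_img assms(2) by blast
 fix H and g :: "gp \<Rightarrow> gp" assume H: "grp H" "H \<subseteq> f ` L" "ghom g H"
 have "ghom (g \<circ> f) (pre f L H)"
  using ghom_comp[OF ghom_sub[OF assms(2) grp_pre[OF assms(2) H(1)] pre_sub] H(3)] img_pre[OF H(2)] by simp
 moreover have "(g \<circ> f) ` pre f L H = g ` H" using img_pre[OF H(2)] by (metis image_comp)
 ultimately show "dense (g ` H)"
  using assms(1) grp_pre[OF assms(2) H(1)] pre_sub[of f L H] unfolding Good_def by metis
qed

lemma Good_dense: "Good L \<Longrightarrow> dense L"
proof -
 assume L: "Good L"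
 have "ghom id L" using Good_grp[OF L] by (simp add: ghom_def)
 hence "dense (id ` L)" using L unfolding Good_def by blast
 thus ?thesis by simp
qed

lemma finite_subs: "grp L \<Longrightarrow> finite (subs L)"
 unfolding subs_def by (rule finite_subset[of _ "Pow L"]) (auto simp: grpD(1))

section \<open>Counting non-permuting pairs in small sections\<close>

lemma dense_nonpermuting:
 assumes "dense L" "grp L" "NP \<subseteq> subs L \<times> subs L" "\<And>A B. (A, B) \<in> NP \<Longrightarrow> prd A B \<noteq> prd B A"
 shows "25 * card NP < 2 * (card (subs L))\<^sup>2"
proof -
 have f: "finite (subs L \<times> subs L)" using finite_subs assms(2) by blast
 have "pp L \<subseteq> subs L \<times> subs L - NP" using assms(4) by (auto simp: pp_def)
 hence "card (pp L) \<le> card (subs L \<times> subs L - NP)" using f by (intro card_mono) auto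
 also have "\<dots> = (card (subs L))\<^sup>2 - card NP"
  using f assms(3) by (simp add: card_Diff_subset finite_subset card_cartesian_product power2_eq_square)
 finally have "card (pp L) \<le> (card (subs L))\<^sup>2 - card NP" .
 moreover have "card NP \<le> (card (subs L))\<^sup>2"
  using card_mono[OF f assms(3)] by (simp add: card_cartesian_product power2_eq_square)
 ultimately show ?thesis using assms(1) unfolding dense_def by linarith
qed

text \<open>Here n and a are the numbers of subgroups in the families \<open>R\<close> and
  \<open>A\<close> of the next lemma, and 3 bounds the rest. For n = 2 and a = 0 both sides equal
  50.\<close>

lemma not_dense_numeric:
 fixes n a :: nat
 assumes "2 \<le> n" "a \<le> n" shows "2 * (n + a + 3)\<^sup>2 \<le> 25 * (n * (n - 1) + 2 * (n * a))"
proof -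
 have n: "2 \<le> int n" "int a \<le> int n" "0 \<le> int a" using assms by auto
 \<comment> \<open>The difference of the two sides is the sum of this product and the next
   one.\<close>
 have "0 \<le> (int n - 2) * (23 * int n + 9)" using n by simp
 moreover have "0 \<le> int a * (46 * int n - 2 * int a - 12)" using n by simp
 ultimately have "2 * (int n + int a + 3)\<^sup>2 \<le> 25 * (int n * (int n - 1) + 2 * (int n * int a))"
  by (simp add: power2_eq_square algebra_simps)
 moreover have "int (n - 1) = int n - 1" using assms by simp
 ultimately have "int (2 * (n + a + 3)\<^sup>2) \<le> int (25 * (n * (n - 1) + 2 * (n * a)))"
  by (simp only: of_nat_mult of_nat_add of_nat_power of_nat_numeral)
 thus ?thesis by linarith
qed

text \<open>The sections given by irreducible actions fit this pattern: complements in
  \<open>R\<close> that pairwise fail to permute, subgroups in \<open>A\<close> that permute with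
  none of them, and at most three others. Only the pairs within \<open>R\<close> and between
  \<open>R\<close> and \<open>A\<close> are counted.\<close>

lemma not_dense_count:
 assumes L: "grp L" and R: "R \<subseteq> subs L" "2 \<le> card R" and A: "A \<subseteq> subs L" "card A \<le> card R" "R \<inter> A = {}"
  and RR: "\<And>C D. C \<in> R \<Longrightarrow> D \<in> R \<Longrightarrow> C \<noteq> D \<Longrightarrow> prd C D \<noteq> prd D C"
  and RA: "\<And>C D. C \<in> R \<Longrightarrow> D \<in> A \<Longrightarrow> prd C D \<noteq> prd D C"
  and rest: "card (subs L - R - A) \<le> 3"
 shows "\<not> dense L"
proof
 assume d: "dense L"
 have fin: "finite R" "finite A" using finite_subs[OF L] R(1) A(1) finite_subset by blast+
 define NP where "NP = (R \<times> R - Id_on R) \<union> R \<times> A \<union> A \<times> R"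
 have "card (R \<times> R - Id_on R) = card R * (card R - 1)"
 proof -
  have e: "Id_on R = (\<lambda>x. (x, x)) ` R" by auto
  have "card (Id_on R) = card R" unfolding e by (rule card_image) (simp add: inj_on_def)
  moreover have "finite (Id_on R)" unfolding e using fin by simp
  moreover have "Id_on R \<subseteq> R \<times> R" by auto
  ultimately show ?thesis
   by (simp add: card_Diff_subset card_cartesian_product diff_mult_distrib2)
 qed
 moreover have "card NP = card (R \<times> R - Id_on R) + card (R \<times> A) + card (A \<times> R)"
  unfolding NP_def using fin A(3) by (subst card_Un_disjoint, simp, simp, blast)+ simp
 ultimately have NP: "card NP = card R * (card R - 1) + 2 * (card R * card A)"
  by (simp add: card_cartesian_product)
 have "25 * card NP < 2 * (card (subs L))\<^sup>2"
 proof (rule dense_nonpermuting[OF d L])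
  show "NP \<subseteq> subs L \<times> subs L" using R(1) A(1) by (auto simp: NP_def)
  fix C D assume "(C, D) \<in> NP"
  thus "prd C D \<noteq> prd D C" using RR RA by (auto simp: NP_def Id_on_def) metis
 qed
 moreover have "card (subs L) \<le> card R + card A + 3"
 proof -
  have "subs L = (R \<union> A) \<union> (subs L - R - A)" using R(1) A(1) by blast
  hence "card (subs L) \<le> card (R \<union> A) + card (subs L - R - A)" by (metis card_Un_le)
  thus ?thesis using card_Un_le[of R A] rest by linarith
 qed
 hence "(card (subs L))\<^sup>2 \<le> (card R + card A + 3)\<^sup>2" by (rule power_mono) simp
 moreover have "2 * (card R + card A + 3)\<^sup>2 \<le> 25 * card NP"
  unfolding NP by (rule not_dense_numeric[OF R(2) A(2)])
 ultimately show False by linarith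
qed

lemma prime_order_eq:
 assumes "grp C" "grp D" "card C = p" "card D = p" "prime p" "x \<in> C" "x \<in> D" "x \<noteq> 1"
 shows "C = D"
 using prime_card_cyc(1)[OF assms(1,3,5,6,8)] prime_card_cyc(1)[OF assms(2,4,5,7,8)] by simp

lemma prime_order_Int:
 assumes "grp C" "grp D" "card C = p" "card D = p" "prime p" "C \<noteq> D"
 shows "C \<inter> D = {1}"
 using prime_order_eq[OF assms(1-5)] assms(6) grpD(2)[OF assms(1)] grpD(2)[OF assms(2)] by blast

lemma od_pow_less:
 assumes "grp L" "x \<in> L" "prime r" "r dvd od x" shows "od (x ^ r) < od x"
proof -
 have "(x ^ r) ^ (od x div r) = 1" using od(2)[OF assms(1,2)] assms(4) by (simp flip: power_mult)
 hence "od (x ^ r) dvd od x div r" using od(3)[OF assms(1) grpD(5)[OF assms(1,2)]] by blast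
 moreover have "0 < od x div r" "od x div r < od x"
  using od(1)[OF assms(1,2)] assms(4) prime_gt_1_nat[OF assms(3)]
  by (auto simp: dvd_div_eq_0_iff intro: div_less_dividend)
 ultimately show ?thesis using dvd_imp_le[of "od (x ^ r)" "od x div r"] by linarith
qed

text \<open>A non-trivial action of a cyclic group on \<open>V\<close> yields, in a suitable section,
 a non-trivial action of a group of prime order.\<close>

lemma prime_action:
 fixes L :: "gp set"
 assumes "Good L" "grp V" "V \<subseteq> L" "k \<in> nz L V" "k \<notin> cz L V" "V \<inter> cyc k = {1}"
 obtains f :: "gp \<Rightarrow> gp" and H c r where "grp H" "H \<subseteq> L" "V \<subseteq> H" "ghom f H" "Good (f ` H)"
  "inj_on f V" "prime r" "r dvd od k" "nml (f ` V) (f ` H)" "c \<in> f ` H" "c ^ r = 1" "card (cyc c) = r"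
  "f ` H = prd (f ` V) (cyc c)" "f ` V \<inter> cyc c = {1}" "\<exists>v\<in>f ` V. c * v \<noteq> v * c"
proof -
 have L: "grp L" using assms(1) Good_grp by blast
 have kL: "k \<in> L" using assms(4) nz_sub by blast
 note ck = grp_cyc[OF L kL]
 have ckn: "cyc k \<subseteq> nz L V" using cyc_least[OF grp_nz[OF L] assms(4)] .
 \<comment> \<open>An element of least order among the powers of k that do not centralize
   \<open>V\<close>. For every prime r dividing this order, \<open>k1 ^ r\<close> has smaller order
   and so centralizes \<open>V\<close>.\<close>
 obtain k1 where k1: "k1 \<in> cyc k - cz L V"
  and mk: "\<And>j. j \<in> cyc k - cz L V \<Longrightarrow> od k1 \<le> od j"
 proof -
  have "k \<in> cyc k - cz L V" using assms(5) by simp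
  thus ?thesis using that ex_has_least_nat[of "\<lambda>j. j \<in> cyc k - cz L V" k od] by blast
 qed
 have k1L: "k1 \<in> L" using k1 ck(2) by blast
 note c1 = grp_cyc[OF L k1L]
 have c1k: "cyc k1 \<subseteq> cyc k" using cyc_least[OF ck(1)] k1 by blast
 have "k1 \<noteq> 1" using k1 grpD(2)[OF grp_cz[OF L]] by blast
 hence "od k1 \<noteq> 1" using od_eq_one[OF L k1L] by simp
 then obtain r where r: "prime r" "r dvd od k1" using prime_factor_nat by blast
 have rk: "r dvd od k" using r(2) lagrange_dvd[OF ck(1) c1(1) c1k] od(4)[OF L kL] od(4)[OF L k1L] dvd_trans by metis
 \<comment> \<open>Dividing by this central subgroup of \<open>H\<close> leaves an action of prime
   order r, and \<open>V\<close> embeds in the quotient because it meets \<open>cyc k\<close>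
   trivially.\<close>
 define N0 where "N0 = cyc (k1 ^ r)"
 have krL: "k1 ^ r \<in> L" using grpD(5)[OF L k1L] .
 have "k1 ^ r \<in> cyc k" using c1k by auto
 moreover have "od (k1 ^ r) < od k1" using od_pow_less[OF L k1L r] .
 ultimately have krc: "k1 ^ r \<in> cz L V" using mk[of "k1 ^ r"] by (auto simp: not_le)
 have gN0: "grp N0" unfolding N0_def using grp_cyc(1)[OF L krL] .
 have N0k: "N0 \<subseteq> cyc k1" unfolding N0_def using cyc_least[OF c1(1)] by simp
 have N0c: "N0 \<subseteq> cz L V" unfolding N0_def using cyc_least[OF grp_cz[OF L] krc] .
 define H where "H = prd V (cyc k1)"
 have k1n: "cj j v \<in> V" if "j \<in> cyc k1" "v \<in> V" for j v
  using that ckn c1k nz_D by blast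
 have gH: "grp H" unfolding H_def by (rule grp_prd[OF assms(2) c1(1) k1n])
 have HL: "H \<subseteq> L" unfolding H_def by (rule prd_least[OF assms(3) c1(2) L])
 have VH: "V \<subseteq> H" "cyc k1 \<subseteq> H" unfolding H_def using prd_sub1 prd_sub2 assms(2) c1(1) by blast+
 have nV: "nml V H" unfolding H_def by (rule nml_prd_left[OF assms(2) c1(1) k1n])
 have nN: "nml N0 H"
  unfolding nml_def
 proof (intro conjI ballI gN0 gH)
  show "N0 \<subseteq> H" using N0k VH by blast
  fix h n assume h: "h \<in> H" and n: "n \<in> N0"
  obtain w j where w: "w \<in> V" "j \<in> cyc k1" "h = w * j" using h by (auto simp: H_def prd_iff)
  have "cj j n = n" using cyc_abelian[OF w(2)] n N0k by (auto simp: cj_eq_iff)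
  moreover have "cj w n = n" using n N0c w(1) by (auto simp: cj_eq_iff cz_def)
  ultimately show "cj h n \<in> N0" using n w(3) by (simp flip: cj_cj)
 qed
 obtain f :: "gp \<Rightarrow> gp" where f: "ghom f H" "ker f H = N0" using quotient_exists[OF nN] by blast
 have VN: "V \<inter> N0 = {1}" using assms(6) N0k c1k grpD(2)[OF gN0] by blast
 have fm: "f x = f y \<longleftrightarrow> inverse x * y \<in> N0" if "x \<in> H" "y \<in> H" for x y
  using ghom_eq_iff[OF f(1) that] f(2) by simp
 have inj: "inj_on f V"
 proof (rule inj_onI)
  fix x y assume xy: "x \<in> V" "y \<in> V" "f x = f y"
  hence "inverse x * y \<in> V \<inter> N0" using fm VH(1) grpD(3,4)[OF assms(2)] by blast
  thus "x = y" using VN by (simp add: mult_eq_one_iff)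
 qed
 have k1H: "k1 \<in> H" using VH(2) by auto
 define c where "c = f k1"
 have cH: "c \<in> f ` H" using k1H by (simp add: c_def)
 have gfH: "grp (f ` H)" using grp_img f(1) by blast
 have cr: "c ^ r = 1"
 proof -
  have "k1 ^ r \<in> ker f H" unfolding f(2) by (simp add: N0_def)
  hence "f (k1 ^ r) = 1" by (simp add: ker_def)
  thus ?thesis using ghomD(5)[OF f(1) k1H] by (simp add: c_def)
 qed
 have "c \<noteq> 1"
 proof
  assume "c = 1"
  hence "k1 \<in> N0" using f(2) k1H by (auto simp: c_def ker_def)
  thus False using N0c k1 by blast
 qed
 hence cc: "card (cyc c) = r" using card_cyc_prime[OF gfH cH _ cr r(1)] by simp
 have fc: "f ` cyc k1 = cyc c"
  unfolding cyc_def c_def image_image using ghomD(5)[OF f(1) k1H] by simp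
 have fH: "f ` H = prd (f ` V) (cyc c)"
 proof (intro equalityI subsetI)
  fix y assume "y \<in> f ` H"
  then obtain v j where vj: "v \<in> V" "j \<in> cyc k1" "y = f (v * j)" by (auto simp: H_def prd_iff)
  hence "y = f v * f j" using ghomD(2)[OF f(1), of v j] VH by blast
  thus "y \<in> prd (f ` V) (cyc c)" using vj fc by (auto intro: prdI)
 next
  fix y assume "y \<in> prd (f ` V) (cyc c)"
  then obtain v j where vj: "v \<in> V" "j \<in> cyc k1" "y = f v * f j" unfolding fc[symmetric] prd_iff by blast
  hence "y = f (v * j)" using ghomD(2)[OF f(1), of v j] VH by (metis subsetD)
  moreover have "v * j \<in> H" unfolding H_def using vj by (simp add: prdI)
  ultimately show "y \<in> f ` H" by blast
 qed
 have Vc: "f ` V \<inter> cyc c = {1}"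
 proof
  show "{1} \<subseteq> f ` V \<inter> cyc c"
   using ghomD(3)[OF f(1)] grpD(2)[OF assms(2)] grpD(2)[OF grp_cyc(1)[OF gfH cH]] by force
  show "f ` V \<inter> cyc c \<subseteq> {1}"
  proof
   fix y assume "y \<in> f ` V \<inter> cyc c"
   then obtain v j where vj: "v \<in> V" "j \<in> cyc k1" "y = f v" "y = f j" unfolding fc[symmetric] by blast
   hence "inverse v * j \<in> N0" using fm[of v j] VH by auto
   hence "inverse v * j \<in> cyc k1" using N0k by blast
   hence "inverse v \<in> cyc k1" using vj(2) grp_cancel(2)[OF c1(1)] by blast
   hence "v \<in> cyc k1" using grp_inv_iff c1(1) by blast
   hence "v = 1" using assms(6) c1k vj(1) by blast
   thus "y \<in> {1}" using vj(3) ghomD(3)[OF f(1)] by simp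
  qed
 qed
 have nc: "\<exists>v\<in>f ` V. c * v \<noteq> v * c"
 proof (rule ccontr)
  assume a: "\<not> ?thesis"
  have "k1 * v = v * k1" if v: "v \<in> V" for v
  proof -
   have vH: "v \<in> H" using v VH by blast
   have "f (cj k1 v) = cj c (f v)" using ghomD(6)[OF f(1) k1H vH] by (simp add: c_def)
   also have "\<dots> = f v" using a v by (auto simp: cj_eq_iff)
   finally have "cj k1 v = v" using inj k1n[of k1 v] v by (auto simp: inj_on_def)
   thus ?thesis by (simp add: cj_eq_iff)
  qed
  thus False using k1 k1L by (auto simp: cz_def)
 qed
 show thesis
  by (rule that[OF gH HL VH(1) f(1) Good_img[OF Good_sub[OF assms(1) gH HL] f(1)] inj r(1) rk
     nml_img[OF f(1) nV] cH cr cc fH Vc nc])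
qed

lemma pgr_prime: "grp A \<Longrightarrow> card A = p \<Longrightarrow> pgr p A"
 unfolding pgr_def by (metis power_one_right)

text \<open>The subgroups of order r are Sylow subgroups, hence conjugate, and conjugating by
  elements of \<open>V\<close> suffices. As c fixes no non-trivial element of \<open>V\<close>,
  different elements give different conjugates. Two that permute would generate a subgroup of order
  r^2, which does not divide |V| r.\<close>

lemma complements_of_prime_order:
 assumes "nml V S" "card (cyc c) = r" "prime r" "S = prd V (cyc c)" "V \<inter> cyc c = {1}" "c \<in> S"
  and nd: "\<not> r dvd card V" and fx: "\<And>u. u \<in> V \<Longrightarrow> c * u = u * c \<Longrightarrow> u = 1"
 defines "R \<equiv> {A \<in> subs S. card A = r}"
 shows "card R = card V" "\<And>C D. C \<in> R \<Longrightarrow> D \<in> R \<Longrightarrow> C \<noteq> D \<Longrightarrow> prd C D \<noteq> prd D C"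
  "card S = card V * r" "\<And>D. D \<in> R \<Longrightarrow> \<exists>v\<in>V. D = cj v ` cyc c"
proof -
 note V = nmlD[OF assms(1)]
 note C = grp_cyc[OF V(2) assms(6)]
 show cS: "card S = card V * r"
  using card_prd[OF V(1) C(1)] assms(2,4,5) by simp
 have sC: "syl r (cyc c) S"
 proof -
  have "card (lcs S (cyc c)) * r = card V * r" using lagrange[OF V(2) C(1,2)] assms(2) cS by metis
  hence "card (lcs S (cyc c)) = card V" using prime_gt_0_nat[OF assms(3)] by auto
  thus ?thesis using V(2) C pgr_prime[OF C(1) assms(2)] nd by (simp add: syl_def)
 qed
 show ex: "\<exists>v\<in>V. D = cj v ` cyc c" if "D \<in> R" for D
 proof -
  have D: "grp D" "D \<subseteq> S" "card D = r" using that by (auto simp: R_def subs_def)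
  hence "pgr r D" using pgr_prime by blast
  then obtain s where s: "s \<in> S" "D \<subseteq> cj s ` cyc c" using syl_contains_conj[OF sC assms(3)] D(2) by blast
  hence e: "D = cj s ` cyc c"
   using card_subset_eq[of "cj s ` cyc c" D] D assms(2) grpD(1)[OF C(1)] by simp
  obtain v j where vj: "v \<in> V" "j \<in> cyc c" "s = v * j" using s(1) assms(4) by (auto simp: prd_iff)
  have "cj j ` cyc c = cyc c" using cj_img_grp[OF C(1) vj(2)] .
  hence "D = cj v ` cyc c" using e vj(3) by (simp flip: cj_img_comp)
  thus ?thesis using vj(1) by blast
 qed
 have "R = (\<lambda>v. cj v ` cyc c) ` V"
 proof
  show "R \<subseteq> (\<lambda>v. cj v ` cyc c) ` V" using ex by blast
  have "cj v ` cyc c \<subseteq> S" if "v \<in> V" for v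
   using that V(3) C(2) grpD(6)[OF V(2)] by blast
  thus "(\<lambda>v. cj v ` cyc c) ` V \<subseteq> R"
   using grp_cj[OF C(1)] assms(2) by (auto simp: R_def subs_def)
 qed
 moreover have "inj_on (\<lambda>v. cj v ` cyc c) V"
 proof (rule inj_onI)
  fix v w assume vw: "v \<in> V" "w \<in> V" "cj v ` cyc c = cj w ` cyc c"
  define u where "u = inverse w * v"
  have u: "u \<in> V" using vw grpD(3,4)[OF V(1)] by (simp add: u_def)
  have "cj u ` cyc c = cj (inverse w) ` cj v ` cyc c" unfolding u_def by (simp only: cj_img_comp)
  also have "\<dots> = cyc c" unfolding vw(3) by simp
  finally have "cj u c \<in> cyc c" using cyc_self by blast
  hence "cm u c \<in> cyc c" using grpD(3)[OF C(1) _ grpD(4)[OF C(1) cyc_self]]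
   by (simp add: cm_def cj_def)
  moreover have "cm u c \<in> V"
  proof -
   have "cm u c = u * cj c (inverse u)" by (simp add: cm_def cj_def mult.assoc)
   moreover have "cj c (inverse u) \<in> V" using V(4)[OF assms(6) grpD(4)[OF V(1) u]] .
   ultimately show ?thesis using u grpD(3)[OF V(1)] by simp
  qed
  ultimately have "cm u c = 1" using assms(5) by blast
  hence "u = 1" using fx[OF u] by (simp add: cm_eq_one)
  hence "inverse w = inverse v" unfolding u_def by (simp add: mult_eq_one_iff)
  thus "v = w" by simp
 qed
 ultimately show "card R = card V" by (simp add: card_image)
 show "prd A B \<noteq> prd B A" if AB: "A \<in> R" "B \<in> R" "A \<noteq> B" for A B
 proof
  assume e: "prd A B = prd B A"
  have g: "grp A" "grp B" "A \<subseteq> S" "B \<subseteq> S" "card A = r" "card B = r" using AB by (auto simp: R_def subs_def)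
  have "grp (prd A B)" using grp_prd_iff[OF g(1,2)] e by simp
  hence "card (prd A B) dvd card S" using lagrange_dvd[OF V(2)] prd_least[OF g(3,4) V(2)] by blast
  moreover have "card (prd A B) = r * r"
   using card_prd[OF g(1,2)] prime_order_Int[OF g(1,2,5,6) assms(3) AB(3)] g by simp
  ultimately have "r * r dvd r * card V" using cS by (simp add: mult.commute)
  hence "r dvd card V" using assms(3) by (simp add: prime_gt_0_nat)
  thus False using nd by simp
 qed
qed

text \<open>If \<open>c\<close> acts irreducibly on the abelian group \<open>V\<close>, then every subgroup of \<open>V \<rtimes> \<langle>c\<rangle>\<close> is
 contained in \<open>V\<close>, has order \<open>r\<close>, or is the whole group.\<close>

lemma irreducible_not_dense:
 assumes V: "nml V S" "ab V" and c: "card (cyc c) = r" "prime r" "S = prd V (cyc c)" "V \<inter> cyc c = {1}" "c \<in> S"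
  and nd: "\<not> r dvd card V" and nt: "\<exists>v\<in>V. c * v \<noteq> v * c"
  and irr: "\<And>B. grp B \<Longrightarrow> B \<subseteq> V \<Longrightarrow> c \<in> nz S B \<Longrightarrow> B = {1} \<or> B = V"
  and few: "card (subs V) \<le> card V + 2"
 shows "\<not> dense S"
proof -
 note n = nmlD[OF V(1)]
 have aVn: "V \<subseteq> nz S B" if "B \<subseteq> V" for B
 proof
  fix v assume v: "v \<in> V"
  have "cj v b = b" if "b \<in> B" for b using abD[OF V(2) v] that \<open>B \<subseteq> V\<close> by (auto simp: cj_eq_iff)
  thus "v \<in> nz S B" using v n(3) by (auto simp: nz_def)
 qed
 have fx: "u = 1" if u: "u \<in> V" "c * u = u * c" for u
 proof -
  have "c \<in> nz S (cz V {c})"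
  proof (rule nzI[OF grpD(1)[OF grp_cz[OF n(1)]] c(5)])
   fix a assume a: "a \<in> cz V {c}"
   hence "cj c a = a" by (simp add: cz_def cj_eq_iff)
   thus "cj c a \<in> cz V {c}" using a by simp
  qed
  hence "cz V {c} = {1} \<or> cz V {c} = V" by (rule irr[OF grp_cz[OF n(1)] cz_sub])
  moreover have "cz V {c} \<noteq> V" using nt by (force simp: cz_def)
  moreover have "u \<in> cz V {c}" using u unfolding cz_def by simp
  ultimately show ?thesis by blast
 qed
 define R where "R = {A \<in> subs S. card A = r}"
 note cp = complements_of_prime_order[OF V(1) c nd fx, folded R_def]
 have tri: "B \<subseteq> V \<or> B \<in> R \<or> B = S" if B: "grp B" "B \<subseteq> S" for B
 proof -
  define I where "I = V \<inter> B"
  have I: "grp I" "I \<subseteq> V" "I \<subseteq> B" unfolding I_def using grp_Int[OF n(1) B(1)] by auto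
  define m where "m = card (lcs B I)"
  have m: "card B = m * card I" unfolding m_def by (rule lagrange[OF B(1) I(1,3)])
  have "card (prd V B) * card I = card V * card B" using card_prd[OF n(1) B(1)] by (simp add: I_def)
  hence "card (prd V B) = card V * m" unfolding m using grpD(8)[OF I(1)] by simp
  moreover have "card (prd V B) dvd card S"
   by (rule lagrange_dvd[OF n(2) grp_prd_nml[OF V(1) B] prd_sub_nml[OF V(1) B(2)]])
  ultimately have "m dvd r" using cp(3) grpD(8)[OF n(1)] by simp
  hence "m = 1 \<or> m = r" using c(2) by (auto simp: prime_nat_iff)
  thus ?thesis
  proof
   assume "m = 1"
   hence "I = B" using subgroup_eq_card[OF B(1) I(3)] m by simp
   thus ?thesis using I(2) by simp
  next
   assume mr: "m = r"
   \<comment> \<open>\<open>B\<close> contains a conjugate of \<open>cyc c\<close> by an element of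
     \<open>V\<close>. Since \<open>V\<close> is abelian, \<open>I\<close> is then invariant under c
     itself, and irreducibility applies.\<close>
   then obtain x where x: "x \<in> B" "x \<noteq> 1" "x ^ r = 1" using cauchy[OF B(1) c(2)] m by auto
   have xS: "x \<in> S" using x(1) B(2) by blast
   have "cyc x \<in> R" using grp_cyc[OF n(2) xS] card_cyc_prime[OF n(2) xS x(2,3) c(2)] by (simp add: R_def subs_def)
   then obtain v where v: "v \<in> V" "cyc x = cj v ` cyc c" using cp(4) by blast
   have "B \<subseteq> nz S I" using nmlD(5)[OF nml_Int[OF V(1) B]] B(2) unfolding I_def nz_def by blast
   hence "cj v c \<in> nz S I" using cyc_least[OF B(1) x(1)] v(2) cyc_self[of c] by blast
   hence "cj (inverse v) (cj v c) \<in> nz S I"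
    using aVn[OF I(2)] v(1) grpD(4,6)[OF grp_nz[OF n(2)]] by blast
   hence "I = {1} \<or> I = V" using irr[OF I(1,2)] by simp
   thus ?thesis
   proof
    assume "I = {1}" thus ?thesis using m mr B by (simp add: R_def subs_def)
   next
    assume "I = V"
    hence "card B = card S" using m mr cp(3) by (metis mult.commute)
    hence "B = S" by (intro subgroup_eq_card[OF n(2) B(2)]) simp
    thus ?thesis by simp
   qed
  qed
 qed
 \<comment> \<open>The hypothesis \<open>few\<close> keeps \<open>AA\<close> from being larger than
   \<open>R\<close>, as the count requires; outside both families only {1}, \<open>V\<close> and
   \<open>S\<close> remain.\<close>
 define AA where "AA = subs V - {{1}, V}"
 have V1: "V \<noteq> {1}" using nt by auto
 show ?thesis
 proof (rule not_dense_count[of S R AA, OF n(2)])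
  show "R \<subseteq> subs S" "AA \<subseteq> subs S" using n(3) by (auto simp: R_def AA_def subs_def)
  show "2 \<le> card R" using cp(1) grp_card_one[OF n(1)] grpD(8)[OF n(1)] V1 by (metis One_nat_def Suc_leI nat_neq_iff less_one numeral_2_eq_2)
  have rV: "B \<notin> R" if "B \<subseteq> V" for B using lagrange_dvd[OF n(1) _ that] nd by (auto simp: R_def subs_def)
  thus "R \<inter> AA = {}" by (auto simp: AA_def subs_def)
  have "{{1}, V} \<subseteq> subs V" using n(1) grpD(2)[OF n(1)] by (auto simp: subs_def)
  hence "card AA = card (subs V) - 2" unfolding AA_def using V1 by (subst card_Diff_subset) auto
  thus "card AA \<le> card R" using few cp(1) by linarith
  show "prd D B \<noteq> prd B D" if DB: "D \<in> R" "B \<in> AA" for D B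
  proof
   assume e: "prd D B = prd B D"
   have g: "grp D" "grp B" "D \<subseteq> S" "B \<subseteq> V" "card D = r" "B \<noteq> {1}" "B \<noteq> V" using DB by (auto simp: R_def AA_def subs_def)
   have BS: "B \<subseteq> S" using g(4) n(3) by blast
   define E where "E = prd D B"
   have E: "grp E" "E \<subseteq> S" "D \<subseteq> E" "B \<subseteq> E" unfolding E_def
    using grp_prd_iff[OF g(1,2)] e prd_least[OF g(3) BS n(2)] prd_sub1[OF g(1,2)] prd_sub2[OF g(1,2)] by auto
   have "\<not> E \<subseteq> V" using rV[of D] DB(1) E(3) by blast
   moreover have "E \<notin> R"
   proof
    assume "E \<in> R"
    hence "D = E" using subgroup_eq_card[OF E(1,3)] g(5) by (simp add: R_def)
    hence "card B dvd r" "card B dvd card V" using lagrange_dvd[OF g(1,2)] lagrange_dvd[OF n(1) g(2,4)] E(4) g(5) by auto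
    thus False using c(2) nd g(2,6) grp_card_one[OF g(2)] by (metis prime_nat_iff)
   qed
   moreover have "E \<noteq> S"
   proof
    assume "E = S"
    hence "card V * r * card (D \<inter> B) = r * card B" using card_prd[OF g(1,2)] cp(3) g(5) by (simp add: E_def)
    hence "card V * card (D \<inter> B) = card B" using prime_gt_0_nat[OF c(2)] by simp
    moreover have "card (D \<inter> B) > 0" by (rule grpD(8)[OF grp_Int[OF g(1,2)]])
    ultimately have "card V \<le> card B" by (metis dvd_imp_le dvd_triv_left grpD(8)[OF g(2)])
    thus False using subgroup_eq_card[OF n(1) g(4)] g(7) by blast
   qed
   ultimately show False using tri[OF E(1,2)] by blast
  qed
  have "subs S - R - AA \<subseteq> {{1}, V, S}" using tri by (auto simp: AA_def subs_def)
  hence "card (subs S - R - AA) \<le> card {{1}, V, S}" by (rule card_mono[rotated]) simp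
  also have "\<dots> \<le> 3" by (simp add: card_insert_if)
  finally show "card (subs S - R - AA) \<le> 3" .
 qed (use cp(2) in auto)
qed

section \<open>Normalizers of subgroups of order p and p^2\<close>

lemma prime_order_ab: assumes "grp A" "card A = p" "prime p" shows "ab A"
proof -
 have "A \<noteq> {1}" using assms by auto
 then obtain a where "a \<in> A" "a \<noteq> 1" using grpD(2)[OF assms(1)] by blast
 thus ?thesis using prime_card_cyc(1)[OF assms] ab_cyc by metis
qed

text \<open>A non-trivial action would produce a section of order p r in which an element of order r
  acts without fixed points on a group of order p; the smallest example is S_3. The case r = p
  cannot occur, because in a p-group a normal subgroup of order p is central.\<close>

lemma normalizer_prime_order:
 fixes L :: "gp set"
 assumes "Good L" "grp A" "A \<subseteq> L" "card A = p" "prime p"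
 shows "nz L A = cz L A"
proof (rule ccontr)
 assume "nz L A \<noteq> cz L A"
 then obtain k where k: "k \<in> nz L A" "k \<notin> cz L A" using cz_sub_nz by blast
 have L: "grp L" using assms(1) Good_grp by blast
 have kL: "k \<in> L" using k nz_sub by blast
 note ck = grp_cyc[OF L kL]
 have i: "A \<inter> cyc k = {1}"
 proof (rule ccontr)
  assume "A \<inter> cyc k \<noteq> {1}"
  then obtain a where a: "a \<in> A" "a \<in> cyc k" "a \<noteq> 1" using grpD(2)[OF assms(2)] grpD(2)[OF ck(1)] by blast
  hence "A \<subseteq> cyc k" using prime_card_cyc(1)[OF assms(2,4,5) a(1,3)] cyc_least[OF ck(1) a(2)] by simp
  hence "\<forall>x\<in>A. k * x = x * k" using cyc_abelian[OF cyc_self] by blast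
  thus False using k(2) kL by (simp add: cz_def)
 qed
 obtain f :: "gp \<Rightarrow> gp" and H c r where f: "grp H" "H \<subseteq> L" "A \<subseteq> H" "ghom f H" "Good (f ` H)"
  "inj_on f A" "prime r" "r dvd od k" "nml (f ` A) (f ` H)" "c \<in> f ` H" "c ^ r = 1" "card (cyc c) = r"
  "f ` H = prd (f ` A) (cyc c)" "f ` A \<inter> cyc c = {1}" "\<exists>v\<in>f ` A. c * v \<noteq> v * c"
  using prime_action[OF assms(1-3) k i] .
 define S where "S = f ` H"
 define V where "V = f ` A"
 have V: "nml V S" "grp V" "card V = p" "grp S" "V \<subseteq> S"
  using f(9) nmlD[OF f(9)] card_image[OF f(6)] assms(4) by (simp_all add: S_def V_def)
 note F = f[folded S_def V_def]
 have nct: "u = 1" if "u \<in> V" "c * u = u * c" for u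
 proof (rule ccontr)
  assume "u \<noteq> 1"
  hence "V = cyc u" using prime_card_cyc(1)[OF V(2,3) assms(5) that(1)] by blast
  moreover have "cyc u \<subseteq> cz S {c}"
   by (rule cyc_least[OF grp_cz[OF V(4)]]) (use that V in "auto simp: cz_def")
  ultimately show False using F(15) by (auto simp: cz_def)
 qed
 have "r \<noteq> p"
 proof
  assume rp: "r = p"
  have "card S = p * r" using card_prd[OF V(2) grp_cyc(1)[OF V(4) F(10)]] V(3) F(12,13,14) by simp
  hence "pgr p S" using V(4) rp by (auto simp: pgr_def power2_eq_square intro: exI[of _ 2])
  moreover have "V \<noteq> {1}" using V(3) assms(5) by auto
  ultimately obtain z where "z \<in> V" "z \<noteq> 1" "\<forall>g\<in>S. g * z = z * g"
   using pgr_normal_meets_center[OF _ assms(5) V(1)] by blast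
  thus False using nct F(10) by blast
 qed
 hence nd: "\<not> r dvd card V" using V(3) F(7) assms(5) primes_dvd_imp_eq by blast
 have sub: "B = {1} \<or> B = V" if B: "grp B" "B \<subseteq> V" for B
 proof -
  have "card B = 1 \<or> card B = p" using lagrange_dvd[OF V(2) B] V(3) assms(5) by (auto simp: prime_nat_iff)
  thus ?thesis using grp_card_one[OF B(1)] subgroup_eq_card[OF V(2) B(2)] V(3) by auto
 qed
 have "subs V \<subseteq> {{1}, V}" using sub by (auto simp: subs_def)
 hence "card (subs V) \<le> card {{1}, V}" by (rule card_mono[rotated]) simp
 also have "\<dots> \<le> card V + 2" by (simp add: card_insert_if)
 finally have few: "card (subs V) \<le> card V + 2" .
 have "ab V" using prime_order_ab[OF V(2,3) assms(5)] .
 hence "\<not> dense S" using irreducible_not_dense[OF V(1) _ F(12,7,13,14,10) nd F(15) _ few] sub by blast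
 thus False using Good_dense F(5) by blast
qed

text \<open>If d displaces v by a factor l that d centralizes, powers of d displace v by powers of
  l. With d of finite order this bounds the order of l.\<close>

lemma cj_power_shift:
 assumes "cj d v = l * v" "cj d l = l" shows "cj (d ^ n) v = l ^ n * v"
proof (induction n)
 case (Suc n)
 have "cj (d ^ Suc n) v = cj d (cj (d ^ n) v)" by (simp add: cj_cj)
 thus ?case using Suc assms by (simp add: cj_mult cj_pow) (metis mult.assoc power_commutes)
qed simp

text \<open>An irreducible action is excluded by counting. In a reducible one an invariant subgroup
  B of order p and the quotient by B are both centralized by the case of prime order, so commutators
  with c have order dividing both p and r. Coprimality rules out r = p, where this last step would
  be empty.\<close>

lemma normalizer_rank_two:
 fixes L :: "gp set"
 assumes "Good L" "grp A" "A \<subseteq> L" "card A = p ^ 2" "prime p" "ab A" "\<And>v. v \<in> A \<Longrightarrow> v ^ p = 1"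
  "k \<in> nz L A" "coprime (od k) p"
 shows "k \<in> cz L A"
proof (rule ccontr)
 assume k: "k \<notin> cz L A"
 have L: "grp L" using assms(1) Good_grp by blast
 have kL: "k \<in> L" using assms(8) nz_sub by blast
 note ck = grp_cyc[OF L kL]
 have i: "A \<inter> cyc k = {1}"
 proof -
  have g: "grp (A \<inter> cyc k)" using grp_Int assms(2) ck(1) by blast
  have "card (A \<inter> cyc k) dvd p ^ 2" "card (A \<inter> cyc k) dvd od k"
   using lagrange_dvd[OF assms(2) g] lagrange_dvd[OF ck(1) g] assms(4) od(4)[OF L kL] by auto
  moreover have "coprime (od k) (p ^ 2)" using assms(9) by simp
  ultimately have "card (A \<inter> cyc k) = 1" by (metis coprime_common_divisor_nat)
  thus ?thesis using grp_card_one g by blast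
 qed
 obtain f :: "gp \<Rightarrow> gp" and H c r where f: "grp H" "H \<subseteq> L" "A \<subseteq> H" "ghom f H" "Good (f ` H)"
  "inj_on f A" "prime r" "r dvd od k" "nml (f ` A) (f ` H)" "c \<in> f ` H" "c ^ r = 1" "card (cyc c) = r"
  "f ` H = prd (f ` A) (cyc c)" "f ` A \<inter> cyc c = {1}" "\<exists>v\<in>f ` A. c * v \<noteq> v * c"
  using prime_action[OF assms(1-3,8) k i] .
 define S where "S = f ` H"
 define V where "V = f ` A"
 have V: "nml V S" "grp V" "card V = p ^ 2" "grp S" "V \<subseteq> S"
  using f(9) nmlD[OF f(9)] card_image[OF f(6)] assms(4) by (simp_all add: S_def V_def)
 note F = f[folded S_def V_def]
 have Vab: "ab V" unfolding V_def using ab_img[OF f(4) assms(6) f(3)] .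
 have Vp: "v ^ p = 1" if v: "v \<in> V" for v
 proof -
  obtain a where a: "a \<in> A" "v = f a" using v by (auto simp: V_def)
  hence "v ^ p = f (a ^ p)" using ghomD(5)[OF f(4), of a p] f(3) by auto
  thus ?thesis using assms(7)[OF a(1)] ghomD(3)[OF f(4)] by simp
 qed
 have rp: "r \<noteq> p"
 proof
  assume "r = p"
  hence "p dvd gcd (od k) p" using F(8) by simp
  hence "p dvd 1" using assms(9) by (simp add: coprime_iff_gcd_eq_1)
  thus False using assms(5) by auto
 qed
 hence nd: "\<not> r dvd card V" using V(3) F(7) assms(5)
  by (metis prime_dvd_power primes_dvd_imp_eq)
 \<comment> \<open>The action of \<open>c\<close> on \<open>V\<close> is irreducible.\<close>
 have irr: False if B: "grp B" "B \<subseteq> V" "card B = p" "c \<in> nz S B" for B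
 proof -
  have BS: "B \<subseteq> S" using B(2) V(5) by blast
  have cB: "c \<in> cz S B" using normalizer_prime_order[OF F(5) B(1) BS B(3) assms(5)] B(4) by blast
  have nB: "nml B S"
  proof -
   have "V \<subseteq> nz S B"
   proof
    fix v assume v: "v \<in> V"
    have "cj v b = b" if "b \<in> B" for b using abD[OF Vab v] that B(2) by (auto simp: cj_eq_iff)
    thus "v \<in> nz S B" using v V(5) by (auto simp: nz_def)
   qed
   moreover have "cyc c \<subseteq> nz S B" using cyc_least[OF grp_nz[OF V(4)] B(4)] .
   ultimately have "S \<subseteq> nz S B" unfolding F(13) using prd_least[OF _ _ grp_nz[OF V(4)]] F(13) by simp
   thus ?thesis using nml_iff_nz[OF B(1) V(4) BS] nz_sub by blast
  qed
  obtain q :: "gp \<Rightarrow> gp" where q: "ghom q S" "ker q S = B" using quotient_exists[OF nB] by blast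
  have "card V = card (q ` V) * card B"
   using card_img[OF q(1) V(2,5)] q(2) B(2) by (simp add: Int_absorb1)
  hence cq: "card (q ` V) = p" using V(3) B(3) assms(5) by (simp add: power2_eq_square prime_gt_0_nat)
  have gq: "Good (q ` S)" using Good_img[OF F(5) q(1)] .
  have nq: "nml (q ` V) (q ` S)" using nml_img[OF q(1) V(1)] .
  have "nz (q ` S) (q ` V) = q ` S" using nml_iff_nz[of "q ` V" "q ` S"] nmlD[OF nq] nq by blast
  hence "q ` S = cz (q ` S) (q ` V)"
   using normalizer_prime_order[OF gq nmlD(1,3)[OF nq] cq assms(5)] by simp
  hence qc: "q c * q v = q v * q c" if "v \<in> V" for v
   using that F(10) by (auto simp: cz_def)
  have "c * v = v * c" if v: "v \<in> V" for v
  proof -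
   have vS: "v \<in> S" using v V(5) by blast
   have "q (cm c v) = 1" using ghomD(7)[OF q(1) F(10) vS] qc[OF v] by (simp add: cm_eq_one)
   hence l: "cm c v \<in> B" using q(2) grpD(7)[OF V(4) F(10) vS] by (auto simp: ker_def)
   have "cj (c ^ r) v = cm c v ^ r * v"
   proof (rule cj_power_shift)
    show "cj c v = cm c v * v" by (rule cj_cm)
    show "cj c (cm c v) = cm c v" using cB l by (auto simp: cz_def cj_eq_iff)
   qed
   hence "cm c v ^ r = 1" using F(11) by simp (metis mult_1_left right_cancel)
   moreover have "cm c v ^ p = 1" using Vp l B(2) by blast
   moreover have "coprime r p" using rp F(7) assms(5) primes_coprime by blast
   ultimately have "cm c v = 1" using pow_coprime_one[OF V(2), of "cm c v" r p] l B(2) by blast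
   thus ?thesis by (simp add: cm_eq_one)
  qed
  thus False using F(15) by blast
 qed
 have sub: "B = {1} \<or> B = V \<or> card B = p" if B: "grp B" "B \<subseteq> V" for B
 proof -
  have "card B dvd p ^ 2" using lagrange_dvd[OF V(2) B] V(3) by simp
  then obtain i where i: "i \<le> 2" "card B = p ^ i" using divides_primepow_nat[OF assms(5)] by blast
  hence "i = 0 \<or> i = 1 \<or> i = 2" by linarith
  thus ?thesis using i(2) grp_card_one[OF B(1)] subgroup_eq_card[OF V(2) B(2)] V(3) by auto
 qed
 \<comment> \<open>Apart from \<open>V\<close> itself every subgroup is cyclic; this crude count is
   all that is needed for \<open>few\<close>.\<close>
 have "subs V \<subseteq> insert V (cyc ` V)"
 proof
  fix B assume "B \<in> subs V"
  hence B: "grp B" "B \<subseteq> V" by (auto simp: subs_def)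
  consider "B = {1}" | "B = V" | "card B = p" using sub[OF B] by blast
  thus "B \<in> insert V (cyc ` V)"
  proof cases
   case 1
   moreover have "cyc 1 = {1 :: gp}" by (auto simp: cyc_def)
   ultimately show ?thesis using grpD(2)[OF V(2)] by blast
  next
   case 3
   hence "B \<noteq> {1}" using assms(5) by auto
   then obtain b where "b \<in> B" "b \<noteq> 1" using grpD(2)[OF B(1)] by blast
   thus ?thesis using prime_card_cyc(1)[OF B(1) 3 assms(5)] B(2) by blast
  qed simp
 qed
 hence "card (subs V) \<le> card (insert V (cyc ` V))" by (rule card_mono[rotated]) (simp add: grpD(1)[OF V(2)])
 also have "\<dots> \<le> Suc (card (cyc ` V))" by (rule card_insert_le_m1) simp_all
 also have "\<dots> \<le> card V + 2" using card_image_le[OF grpD(1)[OF V(2)], of cyc] by simp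
 finally have few: "card (subs V) \<le> card V + 2" .
 have "\<not> dense S" using irreducible_not_dense[OF V(1) Vab F(12,7,13,14,10) nd F(15) _ few] sub irr by blast
 thus False using Good_dense F(5) by blast
qed

section \<open>Groups of order p^3 generated by two elements of order p\<close>

lemma pow_mult_commuting:
 fixes x y :: "'a::monoid_mult"
 assumes "x * y = y * x" shows "(x * y) ^ n = x ^ n * y ^ n"
proof (induction n)
 case (Suc n)
 have c: "y * x ^ n = x ^ n * y"
  by (induction n) (simp_all add: assms flip: mult.assoc, metis assms mult.assoc)
 have "(x * y) ^ Suc n = x * (y * x ^ n) * y ^ n" using Suc by (simp add: mult.assoc)
 thus ?case unfolding c by (simp add: mult.assoc)
qed simp

lemma swap_factors:
 fixes u a v b :: "'a::monoid_mult"
 assumes "v * a = a * v" shows "(u * a) * (v * b) = (u * v) * (a * b)"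
proof -
 have "(u * a) * (v * b) = u * (a * v) * b" by (simp add: mult.assoc)
 thus ?thesis unfolding assms[symmetric] by (simp add: mult.assoc)
qed

text \<open>Equality holds for b = 4 and p = 2, the dihedral group of order 8 with four non-central
  subgroups of order 2 among its ten subgroups. The substitutions make the difference a polynomial
  in s and t with non-negative coefficients.\<close>

lemma not_dense_numeric_extraspecial:
 fixes b p :: nat
 assumes "2 * p \<le> b" "2 \<le> p" shows "2 * (b + p + 4)\<^sup>2 \<le> 25 * (b * (b - p))"
proof -
 obtain t where t: "b = 2 * p + t" using assms(1) le_Suc_ex by blast
 obtain s where s: "p = 2 + s" using assms(2) le_Suc_ex by blast
 show ?thesis unfolding t s by (simp add: power2_eq_square algebra_simps)
qed

text \<open>If x and y do not commute they generate a group S of order p^3, dihedral of order 8 when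
  p = 2; let Z be generated by the central commutator. Besides {1}, Z and S there are at most p + 1
  subgroups of order p^2 and a set \<open>BB\<close> of at least 2 p further subgroups of order p,
  each permuting with at most p members of \<open>BB\<close>. This leaves too many non-permuting
  pairs.\<close>

lemma commuting_of_central_commutator:
 fixes L :: "gp set"
 assumes "Good L" "x \<in> L" "y \<in> L" "prime p" "x ^ p = 1" "y ^ p = 1"
  "x * cm x y = cm x y * x" "y * cm x y = cm x y * y"
 shows "x * y = y * x"
proof (rule ccontr)
 assume nc: "x * y \<noteq> y * x"
 have L: "grp L" using assms(1) Good_grp by blast
 define z where "z = cm x y"
 have z1: "z \<noteq> 1" using nc by (simp add: z_def cm_eq_one)
 have xz: "x * z = z * x" and yz: "y * z = z * y" using assms(7,8) by (simp_all add: z_def)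
 have zL: "z \<in> L" unfolding z_def using grpD(7)[OF L assms(2,3)] .
 have xy: "cj x y = z * y" unfolding z_def by (rule cj_cm)
 have "cj (x ^ p) y = z ^ p * y"
  by (rule cj_power_shift[OF xy]) (simp add: cj_eq_iff xz)
 hence zp: "z ^ p = 1" using assms(5) by (simp add: mult_eq_one_iff) (metis mult_1_left right_cancel)
 have x1: "x \<noteq> 1" and y1: "y \<noteq> 1" using nc by auto
 define Z where "Z = cyc z"
 have Z: "grp Z" "Z \<subseteq> L" "card Z = p" "z \<in> Z"
  using grp_cyc[OF L zL] card_cyc_prime[OF L zL z1 zp assms(4)] by (simp_all add: Z_def)
 have Y: "grp (cyc y)" "cyc y \<subseteq> L" "card (cyc y) = p"
  using grp_cyc[OF L assms(3)] card_cyc_prime[OF L assms(3) y1 assms(6,4)] by simp_all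
 have X: "grp (cyc x)" "cyc x \<subseteq> L" "card (cyc x) = p"
  using grp_cyc[OF L assms(2)] card_cyc_prime[OF L assms(2) x1 assms(5,4)] by simp_all
 have Zx: "Z \<subseteq> cz L {x}" unfolding Z_def
  by (rule cyc_least[OF grp_cz[OF L]]) (simp add: cz_def zL xz)
 have Zy: "Z \<subseteq> cz L {y}" unfolding Z_def
  by (rule cyc_least[OF grp_cz[OF L]]) (simp add: cz_def zL yz)
 have yZ: "y \<notin> Z" using Zx nc by (auto simp: cz_def)
 have ZY: "Z \<inter> cyc y = {1}" using prime_order_Int[OF Z(1) Y(1) Z(3) Y(3) assms(4)] yZ cyc_self by blast
 define A where "A = prd Z (cyc y)"
 have gA: "grp A" unfolding A_def
 proof (rule grp_prd_comm[OF Z(1) Y(1)])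
  fix n k assume n: "n \<in> Z" and k: "k \<in> cyc y"
  have "cyc y \<subseteq> cz L {n}"
   by (rule cyc_least[OF grp_cz[OF L]]) (use Zy n assms(3) in "auto simp: cz_def")
  thus "n * k = k * n" using k by (auto simp: cz_def)
 qed
 have AL: "A \<subseteq> L" unfolding A_def by (rule prd_least[OF Z(2) Y(2) L])
 have ZA: "Z \<subseteq> A" "cyc y \<subseteq> A" unfolding A_def using prd_sub1 prd_sub2 Z(1) Y(1) by blast+
 have cA: "card A = p * p" unfolding A_def using card_prd[OF Z(1) Y(1)] ZY Z(3) Y(3) by simp
 have Ay: "A \<subseteq> cz L {y}" unfolding A_def
 proof (rule prd_least[OF Zy _ grp_cz[OF L]])
  show "cyc y \<subseteq> cz L {y}" by (rule cyc_least[OF grp_cz[OF L]]) (simp add: cz_def assms(3))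
 qed
 have xA: "x \<notin> A" using Ay nc by (auto simp: cz_def)
 have xnA: "cj x a \<in> A" if "a \<in> A" for a
 proof -
  obtain u w where u: "u \<in> Z" and w: "w \<in> cyc y" and a: "a = u * w" using \<open>a \<in> A\<close> by (auto simp: A_def prd_iff)
  obtain j where j: "w = y ^ j" using w by (auto simp: cyc_def)
  have "cj x u = u" using Zx u by (auto simp: cz_def cj_eq_iff)
  moreover have "cj x w = (z * y) ^ j" by (simp add: j cj_pow xy)
  moreover have "z * y \<in> A" using ZA Z(4) cyc_self[of y] grpD(3)[OF gA] by blast
  ultimately show ?thesis using a u ZA grpD(3)[OF gA] grpD(5)[OF gA] by (auto simp: cj_mult)
 qed
 have "cyc x \<subseteq> nz L A"
  by (rule cyc_least[OF grp_nz[OF L]]) (rule nzI[OF grpD(1)[OF gA] assms(2) xnA])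
 hence xn: "cj k a \<in> A" if "k \<in> cyc x" "a \<in> A" for k a using that nz_D by blast
 have AX: "A \<inter> cyc x = {1}"
 proof (rule ccontr)
  assume "A \<inter> cyc x \<noteq> {1}"
  then obtain a where a: "a \<in> A" "a \<in> cyc x" "a \<noteq> 1" using grpD(2)[OF gA] grpD(2)[OF X(1)] by blast
  hence "cyc x \<subseteq> A" using prime_card_cyc(1)[OF X(1,3) assms(4) a(2,3)] cyc_least[OF gA a(1)] by simp
  thus False using xA cyc_self by blast
 qed
 define S where "S = prd A (cyc x)"
 have gS: "grp S" unfolding S_def by (rule grp_prd[OF gA X(1) xn])
 have SL: "S \<subseteq> L" unfolding S_def by (rule prd_least[OF AL X(2) L])
 have cS: "card S = p * p * p" unfolding S_def using card_prd[OF gA X(1)] AX cA X(3) by simp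
 have AS: "A \<subseteq> S" "cyc x \<subseteq> S" unfolding S_def using prd_sub1 prd_sub2 gA X(1) by blast+
 have ZS: "Z \<subseteq> S" and xS: "x \<in> S" and yS: "y \<in> S" and zS: "z \<in> S"
  using AS ZA Z(4) cyc_self by blast+
 have Sgen: "S \<subseteq> K" if K: "grp K" "x \<in> K" "y \<in> K" "z \<in> K" for K
  unfolding S_def A_def Z_def
  by (intro prd_least cyc_least K)
 have Zc: "u * s = s * u" if u: "u \<in> Z" and s: "s \<in> S" for u s
 proof -
  have "S \<subseteq> cz S {z}" by (rule Sgen[OF grp_cz[OF gS]]) (auto simp: cz_def xS yS zS xz yz)
  hence "z \<in> cz S {s}" using s zS by (auto simp: cz_def)
  hence "Z \<subseteq> cz S {s}" unfolding Z_def by (rule cyc_least[OF grp_cz[OF gS]])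
  thus ?thesis using u by (auto simp: cz_def)
 qed
 have gZK: "grp (prd Z K)" if "grp K" "K \<subseteq> S" for K
  by (rule grp_prd_comm[OF Z(1) that(1)]) (use Zc that(2) in blast)
 have nZ: "nml Z S"
 proof -
  have "cj g n = n" if "g \<in> S" "n \<in> Z" for g n using Zc[OF that(2,1)] by (simp add: cj_eq_iff)
  thus ?thesis using gS Z(1) ZS by (simp add: nml_def)
 qed
 have cmZ: "cm s t \<in> Z" if st: "s \<in> S" "t \<in> S" for s t
 proof -
  obtain f :: "gp \<Rightarrow> gp" where f: "ghom f S" "ker f S = Z" using quotient_exists[OF nZ] by blast
  have gf: "grp (f ` S)" using grp_img f(1) by blast
  have fz: "f z = 1" using f(2) Z(4) by (auto simp: ker_def)
  have "f x * f y = f (z * (y * x))"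
   using ghomD(2)[OF f(1) xS yS] by (simp add: z_def cm_def gsimps)
  also have "\<dots> = f y * f x"
   using ghomD(2)[OF f(1) zS grpD(3)[OF gS yS xS]] ghomD(2)[OF f(1) yS xS] fz by simp
  finally have fxy: "f x * f y = f y * f x" .
  have xy: "{f x, f y} \<subseteq> f ` S" using xS yS by blast
  have gg: "grp (gen {f x, f y})" by (rule grp_gen[OF xy gf])
  have "S \<subseteq> pre f S (gen {f x, f y})"
   by (rule Sgen[OF grp_pre[OF f(1) gg]]) (use gen_inc[of "{f x, f y}"] grpD(2)[OF gg] fz xS yS zS in "auto simp: pre_def")
  hence "f s \<in> gen {f x, f y}" "f t \<in> gen {f x, f y}" using st by (auto simp: pre_def)
  hence "f s * f t = f t * f s" using gen_abelian[OF xy gf] fxy by fastforce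
  hence "f (cm s t) = 1" using ghomD(7)[OF f(1) st] by (simp add: cm_eq_one)
  thus ?thesis using f(2) grpD(7)[OF gS st] by (auto simp: ker_def)
 qed
 have prm: "p > 1" "p > 0" using prime_gt_1_nat[OF assms(4)] by auto
 have sub_card: "card K = 1 \<or> card K = p \<or> card K = p * p \<or> card K = p * p * p"
  if "grp K" "K \<subseteq> S" for K
 proof -
  have "card K dvd p ^ 3" using lagrange_dvd[OF gS that] cS by (simp add: power3_eq_cube)
  then obtain i where i: "i \<le> 3" "card K = p ^ i" using divides_primepow_nat[OF assms(4)] by blast
  hence "i = 0 \<or> i = 1 \<or> i = 2 \<or> i = 3" by linarith
  thus ?thesis using i(2) by (auto simp: power2_eq_square power3_eq_cube)
 qed
 have ZI: "Z \<subseteq> K \<or> Z \<inter> K = {1}" if gK: "grp K" for K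
 proof (cases "Z \<inter> K = {1}")
  case False
  then obtain a where a: "a \<in> Z" "a \<in> K" "a \<noteq> 1" using grpD(2)[OF Z(1)] grpD(2)[OF gK] by blast
  thus ?thesis using prime_card_cyc(1)[OF Z(1,3) assms(4) a(1,3)] cyc_least[OF gK a(2)] by simp
 qed simp
 \<comment> \<open>If K misses Z, then S = Z K and commutators of K lie in
   \<open>Z \<inter> K\<close>, which is trivial; x and y would commute.\<close>
 have ord2: "Z \<subseteq> K" if K: "grp K" "K \<subseteq> S" "card K = p * p" for K
 proof (rule ccontr)
  assume "\<not> Z \<subseteq> K"
  hence i: "Z \<inter> K = {1}" using ZI K(1) by blast
  have "card (prd Z K) = card S" using card_prd[OF Z(1) K(1)] i Z(3) K(3) cS by simp
  hence "prd Z K = S" using subgroup_eq_card[OF gS prd_least[OF ZS K(2) gS]] by simp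
  then obtain u a v b where "u \<in> Z" "a \<in> K" "x = u * a" "v \<in> Z" "b \<in> K" "y = v * b"
   using xS yS by (auto simp: prd_iff)
  have "cm a b \<in> Z \<inter> K" using cmZ[of a b] K(2) \<open>a \<in> K\<close> \<open>b \<in> K\<close> grpD(7)[OF K(1)] by blast
  hence ab: "a * b = b * a" using i by (simp add: cm_eq_one)
  have ub: "u * s = s * u" "v * s = s * v" if "s \<in> S" for s using Zc that \<open>u \<in> Z\<close> \<open>v \<in> Z\<close> by blast+
  have S4: "a \<in> S" "b \<in> S" "u \<in> S" "v \<in> S" using K(2) ZS \<open>a \<in> K\<close> \<open>b \<in> K\<close> \<open>u \<in> Z\<close> \<open>v \<in> Z\<close> by auto
  have "x * y = (u * v) * (a * b)" using \<open>x = u * a\<close> \<open>y = v * b\<close> swap_factors[OF ub(2)[OF S4(1)]] by simp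
  also have "\<dots> = (v * u) * (b * a)" using ub(1)[OF S4(4)] ab by simp
  also have "\<dots> = y * x" using \<open>x = u * a\<close> \<open>y = v * b\<close> swap_factors[OF ub(1)[OF S4(2)]] by simp
  finally show False using nc by simp
 qed
 define BB where "BB = {B \<in> subs S. card B = p \<and> B \<noteq> Z}"
 define AA where "AA = {B \<in> subs S. card B = p * p}"
 have fsub: "finite (subs S)" using finite_subs gS by blast
 have BI: "B \<inter> Z = {1}" if "B \<in> BB" for B
  using that prime_order_Int[of B Z p] Z assms(4) by (auto simp: BB_def subs_def)
 have Zp: "u ^ p = 1" if "u \<in> Z" for u using pow_card(1)[OF Z(1) that] Z(3) by simp
 have mk: "cyc (w * u) \<in> BB" if w: "w \<in> S" "w \<notin> Z" "w ^ p = 1" and u: "u \<in> Z" for w u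
 proof -
  have wu: "w * u \<in> S" "w * u \<notin> Z" using w u ZS grpD(3)[OF gS] grp_cancel(2)[OF Z(1) u] by blast+
  have "(w * u) ^ p = 1" using pow_mult_commuting[of w u p] Zc[OF u w(1)] w(3) Zp[OF u] by simp
  moreover have "w * u \<noteq> 1" using wu(2) grpD(2)[OF Z(1)] by metis
  ultimately have "card (cyc (w * u)) = p" using card_cyc_prime[OF gS wu(1) _ _ assms(4)] by blast
  thus ?thesis using grp_cyc[OF gS wu(1)] wu(2) cyc_self by (auto simp: BB_def subs_def)
 qed
 have inj: "inj_on (\<lambda>u. cyc (w * u)) Z" if w: "w \<in> S" "w \<notin> Z" "w ^ p = 1" for w
 proof (rule inj_onI)
  fix u v assume uv: "u \<in> Z" "v \<in> Z" "cyc (w * u) = cyc (w * v)"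
  have g: "grp (cyc (w * u))" using mk[OF w uv(1)] by (simp add: BB_def subs_def)
  have wv: "w * v \<in> cyc (w * u)" unfolding uv(3) by simp
  have "inverse (w * u) * (w * v) \<in> cyc (w * u)" by (rule grpD(3)[OF g grpD(4)[OF g cyc_self] wv])
  hence "inverse u * v \<in> cyc (w * u)" by (simp add: gsimps)
  moreover have "inverse u * v \<in> Z" using uv grpD(3,4)[OF Z(1)] by simp
  ultimately have "inverse u * v = 1" using BI[OF mk[OF w uv(1)]] by blast
  thus "u = v" by (simp add: mult_eq_one_iff)
 qed
 have xZ: "x \<notin> Z" using xA ZA by blast
 \<comment> \<open>Multiplying x, and likewise y, by the p elements of Z gives p different
   subgroups; the two families are disjoint because x and y do not commute.\<close>
 have b2: "2 * p \<le> card BB"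
 proof -
  define F where "F w = (\<lambda>u. cyc (w * u)) ` Z" for w
  have cF: "card (F x) = p" "card (F y) = p"
   unfolding F_def using card_image[OF inj[OF xS xZ assms(5)]] card_image[OF inj[OF yS yZ assms(6)]] Z(3) by auto
  have "F x \<inter> F y = {}"
  proof (rule ccontr)
   assume "F x \<inter> F y \<noteq> {}"
   then obtain u v where uv: "u \<in> Z" "v \<in> Z" "cyc (x * u) = cyc (y * v)" by (auto simp: F_def)
   hence "y * v \<in> cyc (x * u)" by simp
   hence c: "(x * u) * (y * v) = (y * v) * (x * u)" using cyc_abelian cyc_self by blast
   have "(x * u) * (y * v) = x * y * (u * v)" using swap_factors[of y u x v] Zc[OF uv(1) yS] by simp
   moreover have "(y * v) * (x * u) = y * x * (u * v)"
    using swap_factors[of x v y u] Zc[OF uv(2) xS] Zc[OF uv(1) subsetD[OF ZS uv(2)]] by simp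
   ultimately show False using c nc by simp
  qed
  moreover have "F x \<union> F y \<subseteq> BB" unfolding F_def using mk xS yS xZ yZ assms(5,6) by blast
  moreover have "finite (F x)" "finite (F y)" using grpD(1)[OF Z(1)] by (auto simp: F_def)
  ultimately have "card (F x) + card (F y) \<le> card BB"
   using card_mono[of BB "F x \<union> F y"] fsub by (simp add: card_Un_disjoint BB_def)
  thus ?thesis using cF by simp
 qed
 \<comment> \<open>Two different permuting members of \<open>BB\<close> generate a subgroup of order
   p^2. It contains Z, so it is E = Z B, and a member of \<open>BB\<close> inside E is generated by
   b u for a fixed b in B and some u in Z.\<close>
 have perm_le: "card {B' \<in> BB. prd B B' = prd B' B} \<le> p" if B: "B \<in> BB" for B
 proof -
  have gB: "grp B" "B \<subseteq> S" "card B = p" "B \<noteq> Z" using B by (auto simp: BB_def subs_def)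
  have "B \<noteq> {1}" using gB(3) prm by auto
  then obtain b where b: "b \<in> B" "b \<noteq> 1" using grpD(2)[OF gB(1)] by blast
  have bZ: "b \<notin> Z" using b BI[OF B] by blast
  define E where "E = prd Z B"
  have gE: "grp E" "E \<subseteq> S" unfolding E_def using gZK[OF gB(1,2)] prd_least[OF ZS gB(2) gS] by auto
  have cE: "card E = p * p" unfolding E_def using card_prd[OF Z(1) gB(1)] BI[OF B] Z(3) gB(3) by (simp add: Int_commute)
  have BE: "B \<subseteq> E" "Z \<subseteq> E" unfolding E_def using prd_sub1 prd_sub2 Z(1) gB(1) by blast+
  have "{B' \<in> BB. prd B B' = prd B' B} \<subseteq> cyc ` (*) b ` Z"
  proof
   fix B' assume "B' \<in> {B' \<in> BB. prd B B' = prd B' B}"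
   hence B': "B' \<in> BB" "prd B B' = prd B' B" by auto
   hence g': "grp B'" "B' \<subseteq> S" "card B' = p" "B' \<noteq> Z" by (auto simp: BB_def subs_def)
   have "B' \<subseteq> E"
   proof (cases "B' = B")
    case False
    have g: "grp (prd B B')" using grp_prd_iff[OF gB(1) g'(1)] B'(2) by simp
    have s: "prd B B' \<subseteq> S" by (rule prd_least[OF gB(2) g'(2) gS])
    have "B \<inter> B' = {1}" using prime_order_Int[OF gB(1) g'(1) gB(3) g'(3) assms(4)] False by simp
    hence c: "card (prd B B') = p * p" using card_prd[OF gB(1) g'(1)] gB(3) g'(3) by simp
    have "Z \<subseteq> prd B B'" using ord2[OF g s c] .
    hence "E \<subseteq> prd B B'" unfolding E_def using prd_least prd_sub1[OF gB(1) g'(1)] g by blast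
    hence "E = prd B B'" using subgroup_eq_card[OF g] c cE by simp
    thus ?thesis using prd_sub2[OF gB(1) g'(1)] by simp
   qed (use BE in simp)
   hence s: "prd Z B' \<subseteq> E" using prd_least[OF BE(2) _ gE(1)] by blast
   have "card (prd Z B') = p * p" using card_prd[OF Z(1) g'(1)] BI[OF B'(1)] Z(3) g'(3) by (simp add: Int_commute)
   hence "prd Z B' = E" using subgroup_eq_card[OF gE(1) s] cE by simp
   hence "b \<in> prd Z B'" using BE(1) b(1) by blast
   then obtain u b' where ub: "u \<in> Z" "b' \<in> B'" "b = u * b'" by (auto simp: prd_iff)
   have "b' \<noteq> 1" using ub bZ by auto
   hence e: "B' = cyc b'" using prime_card_cyc(1)[OF g'(1,3) assms(4) ub(2)] by blast
   have "b = b' * u" using ub Zc[OF ub(1), of b'] g'(2) by auto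
   hence "b' = b * inverse u" by (simp add: mult.assoc)
   moreover have "inverse u \<in> Z" using grpD(4)[OF Z(1) ub(1)] .
   ultimately show "B' \<in> cyc ` (*) b ` Z" using e by blast
  qed
  hence "card {B' \<in> BB. prd B B' = prd B' B} \<le> card (cyc ` (*) b ` Z)"
   by (rule card_mono[rotated]) (simp add: grpD(1)[OF Z(1)])
  also have "\<dots> \<le> card ((*) b ` Z)" by (rule card_image_le) (simp add: grpD(1)[OF Z(1)])
  finally show ?thesis using Z(3) by simp
 qed
 \<comment> \<open>Different subgroups of order p^2 meet exactly in Z, so the sets B - Z are
   disjoint in S - Z.\<close>
 have cAA: "card AA \<le> p + 1"
 proof -
  have d: "(B - Z) \<inter> (C - Z) = {}" if BC: "B \<in> AA" "C \<in> AA" "B \<noteq> C" for B C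
  proof -
   have B: "grp B" "B \<subseteq> S" "card B = p * p" and C: "grp C" "C \<subseteq> S" "card C = p * p" using BC(1,2) by (auto simp: AA_def subs_def)
   define I where "I = B \<inter> C"
   have I: "grp I" "I \<subseteq> S" "I \<subseteq> B" "I \<subseteq> C" "Z \<subseteq> I" unfolding I_def using grp_Int[OF B(1) C(1)] B(2) ord2[OF B] ord2[OF C] by auto
   have "card I \<noteq> p * p" using subgroup_eq_card[OF B(1) I(3)] subgroup_eq_card[OF C(1) I(4)] B(3) C(3) BC(3) by auto
   moreover have "p \<le> card I" "card I \<le> p * p" using card_mono[OF grpD(1)[OF I(1)] I(5)] card_mono[OF grpD(1)[OF B(1)] I(3)] Z(3) B(3) by auto
   ultimately have "card I = p" using sub_card[OF I(1,2)] prm by auto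
   hence "Z = I" using subgroup_eq_card[OF I(1,5)] Z(3) by simp
   thus ?thesis by (auto simp: I_def)
  qed
  have f: "finite AA" "finite S" using fsub grpD(1)[OF gS] by (simp_all add: AA_def)
  have cd: "card (B - Z) = p * p - p \<and> finite (B - Z) \<and> B - Z \<subseteq> S - Z" if "B \<in> AA" for B
   using that ord2[of B] card_Diff_subset[OF grpD(1)[OF Z(1)], of B] Z(3) grpD(1) by (auto simp: AA_def subs_def)
  have "(\<Sum>B\<in>AA. card (B - Z)) = card (\<Union>B\<in>AA. B - Z)" by (rule card_UN_disjoint[symmetric]) (use f cd d in auto)
  also have "\<dots> \<le> card (S - Z)" by (rule card_mono) (use f cd in auto)
  also have "\<dots> = p * p * p - p" using card_Diff_subset[OF grpD(1)[OF Z(1)] ZS] cS Z(3) by simp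
  also have "(\<Sum>B\<in>AA. card (B - Z)) = card AA * (p * p - p)" using cd by simp
  finally have "card AA * (p * p - p) \<le> (p + 1) * (p * p - p)" by (simp add: algebra_simps)
  moreover have "0 < p * p - p" using prm by simp
  ultimately show ?thesis by (metis mult_le_cancel2)
 qed
 have total: "card (subs S) \<le> card BB + p + 4"
 proof -
  have "subs S \<subseteq> BB \<union> AA \<union> {{1}, Z, S}"
  proof
   fix K assume "K \<in> subs S"
   hence K: "grp K" "K \<subseteq> S" by (auto simp: subs_def)
   consider "card K = 1" | "card K = p" | "card K = p * p" | "card K = p * p * p" using sub_card[OF K] by blast
   thus "K \<in> BB \<union> AA \<union> {{1}, Z, S}"
   proof cases
    case 1 thus ?thesis using grp_card_one K(1) by blast
   next
    case 2 thus ?thesis using K by (auto simp: BB_def subs_def)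
   next
    case 3 thus ?thesis using K by (auto simp: AA_def subs_def)
   next
    case 4 thus ?thesis using subgroup_eq_card[OF gS K(2)] cS by simp
   qed
  qed
  hence "card (subs S) \<le> card (BB \<union> AA \<union> {{1}, Z, S})"
   by (rule card_mono[rotated]) (use fsub in "simp add: BB_def AA_def")
  also have "\<dots> \<le> card BB + card AA + card {{1}, Z, S}"
   using card_Un_le[of "BB \<union> AA" "{{1}, Z, S}"] card_Un_le[of BB AA] by linarith
  also have "card {{1}, Z, S} \<le> 3" by (simp add: card_insert_if)
  finally show ?thesis using cAA by simp
 qed
 define NP where "NP = Sigma BB (\<lambda>B. {B' \<in> BB. prd B B' \<noteq> prd B' B})"
 have fB: "finite BB" using fsub by (simp add: BB_def)
 have "card NP = (\<Sum>B\<in>BB. card {B' \<in> BB. prd B B' \<noteq> prd B' B})"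
  unfolding NP_def using fB by (intro card_SigmaI) auto
 moreover have "card BB - p \<le> card {B' \<in> BB. prd B B' \<noteq> prd B' B}" if "B \<in> BB" for B
 proof -
  have "card BB = card {B' \<in> BB. prd B B' = prd B' B} + card {B' \<in> BB. prd B B' \<noteq> prd B' B}"
   using fB by (subst card_Un_disjoint[symmetric]) (auto intro: arg_cong[where f=card])
  thus ?thesis using perm_le[OF that] by linarith
 qed
 ultimately have NP: "card BB * (card BB - p) \<le> card NP"
  using sum_bounded_below[of BB "card BB - p" "\<lambda>B. card {B' \<in> BB. prd B B' \<noteq> prd B' B}"] by simp
 have "25 * card NP < 2 * (card (subs S))\<^sup>2"
  by (rule dense_nonpermuting[OF Good_dense[OF Good_sub[OF assms(1) gS SL]] gS]) (auto simp: NP_def BB_def)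
 also have "\<dots> \<le> 2 * (card BB + p + 4)\<^sup>2" using total by (simp add: power_mono)
 also have "\<dots> \<le> 25 * (card BB * (card BB - p))"
  by (rule not_dense_numeric_extraspecial[OF b2 prime_ge_2_nat[OF assms(4)]])
 also have "\<dots> \<le> 25 * card NP" using NP by simp
 finally show False by simp
qed

text \<open>The exclusion of these groups of order p^3, applied in the quotient of the normalizer of
  \<open>N\<close> by \<open>N\<close>.\<close>

lemma commuting_of_central_commutator_mod:
 fixes L :: "gp set"
 assumes "Good L" "grp N" "N \<subseteq> L" "prime p" "x \<in> nz L N" "y \<in> nz L N" "x ^ p \<in> N" "y ^ p \<in> N"
  "cm x (cm x y) \<in> N" "cm y (cm x y) \<in> N"
 shows "cm x y \<in> N"
proof -
 have L: "grp L" using assms(1) Good_grp by blast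
 define K where "K = nz L N"
 have gK: "grp K" unfolding K_def by (rule grp_nz[OF L])
 have n: "nml N K" unfolding K_def by (rule nml_nz[OF assms(2) L assms(3)])
 obtain f :: "gp \<Rightarrow> gp" where f: "ghom f K" "ker f K = N" using quotient_exists[OF n] by blast
 have xK: "x \<in> K" and yK: "y \<in> K" using assms(5,6) by (simp_all add: K_def)
 have zK: "cm x y \<in> K" using grpD(7)[OF gK xK yK] .
 have k: "f a = 1" if "a \<in> N" for a using that f(2) by (auto simp: ker_def)
 have g: "Good (f ` K)" using Good_img[OF Good_sub[OF assms(1) gK nz_sub[of L N, folded K_def]] f(1)] .
 have "f x ^ p = 1" "f y ^ p = 1" using k[OF assms(7)] k[OF assms(8)] ghomD(5)[OF f(1) xK] ghomD(5)[OF f(1) yK] by auto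
 moreover have "cm (f x) (cm (f x) (f y)) = 1" "cm (f y) (cm (f x) (f y)) = 1"
  using k[OF assms(9)] k[OF assms(10)] ghomD(7)[OF f(1) xK zK] ghomD(7)[OF f(1) yK zK] ghomD(7)[OF f(1) xK yK] by auto
 ultimately have "f x * f y = f y * f x"
  using commuting_of_central_commutator[OF g imageI[OF xK] imageI[OF yK] assms(4)] by (simp add: cm_eq_one)
 hence "f (cm x y) = 1" using ghomD(7)[OF f(1) xK yK] by (simp add: cm_eq_one)
 thus ?thesis using f(2) zK by (auto simp: ker_def)
qed

section \<open>Coprime action\<close>

abbreviation "phi_gens p U \<equiv> (\<lambda>(x, y). cm x y) ` (U \<times> U) \<union> (\<lambda>x. x ^ p) ` U"

text \<open>For a p-group this is the Frattini subgroup.\<close>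

definition phi :: "nat \<Rightarrow> 'a::group_mult set \<Rightarrow> 'a set" where
 "phi p U = gen (phi_gens p U)"

lemma phi_gens_sub: "grp U \<Longrightarrow> phi_gens p U \<subseteq> U"
 using grpD(5,7)[of U] by auto

lemma phi:
 assumes "grp U"
 shows "grp (phi p U)" "phi p U \<subseteq> U" "x \<in> U \<Longrightarrow> y \<in> U \<Longrightarrow> cm x y \<in> phi p U" "x \<in> U \<Longrightarrow> x ^ p \<in> phi p U"
proof -
 show "grp (phi p U)" unfolding phi_def by (rule grp_gen[OF phi_gens_sub[OF assms] assms])
 show "phi p U \<subseteq> U" unfolding phi_def by (rule gen_sub[OF phi_gens_sub[OF assms] assms])
 show "cm x y \<in> phi p U" if "x \<in> U" "y \<in> U"
  unfolding phi_def by (rule gen_inc[THEN subsetD]) (use that in auto)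
 show "x ^ p \<in> phi p U" if "x \<in> U"
  unfolding phi_def by (rule gen_inc[THEN subsetD]) (use that in auto)
qed

lemma nml_phi: assumes "nml U L" shows "nml (phi p U) L"
 unfolding nml_def
proof (intro conjI ballI)
 note U = nmlD[OF assms]
 show "grp (phi p U)" "grp L" "phi p U \<subseteq> L"
  using phi(1,2)[OF U(1), of p] U(2,3) by auto
 fix g n assume g: "g \<in> L" "n \<in> phi p U"
 show "cj g n \<in> phi p U"
  using g(2) unfolding phi_def
 proof (rule gen_cj_closed[rotated 3])
  show "phi_gens p U \<subseteq> U" by (rule phi_gens_sub[OF U(1)])
  fix a assume "a \<in> phi_gens p U"
  then consider x y where "x \<in> U" "y \<in> U" "cj g a = cm (cj g x) (cj g y)"
   | x where "x \<in> U" "cj g a = cj g x ^ p" by (auto simp: cj_cm_distrib cj_pow)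
  thus "cj g a \<in> gen (phi_gens p U)"
   using U(4)[OF g(1)] phi(3,4)[OF U(1)] unfolding phi_def[symmetric] by cases auto
 qed (rule U(1))
qed

text \<open>A proper \<open>C\<close> lies in the kernel of a non-trivial homomorphism to an abelian
  group of exponent p, and that kernel contains \<open>phi p U\<close> as well.\<close>

lemma phi_nongenerator:
 assumes "pgr p U" "prime p" "grp C" "C \<subseteq> U" "U \<subseteq> prd C (phi p U)" shows "C = U"
proof (rule ccontr)
 assume "C \<noteq> U"
 hence "C \<subset> U" using assms(4) by blast
 then obtain f :: "'a \<Rightarrow> gp" where f: "ghom f U" "ab (f ` U)" "\<And>x. x \<in> U \<Longrightarrow> f (x ^ p) = 1" "C \<subseteq> ker f U" "ker f U \<noteq> U"
  using pgr_elementary_quotient[OF assms(1-3)] by blast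
 have U: "grp U" using assms(1) pgr_grp by blast
 have gk: "grp (ker f U)" using nml_ker[OF f(1)] nmlD(1) by blast
 have "phi p U \<subseteq> ker f U"
  unfolding phi_def
 proof (rule gen_sub[OF _ gk])
  have "f (cm x y) = 1" if "x \<in> U" "y \<in> U" for x y
   using ghomD(7)[OF f(1) that] abD[OF f(2), of "f x" "f y"] that by (simp add: cm_eq_one)
  thus "phi_gens p U \<subseteq> ker f U"
   using f(3) grpD(5,7)[OF U] by (auto simp: ker_def)
 qed
 hence "U \<subseteq> ker f U" using prd_least[OF f(4) _ gk] assms(5) by blast
 thus False using f(5) by (auto simp: ker_def)
qed

lemma pgr_coprime_dvd: "pgr p N \<Longrightarrow> prime p \<Longrightarrow> prime r \<Longrightarrow> r \<noteq> p \<Longrightarrow> \<not> r dvd card N"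
 unfolding pgr_iff_pig pig_def by blast

lemma coprime_frattini:
 assumes "pgr p U" "prime p" "pgr r B" "prime r" "r \<noteq> p"
  "\<And>b u. b \<in> B \<Longrightarrow> u \<in> U \<Longrightarrow> cj b u \<in> U"
  "\<And>b u. b \<in> B \<Longrightarrow> u \<in> U \<Longrightarrow> inverse u * cj b u \<in> phi p U"
  "b \<in> B" "u \<in> U"
 shows "b * u = u * b"
proof -
 have U: "grp U" using assms(1) pgr_grp by blast
 note P = phi[OF U, where p=p]
 have "cz U B = U"
 proof (rule phi_nongenerator[OF assms(1,2) grp_cz[OF U] cz_sub])
  show "U \<subseteq> prd (cz U B) (phi p U)"
  proof
   fix y assume y: "y \<in> U"
   have nc: "cj b n \<in> phi p U" if b: "b \<in> B" and n: "n \<in> phi p U" for b n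
   proof -
    have "n \<in> U" using n P(2) by blast
    hence "inverse n * cj b n \<in> phi p U" using assms(7) b by blast
    thus ?thesis using grp_cancel(1)[OF P(1) grpD(4)[OF P(1) n]] by blast
   qed
   have "\<not> r dvd card (phi p U)" using pgr_coprime_dvd[OF pgr_sub[OF assms(1,2) P(1,2)] assms(2,4,5)] .
   then obtain n where n: "n \<in> phi p U" "\<And>b. b \<in> B \<Longrightarrow> b * (y * n) = (y * n) * b"
    using coset_fixpoint[OF assms(3,4) P(1) _ nc assms(7)[OF _ y]] by blast
   hence "y * n \<in> cz U B" using grpD(3)[OF U y, of n] P(2) by (auto simp: cz_def)
   moreover have "y = (y * n) * inverse n" by (simp add: mult.assoc)
   ultimately show "y \<in> prd (cz U B) (phi p U)" using prdI grpD(4)[OF P(1) n(1)] by metis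
  qed
 qed
 hence "u \<in> cz U B" using assms(9) by simp
 thus ?thesis using assms(8) by (simp add: cz_def)
qed

subsection \<open>Ordered products in commutative subsets\<close>

text \<open>Factors need not commute in the whole type, so an order of multiplication is fixed;
  rearrangement is justified only inside an abelian subset.\<close>

fun nprod :: "(nat \<Rightarrow> 'a::group_mult) \<Rightarrow> nat \<Rightarrow> 'a" where
 "nprod f 0 = 1"
| "nprod f (Suc n) = nprod f n * f n"

lemma nprod_in: "grp H \<Longrightarrow> (\<And>i. f i \<in> H) \<Longrightarrow> nprod f n \<in> H"
 by (induction n) (auto simp: grpD)

lemma nprod_one: "nprod (\<lambda>i. 1) n = 1"
 by (induction n) auto

lemma nprod_const: "nprod (\<lambda>i. x) n = x ^ n"
 by (induction n) (auto simp: power_commutes)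

lemma nprod_mult:
 assumes "grp V" "ab V" "\<And>i. f i \<in> V" "\<And>i. g i \<in> V"
 shows "nprod (\<lambda>i. f i * g i) n = nprod f n * nprod g n"
proof (induction n)
 case (Suc n)
 have "f n * nprod g n = nprod g n * f n" using abD[OF assms(2)] assms nprod_in by blast
 thus ?case using Suc swap_factors[of "f n" "nprod g n" "nprod f n" "g n"] by simp
qed simp

lemma nprod_swap:
 assumes "grp V" "ab V" "\<And>i j. F i j \<in> V"
 shows "nprod (\<lambda>i. nprod (F i) m) n = nprod (\<lambda>j. nprod (\<lambda>i. F i j) n) m"
proof (induction m)
 case 0
 thus ?case by (simp add: nprod_one)
next
 case (Suc m)
 have "nprod (\<lambda>i. nprod (F i) m * F i m) n = nprod (\<lambda>i. nprod (F i) m) n * nprod (\<lambda>i. F i m) n"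
  by (rule nprod_mult[OF assms(1,2)]) (use assms nprod_in in blast)+
 thus ?case using Suc by simp
qed

lemma nprod_cong: "(\<And>i. i < n \<Longrightarrow> f i = g i) \<Longrightarrow> nprod f n = nprod g n"
 by (induction n) auto

lemma nprod_cj: "cj d (nprod f n) = nprod (\<lambda>i. cj d (f i)) n"
 by (induction n) (auto simp: cj_mult)

lemma nprod_shift:
 assumes "grp V" "ab V" "\<And>i. f i \<in> V" "f n = f 0"
 shows "nprod (\<lambda>i. f (Suc i)) n = nprod f n"
proof -
 have "f 0 * nprod (\<lambda>i. f (Suc i)) n = nprod f (Suc n)"
  by (induction n) (simp_all add: mult.assoc[symmetric])
 also have "\<dots> = f 0 * nprod f n" using assms(4) abD[OF assms(2), of "nprod f n" "f 0"] nprod_in[OF assms(1,3)] assms(3) by simp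
 finally show ?thesis by simp
qed

text \<open>If the non-trivial elements of a group \<open>D\<close> containing two independent commuting elements
 of order \<open>p\<close> act without fixed points on an abelian group \<open>V\<close>, then
 \<open>\<Prod>j. \<Prod>i. (a * b^j)^i\<close> acts trivially on the one hand and as \<open>v \<mapsto> v ^ p\<close> on the other.\<close>

lemma noncyclic_fixed_points:
 fixes V :: "'a::group_mult set"
 assumes "grp V" "ab V" "prime p" "a ^ p = 1" "b ^ p = 1" "a * b = b * a"
  and inv: "\<And>v. v \<in> V \<Longrightarrow> cj a v \<in> V" "\<And>v. v \<in> V \<Longrightarrow> cj b v \<in> V"
  and fpf: "\<And>v i j. v \<in> V \<Longrightarrow> i < p \<Longrightarrow> j < p \<Longrightarrow> i \<noteq> 0 \<or> j \<noteq> 0 \<Longrightarrow> a ^ i * b ^ j * v = v * (a ^ i * b ^ j) \<Longrightarrow> v = 1"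
  and v: "v \<in> V"
 shows "v ^ p = 1"
proof -
 have ia: "cj (a ^ n) w \<in> V" if "w \<in> V" for n w
  using that by (induction n) (auto simp: inv(1) simp flip: cj_cj)
 have ib: "cj (b ^ n) w \<in> V" if "w \<in> V" for n w
  using that by (induction n) (auto simp: inv(2) simp flip: cj_cj)
 have abn: "a * b ^ j = b ^ j * a" for j
  by (induction j) (simp_all add: assms(6) flip: mult.assoc, metis assms(6) mult.assoc)
 have pw: "(a ^ i * b ^ j) ^ n = a ^ (i * n) * b ^ (j * n)" for i j n
 proof -
  have "a ^ i * b ^ j = b ^ j * a ^ i"
   by (induction i) (simp_all add: abn mult.assoc, metis abn mult.assoc)
  thus ?thesis using pow_mult_commuting by (metis power_mult)
 qed
 \<comment> \<open>The product over the powers of d = a^i b^j is fixed by d, hence trivial unless i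
   = j = 0.\<close>
 have norm1: "nprod (\<lambda>k. cj ((a ^ i * b ^ j) ^ k) w) p = 1" if w: "w \<in> V" and ij: "i < p" "j < p" "i \<noteq> 0 \<or> j \<noteq> 0" for w i j
 proof -
  define d where "d = a ^ i * b ^ j"
  have inV: "cj (d ^ k) w \<in> V" for k unfolding d_def pw using ia ib w by (simp flip: cj_cj)
  have "d ^ p = 1" unfolding d_def pw using assms(4,5) by (simp add: power_mult mult.commute[of _ p])
  hence e: "cj (d ^ p) w = cj (d ^ 0) w" by simp
  have "cj d (nprod (\<lambda>k. cj (d ^ k) w) p) = nprod (\<lambda>k. cj (d ^ Suc k) w) p"
   by (simp add: nprod_cj cj_cj)
  also have "\<dots> = nprod (\<lambda>k. cj (d ^ k) w) p"
   using nprod_shift[OF assms(1,2), of "\<lambda>k. cj (d ^ k) w" p] inV e by blast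
  finally have "d * nprod (\<lambda>k. cj (d ^ k) w) p = nprod (\<lambda>k. cj (d ^ k) w) p * d" by (simp add: cj_eq_iff)
  thus ?thesis using fpf[OF nprod_in[OF assms(1) inV] ij] by (simp add: d_def)
 qed
 have p: "0 < p" "1 < p" using prime_gt_1_nat[OF assms(3)] by auto
 have inV: "cj (a ^ i) (cj (b ^ (i * j)) v) \<in> V" for i j using ia ib v by blast
 have "nprod (\<lambda>j. nprod (\<lambda>i. cj (a ^ i) (cj (b ^ (i * j)) v)) p) p = nprod (\<lambda>j. 1) p"
 proof (rule nprod_cong)
  fix j assume j: "j < p"
  have "nprod (\<lambda>i. cj ((a ^ 1 * b ^ j) ^ i) v) p = 1" by (rule norm1[OF v p(2) j]) simp
  thus "nprod (\<lambda>i. cj (a ^ i) (cj (b ^ (i * j)) v)) p = 1"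
   unfolding pw by (simp add: cj_cj mult.commute)
 qed
 hence "1 = nprod (\<lambda>i. nprod (\<lambda>j. cj (a ^ i) (cj (b ^ (i * j)) v)) p) p"
  using nprod_swap[OF assms(1,2), of "\<lambda>i j. cj (a ^ i) (cj (b ^ (i * j)) v)"] inV by (simp add: nprod_one)
 also have "\<dots> = nprod (\<lambda>i. if i = 0 then v ^ p else 1) p"
 proof (rule nprod_cong)
  fix i assume i: "i < p"
  show "nprod (\<lambda>j. cj (a ^ i) (cj (b ^ (i * j)) v)) p = (if i = 0 then v ^ p else 1)"
  proof (cases "i = 0")
   case False
   have "nprod (\<lambda>j. cj ((a ^ 0 * b ^ i) ^ j) v) p = 1" by (rule norm1[OF v p(1) i]) (use False in simp)
   hence "nprod (\<lambda>j. cj (b ^ (i * j)) v) p = 1" by (simp flip: power_mult)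
   hence "cj (a ^ i) (nprod (\<lambda>j. cj (b ^ (i * j)) v) p) = 1" by simp
   thus ?thesis using False by (simp add: nprod_cj)
  qed (simp add: nprod_const)
 qed
 also have "\<dots> = v ^ p"
 proof -
  have "nprod (\<lambda>i. if i = 0 then v ^ p else 1) (Suc n) = v ^ p" for n by (induction n) auto
  thus ?thesis using p(1) by (metis Suc_pred')
 qed
 finally show ?thesis by simp
qed

text \<open>Let D be generated by a and b, and W by the centralizers in question. Induction over the
  D-invariant subgroups K of \<open>Y\<close>: the derived subgroup of K lies in W by induction, so
  K is abelian modulo M = W \<inter> K. Non-trivial elements of D act on that quotient without fixed
  points, because fixed points lift into W. By \<open>noncyclic_fixed_points\<close> its exponent
  divides p, while its order is prime to p.\<close>

lemma coprime_generation:
 fixes Y :: "'a::group_mult set"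
 assumes Y: "solv Y" "\<not> p dvd card Y" and p: "prime p" and T: "grp T" "a \<in> T" "b \<in> T"
  and ord: "a ^ p = 1" "b ^ p = 1" "a \<noteq> 1" "b \<notin> cyc a" "a * b = b * a"
  and inv: "\<And>y. y \<in> Y \<Longrightarrow> cj a y \<in> Y" "\<And>y. y \<in> Y \<Longrightarrow> cj b y \<in> Y"
 shows "Y \<subseteq> gen (\<Union>d\<in>prd (cyc a) (cyc b) - {1}. cz Y {d})"
proof -
 have gY: "grp Y" using Y(1) solv_grp by blast
 note ca = grp_cyc[OF T(1,2)] and cb = grp_cyc[OF T(1,3)]
 define D where "D = prd (cyc a) (cyc b)"
 have acb: "cyc b \<subseteq> cz T {a}" by (rule cyc_least[OF grp_cz[OF T(1)]]) (simp add: cz_def T ord)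
 have comm: "s * t = t * s" if "s \<in> cyc a" "t \<in> cyc b" for s t
 proof -
  have "cyc a \<subseteq> cz T {t}" by (rule cyc_least[OF grp_cz[OF T(1)]]) (use acb that T in "auto simp: cz_def")
  thus ?thesis using that by (auto simp: cz_def)
 qed
 have gD: "grp D" unfolding D_def by (rule grp_prd_comm[OF ca(1) cb(1) comm])
 have DT: "D \<subseteq> T" unfolding D_def by (rule prd_least[OF ca(2) cb(2) T(1)])
 have aD: "a \<in> D" "b \<in> D" unfolding D_def using prd_sub1[OF ca(1) cb(1)] prd_sub2[OF ca(1) cb(1)] cyc_self by blast+
 have abD: "d * e = e * d" if de: "d \<in> D" "e \<in> D" for d e
 proof -
  obtain s t u v where 1: "s \<in> cyc a" "t \<in> cyc b" "d = s * t" "u \<in> cyc a" "v \<in> cyc b" "e = u * v"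
   using de unfolding D_def prd_iff by blast
  thus ?thesis using swap_factors[OF comm[OF 1(4,2)], of s v] swap_factors[OF comm[OF 1(1,5)], of u t]
    cyc_abelian[OF 1(1,4)] cyc_abelian[OF 1(2,5)] by simp
 qed
 have Dnz: "cj d y \<in> Y" if dy: "d \<in> D" "y \<in> Y" for d y
 proof -
  have 1: "cj (a ^ n) w \<in> Y" if "w \<in> Y" for n w
   using that by (induction n) (auto simp: inv(1) simp flip: cj_cj)
  have 2: "cj (b ^ n) w \<in> Y" if "w \<in> Y" for n w
   using that by (induction n) (auto simp: inv(2) simp flip: cj_cj)
  obtain i j where "d = a ^ i * b ^ j" using dy(1) by (auto simp: D_def prd_iff cyc_def)
  thus ?thesis using 1 2 dy(2) by (simp flip: cj_cj)
 qed
 have Dp: "d ^ p = 1" if dD: "d \<in> D" for d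
 proof -
  obtain i j where d: "d = a ^ i * b ^ j" using dD by (auto simp: D_def prd_iff cyc_def)
  have "d ^ p = (a ^ i) ^ p * (b ^ j) ^ p" unfolding d by (rule pow_mult_commuting, rule comm) simp_all
  moreover have "(a ^ i) ^ p = (a ^ p) ^ i" "(b ^ j) ^ p = (b ^ p) ^ j" by (simp_all add: mult.commute flip: power_mult)
  ultimately show ?thesis by (simp add: ord)
 qed
 have nontriv: "a ^ i * b ^ j \<noteq> 1" if ij: "i < p" "j < p" "i \<noteq> 0 \<or> j \<noteq> 0" for i j
 proof
  assume e: "a ^ i * b ^ j = 1"
  hence "b ^ j = inverse (a ^ i)" by (simp add: mult_eq_one_iff)
  hence bj: "b ^ j \<in> cyc a" using grpD(4)[OF ca(1)] by simp
  have cop: "coprime k p" if "k < p" "k \<noteq> 0" for k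
   using that p by (metis bot_nat_0.not_eq_extremum coprime_commute dvd_imp_le linorder_not_less prime_imp_coprime)
  have ob: "b \<noteq> 1" using ord(4) grpD(2)[OF ca(1)] by blast
  have "j = 0"
  proof (rule ccontr)
   assume "j \<noteq> 0"
   hence "b \<in> cyc a" using pow_coprime_mem[OF T(1,3) ca(1) bj] cop[OF ij(2)] od_prime[OF T(1,3) ob ord(2) p] by simp
   thus False using ord(4) by blast
  qed
  hence "a ^ i = 1" "i \<noteq> 0" using e ij by auto
  hence "a = 1" using pow_coprime_one[OF T(1,2) _ ord(1)] cop[OF ij(1)] by blast
  thus False using ord(3) by blast
 qed
 define W where "W = gen (\<Union>d\<in>D - {1}. cz Y {d})"
 have Wg: "(\<Union>d\<in>D - {1}. cz Y {d}) \<subseteq> Y" by (auto simp: cz_def)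
 have gW: "grp W" unfolding W_def by (rule grp_gen[OF Wg gY])
 have Wi: "cz Y {d} \<subseteq> W" if "d \<in> D" "d \<noteq> 1" for d
  unfolding W_def using gen_inc[of "\<Union>d\<in>D - {1}. cz Y {d}"] that by blast
 have Winv: "cj e w \<in> W" if e: "e \<in> D" and w: "w \<in> W" for e w
  using w unfolding W_def
 proof (rule gen_cj_closed[OF Wg gY, rotated])
  fix y assume "y \<in> (\<Union>d\<in>D - {1}. cz Y {d})"
  then obtain d where d: "d \<in> D" "d \<noteq> 1" "y \<in> Y" "y * d = d * y" by (auto simp: cz_def)
  have "cj e d = d" using abD[OF e d(1)] by (simp add: cj_eq_iff)
  moreover have "cj e (d * y) = cj e (y * d)" using d(4) by simp
  ultimately have "d * cj e y = cj e y * d" by (simp add: cj_mult)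
  hence "cj e y \<in> cz Y {d}" using Dnz[OF e d(3)] by (simp add: cz_def)
  thus "cj e y \<in> gen (\<Union>d\<in>D - {1}. cz Y {d})" using Wi[OF d(1,2)] unfolding W_def by blast
 qed
 have "K \<subseteq> W" if "grp K" "K \<subseteq> Y" "\<And>d k. d \<in> D \<Longrightarrow> k \<in> K \<Longrightarrow> cj d k \<in> K" for K
  using that
 proof (induction "card K" arbitrary: K rule: less_induct)
  case less
  note K = less.prems
  show ?case
  proof (cases "K = {1}")
   case True
   thus ?thesis using grpD(2)[OF gW] by simp
  next
   case False
   have dK: "der K \<subset> K" using solv_der[OF Y(1) K(1,2) False] .
   define H where "H = prd K D"
   have gH: "grp H" unfolding H_def by (rule grp_prd[OF K(1) gD K(3)])
   have KH: "K \<subseteq> H" "D \<subseteq> H" unfolding H_def using prd_sub1 prd_sub2 K(1) gD by blast+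
   have nK: "nml K H" unfolding H_def by (rule nml_prd_left[OF K(1) gD K(3)])
   have dW: "der K \<subseteq> W"
   proof (rule less.hyps)
    show "card (der K) < card K" by (rule psubset_card_mono[OF grpD(1)[OF K(1)] dK])
    show "grp (der K)" "der K \<subseteq> Y" using grp_der[OF K(1)] dK K(2) by auto
    show "cj d k \<in> der K" if "d \<in> D" "k \<in> der K" for d k
     using nmlD(4)[OF nml_der[OF nK], of d k] that KH by blast
   qed
   define M where "M = W \<inter> K"
   have gM: "grp M" unfolding M_def by (rule grp_Int[OF gW K(1)])
   have nM: "nml M H"
    unfolding nml_def
   proof (intro conjI ballI gM gH)
    show "M \<subseteq> H" using KH by (auto simp: M_def)
    fix h m assume h: "h \<in> H" and m: "m \<in> M"
    obtain w d where wd: "w \<in> K" "d \<in> D" "h = w * d" using h by (auto simp: H_def prd_iff)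
    have 1: "cj d m \<in> M" using Winv[OF wd(2)] K(3)[OF wd(2)] m by (simp add: M_def)
    have "cm w (cj d m) \<in> M" using cm_in_der[OF wd(1), of "cj d m"] 1 dW dK by (auto simp: M_def)
    hence "cm w (cj d m) * cj d m \<in> M" using 1 grpD(3)[OF gM] by blast
    moreover have "cj h m = cm w (cj d m) * cj d m"
     unfolding wd(3) cj_cj[symmetric] by (rule cj_cm)
    ultimately show "cj h m \<in> M" by simp
   qed
   obtain f :: "'a \<Rightarrow> gp" where f: "ghom f H" "ker f H = M" using quotient_exists[OF nM] by blast
   define V where "V = f ` K"
   have gV: "grp V" unfolding V_def by (rule grp_img_sub[OF f(1) K(1) KH(1)])
   have k1: "f m = 1" if "m \<in> M" for m using that f(2) by (auto simp: ker_def)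
   have abV: "ab V"
    unfolding ab_def V_def
   proof (intro ballI; elim imageE)
    fix x y s t assume "s \<in> K" "t \<in> K" "x = f s" "y = f t"
    hence "f (cm s t) = 1" using k1 cm_in_der[of s K t] dW dK by (auto simp: M_def)
    hence "cm (f s) (f t) = 1" using ghomD(7)[OF f(1), of s t] KH \<open>s \<in> K\<close> \<open>t \<in> K\<close> by auto
    thus "x * y = y * x" using \<open>x = f s\<close> \<open>y = f t\<close> by (simp add: cm_eq_one)
   qed
   have aH: "a \<in> H" "b \<in> H" using aD KH by auto
   \<comment> \<open>A fixed point in the quotient is a coset of M invariant under d. It contains an
     element centralized by d, which lies in W, so the coset is M itself.\<close>
   have fpf: "v = 1" if v: "v \<in> V" and ij: "i < p" "j < p" "i \<noteq> 0 \<or> j \<noteq> 0"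
    and c: "f a ^ i * f b ^ j * v = v * (f a ^ i * f b ^ j)" for v i j
   proof -
    obtain y where y: "y \<in> K" "v = f y" using v by (auto simp: V_def)
    define d where "d = a ^ i * b ^ j"
    have dD: "d \<in> D" unfolding d_def using grpD(3,5)[OF gD] aD by simp
    have d1: "d \<noteq> 1" unfolding d_def by (rule nontriv[OF ij])
    have dH: "d \<in> H" and yH: "y \<in> H" using dD y KH by auto
    have fd: "f d = f a ^ i * f b ^ j"
     unfolding d_def using ghomD(2)[OF f(1) grpD(5)[OF gH aH(1)] grpD(5)[OF gH aH(2)]] ghomD(5)[OF f(1) aH(1)] ghomD(5)[OF f(1) aH(2)] by simp
    have "cj (f d) (f y) = f y" using c y(2) fd by (simp add: cj_eq_iff)
    hence "f (cj d y) = f y" using ghomD(6)[OF f(1) dH yH] by simp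
    hence dy: "inverse y * cj d y \<in> M" using ghom_eq_iff[OF f(1) yH grpD(6)[OF gH dH yH]] f(2) by simp
    have pd: "pgr p (cyc d)" using pgr_cyc[OF T(1) subsetD[OF DT dD] _ p, of 1] Dp[OF dD] by simp
    have cd: "cyc d \<subseteq> D" by (rule cyc_least[OF gD dD])
    have Mi: "cj e n \<in> M" if "e \<in> cyc d" "n \<in> M" for e n
     using Winv K(3) that cd by (auto simp: M_def)
    have "\<not> p dvd card M"
     using lagrange_dvd[OF gY gM] K(2) Y(2) dvd_trans by (auto simp: M_def)
    moreover have "inverse y * cj e y \<in> M" if e: "e \<in> cyc d" for e
    proof -
     obtain n where n: "e = d ^ n" using e by (auto simp: cyc_def)
     show ?thesis unfolding n
     proof (induction n)
      case (Suc n)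
      have "inverse y * cj (d ^ Suc n) y = (inverse y * cj d y) * cj d (inverse y * cj (d ^ n) y)"
       by (simp add: cj_mult cj_inv cj_cj gsimps)
      moreover have "cj d (inverse y * cj (d ^ n) y) \<in> M" by (rule Mi[OF cyc_self Suc])
      ultimately show ?case using dy grpD(3)[OF gM] by metis
     qed (simp add: grpD(2)[OF gM])
    qed
    ultimately obtain n where n: "n \<in> M" "\<forall>e\<in>cyc d. e * (y * n) = (y * n) * e"
     using coset_fixpoint[OF pd p gM _ Mi, of y] by blast
    have "y \<in> Y" "n \<in> Y" using y(1) n(1) K(2) by (auto simp: M_def)
    hence "y * n \<in> Y" by (rule grpD(3)[OF gY])
    moreover have "d * (y * n) = (y * n) * d" using n(2) cyc_self by blast
    ultimately have "y * n \<in> cz Y {d}" by (simp add: cz_def)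
    hence "y * n \<in> W" using Wi[OF dD d1] by blast
    hence "y \<in> M" using n(1) y(1) grp_cancel(2)[OF gW] by (auto simp: M_def)
    thus "v = 1" using k1 y(2) by simp
   qed
   have "f y = 1" if y: "y \<in> K" for y
   proof -
    have fy: "f y \<in> V" using y by (simp add: V_def)
    have "f y ^ p = 1"
    proof (rule noncyclic_fixed_points[OF gV abV p _ _ _ _ _ fpf fy])
     show "f a ^ p = 1" "f b ^ p = 1" using ghomD(5)[OF f(1)] aH ord ghomD(3)[OF f(1)] by metis+
     show "f a * f b = f b * f a" using ghomD(2)[OF f(1)] aH ord(5) by metis
     have cV: "cj (f d) v \<in> V" if d: "d \<in> D" and v: "v \<in> V" for d v
     proof -
      obtain k where k: "k \<in> K" "v = f k" using v by (auto simp: V_def)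
      have "f (cj d k) = cj (f d) v" using ghomD(6)[OF f(1), of d k] d k KH by auto
      thus ?thesis using K(3)[OF d k(1)] unfolding V_def by (metis imageI)
     qed
     show "cj (f a) v \<in> V" "cj (f b) v \<in> V" if "v \<in> V" for v
      using cV that aD by blast+
    qed
    moreover have "f y ^ card K = 1" using pow_card(1)[OF K(1) y] ghomD(5)[OF f(1), of y "card K"] ghomD(3)[OF f(1)] y KH by auto
    moreover have "\<not> p dvd card K" using lagrange_dvd[OF gY K(1,2)] Y(2) dvd_trans by blast
    hence "coprime p (card K)" using p by (simp add: prime_imp_coprime)
    ultimately show ?thesis using pow_coprime_one[OF gV fy] by blast
   qed
   hence "K \<subseteq> ker f H" using KH by (auto simp: ker_def)
   thus ?thesis using f(2) by (simp add: M_def)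
  qed
 qed
 thus ?thesis using gY Dnz unfolding W_def D_def by blast
qed

text \<open>Two applications of \<open>coprime_generation\<close>: to \<open>Y\<close>, and to the
  centralizer of each d. The second uses a and b generating a group that meets \<open>cyc d\<close>
  trivially; such a pair exists because \<open>E\<close> has order at least p^3.\<close>

lemma coprime_generation_rank_three:
 fixes Y :: "'a::group_mult set"
 assumes Y: "solv Y" "\<not> p dvd card Y" and p: "prime p"
  and E: "grp E" "ab E" "\<And>x. x \<in> E \<Longrightarrow> x ^ p = 1" "p ^ 3 \<le> card E"
  and inv: "\<And>e y. e \<in> E \<Longrightarrow> y \<in> Y \<Longrightarrow> cj e y \<in> Y"
 shows "Y \<subseteq> gen (\<Union>d\<in>E - {1}. \<Union>e\<in>E - cyc d. cz Y {d, e})"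
proof -
 have gY: "grp Y" using Y(1) solv_grp by blast
 define W where "W = gen (\<Union>d\<in>E - {1}. \<Union>e\<in>E - cyc d. cz Y {d, e})"
 have Ws: "(\<Union>d\<in>E - {1}. \<Union>e\<in>E - cyc d. cz Y {d, e}) \<subseteq> Y" by (auto simp: cz_def)
 have gW: "grp W" unfolding W_def by (rule grp_gen[OF Ws gY])
 have Wi: "cz Y {d, e} \<subseteq> W" if "d \<in> E" "d \<noteq> 1" "e \<in> E" "e \<notin> cyc d" for d e
  unfolding W_def using gen_inc[of "\<Union>d\<in>E - {1}. \<Union>e\<in>E - cyc d. cz Y {d, e}"] that by blast
 have cE: "grp (cyc x)" "cyc x \<subseteq> E" if "x \<in> E" for x using grp_cyc[OF E(1) that] by auto
 have cyc_le: "card (cyc x) \<le> p" if "x \<in> E" for x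
  using E(3)[OF that] od(4)[OF E(1) that] od(3)[OF E(1) that, of p] prime_gt_0_nat[OF p] by (simp add: dvd_imp_le)
 have pow: "x ^ i = 1" if x: "x \<in> E" "x ^ i \<in> F" "x \<notin> F" and F: "grp F" for x i F
 proof (cases "p dvd i")
  case True
  thus ?thesis using E(3)[OF x(1)] by (auto simp: power_mult)
 next
  case False
  have "x \<noteq> 1" using x(3) grpD(2)[OF F] by blast
  hence "od x = p" using od_prime[OF E(1) x(1) _ E(3)[OF x(1)] p] by blast
  hence "coprime i (od x)" using prime_imp_coprime[OF p False] by (simp add: coprime_commute)
  thus ?thesis using pow_coprime_mem[OF E(1) x(1) F x(2)] x(3) by blast
 qed
 have ex: "\<exists>a\<in>E. \<exists>b\<in>E. a \<noteq> 1 \<and> b \<notin> cyc a \<and> (\<forall>e\<in>prd (cyc a) (cyc b). e \<in> cyc d \<longrightarrow> e = 1)" if d: "d \<in> E" for d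
 proof -
  have lt: "p < p ^ 3" "p * p < p ^ 3"
   using power_strict_increasing[OF _ prime_gt_1_nat[OF p], of 1 3] power_strict_increasing[OF _ prime_gt_1_nat[OF p], of 2 3] by (simp_all add: power2_eq_square)
  have "\<not> E \<subseteq> cyc d" using card_mono[OF grpD(1)[OF cE(1)[OF d]], of E] cyc_le[OF d] E(4) lt by auto
  then obtain a where a: "a \<in> E" "a \<notin> cyc d" by blast
  note ca = cE(1)[OF a(1)] and cd = cE(1)[OF d]
  define F where "F = prd (cyc d) (cyc a)"
  have F: "grp F" unfolding F_def by (rule grp_prd_comm[OF cd ca]) (use abD[OF E(2)] cE(2) d a(1) in blast)
  have "card F \<le> card (cyc d \<times> cyc a)" unfolding F_def prd_def by (rule card_image_le) (simp add: grpD(1) cd ca)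
  also have "\<dots> \<le> p * p" using cyc_le d a(1) by (simp add: card_cartesian_product mult_le_mono)
  finally have "\<not> E \<subseteq> F" using card_mono[OF grpD(1)[OF F], of E] E(4) lt by auto
  then obtain b where b: "b \<in> E" "b \<notin> F" by blast
  have sub: "cyc d \<subseteq> F" "cyc a \<subseteq> F" unfolding F_def using prd_sub1[OF cd ca] prd_sub2[OF cd ca] .
  have "e = 1" if e: "e \<in> prd (cyc a) (cyc b)" "e \<in> cyc d" for e
  proof -
   obtain i j where ij: "e = a ^ i * b ^ j" using e(1) by (auto simp: prd_iff cyc_def)
   have "a ^ i \<in> F" using sub(2) by auto
   hence "b ^ j \<in> F" using grp_cancel(1)[OF F, of "a ^ i" "b ^ j"] ij e(2) sub(1) by auto
   hence "b ^ j = 1" by (rule pow[OF b(1) _ b(2) F])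
   moreover hence "a ^ i = 1" using pow[OF a(1) _ a(2) cd] ij e(2) by simp
   ultimately show ?thesis using ij by simp
  qed
  moreover have "a \<noteq> 1" using a(2) grpD(2)[OF cd] by metis
  ultimately show ?thesis using a(1) b sub(2) by blast
 qed
 have step: "Z \<subseteq> W" if Z: "grp Z" "Z \<subseteq> Y" and d: "d \<in> E" and inv: "\<And>e z. e \<in> E \<Longrightarrow> z \<in> Z \<Longrightarrow> cj e z \<in> Z"
  and W: "\<And>e. e \<in> E \<Longrightarrow> e \<noteq> 1 \<Longrightarrow> e \<notin> cyc d \<Longrightarrow> cz Z {e} \<subseteq> W" for Z d
 proof -
  obtain a b where ab: "a \<in> E" "b \<in> E" "a \<noteq> 1" "b \<notin> cyc a" "\<And>e. e \<in> prd (cyc a) (cyc b) \<Longrightarrow> e \<in> cyc d \<Longrightarrow> e = 1"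
   using ex[OF d] by blast
  have "\<not> p dvd card Z" using lagrange_dvd[OF gY Z] Y(2) dvd_trans by blast
  hence "Z \<subseteq> gen (\<Union>e\<in>prd (cyc a) (cyc b) - {1}. cz Z {e})"
   by (intro coprime_generation[OF solv_sub[OF Y(1) Z] _ p E(1) ab(1,2) E(3)[OF ab(1)] E(3)[OF ab(2)] ab(3,4)
      abD[OF E(2) ab(1,2)] inv[OF ab(1)] inv[OF ab(2)]])
  also have "\<dots> \<subseteq> W"
  proof (rule gen_sub[OF UN_least gW])
   fix e assume e: "e \<in> prd (cyc a) (cyc b) - {1}"
   hence "e \<in> E" using prd_least[OF cE(2)[OF ab(1)] cE(2)[OF ab(2)] E(1)] by blast
   thus "cz Z {e} \<subseteq> W" using W ab(5) e by blast
  qed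
  finally show ?thesis .
 qed
 have main: "cz Y {d} \<subseteq> W" if d: "d \<in> E" "d \<noteq> 1" for d
 proof (rule step[OF grp_cz[OF gY] cz_sub d(1)])
  show "cj e z \<in> cz Y {d}" if e: "e \<in> E" and z: "z \<in> cz Y {d}" for e z
  proof -
   have "cj e d = d" using abD[OF E(2) e d(1)] by (simp add: cj_eq_iff)
   moreover have "z * d = d * z" using z by (simp add: cz_def)
   hence "cj e (z * d) = cj e (d * z)" by simp
   ultimately show ?thesis using inv[OF e] z by (simp add: cz_def cj_mult)
  qed
  have "cz (cz Y {d}) {e} = cz Y {d, e}" for e by (auto simp: cz_def)
  thus "cz (cz Y {d}) {e} \<subseteq> W" if "e \<in> E" "e \<notin> cyc d" for e using Wi[OF d that] by simp
 qed
 have "Y \<subseteq> W" by (rule step[OF gY subset_refl grpD(2)[OF E(1)] inv main])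
 thus ?thesis by (simp add: W_def)
qed

subsection \<open>Elements of order dividing p in abelian groups\<close>

text \<open>For an abelian group and a prime p this is the subgroup \<Omega>_1; its order measures
  the rank of \<open>A\<close> at p.\<close>

definition Om :: "nat \<Rightarrow> 'a::group_mult set \<Rightarrow> 'a set" where
 "Om p A = {x \<in> A. x ^ p = 1}"

lemma Om:
 assumes "grp A" "ab A"
 shows "grp (Om p A)" "Om p A \<subseteq> A" "ab (Om p A)" "x \<in> Om p A \<Longrightarrow> x ^ p = 1"
proof -
 show s: "Om p A \<subseteq> A" "x \<in> Om p A \<Longrightarrow> x ^ p = 1" by (auto simp: Om_def)
 show "ab (Om p A)" using ab_sub[OF assms(2) s(1)] .
 show "grp (Om p A)"
 proof (rule grpI)
  show "finite (Om p A)" using s(1) grpD(1)[OF assms(1)] finite_subset by blast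
  show "1 \<in> Om p A" using grpD(2)[OF assms(1)] by (simp add: Om_def)
  show "x * y \<in> Om p A" if "x \<in> Om p A" "y \<in> Om p A" for x y
   using that pow_mult_commuting[of x y p] abD[OF assms(2), of x y] grpD(3)[OF assms(1)] by (auto simp: Om_def)
  show "inverse x \<in> Om p A" if "x \<in> Om p A" for x
   using that grpD(4)[OF assms(1)] by (auto simp: Om_def pow_inv)
 qed
qed

lemma Om_cj: "x \<in> Om p A \<Longrightarrow> cj g x \<in> A \<Longrightarrow> cj g x \<in> Om p A"
 by (simp add: Om_def flip: cj_pow)

lemma elementary_pgr:
 assumes "grp A" "prime p" "\<And>x. x \<in> A \<Longrightarrow> x ^ p = 1" shows "pgr p A"
 unfolding pgr_iff_pig[OF assms(2)] pig_def
proof (intro conjI allI impI)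
 fix r :: nat assume r: "prime r" "r dvd card A"
 then obtain x where x: "x \<in> A" "x \<noteq> 1" "x ^ r = 1" using cauchy assms(1) by blast
 hence "od x = r" "od x = p" using od_prime[OF assms(1) x(1,2)] assms r(1) by blast+
 thus "r \<in> {p}" by simp
qed (rule assms(1))

lemma Om_nontriv: "pgr p A \<Longrightarrow> prime p \<Longrightarrow> A \<noteq> {1} \<Longrightarrow> \<exists>x\<in>Om p A. x \<noteq> 1"
 using pgr_order_p[of p A] by (auto simp: Om_def)

text \<open>Induction on the order of y. Since y^p is centralized, y and its conjugates under
  \<open>B\<close> differ by elements of \<open>Om p A\<close>. The coset of y is therefore
  invariant and contains a centralized element, and \<open>Om p A\<close> is centralized by
  assumption.\<close>

lemma coprime_Om:
 assumes A: "grp A" "ab A" "pgr p A" "prime p" and B: "pgr r B" "prime r" "r \<noteq> p"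
  and inv: "\<And>b x. b \<in> B \<Longrightarrow> x \<in> A \<Longrightarrow> cj b x \<in> A"
  and Omc: "\<And>b x. b \<in> B \<Longrightarrow> x \<in> Om p A \<Longrightarrow> b * x = x * b"
  and b: "b \<in> B" and x: "x \<in> A"
 shows "b * x = x * b"
proof -
 note O = Om[OF A(1,2), where p=p]
 have "\<forall>c\<in>B. c * y = y * c" if "y \<in> A" for y
  using that
 proof (induction "od y" arbitrary: y rule: less_induct)
  case less
  show ?case
  proof (cases "y = 1")
   case False
   obtain k where k: "od y = p ^ k" using pgr_od[OF A(3,4) less.prems] .
   hence "p dvd od y" using False od_eq_one[OF A(1) less.prems] by (cases k) auto
   hence IH: "\<forall>c\<in>B. c * y ^ p = y ^ p * c"
    using less.hyps[OF od_pow_less[OF A(1) less.prems A(4)] grpD(5)[OF A(1) less.prems]] by blast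
   have wO: "inverse y * cj c y \<in> Om p A" if c: "c \<in> B" for c
   proof -
    have w: "inverse y * cj c y \<in> A" using inv[OF c less.prems] grpD(3,4)[OF A(1)] less.prems by simp
    have "(inverse y * cj c y) ^ p = inverse y ^ p * cj c y ^ p"
     by (rule pow_mult_commuting, rule abD[OF A(2)]) (use inv[OF c less.prems] grpD(4)[OF A(1)] less.prems in auto)
    also have "cj c y ^ p = y ^ p" using IH c by (simp add: cj_eq_iff flip: cj_pow)
    finally show ?thesis using w by (simp add: Om_def pow_inv)
   qed
   have "\<not> r dvd card (Om p A)" using pgr_coprime_dvd[OF pgr_sub[OF A(3,4) O(1,2)] A(4) B(2,3)] .
   moreover have "cj c n \<in> Om p A" if "c \<in> B" "n \<in> Om p A" for c n using that inv O(2) Om_cj by blast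
   ultimately obtain n where n: "n \<in> Om p A" "\<And>c. c \<in> B \<Longrightarrow> c * (y * n) = (y * n) * c"
    using coset_fixpoint[OF B(1,2) O(1), of y] wO by blast
   show ?thesis
   proof
    fix c assume c: "c \<in> B"
    have "cj c (y * n) = y * n" "cj c n = n" using n c Omc[OF c n(1)] by (simp_all add: cj_eq_iff)
    hence "cj c y = y" by (simp add: cj_mult)
    thus "c * y = y * c" by (simp add: cj_eq_iff)
   qed
  qed simp
 qed
 thus ?thesis using b x by blast
qed

lemma elementary_card:
 assumes "grp A" "prime p" "\<And>x. x \<in> A \<Longrightarrow> x ^ p = 1" "card A < p ^ 3"
 shows "card A = 1 \<or> card A = p \<or> card A = p ^ 2"
proof -
 obtain k where k: "card A = p ^ k" using elementary_pgr[OF assms(1-3)] by (auto simp: pgr_def)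
 have "k < 3" by (rule power_less_imp_less_exp[OF prime_gt_1_nat[OF assms(2)]]) (use assms(4) k in simp)
 hence "k = 0 \<or> k = 1 \<or> k = 2" by linarith
 thus ?thesis using k by auto
qed

lemma small_elementary_centralized:
 fixes L :: "gp set"
 assumes "Good L" "grp A" "A \<subseteq> L" "ab A" "prime p" "\<And>x. x \<in> A \<Longrightarrow> x ^ p = 1" "card A < p ^ 3"
  "k \<in> nz L A" "coprime (od k) p"
 shows "k \<in> cz L A"
proof -
 have "card A = 1 \<or> card A = p \<or> card A = p ^ 2" by (rule elementary_card) (use assms in auto)
 thus ?thesis
proof (elim disjE)
 assume "card A = 1"
 hence "A = {1}" using grp_card_one assms(2) by blast
 thus ?thesis using assms(8) by (auto simp: cz_def nz_def)
next
 assume "card A = p"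
 thus ?thesis using normalizer_prime_order[OF assms(1-3) _ assms(5)] assms(8) by blast
next
 assume "card A = p ^ 2"
 thus ?thesis using normalizer_rank_two[OF assms(1-3) _ assms(5,4,6,8,9)] by blast
qed
qed

text \<open>Whether a coprime action on an abelian p-group is trivial is decided on
  \<open>Om p A\<close>, and there rank at most two is covered by the excluded sections.\<close>

lemma small_rank_centralized:
 fixes L :: "gp set"
 assumes "Good L" "pgr p A" "prime p" "A \<subseteq> L" "ab A" "card (Om p A) < p ^ 3"
  "pgr r B" "prime r" "r \<noteq> p" "B \<subseteq> nz L A"
 shows "B \<subseteq> cz L A"
proof
 fix b assume b: "b \<in> B"
 have L: "grp L" using assms(1) Good_grp by blast
 have A: "grp A" using assms(2) pgr_grp by blast
 note O = Om[OF A assms(5), where p=p]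
 have inv: "cj c x \<in> A" if "c \<in> B" "x \<in> A" for c x using that assms(10) nz_D by blast
 have BL: "c \<in> L" if "c \<in> B" for c using that assms(10) nz_sub by blast
 have OL: "Om p A \<subseteq> L" using O(2) assms(4) by blast
 have "c * x = x * c" if c: "c \<in> B" and x: "x \<in> Om p A" for c x
 proof -
  have "c \<in> nz L (Om p A)"
  proof (rule nzI[OF grpD(1)[OF O(1)] BL[OF c]])
   fix a assume "a \<in> Om p A"
   thus "cj c a \<in> Om p A" using Om_cj[of a p A c] inv[OF c] O(2) by blast
  qed
  moreover obtain k where "od c = r ^ k" using pgr_od[OF assms(7,8) c] .
  hence "coprime (od c) p" using primes_coprime[OF assms(8,3,9)] by simp
  ultimately have "c \<in> cz L (Om p A)"
   using small_elementary_centralized[OF assms(1) O(1) OL O(3) assms(3) O(4) assms(6)] by blast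
  thus ?thesis using x by (simp add: cz_def)
 qed
 hence "b * x = x * b" if "x \<in> A" for x
  using coprime_Om[OF A assms(5,2,3,7,8,9) inv _ b that] by blast
 thus "b \<in> cz L A" using BL[OF b] by (simp add: cz_def)
qed

text \<open>Sylow subgroups for primes other than p centralize \<open>A\<close> because its rank is
  at most two; those for p do so by hypothesis.\<close>

lemma small_rank_central:
 fixes L :: "gp set"
 assumes L: "Good L" and A: "nml A L" "pgr p A" "prime p" "ab A" "card (Om p A) < p ^ 3"
  and P: "\<And>P. syl p P L \<Longrightarrow> P \<subseteq> cz L A"
 shows "cz L A = L"
proof (rule all_sylow[OF Good_grp[OF L] grp_cz[OF Good_grp[OF L]] cz_sub])
 fix r :: nat assume r: "prime r"
 obtain R where R: "syl r R L" using syl_exists[OF Good_grp[OF L] r] by blast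
 have "R \<subseteq> cz L A"
 proof (cases "r = p")
  case False
  have "R \<subseteq> nz L A" using nml_iff_nz[OF nmlD(1,2,3)[OF A(1)]] A(1) sylD(4)[OF R] by simp
  thus ?thesis
   by (rule small_rank_centralized[OF L A(2,3) nmlD(3)[OF A(1)] A(4,5) sylD(2)[OF R] r False])
 qed (use P R in simp)
 thus "\<exists>P. syl r P L \<and> P \<subseteq> cz L A" using R by blast
qed

section \<open>Solvable groups: p-length one\<close>

lemma commutator_hom:
 fixes V :: "'a::group_mult set"
 assumes V: "grp V" "ab V" and inv: "\<And>v. v \<in> V \<Longrightarrow> cj x v \<in> V"
 shows "ghom (cm x) V" "ker (cm x) V = cz V {x}" "cm x ` V \<subseteq> V" "card V = card (cm x ` V) * card (cz V {x})"
proof -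
 have c: "cm x v = cj x v * inverse v" for v by (simp add: cj_def cm_def)
 show im: "cm x ` V \<subseteq> V" using inv grpD(3,4)[OF V(1)] by (auto simp: c)
 show h: "ghom (cm x) V" unfolding ghom_def
 proof (intro conjI ballI V(1))
  fix v w assume v: "v \<in> V" "w \<in> V"
  have "inverse v * (cj x w * inverse w) = (cj x w * inverse w) * inverse v"
   by (rule abD[OF V(2)]) (use v inv grpD(3,4)[OF V(1)] in auto)
  moreover have "inverse w * inverse v = inverse v * inverse w"
   by (rule abD[OF V(2)]) (use v grpD(4)[OF V(1)] in auto)
  ultimately show "cm x (v * w) = cm x v * cm x w" by (simp add: c cj_mult gsimps)
 qed
 show k: "ker (cm x) V = cz V {x}" by (auto simp: ker_def cz_def cm_eq_one)
 have "V \<inter> cz V {x} = cz V {x}" using cz_sub by blast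
 thus "card V = card (cm x ` V) * card (cz V {x})" using card_img[OF h V(1)] k by simp
qed

lemma card_fixed_points_p_element:
 fixes L :: "gp set"
 assumes L: "Good L" and V: "nml V L" "ab V" "\<And>v. v \<in> V \<Longrightarrow> v ^ p = 1" and p: "prime p"
  and x: "x \<in> L" "x ^ p \<in> V"
 shows "card V \<le> p * card (cz V {x})"
proof -
 have gL: "grp L" using Good_grp[OF L] .
 note gV = nmlD(1)[OF V(1)] and VL = nmlD(3)[OF V(1)] and inv = nmlD(4)[OF V(1) x(1)]
 note h = commutator_hom[OF gV V(2) inv]
 define N where "N = cyc (x ^ p)"
 have gN: "grp N" "N \<subseteq> V" unfolding N_def using grp_cyc[OF gV x(2)] by blast+
 have NL: "N \<subseteq> L" using gN(2) VL by blast
 define K where "K = pre (cm x) V N"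
 have gK: "grp K" "K \<subseteq> V" unfolding K_def by (rule grp_pre[OF h(1) gN(1)], assumption, rule pre_sub)
 have nzN: "w \<in> nz L N" if "w \<in> L" "\<And>y. y \<in> N \<Longrightarrow> cj w y = y" for w
  by (rule nzI[OF grpD(1)[OF gN(1)] that(1)]) (simp add: that(2))
 have xN: "x \<in> nz L N"
 proof (rule nzN[OF x(1)])
  fix y assume "y \<in> N"
  then obtain i where "y = (x ^ p) ^ i" by (auto simp: N_def cyc_def)
  thus "cj x y = y" by (simp only: cj_pow cj_eq_iff[THEN iffD2] power_commutes power_Suc[symmetric] power_Suc2[symmetric])
 qed
 have step: "v \<in> K" if v: "v \<in> V" "cm x v \<in> K" for v
 proof -
  have vN: "v \<in> nz L N" using v(1) VL abD[OF V(2) v(1)] gN(2) by (intro nzN) (auto simp: cj_eq_iff)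
  have cV: "cm x v \<in> V" using v(2) gK(2) by blast
  have "v ^ p \<in> N" "x ^ p \<in> N" using V(3)[OF v(1)] grpD(2)[OF gN(1)] by (simp_all add: N_def)
  moreover have "cm v (cm x v) \<in> N" using abD[OF V(2) v(1) cV] cm_eq_one[of v "cm x v"] grpD(2)[OF gN(1)] by simp
  moreover have "cm x (cm x v) \<in> N" using v(2) by (simp add: K_def pre_def)
  ultimately have "cm x v \<in> N" using commuting_of_central_commutator_mod[OF L gN(1) NL p xN vN] by blast
  thus ?thesis using v(1) by (simp add: K_def pre_def)
 qed
 have "K = V"
 proof (rule ccontr)
  assume "K \<noteq> V"
  define D where "D = prd K (cyc x)"
  define T where "T = prd V (cyc x)"
  have gc: "grp (cyc x)" "cyc x \<subseteq> L" using grp_cyc[OF gL x(1)] by blast+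
  have "x \<in> nz L K"
  proof (rule nzI[OF grpD(1)[OF gK(1)] x(1)])
   fix v assume v: "v \<in> K"
   hence "cm x v \<in> N" by (simp add: K_def pre_def)
   moreover have "N \<subseteq> K"
   proof
    fix y assume y: "y \<in> N"
    hence "x * y = y * x" using cyc_abelian[of y "x ^ p"] nz_D[OF xN] by (auto simp: N_def cyc_def simp flip: power_mult power_Suc power_Suc2)
    hence "cm x y = 1" by (simp add: cm_eq_one)
    thus "y \<in> K" using y gN grpD(2)[OF gN(1)] by (auto simp: K_def pre_def)
   qed
   ultimately show "cj x v \<in> K" unfolding cj_cm using grpD(3)[OF gK(1) _ v] by blast
  qed
  hence cn: "cyc x \<subseteq> nz L K" by (rule cyc_least[OF grp_nz[OF gL]])
  have gD: "grp D" unfolding D_def by (rule grp_prd[OF gK(1) gc(1)]) (use cn nz_D in blast)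
  have gT: "grp T" unfolding T_def by (rule grp_prd_nml[OF V(1) gc])
  have "x ^ (p ^ 2) = 1" using V(3)[OF x(2)] by (simp add: power2_eq_square power_mult)
  hence pT: "pgr p T"
   unfolding pgr_iff_pig[OF p] unfolding T_def
   by (intro pig_prd) (use elementary_pgr[OF gV p V(3)] pgr_cyc[OF gL x(1) _ p] pgr_iff_pig[OF p] gT T_def in auto)
  have xD: "cyc x \<subseteq> D" "K \<subseteq> D" unfolding D_def using prd_sub2[OF gK(1) gc(1)] prd_sub1[OF gK(1) gc(1)] .
  have DV: "D \<inter> V \<subseteq> K"
  proof
   fix d assume d: "d \<in> D \<inter> V"
   then obtain a b where ab: "a \<in> K" "b \<in> cyc x" "d = a * b" by (auto simp: D_def prd_iff)
   have "b \<in> V" using grp_cancel(1)[OF gV, of a b] ab gK(2) d by auto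
   moreover have "cm x b = 1" using cyc_abelian[OF cyc_self ab(2)] by (simp add: cm_eq_one)
   ultimately have "b \<in> K" using grpD(2)[OF gN(1)] by (simp add: K_def pre_def)
   thus "d \<in> K" using ab grpD(3)[OF gK(1)] by blast
  qed
  have DT: "D \<subseteq> T" using gK(2) unfolding D_def T_def prd_def by blast
  have VT: "V \<subseteq> T" unfolding T_def by (rule prd_sub1[OF gV gc(1)])
  have "D \<noteq> T" using DV VT \<open>K \<noteq> V\<close> gK(2) by blast
  hence "D \<subset> nz T D" using pgr_nz_grows[OF pT p gD] DT by blast
  then obtain g where g: "g \<in> nz T D" "g \<notin> D" by blast
  have "g \<in> T" using g(1) nz_sub[of T D] by (rule subsetD[rotated])
  then obtain v b where vb: "v \<in> V" "b \<in> cyc x" "g = v * b" unfolding T_def prd_iff by blast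
  have bD: "b \<in> nz T D" using nz_self[OF gD DT] xD vb(2) by blast
  have v1: "v \<notin> K" using vb g(2) by (auto simp: D_def prd_iff)
  have vn: "v \<in> nz T D" using g(1) grp_cancel(2)[OF grp_nz[OF gT] bD] vb(3) by blast
  have xx: "x \<in> D" using xD cyc_self by blast
  have "cm v x * x \<in> D" using nz_D[OF vn xx] by (simp add: cj_cm)
  hence "cm v x \<in> D" using grp_cancel(2)[OF gD xx] by simp
  hence "cm x v \<in> D" using grpD(4)[OF gD] cm_inverse by metis
  moreover have "cm x v \<in> V" using h(3) vb(1) by blast
  ultimately show False using DV step[OF vb(1)] v1 by blast
 qed
 hence "cm x ` V \<subseteq> N" by (auto simp: K_def pre_def)
 hence "card (cm x ` V) \<le> card N" by (rule card_mono[OF grpD(1)[OF gN(1)]])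
 also have "\<dots> \<le> p" unfolding N_def using od(3)[OF gV x(2), of p] od(4)[OF gV x(2)] V(3)[OF x(2)] prime_gt_0_nat[OF p] by (simp add: dvd_imp_le)
 finally have "card (cm x ` V) * card (cz V {x}) \<le> p * card (cz V {x})" by (rule mult_le_mono1)
 moreover have "card V = card (cm x ` V) * card (cz V {x})" by (rule h(4))
 ultimately show ?thesis by simp
qed

lemma card_Int_index:
 assumes "grp V" "grp A" "grp B" "A \<subseteq> V" "B \<subseteq> V" "card V \<le> m * card A" "card V \<le> m * card B"
 shows "card V \<le> m * m * card (A \<inter> B)"
proof -
 have "prd A B \<subseteq> V" using prd_least assms by blast
 hence c: "card (prd A B) \<le> card V" using card_mono grpD(1)[OF assms(1)] by blast
 have "card V * card V \<le> (m * card A) * (m * card B)" using assms(6,7) by (rule mult_le_mono)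
 also have "\<dots> = m * m * (card (prd A B) * card (A \<inter> B))" using card_prd[OF assms(2,3)] by simp
 also have "\<dots> \<le> m * m * (card V * card (A \<inter> B))" using c by (intro mult_le_mono2 mult_le_mono1)
 finally have "card V * card V \<le> card V * (m * m * card (A \<inter> B))" by (simp add: ac_simps)
 thus ?thesis using grpD(8)[OF assms(1)] by simp
qed

text \<open>Let U be the largest normal p-subgroup and V its quotient by the Frattini subgroup. If
  \<open>P\<close> were larger than U, a p-element outside U would fail to commute modulo U with an
  r-element. Their commutator is a product of two p-elements, each fixing nearly all of V, so it
  acts non-trivially only on a group of rank at most two; there the excluded sections leave it no
  non-trivial action.\<close>

theorem sylow_normal:
 fixes L :: "gp set"
 assumes L: "Good L" "solv L" and p: "prime p" and c: "core (- {p}) L = {1}" and P: "syl p P L"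
 shows "nml P L"
proof -
 have gL: "grp L" using Good_grp[OF L(1)] .
 define U where "U = core {p} L"
 have nU: "nml U L" "pgr p U" unfolding U_def pgr_iff_pig[OF p] using core(1,2)[OF gL] by blast+
 note gU = nmlD(1)[OF nU(1)] and UL = nmlD(3)[OF nU(1)]
 have cU: "cz L U \<subseteq> U" unfolding U_def by (rule hall_higman[OF L(2) p c])
 obtain f1 :: "gp \<Rightarrow> gp" where f1: "ghom f1 L" "ker f1 L = phi p U" using quotient_exists[OF nml_phi[OF nU(1)]] by blast
 define V where "V = f1 ` U"
 define L1 where "L1 = f1 ` L"
 have L1: "Good L1" unfolding L1_def by (rule Good_img[OF L(1) f1(1)])
 have gL1: "grp L1" using Good_grp[OF L1] .
 have nV: "nml V L1" unfolding V_def L1_def by (rule nml_img[OF f1(1) nU(1)])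
 note gV = nmlD(1)[OF nV]
 have ker1: "f1 x = 1" if "x \<in> phi p U" for x using that f1(2) unfolding ker_def by blast
 have Vp: "v ^ p = 1" if "v \<in> V" for v
 proof -
  obtain a where a: "a \<in> U" "v = f1 a" using \<open>v \<in> V\<close> by (auto simp: V_def)
  have aL: "a \<in> L" using a(1) UL by blast
  show ?thesis using ghomD(5)[OF f1(1) aL, of p] ker1[OF phi(4)[OF gU a(1)]] a(2) by simp
 qed
 have aV: "ab V" unfolding ab_def
 proof (intro ballI)
  fix v w assume "v \<in> V" "w \<in> V"
  then obtain a b where ab: "a \<in> U" "b \<in> U" "v = f1 a" "w = f1 b" by (auto simp: V_def)
  have "cm v w = f1 (cm a b)" using ghomD(7)[OF f1(1) subsetD[OF UL ab(1)] subsetD[OF UL ab(2)]] ab(3,4) by simp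
  thus "v * w = w * v" using ker1[OF phi(3)[OF gU ab(1,2)]] by (simp add: cm_eq_one)
 qed
 \<comment> \<open>An element of prime order r different from p in the preimage C would centralize U
   modulo its Frattini subgroup, hence U itself, against Hall and Higman. So C is a normal
   p-subgroup.\<close>
 have czV: "cz L1 V \<subseteq> V"
 proof -
  define C where "C = pre f1 L (cz L1 V)"
  have nC: "nml C L" unfolding C_def using nml_pre[OF f1(1)] nml_cz[OF nV] by (simp add: L1_def)
  have "pig {p} C" unfolding pig_def
  proof (intro conjI allI impI nmlD(1)[OF nC])
   fix r :: nat assume r: "prime r" "r dvd card C"
   show "r \<in> {p}"
   proof (rule ccontr)
    assume "r \<notin> {p}"
    hence rp: "r \<noteq> p" by simp
    obtain b where b: "b \<in> C" "b \<noteq> 1" "b ^ r = 1" using cauchy[OF nmlD(1)[OF nC] r] by blast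
    have bL: "b \<in> L" using b(1) nmlD(3)[OF nC] by blast
    have Br: "pgr r (cyc b)" using pgr_cyc[OF gL bL, of r 1] b(3) r(1) by simp
    have BC: "cyc b \<subseteq> C" using cyc_least[OF nmlD(1)[OF nC] b(1)] .
    have "b * u = u * b" if u: "u \<in> U" for u
    proof (rule coprime_frattini[OF nU(2) p Br r(1) rp _ _ cyc_self u])
     fix d w assume d: "d \<in> cyc b" and w: "w \<in> U"
     have dL: "d \<in> L" "f1 d \<in> cz L1 V" using d BC by (auto simp: C_def pre_def)
     show cw: "cj d w \<in> U" using nmlD(4)[OF nU(1) dL(1) w] .
     have "f1 (cj d w) = f1 w" using dL w UL unfolding V_def cz_def
      by (subst ghomD(6)[OF f1(1)]) (auto simp: cj_eq_iff)
     hence "inverse w * cj d w \<in> ker f1 L" using ghom_eq_iff[OF f1(1), of w "cj d w"] w cw UL by auto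
     thus "inverse w * cj d w \<in> phi p U" using f1(2) by simp
    qed
    hence bU: "b \<in> U" using cU bL by (auto simp: cz_def)
    obtain m where "od b = p ^ m" using pgr_od[OF nU(2) p bU] .
    moreover have "od b = r" using od_prime[OF gL bL b(2,3) r(1)] .
    ultimately show False using r(1) rp p by (metis prime_dvd_power primes_dvd_imp_eq dvd_refl)
   qed
  qed
  hence CU: "C \<subseteq> U" unfolding U_def using core(3)[OF gL nC] by blast
  show ?thesis
  proof
   fix z assume z: "z \<in> cz L1 V"
   then obtain g where "g \<in> L" "z = f1 g" using cz_sub[of L1 V] by (auto simp: L1_def)
   thus "z \<in> V" using z CU by (auto simp: C_def pre_def V_def)
  qed
 qed
 obtain f2 :: "gp \<Rightarrow> gp" where f2: "ghom f2 L1" "ker f2 L1 = V" using quotient_exists[OF nV] by blast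
 define f where "f = f2 \<circ> f1"
 have f: "ghom f L" unfolding f_def by (rule ghom_comp[OF f1(1) f2(1)]) (simp add: L1_def)
 have kf: "ker f L = U"
 proof
  show "U \<subseteq> ker f L" using f2(2) UL unfolding f_def ker_def V_def by auto
  show "ker f L \<subseteq> U"
  proof
   fix g assume "g \<in> ker f L"
   hence g: "g \<in> L" "f1 g \<in> V" using f2(2) by (auto simp: ker_def f_def L1_def)
   then obtain u where u: "u \<in> U" "f1 g = f1 u" by (auto simp: V_def)
   hence "inverse u * g \<in> U" using ghom_eq_iff[OF f1(1), of u g] g(1) UL f1(2) phi(2)[OF gU, of p] by auto
   thus "g \<in> U" using grp_cancel(1)[OF gU grpD(4)[OF gU u(1)]] by simp
  qed
 qed
 define L2 where "L2 = f ` L"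
 have sL2: "solv L2" unfolding L2_def by (rule solv_img[OF f L(2)])
 have cL2: "core {p} L2 = {1}" unfolding L2_def by (rule core_quotient[OF f]) (simp add: kf U_def)
 have gL2: "grp L2" using solv_grp[OF sL2] .
 have "P \<subseteq> U"
 proof
  fix x0 assume x0: "x0 \<in> P"
  show "x0 \<in> U"
  proof (rule ccontr)
   assume x0U: "x0 \<notin> U"
   \<comment> \<open>Some power x of x0 lies outside U while x^p lies in U.\<close>
   obtain j where j: "od x0 = p ^ j" using pgr_od[OF sylD(2)[OF P] p x0] .
   have "x0 ^ (p ^ j) \<in> U" using od(2)[OF sylD(3)[OF P] x0] j grpD(2)[OF gU] by simp
   then obtain m where m: "x0 ^ (p ^ m) \<in> U" "\<And>i. i < m \<Longrightarrow> x0 ^ (p ^ i) \<notin> U"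
    using exists_least_iff[of "\<lambda>m. x0 ^ (p ^ m) \<in> U"] by blast
   obtain i where i: "m = Suc i" using m(1) x0U by (cases m) auto
   define x where "x = x0 ^ (p ^ i)"
   have xU: "x \<notin> U" and xpU: "x ^ p \<in> U" using m i by (simp_all add: x_def mult.commute flip: power_mult)
   have xP: "x \<in> P" unfolding x_def using grpD(5)[OF sylD(3)[OF P] x0] .
   have xL: "x \<in> L" using xP sylD(4)[OF P] by blast
   obtain n where n: "od x = p ^ n" using pgr_od[OF sylD(2)[OF P] p xP] .
   have xn: "x ^ (p ^ n) = 1" using od(2)[OF gL xL] n by simp
   have fxn: "f x ^ (p ^ n) = 1" using xn ghomD(5)[OF f xL, of "p ^ n"] ghomD(3)[OF f] by simp
   have "f x \<noteq> 1" using xU xL kf by (auto simp: ker_def)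
   have fxL: "f x \<in> L2" using xL by (simp add: L2_def)
   \<comment> \<open>Otherwise the image of x, a p-element, would lie in \<open>core {p} L2\<close>,
     which is trivial.\<close>
   have "\<not> (\<forall>r. prime r \<longrightarrow> (\<forall>y\<in>core {r} L2. f x * y = y * f x))"
   proof
    assume "\<forall>r. prime r \<longrightarrow> (\<forall>y\<in>core {r} L2. f x * y = y * f x)"
    hence "f x \<in> core {p} L2" using fitting(3)[OF sL2 p _ fxn] fxL by blast
    thus False using cL2 \<open>f x \<noteq> 1\<close> by simp
   qed
   then obtain r y2 where r: "prime r" and y2: "y2 \<in> core {r} L2" "f x * y2 \<noteq> y2 * f x" by blast
   have rp: "r \<noteq> p"
   proof
    assume "r = p" hence "y2 = 1" using y2(1) cL2 by simp
    thus False using y2(2) by simp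
   qed
   have "y2 \<in> L2" using y2(1) core_sub[OF gL2] by blast
   then obtain y where y: "y \<in> L" "y2 = f y" by (auto simp: L2_def)
   define x1 where "x1 = f1 x" define y1 where "y1 = f1 y"
   have xy1: "x1 \<in> L1" "y1 \<in> L1" using xL y(1) by (auto simp: x1_def y1_def L1_def)
   define k where "k = cm x1 y1"
   have kL: "k \<in> L1" unfolding k_def using grpD(7)[OF gL1 xy1] .
   have f2k: "f2 k = cm (f x) y2" unfolding k_def using ghomD(7)[OF f2(1) xy1] y(2) by (simp add: x1_def y1_def f_def)
   have "f2 k \<noteq> 1" using f2k y2(2) by (simp add: cm_eq_one)
   have pr: "pgr r (core {r} L2)" using core(2)[OF gL2] pgr_iff_pig[OF r] by blast
   have f2kr: "f2 k \<in> core {r} L2"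
    unfolding f2k using grpD(3,4)[OF pgr_grp[OF pr]] nmlD(4)[OF core(1)[OF gL2] fxL] y2(1) by (simp add: cm_def cj_def)
   obtain j where j: "od (f2 k) = r ^ j" using pgr_od[OF pr r f2kr] .
   have f2kj: "f2 k ^ (r ^ j) = 1" using od(2)[OF pgr_grp[OF pr] f2kr] j by simp
   \<comment> \<open>Some r-power of k lies in V, which has exponent p; taking the p-th power
     produces an element of r-power order.\<close>
   define k3 where "k3 = k ^ p"
   have k3L: "k3 \<in> L1" unfolding k3_def using grpD(5)[OF gL1 kL] .
   have "f2 (k ^ (r ^ j)) = 1" using ghomD(5)[OF f2(1) kL] f2kj by simp
   hence "k ^ (r ^ j) \<in> V" using grpD(5)[OF gL1 kL] f2(2) by (auto simp: ker_def)
   hence k3j: "k3 ^ (r ^ j) = 1" using Vp unfolding k3_def by (metis power_mult mult.commute)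
   have cop: "coprime (r ^ j) p" using primes_coprime[OF r p rp] by simp
   have "f2 k3 \<noteq> 1"
   proof
    assume "f2 k3 = 1"
    hence "f2 k ^ p = 1" using ghomD(5)[OF f2(1) kL] by (simp add: k3_def)
    thus False using pow_coprime_one[OF pgr_grp[OF pr] f2kr f2kj _ cop] \<open>f2 k \<noteq> 1\<close> by blast
   qed
   hence k3V: "k3 \<notin> V" using f2(2) unfolding ker_def by blast
   note inv = nmlD(4)[OF nV k3L]
   note h = commutator_hom[OF gV aV inv]
   define W where "W = cm k3 ` V"
   have gW: "grp W" "W \<subseteq> V" unfolding W_def using grp_img[OF h(1)] h(3) by blast+
   have cW: "card W < p ^ 3"
   proof -
    \<comment> \<open>k is the product of x1 and a conjugate of its inverse. Each centralizes a
      subgroup of index at most p in V, so \<open>k3\<close> centralizes one of index at most p^2,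
      and its commutators with V form a group of order less than p^3.\<close>
    define z where "z = cj y1 (inverse x1)"
    have kz: "k = x1 * z" by (simp add: k_def z_def cm_def cj_def mult.assoc)
    have zL: "z \<in> L1" unfolding z_def using grpD(4,6)[OF gL1] xy1 by blast
    have x1n: "x1 ^ p \<in> V" using imageI[OF xpU, of f1] ghomD(5)[OF f1(1) xL, of p] by (simp add: x1_def V_def)
    have "z ^ p = cj y1 (inverse (x1 ^ p))" by (simp add: z_def pow_inv flip: cj_pow)
    hence zn: "z ^ p \<in> V" using nmlD(4)[OF nV xy1(2) grpD(4)[OF gV x1n]] by simp
    have "card V \<le> p * p * card (cz V {x1} \<inter> cz V {z})"
     by (rule card_Int_index[OF gV grp_cz[OF gV] grp_cz[OF gV] cz_sub cz_sub
      card_fixed_points_p_element[OF L1 nV aV Vp p xy1(1) x1n] card_fixed_points_p_element[OF L1 nV aV Vp p zL zn]])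
    also have "\<dots> \<le> p * p * card (cz V {k3})"
    proof (intro mult_le_mono2 card_mono grpD(1)[OF grp_cz[OF gV]])
     show "cz V {x1} \<inter> cz V {z} \<subseteq> cz V {k3}"
     proof
      fix v assume v: "v \<in> cz V {x1} \<inter> cz V {z}"
      hence "cj v x1 = x1" "cj v z = z" by (auto simp: cz_def cj_eq_iff)
      hence "cj v k3 = k3" by (simp add: k3_def kz cj_mult cj_pow)
      thus "v \<in> cz V {k3}" using v by (simp add: cz_def cj_eq_iff)
     qed
    qed
    finally have "card W * card (cz V {k3}) \<le> p * p * card (cz V {k3})" using h(4) by (simp add: W_def)
    hence "card W \<le> p * p" using grpD(8)[OF grp_cz[OF gV, of "{k3}"]] by simp
    moreover have "p * p < p ^ 3" using power_strict_increasing[of 2 3 p] prime_gt_1_nat[OF p] by (simp add: power2_eq_square)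
    ultimately show ?thesis by linarith
   qed
   have "k3 \<in> nz L1 W"
   proof (rule nzI[OF grpD(1)[OF gW(1)] k3L])
    fix w assume "w \<in> W"
    then obtain v where "v \<in> V" "w = cm k3 v" by (auto simp: W_def)
    moreover hence "cj k3 w = cm k3 (cj k3 v)" using cj_cm_distrib[of k3 k3 v] cj_eq_iff[of k3 k3] by simp
    ultimately show "cj k3 w \<in> W" using inv by (auto simp: W_def)
   qed
   moreover have "coprime (od k3) p"
    using k3j od(3)[OF gL1 k3L] cop coprime_divisors[of "od k3" "r ^ j" p p] by auto
   ultimately have "k3 \<in> cz L1 W"
    using small_elementary_centralized[OF L1 gW(1) _ ab_sub[OF aV gW(2)] p _ cW] gW(2) nmlD(3)[OF nV] Vp by blast
   hence cW1: "cj k3 w = w" if "w \<in> W" for w using that by (simp add: cz_def cj_eq_iff)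
   \<comment> \<open>As \<open>k3\<close> centralizes its own commutators with V, their orders
     divide a power of r as well as p.\<close>
   have "k3 * v = v * k3" if v: "v \<in> V" for v
   proof -
    have w: "cm k3 v \<in> W" using v by (simp add: W_def)
    have "cj (k3 ^ (r ^ j)) v = cm k3 v ^ (r ^ j) * v" by (rule cj_power_shift[OF cj_cm cW1[OF w]])
    hence "cm k3 v ^ (r ^ j) = 1" using k3j by (metis cj_one(1) mult.left_neutral right_cancel)
    moreover have "cm k3 v ^ p = 1" using Vp w gW(2) by blast
    ultimately have "cm k3 v = 1" using pow_coprime_one[OF gW(1) w _ _ cop] by blast
    thus ?thesis by (simp add: cm_eq_one)
   qed
   hence "k3 \<in> cz L1 V" using k3L by (simp add: cz_def)
   thus False using czV k3V by blast
  qed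
 qed
 hence "U = P" using syl_max[OF P p nU(2) _ UL] by blast
 thus ?thesis using nU(1) by simp
qed

lemma prd_eq_pre:
 assumes f: "ghom f L" and H: "grp H" "H \<subseteq> L"
 shows "pre f L (f ` H) = prd (ker f L) H"
proof
 show "prd (ker f L) H \<subseteq> pre f L (f ` H)"
 proof
  fix z assume "z \<in> prd (ker f L) H"
  then obtain k h where kh: "k \<in> ker f L" "h \<in> H" "z = k * h" by (auto simp: prd_iff)
  have kL: "k \<in> L" "f k = 1" "h \<in> L" using kh H(2) by (auto simp: ker_def)
  hence "f z = f h" using ghomD(2)[OF f, of k h] kh(3) by simp
  thus "z \<in> pre f L (f ` H)" using kh grpD(3)[OF ghomD(1)[OF f] kL(1,3)] by (auto simp: pre_def)
 qed
 show "pre f L (f ` H) \<subseteq> prd (ker f L) H"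
 proof
  fix z assume "z \<in> pre f L (f ` H)"
  then obtain h where h: "z \<in> L" "h \<in> H" "f z = f h" by (auto simp: pre_def)
  have hL: "h \<in> L" using h(2) H(2) by blast
  have "f (z * inverse h) = 1" using h ghomD(2)[OF f h(1) grpD(4)[OF ghomD(1)[OF f] hL]] ghomD(4)[OF f hL] by simp
  hence "z * inverse h \<in> ker f L" using h(1) hL grpD(3,4)[OF ghomD(1)[OF f]] by (simp add: ker_def)
  from prdI[OF this h(2)] show "z \<in> prd (ker f L) H" by (simp add: mult.assoc)
 qed
qed

text \<open>Modulo O_p'(L) the image of \<open>P\<close> is normal by \<open>sylow_normal\<close>,
  and the factorization of \<open>L\<close> follows by the Frattini argument. For the last claim the
  images of \<open>Y\<close> and \<open>P\<close> normalize each other and have coprime orders, so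
  they commute; by Hall and Higman the image of \<open>Y\<close> lies in a p-group and is
  trivial.\<close>

lemma p_length_one:
 fixes L :: "gp set"
 assumes L: "Good L" "solv L" and p: "prime p" and P: "syl p P L"
 shows "nml (prd (core (- {p}) L) P) L" "L = prd (core (- {p}) L) (nz L P)"
  "grp Y \<Longrightarrow> Y \<subseteq> L \<Longrightarrow> \<not> p dvd card Y \<Longrightarrow> (\<And>x y. x \<in> P \<Longrightarrow> y \<in> Y \<Longrightarrow> cj x y \<in> Y) \<Longrightarrow> Y \<subseteq> core (- {p}) L"
proof -
 define K where "K = core (- {p}) L"
 have gL: "grp L" using Good_grp[OF L(1)] .
 note gP = sylD(3)[OF P] and PL = sylD(4)[OF P]
 have nK: "nml K L" unfolding K_def by (rule core(1)[OF gL])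
 note gK = nmlD(1)[OF nK]
 obtain f :: "gp \<Rightarrow> gp" where f: "ghom f L" "ker f L = K" using quotient_exists[OF nK] by blast
 define M where "M = f ` L"
 have M: "Good M" "solv M" unfolding M_def using Good_img[OF L(1) f(1)] solv_img[OF f(1) L(2)] by blast+
 have cM: "core (- {p}) M = {1}" unfolding M_def by (rule core_quotient[OF f(1)]) (simp add: f(2) K_def)
 have sM: "syl p (f ` P) M" unfolding M_def by (rule syl_img[OF f(1) P p])
 have nM: "nml (f ` P) M" by (rule sylow_normal[OF M p cM sM])
 have pre: "pre f L (f ` P) = prd K P" using prd_eq_pre[OF f(1) gP PL] f(2) by simp
 show n: "nml (prd (core (- {p}) L) P) L" using nml_pre[OF f(1), of "f ` P"] nM pre by (simp add: M_def K_def)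
 show "L = prd (core (- {p}) L) (nz L P)"
 proof
  have gN: "grp (nz L P)" "nz L P \<subseteq> L" using grp_nz[OF gL] nz_sub by blast+
  show "prd (core (- {p}) L) (nz L P) \<subseteq> L" using prd_sub_nml[OF nK gN(2)] by (simp add: K_def)
  have nKP: "nml (prd K P) L" using n by (simp add: K_def)
  have s: "syl p P (prd K P)" using syl_sub[OF P nmlD(1)[OF nKP] prd_sub2[OF gK gP] nmlD(3)[OF nKP]] .
  have gKN: "grp (prd K (nz L P))" by (rule grp_prd_nml[OF nK gN])
  have "P \<subseteq> prd K (nz L P)" using nz_self[OF gP PL] prd_sub2[OF gK gN(1)] by blast
  hence "prd K P \<subseteq> prd K (nz L P)" using prd_least[OF prd_sub1[OF gK gN(1)] _ gKN] by blast
  hence "prd (prd K P) (nz L P) \<subseteq> prd K (nz L P)" using prd_least[OF _ prd_sub2[OF gK gN(1)] gKN] by blast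
  thus "L \<subseteq> prd (core (- {p}) L) (nz L P)" using frattini[OF nKP s p] by (simp add: K_def)
 qed
 assume Y: "grp Y" "Y \<subseteq> L" "\<not> p dvd card Y" and inv: "\<And>x y. x \<in> P \<Longrightarrow> y \<in> Y \<Longrightarrow> cj x y \<in> Y"
 have "pig (- {p}) Y" using Y(1,3) by (simp add: pig_compl)
 hence fY: "pig (- {p}) (f ` Y)" using pig_img[OF f(1) _ Y(2)] by blast
 have fYP: "f ` P \<inter> f ` Y = {1}" using pgr_pig_Int[OF sylD(2)[OF sM] p fY] .
 have "f ` Y \<subseteq> cz M (core {p} M)"
 proof
  fix z assume "z \<in> f ` Y"
  then obtain y where y: "y \<in> Y" "z = f y" by blast
  have zM: "z \<in> M" "z \<in> f ` Y" using y Y(2) by (auto simp: M_def)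
  have "core {p} M \<subseteq> f ` P"
  proof -
   have gM: "grp M" using solv_grp[OF M(2)] .
   have "pgr p (core {p} M)" using core(2)[OF gM] pgr_iff_pig[OF p] by blast
   moreover have "f ` P \<subseteq> core {p} M" using core(3)[OF gM nM] sylD(2)[OF sM] pgr_iff_pig[OF p] by blast
   ultimately have "core {p} M = f ` P" using syl_max[OF sM p _ _ core_sub[OF gM]] by blast
   thus ?thesis by simp
  qed
  moreover have "z * a = a * z" if a: "a \<in> f ` P" for a
  proof -
   obtain x where x: "x \<in> P" "a = f x" using a by blast
   have "cj a z = f (cj x y)" using ghomD(6)[OF f(1) subsetD[OF PL x(1)] subsetD[OF Y(2) y(1)]] x y by simp
   hence c1: "cj a z \<in> f ` Y" using inv[OF x(1) y(1)] by simp
   have c2: "cj z (inverse a) \<in> f ` P" using nmlD(4)[OF nM zM(1) grpD(4)[OF nmlD(1)[OF nM] a]] .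
   have e: "cm a z = cj a z * inverse z" "cm a z = a * cj z (inverse a)" by (simp_all add: cm_def cj_def mult.assoc)
   have "cm a z \<in> f ` Y" unfolding e(1) using grpD(3)[OF pig_grp[OF fY] c1 grpD(4)[OF pig_grp[OF fY] zM(2)]] .
   moreover have "cm a z \<in> f ` P" unfolding e(2) using grpD(3)[OF nmlD(1)[OF nM] a c2] .
   ultimately have "cm a z = 1" using fYP by blast
   thus ?thesis by (simp add: cm_eq_one)
  qed
  ultimately show "z \<in> cz M (core {p} M)" using zM(1) by (auto simp: cz_def)
 qed
 also have "\<dots> \<subseteq> core {p} M" by (rule hall_higman[OF M(2) p cM])
 finally have "f ` Y \<subseteq> core {p} M" .
 moreover have "core {p} M \<inter> f ` Y = {1}"
  by (rule pgr_pig_Int[OF _ p fY]) (use core(2)[OF solv_grp[OF M(2)]] pgr_iff_pig[OF p] in blast)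
 ultimately have "f ` Y = {1}" using grpD(9)[OF pig_grp[OF fY]] by blast
 hence "Y \<subseteq> ker f L" using Y(2) by (auto simp: ker_def)
 thus "Y \<subseteq> core (- {p}) L" using f(2) by (simp add: K_def)
qed

section \<open>The minimal counterexample\<close>

locale minimal_counterexample =
 fixes G :: "gp set"
 assumes Good_G: "Good G" and G_nontriv: "G \<noteq> {1}" and perfect: "der G = G"
  and simple: "\<And>N. nml N G \<Longrightarrow> N = {1} \<or> N = G"
  and proper_solv: "\<And>H. grp H \<Longrightarrow> H \<subset> G \<Longrightarrow> solv H"
begin

lemma grp_G: "grp G" using Good_grp[OF Good_G] .

lemma not_solv: "\<not> solv G"
 using grp_G perfect G_nontriv unfolding solv_def by blast

lemma not_ab: "\<not> ab G"
 using ab_solv[OF grp_G] not_solv by blast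

lemma proper_nz: assumes "grp A" "A \<subseteq> G" "A \<noteq> {1}" "A \<noteq> G" shows "grp (nz G A)" "nz G A \<subset> G" "Good (nz G A)" "solv (nz G A)"
proof -
 show g: "grp (nz G A)" by (rule grp_nz[OF grp_G])
 have "nz G A \<noteq> G" using simple[of A] nml_iff_nz[OF assms(1) grp_G assms(2)] assms by blast
 thus s: "nz G A \<subset> G" using nz_sub[of G A] by blast
 show "Good (nz G A)" by (rule Good_sub[OF Good_G g nz_sub])
 show "solv (nz G A)" by (rule proper_solv[OF g s])
qed

lemma pgr_proper: "pgr p A \<Longrightarrow> prime p \<Longrightarrow> A \<noteq> G"
 using pgr_solv[of p A] not_solv by blast

text \<open>An involution inverting an element whose order does not divide 2 produces either a
  dihedral group of order 2 r with r an odd prime or a dihedral group of order 8, and both are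
  excluded.\<close>

lemma inverted_square:
 assumes "t \<in> G" "t * t = 1" "d \<in> G" "cj t d = inverse d" shows "d ^ 2 = 1"
proof (rule ccontr)
 assume d2: "d ^ 2 \<noteq> 1"
 have cyc: "cj t (d ^ n) = inverse (d ^ n)" for n using assms(4) by (simp add: cj_pow pow_inv)
 \<comment> \<open>A power a of odd prime order r generates a subgroup normalized by t, so t
   centralizes a as well as inverting it, and a^2 = 1.\<close>
 have odd: "\<not> (prime r \<and> r dvd od d \<and> r \<noteq> 2)" for r
 proof
  assume r: "prime r \<and> r dvd od d \<and> r \<noteq> 2"
  define a where "a = d ^ (od d div r)"
  have aG: "a \<in> G" unfolding a_def using grpD(5)[OF grp_G assms(3)] .
  have ar: "a ^ r = 1" using od(2)[OF grp_G assms(3)] r by (simp add: a_def flip: power_mult)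
  have a1: "a \<noteq> 1"
  proof
   assume "a = 1"
   hence "od d dvd od d div r" using od(3)[OF grp_G assms(3)] by (simp add: a_def)
   moreover have "0 < od d div r" "od d div r < od d"
    using od(1)[OF grp_G assms(3)] r prime_gt_1_nat[of r] by (auto simp: dvd_div_eq_0_iff intro: div_less_dividend)
   ultimately show False using dvd_imp_le[of "od d" "od d div r"] by linarith
  qed
  have ca: "card (cyc a) = r" using card_cyc_prime[OF grp_G aG a1 ar] r by blast
  have cja: "cj t a = inverse a" unfolding a_def by (rule cyc)
  have "t \<in> nz G (cyc a)"
  proof (rule nzI[OF grpD(1)[OF grp_cyc(1)[OF grp_G aG]] assms(1)])
   fix b assume "b \<in> cyc a"
   then obtain i where "b = a ^ i" by (auto simp: cyc_def)
   hence "cj t b = inverse (a ^ i)" using cja by (simp add: cj_pow pow_inv)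
   thus "cj t b \<in> cyc a" using grpD(4)[OF grp_cyc(1)[OF grp_G aG], of "a ^ i"] by simp
  qed
  hence "t \<in> cz G (cyc a)"
   using normalizer_prime_order[OF Good_G grp_cyc(1,2)[OF grp_G aG] ca] r by simp
  hence "cj t a = a" by (simp add: cz_def cj_eq_iff)
  hence "a * a = 1" using cja by (simp add: mult_eq_one_iff)
  hence "a ^ 2 = 1" by (simp add: power2_eq_square)
  moreover have "coprime r 2" using r primes_coprime[of r 2] by simp
  ultimately show False using pow_coprime_one[OF grp_G aG ar] a1 by blast
 qed
 have gC: "grp (cyc d)" "cyc d \<subseteq> G" using grp_cyc[OF grp_G assms(3)] by blast+
 have "pig {2} (cyc d)" unfolding pig_def using gC(1) odd od(4)[OF grp_G assms(3)] by auto
 hence "pgr 2 (cyc d)" unfolding pgr_iff_pig[OF two_is_prime_nat] .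
 then obtain k where k: "od d = 2 ^ k" using pgr_od[of 2 "cyc d" d] by auto
 have "\<not> od d dvd 2" using d2 od(3)[OF grp_G assms(3), of 2] by simp
 hence "k \<noteq> 0" "k \<noteq> 1" unfolding k by (metis one_dvd power_0, metis dvd_refl power_one_right)
 then obtain j where "k = Suc (Suc j)" by (metis One_nat_def not0_implies_Suc)
 hence od4: "od d = 2 ^ j * 4" using k by simp
 \<comment> \<open>Of order 4 and inverted by t: the involutions t and t e generate a dihedral group
   of order 8, and their commutator e^2 is central in it.\<close>
 define e where "e = d ^ (2 ^ j)"
 have eG: "e \<in> G" unfolding e_def using grpD(5)[OF grp_G assms(3)] .
 have e4: "e ^ 4 = 1" using od(2)[OF grp_G assms(3)] od4 by (simp add: e_def flip: power_mult)
 have e2: "e ^ 2 \<noteq> 1"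
 proof
  assume "e ^ 2 = 1"
  hence "od d dvd 2 ^ j * 2" using od(3)[OF grp_G assms(3)] by (simp add: e_def flip: power_mult)
  thus False using od4 by simp
 qed
 have te: "t * e = inverse e * t" using cyc[of "2 ^ j"] by (simp add: e_def cj_def mult_inv_eq_iff)
 have ti: "inverse t = t" using assms(2) inv_unique by blast
 define y where "y = t * e"
 have yG: "y \<in> G" unfolding y_def using grpD(3)[OF grp_G assms(1) eG] .
 have y2: "y * y = 1" unfolding y_def by (subst te) (simp add: gsimps assms(2))
 have yi: "inverse y = y" using y2 inv_unique by blast
 have "t * y = e" unfolding y_def using assms(2) by (metis mult.assoc mult_1_left)
 hence cm: "cm t y = e * e" unfolding cm_def ti yi by (metis mult.assoc)
 have ee: "inverse (e * e) = e * e"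
  using e4 inv_unique[of "e * e" "e * e"] by (simp add: power4_eq_xxxx mult.assoc)
 have c1: "t * cm t y = cm t y * t"
 proof -
  have "cj t (e * e) = e * e" using cyc[of "2 ^ j"] ee by (simp add: cj_mult e_def[symmetric] gsimps)
  thus ?thesis unfolding cm cj_eq_iff .
 qed
 have c2: "y * cm t y = cm t y * y"
  unfolding cm unfolding y_def using c1[unfolded cm] by (metis mult.assoc)
 have "t * y = y * t"
  by (rule commuting_of_central_commutator[OF Good_G assms(1) yG two_is_prime_nat _ _ c1 c2])
   (simp_all add: power2_eq_square assms(2) y2)
 hence "cm t y = 1" by (simp add: cm_eq_one)
 thus False using cm e2 by (simp add: power2_eq_square)
qed

text \<open>The product of two conjugates of an involution is inverted by either of them, so its
  square is trivial and the two commute. All conjugates together then generate an abelian normal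
  subgroup, against simplicity.\<close>

lemma odd_order: "odd (card G)"
proof
 assume "even (card G)"
 then obtain t where t: "t \<in> G" "t \<noteq> 1" "t ^ 2 = 1" using cauchy[OF grp_G two_is_prime_nat] by blast
 have tt: "t * t = 1" using t(3) by (simp add: power2_eq_square)
 define T where "T = (\<lambda>g. cj g t) ` G"
 have TG: "T \<subseteq> G" using t(1) grpD(6)[OF grp_G] by (auto simp: T_def)
 have inv: "s * s = 1" if "s \<in> T" for s
  using that tt by (auto simp: T_def simp flip: cj_mult)
 have ii: "inverse s = s" if "s \<in> T" for s using inv[OF that] inv_unique by blast
 have comm: "a * b = b * a" if "a \<in> T" "b \<in> T" for a b
 proof -
  have "cj a (a * b) = inverse (a * b)" using inv[OF that(1)] ii[OF that(1)] ii[OF that(2)]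
   by (simp add: cj_def inv_mult) (metis mult.assoc mult_1_left)
  hence "(a * b) ^ 2 = 1"
   using inverted_square[OF _ inv[OF that(1)] grpD(3)[OF grp_G]] that TG by blast
  hence "(a * b) * (a * b) = 1" by (simp add: power2_eq_square)
  hence "inverse (a * b) = a * b" using inv_unique by blast
  thus ?thesis using ii[OF that(1)] ii[OF that(2)] by (simp add: inv_mult)
 qed
 have "nml (gen T) G"
 proof (rule gen_nml[OF TG grp_G])
  fix a g assume "a \<in> T" "g \<in> G"
  hence "cj g a \<in> T" using grpD(3)[OF grp_G] by (auto simp: T_def cj_cj)
  thus "cj g a \<in> gen T" using gen_inc[of T] by (rule subsetD[rotated])
 qed
 moreover have "t \<in> gen T" using gen_inc[of T] grpD(2)[OF grp_G] by (force simp: T_def)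
 ultimately have "gen T = G" using simple t(2) by blast
 hence "ab G" unfolding ab_def using gen_abelian[OF TG grp_G comm] by simp
 thus False using not_ab by blast
qed

lemma odd_prime: "prime p \<Longrightarrow> p dvd card G \<Longrightarrow> odd p"
 using odd_order dvd_trans by blast

text \<open>Upward induction on D = P1 \<inter> P2. In N = N_G(D), Sylow subgroups containing the
  normalizers of D in P1 and in P2 are conjugate by an element k of O_p'(N), by p-length one, and k
  centralizes D because D and O_p'(N) are normal with trivial intersection. This joins P1 to P2
  through Sylow subgroups P3 and P4 with larger intersections.\<close>

lemma sylow_conj_centralizer:
 assumes p: "prime p" and A: "A \<noteq> {1}" "A \<noteq> {}"
  and P: "syl p P1 G" "syl p P2 G" "A \<subseteq> P1" "A \<subseteq> P2"
 shows "\<exists>c\<in>cz G A. P2 = cj c ` P1"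
 using P
proof (induction "card G - card (P1 \<inter> P2)" arbitrary: P1 P2 rule: less_induct)
 case less
 note P = less.prems
 show ?case
 proof (cases "P1 = P2")
  case True
  thus ?thesis using grpD(2)[OF grp_cz[OF grp_G]] by (intro bexI[of _ 1]) auto
 next
  case False
  define D where "D = P1 \<inter> P2"
  note g1 = sylD(3)[OF P(1)] and g2 = sylD(3)[OF P(2)]
  have gD: "grp D" unfolding D_def by (rule grp_Int[OF g1 g2])
  have DP: "D \<subseteq> P1" "D \<subseteq> P2" "A \<subseteq> D" "D \<subseteq> G" using P(3,4) sylD(4)[OF P(1)] by (auto simp: D_def)
  have pD: "pgr p D" by (rule pgr_sub[OF sylD(2)[OF P(1)] p gD DP(1)])
  have D1: "D \<noteq> {1}" using DP(3) A by blast
  have "card P1 = card P2" using syl_card[OF P(1) p] syl_card[OF P(2) p] by simp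
  hence ne: "\<not> P1 \<subseteq> P2" "\<not> P2 \<subseteq> P1"
   using False card_subset_eq[OF grpD(1)[OF g2], of P1] card_subset_eq[OF grpD(1)[OF g1], of P2] by auto
  have gr1: "D \<subset> nz P1 D" by (rule pgr_nz_grows[OF sylD(2)[OF P(1)] p gD]) (use DP(1) ne in "auto simp: D_def")
  have gr2: "D \<subset> nz P2 D" by (rule pgr_nz_grows[OF sylD(2)[OF P(2)] p gD]) (use DP(2) ne in "auto simp: D_def")
  define N where "N = nz G D"
  note N = proper_nz[OF gD DP(4) D1 pgr_proper[OF pD p], folded N_def]
  have n12: "nz P1 D \<subseteq> N" "nz P2 D \<subseteq> N" unfolding N_def nz_def using sylD(4)[OF P(1)] sylD(4)[OF P(2)] by blast+
  have pn: "pgr p (nz P1 D)" "pgr p (nz P2 D)"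
   using pgr_sub[OF sylD(2)[OF P(1)] p grp_nz[OF g1] nz_sub] pgr_sub[OF sylD(2)[OF P(2)] p grp_nz[OF g2] nz_sub] .
  obtain S1 where S1: "syl p S1 N" "nz P1 D \<subseteq> S1" using syl_extends[OF N(1) p pn(1) n12(1)] by blast
  obtain S2 where S2: "syl p S2 N" "nz P2 D \<subseteq> S2" using syl_extends[OF N(1) p pn(2) n12(2)] by blast
  define K where "K = core (- {p}) N"
  obtain x where x: "x \<in> N" "S2 = cj x ` S1" using syl_conj[OF S1(1) S2(1) p] by blast
  obtain k n where kn: "k \<in> K" "n \<in> nz N S1" "x = k * n"
   using x(1) p_length_one(2)[OF N(3,4) p S1(1)] unfolding K_def prd_iff[of x, symmetric] by (metis prd_iff)
  have S2k: "S2 = cj k ` S1" using x(2) kn(2,3) by (simp add: nz_def flip: cj_img_comp)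
  have nK: "nml K N" "pig (- {p}) K" unfolding K_def using core(1,2)[OF N(1)] by blast+
  have nD: "nml D N" unfolding N_def by (rule nml_nz[OF gD grp_G DP(4)])
  have kD: "k \<in> cz G D"
  proof -
   have "D \<inter> K = {1}" by (rule pgr_pig_Int[OF pD p nK(2)])
   hence "k * d = d * k" if "d \<in> D" for d using nml_commute[OF nD nK(1) _ that kn(1)] by simp
   moreover have "k \<in> G" using kn(1) nmlD(3)[OF nK(1)] N(2) by blast
   ultimately show ?thesis by (simp add: cz_def)
  qed
  have kG: "k \<in> G" and kA: "k \<in> cz G A" using kD DP(3) by (auto simp: cz_def)
  have S1G: "S1 \<subseteq> G" using sylD(4)[OF S1(1)] N(2) by blast
  obtain P3 where P3: "syl p P3 G" "S1 \<subseteq> P3" using syl_extends[OF grp_G p sylD(2)[OF S1(1)] S1G] by blast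
  have dec: "card G - card (Q \<inter> R) < card G - card (P1 \<inter> P2)" if "D \<subset> Q \<inter> R" "syl p Q G" for Q R
  proof -
   have f: "finite (Q \<inter> R)" using grpD(1)[OF sylD(3)[OF that(2)]] by blast
   have "card D < card (Q \<inter> R)" using psubset_card_mono[OF f that(1)] .
   moreover have "card (Q \<inter> R) \<le> card G" using card_mono[OF grpD(1)[OF grp_G], of "Q \<inter> R"] sylD(4)[OF that(2)] by blast
   ultimately show ?thesis by (simp add: D_def)
  qed
  have "D \<subset> P1 \<inter> P3" using gr1 S1(2) P3(2) nz_sub[of P1 D] by blast
  then obtain c1 where c1: "c1 \<in> cz G A" "P3 = cj c1 ` P1"
   using less.hyps[OF dec[OF _ P(1)] P(1) P3(1) P(3)] DP(3) by blast
  define P4 where "P4 = cj k ` P3"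
  have P4: "syl p P4 G" unfolding P4_def by (rule syl_cj_in[OF P3(1) kG])
  have "S2 \<subseteq> P4" unfolding S2k P4_def using P3(2) by (rule image_mono)
  hence DP4: "D \<subset> P4 \<inter> P2" using gr2 S2(2) nz_sub[of P2 D] by blast
  then obtain c2 where c2: "c2 \<in> cz G A" "P2 = cj c2 ` P4"
   using less.hyps[OF dec[OF _ P4] P4 P(2) _ P(4)] DP(3) by blast
  have "P2 = cj (c2 * (k * c1)) ` P1" unfolding c2(2) P4_def c1(2) by (simp only: cj_img_comp)
  moreover have "c2 * (k * c1) \<in> cz G A" using grpD(3)[OF grp_cz[OF grp_G]] c1(1) c2(1) kA by simp
  ultimately show ?thesis by blast
 qed
qed

end

section \<open>Sylow subgroups without invariant homomorphisms are abelian\<close>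

lemma class_two:
 fixes P :: "'a::group_mult set"
 assumes P: "grp P" and c2: "\<And>x y. x \<in> P \<Longrightarrow> y \<in> P \<Longrightarrow> cm x y \<in> cz P P"
  and x: "x \<in> P" and y: "y \<in> P" and z: "z \<in> P"
 shows "cm (x * y) z = cm x z * cm y z" "cm x (y * z) = cm x y * cm x z"
  "cm x y * z = z * cm x y" "(x * y) ^ n = x ^ n * y ^ n * cm y x ^ (n choose 2)" "cm (x ^ n) y = cm x y ^ n"
proof -
 have c: "cm a b * d = d * cm a b" if "a \<in> P" "b \<in> P" "d \<in> P" for a b d
  using c2[OF that(1,2)] that(3) by (simp add: cz_def)
 have l: "cm (a * b) d = cm a d * cm b d" if "a \<in> P" "b \<in> P" "d \<in> P" for a b d
 proof -
  have "cm (a * b) d = cj a (cm b d) * cm a d" by (simp add: cm_def cj_def gsimps)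
  also have "cj a (cm b d) = cm b d" using c[OF that(2,3,1)] by (simp add: cj_eq_iff)
  also have "cm b d * cm a d = cm a d * cm b d" using c[OF that(2,3) grpD(7)[OF P that(1,3)]] .
  finally show ?thesis .
 qed
 from this[OF x y z] show "cm (x * y) z = cm x z * cm y z" .
 show "cm x (y * z) = cm x y * cm x z"
 proof -
  have "inverse (cm x (y * z)) = cm y x * cm z x" unfolding cm_inverse by (rule l[OF y z x])
  also have "\<dots> = cm z x * cm y x" using c[OF y x grpD(7)[OF P z x]] .
  finally have "inverse (inverse (cm x (y * z))) = inverse (cm z x * cm y x)" by (rule arg_cong)
  thus ?thesis by (simp add: inv_mult cm_inverse)
 qed
 show "cm x y * z = z * cm x y" by (rule c[OF x y z])
 have pw: "cm (a ^ n) b = cm a b ^ n" if "a \<in> P" "b \<in> P" for a b n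
 proof (induction n)
  case (Suc n)
  thus ?case using l[OF that(1) grpD(5)[OF P that(1)] that(2)] by simp
 qed (simp add: cm_def)
 from pw[OF x y] show "cm (x ^ n) y = cm x y ^ n" .
 show "(x * y) ^ n = x ^ n * y ^ n * cm y x ^ (n choose 2)"
 proof (induction n)
  case (Suc n)
  have e: "y ^ n * x = cm y x ^ n * (x * y ^ n)" 
  proof -
   have "y ^ n * x = cm (y ^ n) x * (x * y ^ n)" by (simp add: cm_def gsimps)
   thus ?thesis unfolding pw[OF y x] .
  qed
  have cc: "cm y x ^ k * a = a * cm y x ^ k" if "a \<in> P" for k a
   using power_commuting_commutes[OF c[OF y x that], of k] .
  note xn = grpD(5)[OF P x, of n]
  have "(x * y) ^ Suc n = x ^ n * y ^ n * cm y x ^ (n choose 2) * (x * y)" unfolding power_Suc2 Suc.IH ..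
  also have "\<dots> = x ^ n * (y ^ n * x) * y * cm y x ^ (n choose 2)"
   using cc[OF grpD(3)[OF P x y]] by (simp add: mult.assoc)
  also have "\<dots> = x ^ n * (cm y x ^ n * (x * y ^ n)) * y * cm y x ^ (n choose 2)" unfolding e ..
  also have "\<dots> = (cm y x ^ n * x ^ n) * (x * (y ^ n * y)) * cm y x ^ (n choose 2)"
   unfolding cc[OF xn] by (simp only: mult.assoc)
  also have "\<dots> = cm y x ^ n * (x ^ Suc n * y ^ Suc n) * cm y x ^ (n choose 2)" by (simp only: power_Suc2 mult.assoc)
  also have "\<dots> = x ^ Suc n * y ^ Suc n * (cm y x ^ n * cm y x ^ (n choose 2))"
   unfolding cc[OF grpD(3)[OF P grpD(5)[OF P x] grpD(5)[OF P y]]] by (simp only: mult.assoc)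
  also have "cm y x ^ n * cm y x ^ (n choose 2) = cm y x ^ (Suc n choose 2)"
   by (simp add: numeral_2_eq_2 flip: power_add)
  finally show ?case .
 qed (simp add: numeral_2_eq_2)
qed

text \<open>Since v has order p and lies outside \<open>J\<close>, the assumption forces d and e to
  be congruent modulo p; the conclusion records this in the form in which it is applied to other
  elements.\<close>

lemma power_ratio_mod:
 fixes v :: "'a::group_mult"
 assumes L: "grp L" "v \<in> L" "v ^ p = 1" "prime p" and J: "grp J" "v \<notin> J" "v ^ d * inverse (v ^ e) \<in> J"
 shows "\<And>w :: 'a. w ^ p = 1 \<Longrightarrow> w ^ d = w ^ e"
proof -
 have v1: "v \<noteq> 1" using J(1,2) grpD(2) by blast
 have od: "od v = p" using od_prime[OF L(1,2) v1 L(3,4)] .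
 have main: "p dvd n - m" if "m \<le> n" "v ^ n * inverse (v ^ m) \<in> J" for m n
 proof (rule ccontr)
  assume "\<not> p dvd n - m"
  hence "coprime (n - m) (od v)" using L(4) od by (simp add: prime_imp_coprime coprime_commute)
  moreover have "v ^ (n - m) \<in> J" using that by (simp add: power_diff_group)
  ultimately show False using pow_coprime_mem[OF L(1,2) J(1)] J(2) by blast
 qed
 have pw: "w ^ n = w ^ m" if mn: "m \<le> n" "p dvd n - m" "w ^ p = 1" for m n and w :: 'a
 proof -
  obtain j where "n - m = p * j" using mn(2) by blast
  hence "n = m + p * j" using mn(1) by simp
  thus ?thesis using mn(3) by (simp add: power_add power_mult)
 qed
 fix w :: 'a assume w: "w ^ p = 1"
 show "w ^ d = w ^ e"
 proof (cases "e \<le> d")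
  case True thus ?thesis using pw main J(3) w by blast
 next
  case False
  have "inverse (v ^ d * inverse (v ^ e)) \<in> J" using grpD(4)[OF J(1,3)] .
  hence "v ^ e * inverse (v ^ d) \<in> J" by (simp add: inv_mult)
  thus ?thesis using pw[of d e w] main[of d e] False w by simp
 qed
qed

text \<open>Hypothesis \<open>H\<close> says that commutators of \<open>N\<close> with
  \<open>P\<close> lie in no proper normal subgroup. With p^(m+1) the exponent of \<open>P\<close>,
  the map f sending x to x^(p^m) is a homomorphism with central image V of exponent p. The excluded
  groups of order p^3 confine [x,y] to the span of f x and f y. As V has rank at least three, linear
  algebra then makes [x,y] a scalar multiple of f y modulo f x, with a scalar depending only on x.
  Conjugates of x under \<open>N\<close> have the same scalar, so it vanishes on the elements x^-1
  (n x n^-1), and by \<open>H\<close> on all of \<open>P\<close>; this kills the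
  commutators.\<close>

lemma class_two_abelian:
 fixes N :: "gp set"
 assumes N: "Good N" and P: "nml P N" "syl p P N" and p: "prime p" "odd p"
  and c2: "\<And>x y. x \<in> P \<Longrightarrow> y \<in> P \<Longrightarrow> cm x y \<in> cz P P" and cp: "\<And>x y. x \<in> P \<Longrightarrow> y \<in> P \<Longrightarrow> cm x y ^ p = 1"
  and H: "\<And>B. nml B N \<Longrightarrow> B \<subseteq> P \<Longrightarrow> (\<And>n x. n \<in> N \<Longrightarrow> x \<in> P \<Longrightarrow> inverse x * cj n x \<in> B) \<Longrightarrow> B = P"
 shows "ab P"
proof (rule ccontr)
 assume nab: "\<not> ab P"
 have gN: "grp N" using Good_grp[OF N] .
 note gP = nmlD(1)[OF P(1)] and PN = nmlD(3)[OF P(1)] and pP = sylD(2)[OF P(2)]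
 note cl = class_two[OF gP c2]
 have cc: "cm x y * z = z * cm x y" if "x \<in> P" "y \<in> P" "z \<in> P" for x y z by (rule cl(3)) (use that in auto)
 have p2: "2 < p" using p prime_ge_2_nat[OF p(1)] by (cases "p = 2") auto
 have mulp: "(x * y) ^ p = x ^ p * y ^ p" if "x \<in> P" "y \<in> P" for x y
 proof -
  \<comment> \<open>Here oddness of p enters: it makes the p-th power map multiplicative.\<close>
  have "p dvd (p choose 2)" using p2 p(1) by (intro dvd_choose_prime) auto
  hence "cm y x ^ (p choose 2) = 1" using cp[OF that(2,1)] by (auto simp: power_mult)
  moreover have "(x * y) ^ p = x ^ p * y ^ p * cm y x ^ (p choose 2)"
   by (rule cl(4)) (use that grpD(2)[OF gP] in auto)
  ultimately show ?thesis by simp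
 qed
 have mulpp: "(x * y) ^ (p ^ j) = x ^ (p ^ j) * y ^ (p ^ j)" if "x \<in> P" "y \<in> P" for x y j
 proof (induction j)
  case (Suc j)
  have "(x * y) ^ (p ^ Suc j) = ((x * y) ^ (p ^ j)) ^ p" by (simp add: mult.commute flip: power_mult)
  also have "\<dots> = (x ^ (p ^ j)) ^ p * (y ^ (p ^ j)) ^ p" unfolding Suc by (rule mulp) (use that grpD(5)[OF gP] in auto)
  finally show ?case by (simp add: mult.commute flip: power_mult)
 qed simp
 have xpc: "x ^ p * y = y * x ^ p" if "x \<in> P" "y \<in> P" for x y
 proof -
  have "cm (x ^ p) y = cm x y ^ p" by (rule cl(5)) (use that in auto)
  thus ?thesis using cp[OF that] by (simp add: cm_eq_one)
 qed
 obtain kk where kk: "card P = p ^ kk" using pP by (auto simp: pgr_def)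
 define ee where "ee = (LEAST e. \<forall>x\<in>P. x ^ (p ^ e) = 1)"
 have ee: "\<forall>x\<in>P. x ^ (p ^ ee) = 1"
  unfolding ee_def by (rule LeastI[of _ kk]) (use pow_card(1)[OF gP] kk in auto)
 have "ee \<noteq> 0"
 proof
  assume "ee = 0"
  hence "P \<subseteq> {1}" using ee by auto
  thus False using nab by (auto simp: ab_def)
 qed
 then obtain m where m: "ee = Suc m" using not0_implies_Suc by blast
 have "\<not> (\<forall>x\<in>P. x ^ (p ^ m) = 1)" using not_less_Least[of m "\<lambda>e. \<forall>x\<in>P. x ^ (p ^ e) = 1"] m unfolding ee_def by simp
 then obtain w0 where w0: "w0 \<in> P" "w0 ^ (p ^ m) \<noteq> 1" by blast
 \<comment> \<open>If \<open>P\<close> had exponent p, any two of its elements would fall under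
   \<open>commuting_of_central_commutator\<close>.\<close>
 have m0: "m \<noteq> 0"
 proof
  assume "m = 0"
  hence e1: "\<forall>x\<in>P. x ^ p = 1" using ee m by simp
  have "x * y = y * x" if "x \<in> P" "y \<in> P" for x y
   by (rule commuting_of_central_commutator[OF N _ _ p(1)])
    (use that PN e1 cc in auto)
  thus False using nab by (auto simp: ab_def)
 qed
 define f where "f x = x ^ (p ^ m)" for x :: gp
 have fh: "ghom f P" unfolding ghom_def f_def using mulpp gP by blast
 define V where "V = f ` P"
 have gV: "grp V" unfolding V_def by (rule grp_img[OF fh])
 have fV: "f x \<in> V" if "x \<in> P" for x using that by (simp add: V_def)
 have VP: "V \<subseteq> P" using grpD(5)[OF gP] by (auto simp: V_def f_def)
 obtain m' where m': "m = Suc m'" using m0 not0_implies_Suc by blast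
 have fp: "f x = (x ^ (p ^ m')) ^ p" for x by (simp add: f_def m' mult.commute flip: power_mult)
 have Vc: "v * y = y * v" if "v \<in> V" "y \<in> P" for v y
  using that xpc[OF grpD(5)[OF gP]] by (auto simp: V_def fp)
 have Vp: "v ^ p = 1" if "v \<in> V" for v
  using that ee m by (auto simp: V_def f_def mult.commute simp flip: power_mult)
 have aV: "ab V" unfolding ab_def using Vc VP by blast
 have fcj: "f (cj n x) = cj n (f x)" for n x by (simp add: f_def cj_pow)
 have cI: "grp (cyc v)" "cyc v \<subseteq> V" if "v \<in> V" for v using grp_cyc[OF gV that] by blast+
 have cardI: "card (cyc v) \<le> p" if "v \<in> V" for v
  using od(3)[OF gV that, of p] od(4)[OF gV that] Vp[OF that] prime_gt_0_nat[OF p(1)] by (auto intro: dvd_imp_le)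
 have gprd: "grp (prd A B)" if "grp A" "grp B" "A \<subseteq> V" "B \<subseteq> P" for A B
  by (rule grp_prd_comm[OF that(1,2)]) (use Vc that(3,4) in blast)
 have cardprd: "card (prd (cyc v) (cyc w)) < p ^ 3" if "v \<in> V" "w \<in> V" for v w
 proof -
  have "card (prd (cyc v) (cyc w)) \<le> card (cyc v \<times> cyc w)"
   unfolding prd_def by (rule card_image_le) (simp add: grpD(1)[OF cI(1)] that)
  also have "\<dots> \<le> p * p" using cardI that by (simp add: card_cartesian_product mult_le_mono)
  also have "\<dots> < p ^ 3" using power_strict_increasing[of 2 3 p] p2 by (simp add: power2_eq_square)
  finally show ?thesis .
 qed
 have prdV: "prd (cyc v) (cyc w) \<subseteq> V" "grp (prd (cyc v) (cyc w))" if "v \<in> V" "w \<in> V" for v w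
  using prd_least[OF cI(2) cI(2) gV] gprd[OF cI(1) cI(1) cI(2)] cI(2)[OF that(2)] VP that by blast+
 have icyc: "a \<in> cyc (b::gp)" if "b \<in> cyc a" "b \<in> V" "a \<in> V" "b \<noteq> 1" for a b
 proof -
  have a1: "a \<noteq> 1" using that(1,4) by (auto simp: cyc_def)
  have "cyc a = cyc b" by (rule prime_card_cyc(1)[OF cI(1)[OF that(3)] card_cyc_prime[OF gV that(3) a1 Vp[OF that(3)] p(1)] p(1) that(1,4)])
  thus ?thesis using cyc_self by blast
 qed
 \<comment> \<open>Rank at most two would make \<open>N\<close> centralize V. Then x and its
   conjugates have the same image under f, and \<open>H\<close> puts \<open>P\<close> into the
   kernel.\<close>
 have V3: "p ^ 3 \<le> card V"
 proof (rule ccontr)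
  assume "\<not> p ^ 3 \<le> card V"
  hence small: "card V < p ^ 3" by simp
  have nV: "nml V N" unfolding nml_def
  proof (intro conjI ballI gV gN)
   show "V \<subseteq> N" using VP PN by blast
   fix k a assume "k \<in> N" "a \<in> V"
   thus "cj k a \<in> V" using nmlD(4)[OF P(1)] by (auto simp: V_def simp flip: fcj)
  qed
  have "Om p V \<subseteq> V" by (auto simp: Om_def)
  hence sO: "card (Om p V) < p ^ 3" using card_mono[OF grpD(1)[OF gV]] small by (meson le_less_trans)
  have Qc: "Q \<subseteq> cz N V" if "syl p Q N" for Q
   using syl_normal_unique[OF P(2,1) p(1) that] Vc PN by (auto simp: cz_def)
  have "cz N V = N" by (rule small_rank_central[OF N nV elementary_pgr[OF gV p(1) Vp] p(1) aV sO Qc])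
  hence cent: "cj n v = v" if "n \<in> N" "v \<in> V" for n v using that by (auto simp: cz_def cj_eq_iff)
  have nk: "nml (ker f P) N" unfolding nml_def
  proof (intro conjI ballI gN nmlD(1)[OF nml_ker[OF fh]])
   show "ker f P \<subseteq> N" using PN by (auto simp: ker_def)
   fix g n assume "g \<in> N" "n \<in> ker f P"
   thus "cj g n \<in> ker f P" using nmlD(4)[OF P(1)] by (simp add: ker_def fcj)
  qed
  have "ker f P = P"
  proof (rule H[OF nk])
   show "ker f P \<subseteq> P" by (auto simp: ker_def)
   fix n x assume nx: "n \<in> N" "x \<in> P"
   have "f x = f (cj n x)" using cent[OF nx(1) fV[OF nx(2)]] by (simp add: fcj)
   thus "inverse x * cj n x \<in> ker f P" using ghom_eq_iff[OF fh nx(2) nmlD(4)[OF P(1) nx]] by simp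
  qed
  thus False using w0 by (auto simp: ker_def f_def)
 qed
 \<comment> \<open>V is larger than J, so the elements whose image avoids J still generate
   \<open>P\<close>; it is enough to treat such generic y.\<close>
 have GEN: "P \<subseteq> T" if J: "grp J" "J \<subseteq> V" "card J < p ^ 3" "grp T" "\<And>y. y \<in> P \<Longrightarrow> f y \<notin> J \<Longrightarrow> y \<in> T" for J T
 proof (rule grp_complement_gen[OF gP grp_pre[OF fh J(1)] _ J(4)])
  have "J \<noteq> V" using J(3) V3 by auto
  then obtain y where "y \<in> P" "f y \<notin> J" using J(2) by (auto simp: V_def)
  thus "pre f P J \<subset> P" by (auto simp: pre_def)
  show "P - pre f P J \<subseteq> T" using J(5) by (auto simp: pre_def)
 qed
 \<comment> \<open>An x outside the kernel of f has the full order p^(m+1), so the elements of order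
   p in \<open>cyc x\<close> are powers of \<open>f x\<close>.\<close>
 have Q: "d \<in> cyc (f x)" if d: "d \<in> cyc x" "d ^ p = 1" and x: "x \<in> P" "f x \<noteq> 1" for d x
 proof -
  obtain k where k: "od x = p ^ k" using pgr_od[OF pP p(1) x(1)] .
  have "\<not> p ^ k dvd p ^ m" using od(3)[OF gP x(1), of "p ^ m"] x(2) k by (simp add: f_def)
  hence "Suc m \<le> k" using le_imp_power_dvd[of k m p] by (metis not_less_eq_eq)
  moreover have "p ^ k dvd p ^ Suc m" using od(3)[OF gP x(1), of "p ^ Suc m"] ee x(1) k m by simp
  hence "k \<le> Suc m" using p2 by (meson power_dvd_imp_le le_trans less_imp_le one_le_numeral prime_gt_1_nat p(1))
  ultimately have "od x div p = p ^ m" "p dvd od x" using k p2 by auto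
  thus ?thesis using cyc_order_p[OF gP x(1) p(1) _ d] by (simp add: f_def)
 qed
 have E1: "cm x y \<in> prd (cyc (f x)) (cyc (f y))" if xy: "x \<in> P" "y \<in> P" "f x \<noteq> 1" "f y \<notin> cyc (f x)" for x y
 proof -
  have fy1: "f y \<noteq> 1" using xy(4) grpD(2)[OF cI(1)[OF fV[OF xy(1)]]] by auto
  have cc1: "grp (cyc (z ^ p))" "cyc (z ^ p) \<subseteq> P" if "z \<in> P" for z
   using grp_cyc[OF gP grpD(5)[OF gP that]] by blast+
  have cent: "a * z = z * a" if a: "a \<in> cyc (w ^ p)" and wz: "w \<in> P" "z \<in> P" for a w z
  proof -
   obtain i where "a = (w ^ p) ^ i" using a by (auto simp: cyc_def)
   hence "a = (w ^ i) ^ p" by (simp add: mult.commute flip: power_mult)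
   thus ?thesis using xpc[OF grpD(5)[OF gP wz(1)] wz(2)] by simp
  qed
  \<comment> \<open>Modulo M both x and y have order dividing p, so their commutator lies in M. The
    two factors of M meet trivially, because their elements of order p are powers of f x and of f y
    respectively; hence both components of the commutator have order dividing p.\<close>
  define M where "M = prd (cyc (x ^ p)) (cyc (y ^ p))"
  have gM: "grp M" unfolding M_def
   by (rule grp_prd_comm[OF cc1(1)[OF xy(1)] cc1(1)[OF xy(2)]]) (use cent[OF _ xy(1)] cc1(2)[OF xy(2)] in blast)
  have MP: "M \<subseteq> P" unfolding M_def by (rule prd_least[OF cc1(2)[OF xy(1)] cc1(2)[OF xy(2)] gP])
  have MN: "M \<subseteq> N" using MP PN by blast
  have nzM: "z \<in> nz N M" if "z \<in> P" for z
  proof (rule nzI[OF grpD(1)[OF gM]])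
   show "z \<in> N" using that PN by blast
   fix a assume a: "a \<in> M"
   then obtain b c where bc: "b \<in> cyc (x ^ p)" "c \<in> cyc (y ^ p)" "a = b * c" by (auto simp: M_def prd_iff)
   have "cj z b = b" "cj z c = c" using cent[OF bc(1) xy(1) that] cent[OF bc(2) xy(2) that] by (simp_all add: cj_eq_iff)
   hence "cj z a = a" using bc(3) by (simp add: cj_mult)
   thus "cj z a \<in> M" using a by simp
  qed
  have o: "cm z (cm x y) \<in> M" if "z \<in> P" for z
  proof -
   have "cm z (cm x y) = 1" using cc[OF xy(1,2) that] by (simp add: cm_eq_one)
   thus ?thesis using grpD(2)[OF gM] by simp
  qed
  have "x ^ p \<in> M" "y ^ p \<in> M"
   unfolding M_def using prd_sub1[OF cc1(1)[OF xy(1)] cc1(1)[OF xy(2)]] prd_sub2[OF cc1(1)[OF xy(1)] cc1(1)[OF xy(2)]] cyc_self by blast+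
  hence "cm x y \<in> M"
   using commuting_of_central_commutator_mod[OF N gM MN p(1) nzM[OF xy(1)] nzM[OF xy(2)] _ _ o[OF xy(1)] o[OF xy(2)]] by blast
  then obtain a b where ab: "a \<in> cyc (x ^ p)" "b \<in> cyc (y ^ p)" "cm x y = a * b" by (auto simp: M_def prd_iff)
  have abP: "a \<in> P" "b \<in> P" using ab cc1(2) xy by blast+
  have "a ^ p * b ^ p = 1" using cp[OF xy(1,2)] mulp[OF abP] ab(3) by simp
  hence e: "b ^ p = inverse (a ^ p)" by (simp add: mult_eq_one_iff)
  define D where "D = cyc (x ^ p) \<inter> cyc (y ^ p)"
  have gD: "grp D" "D \<subseteq> P" unfolding D_def using grp_Int[OF cc1(1)[OF xy(1)] cc1(1)[OF xy(2)]] cc1(2)[OF xy(1)] by blast+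
  have "D = {1}"
  proof (rule ccontr)
   assume "D \<noteq> {1}"
   then obtain d where d: "d \<in> D" "d \<noteq> 1" "d ^ p = 1" using pgr_order_p[OF pgr_sub[OF pP p(1) gD] p(1)] by blast
   have sub: "cyc (z ^ p) \<subseteq> cyc z" if "z \<in> P" for z using cyc_least[OF grp_cyc(1)[OF gP that], of "z ^ p"] by simp
   have dd: "d \<in> cyc (f x)" "d \<in> cyc (f y)" using Q[OF _ d(3) xy(1,3)] Q[OF _ d(3) xy(2) fy1] d(1) sub xy(1,2) unfolding D_def by blast+
   have dV: "d \<in> V" using dd(1) cI(2) fV xy(1) by blast
   have "f y \<in> cyc d" by (rule icyc[OF dd(2) dV fV[OF xy(2)] d(2)])
   thus False using xy(4) cyc_least[OF cI(1)[OF fV[OF xy(1)]] dd(1)] by blast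
  qed
  moreover have "b ^ p \<in> cyc (y ^ p)" using grpD(5)[OF cc1(1)[OF xy(2)] ab(2)] .
  moreover have "b ^ p \<in> cyc (x ^ p)" unfolding e using grpD(4,5)[OF cc1(1)[OF xy(1)]] ab(1) by blast
  ultimately have "b ^ p = 1" unfolding D_def by blast
  moreover hence "a ^ p = 1" using e by simp
  moreover have "cyc (x ^ p) \<subseteq> cyc x" "cyc (y ^ p) \<subseteq> cyc y"
   using cyc_least[OF grp_cyc(1)[OF gP xy(1)], of "x ^ p"] cyc_least[OF grp_cyc(1)[OF gP xy(2)], of "y ^ p"] by simp_all
  ultimately have "a \<in> cyc (f x)" "b \<in> cyc (f y)" using Q xy(1-3) fy1 ab(1,2) by blast+
  thus ?thesis unfolding ab(3) by (rule prdI)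
 qed
 have fm: "f (x * y) = f x * f y" if "x \<in> P" "y \<in> P" for x y using ghomD(2)[OF fh that] .
 have E2: "\<exists>c. \<forall>y\<in>P. cm x y * inverse (f y ^ c) \<in> cyc (f x)" if x: "x \<in> P" "f x \<noteq> 1" for x
 proof -
  define I where "I = cyc (f x)"
  have I: "grp I" "I \<subseteq> V" unfolding I_def using cI fV x(1) by blast+
  have Ic: "s * z = z * s" if "s \<in> I" "z \<in> P" for s z using Vc that I(2) by blast
  have "I \<noteq> V" using cardI[OF fV[OF x(1)]] V3 power_strict_increasing[of 1 3 p] p2 by (auto simp: I_def)
  then obtain z where z: "z \<in> P" "f z \<notin> I" using I(2) by (auto simp: V_def)
  define J where "J = prd I (cyc (f z))"
  have J: "grp J" "J \<subseteq> V" "card J < p ^ 3" unfolding J_def I_def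
   using prdV[OF fV[OF x(1)] fV[OF z(1)]] cardprd[OF fV[OF x(1)] fV[OF z(1)]] by auto
  have IJ: "I \<subseteq> J" "cyc (f z) \<subseteq> J" unfolding J_def using prd_sub1 prd_sub2 I(1) cI(1)[OF fV[OF z(1)]] by blast+
  have out: "\<exists>s d. s \<in> I \<and> cm x y = s * f y ^ d" if y: "y \<in> P" "f y \<notin> I" for y
  proof -
   obtain s t where "s \<in> I" "t \<in> cyc (f y)" "cm x y = s * t"
    using E1[OF x(1) y(1) x(2)] y(2) unfolding I_def prd_iff by blast
   thus ?thesis by (auto simp: cyc_def)
  qed
  \<comment> \<open>The exponent c is read off at one element z; comparing y, z and y z shows that
    every generic y has the same exponent modulo p.\<close>
  obtain s0 c where s0: "s0 \<in> I" "cm x z = s0 * f z ^ c" using out[OF z] by blast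
  define dl where "dl y = cm x y * inverse (f y ^ c)" for y
  have h: "ghom dl P" unfolding ghom_def
  proof (intro conjI ballI gP)
   fix a b assume a: "a \<in> P" and b: "b \<in> P"
   have "f (a * b) ^ c = f b ^ c * f a ^ c"
    unfolding fm[OF a b] using abD[OF aV fV[OF a] fV[OF b]] by (simp add: pow_mult_commuting)
   moreover have "cm x (a * b) = cm x a * cm x b" by (rule cl(2)) (use x a b in auto)
   ultimately have "dl (a * b) = (cm x a * cm x b) * (inverse (f a ^ c) * inverse (f b ^ c))" by (simp add: dl_def inv_mult)
   also have "\<dots> = dl a * dl b" unfolding dl_def
    by (rule swap_factors[symmetric])
     (use cc[OF x(1) b, of "inverse (f a ^ c)"] a b VP fV grpD(4,5)[OF gP] in blast)
   finally show "dl (a * b) = dl a * dl b" .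
  qed
  have "P \<subseteq> pre dl P I"
  proof (rule GEN[OF J grp_pre[OF h I(1)]])
   fix y assume y: "y \<in> P" "f y \<notin> J"
   then obtain s d where s: "s \<in> I" "cm x y = s * f y ^ d" using out IJ(1) by blast
   have "f (y * z) \<notin> I"
   proof
    assume "f (y * z) \<in> I"
    hence "f y * f z \<in> J" using fm[OF y(1) z(1)] IJ(1) by auto
    thus False using grp_cancel(2)[OF J(1), of "f z"] IJ(2) y(2) cyc_self by blast
   qed
   then obtain s' e where s': "s' \<in> I" "cm x (y * z) = s' * f (y * z) ^ e" using out grpD(3)[OF gP y(1) z(1)] by blast
   define A where "A = f y" define C where "C = f z"
   have AV: "A \<in> V" "C \<in> V" "A \<in> P" "C \<in> P" using fV y(1) z(1) VP by (auto simp: A_def C_def)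
   have Ap: "A ^ i \<in> V" "A ^ i \<in> P" "C ^ i \<in> V" "C ^ i \<in> P" for i using grpD(5)[OF gV] AV VP by blast+
   have "(s * A ^ d) * (s0 * C ^ c) = s' * (A ^ e * C ^ e)"
   proof -
    have "cm x (y * z) = cm x y * cm x z" by (rule cl(2)) (use x y z in auto)
    thus ?thesis using s s' s0 fm[OF y(1) z(1)] pow_mult_commuting[OF abD[OF aV AV(1,2)], of e] by (simp add: A_def C_def)
   qed
   moreover have "(s * A ^ d) * (s0 * C ^ c) = (s * s0) * (A ^ d * C ^ c)"
    by (rule swap_factors[OF Ic[OF s0(1) Ap(2)]])
   ultimately have eq: "A ^ d * C ^ c = inverse (s * s0) * s' * (A ^ e * C ^ e)"
    by (metis inv_mult_cancel mult.assoc)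
   define g where "g = inverse (s * s0) * s'"
   have g: "g \<in> I" unfolding g_def using grpD(3,4)[OF I(1)] s(1) s'(1) s0(1) by blast
   have "A ^ d = g * (A ^ e * C ^ e) * inverse (C ^ c)" using eq unfolding g_def by (metis mult_inv_eq_iff)
   also have "\<dots> = g * (C ^ e * inverse (C ^ c)) * A ^ e"
   proof -
    have "A ^ e * (C ^ e * inverse (C ^ c)) = (C ^ e * inverse (C ^ c)) * A ^ e"
     by (rule abD[OF aV]) (use Ap grpD(3,4)[OF gV] in blast)+
    thus ?thesis by (simp add: mult.assoc)
   qed
   finally have "A ^ d * inverse (A ^ e) = g * (C ^ e * inverse (C ^ c))" by (simp add: mult_inv_eq_iff)
   moreover have "g * (C ^ e * inverse (C ^ c)) \<in> J" unfolding J_def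
    by (rule prdI[OF g]) (use grpD(3,4)[OF cI(1)[OF AV(2)]] in "auto simp: C_def")
   ultimately have "A ^ d * inverse (A ^ e) \<in> J" by simp
   hence de: "w ^ d = w ^ e" if "w ^ p = 1" for w :: gp
    using power_ratio_mod[OF gV AV(1) Vp[OF AV(1)] p(1) J(1), of d e w] y(2) that by (simp add: A_def)
   have "A ^ e * C ^ c = g * (A ^ e * C ^ e)" using eq de[OF Vp[OF AV(1)]] by (simp add: g_def)
   also have "\<dots> = A ^ e * (g * C ^ e)" using Ic[OF g Ap(2), of e] by (metis mult.assoc)
   finally have "C ^ c * inverse (C ^ e) = g" by (simp add: mult_inv_eq_iff)
   hence ce: "w ^ c = w ^ e" if "w ^ p = 1" for w :: gp
    using power_ratio_mod[OF gV AV(2) Vp[OF AV(2)] p(1) I(1), of c e w] z(2) g that by (simp add: C_def)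
   have "dl y = s" using s(2) de[OF Vp[OF AV(1)]] ce[OF Vp[OF AV(1)]] by (simp add: dl_def A_def mult_inv_eq_iff)
   thus "y \<in> pre dl P I" using y(1) s(1) by (simp add: pre_def)
  qed
  hence "\<forall>y\<in>P. dl y \<in> I" by (auto simp: pre_def)
  thus ?thesis unfolding dl_def I_def by blast
 qed
 have chom: "ghom (cm b) P" if b: "b \<in> P" for b
  unfolding ghom_def using gP by (auto intro!: cl(2) b)
 \<comment> \<open>If all commutators with b stay in a small J, a generic y contributes nothing
   along f y, since \<open>cyc (f y)\<close> meets J trivially.\<close>
 have E3: "cm b y \<in> cyc (f b)" if b: "b \<in> P" and J: "grp J" "J \<subseteq> V" "card J < p ^ 3" "f b \<in> J"
  and bJ: "\<And>z. z \<in> P \<Longrightarrow> cm b z \<in> J" and y: "y \<in> P" for b J y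
 proof -
  have "P \<subseteq> pre (cm b) P (cyc (f b))"
  proof (rule GEN[OF J(1-3) grp_pre[OF chom[OF b] cI(1)[OF fV[OF b]]]])
   fix y assume y: "y \<in> P" "f y \<notin> J"
   have y1: "f y \<noteq> 1" using y(2) grpD(2)[OF J(1)] by auto
   have cJ: "cyc (f b) \<subseteq> J" by (rule cyc_least[OF J(1,4)])
   have "cm b y \<in> prd (cyc (f b)) (cyc (f y))"
   proof (cases "f b = 1")
    case True
    obtain c where "cm y b * inverse (f b ^ c) \<in> cyc (f y)" using E2[OF y(1) y1] b by blast
    hence "cm y b \<in> cyc (f y)" using True by simp
    hence "cm b y \<in> cyc (f y)" using grpD(4)[OF cI(1)[OF fV[OF y(1)]]] cm_inverse by metis
    thus ?thesis using prd_sub2[OF cI(1)[OF fV[OF b]] cI(1)[OF fV[OF y(1)]]] by blast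
   next
    case False
    thus ?thesis using E1[OF b y(1)] y(2) cJ by blast
   qed
   then obtain s t where st: "s \<in> cyc (f b)" "t \<in> cyc (f y)" "cm b y = s * t" by (auto simp: prd_iff)
   have "t \<in> J" using grp_cancel(1)[OF J(1), of s t] st cJ bJ[OF y(1)] by auto
   have "t = 1"
   proof (rule ccontr)
    assume "t \<noteq> 1"
    hence "f y \<in> cyc t" using icyc[OF st(2) _ fV[OF y(1)]] \<open>t \<in> J\<close> J(2) by blast
    thus False using cyc_least[OF J(1) \<open>t \<in> J\<close>] y(2) by blast
   qed
   thus "y \<in> pre (cm b) P (cyc (f b))" using st y(1) by (simp add: pre_def)
  qed
  thus ?thesis using y by (auto simp: pre_def)
 qed
 \<comment> \<open>The elements with scalar zero. They form a normal subgroup of \<open>N\<close>,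
   to which \<open>H\<close> will be applied.\<close>
 define B where "B = {b \<in> P. \<forall>y\<in>P. cm b y \<in> cyc (f b)}"
 have BI: "b \<in> B" if "b \<in> P" "grp J" "J \<subseteq> V" "card J < p ^ 3" "f b \<in> J" "\<And>z. z \<in> P \<Longrightarrow> cm b z \<in> J" for b J
  unfolding B_def using E3[OF that] that(1) by blast
 have ciy: "cm x' y = cj n (cm x (cj (inverse n) y))" if "x' = cj n x" for n x x' y :: gp
  using that by (simp add: cj_cm_distrib)
 have niv: "cj (inverse n) y \<in> P" if "n \<in> N" "y \<in> P" for n y
  using nmlD(4)[OF P(1) grpD(4)[OF gN that(1)] that(2)] .
 have cjc: "cj n s \<in> cyc (f (cj n x))" if "s \<in> cyc (f x)" for n s x
  using that by (auto simp: cyc_def cj_pow fcj)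
 have gB: "grp B"
 proof -
  have mul: "a * b \<in> B" if ab: "a \<in> B" "b \<in> B" for a b
  proof -
   have abP: "a \<in> P" "b \<in> P" using ab by (auto simp: B_def)
   define J where "J = prd (cyc (f a)) (cyc (f b))"
   show ?thesis
   proof (rule BI[of _ J])
    show "a * b \<in> P" using grpD(3)[OF gP abP] .
    show "grp J" "J \<subseteq> V" "card J < p ^ 3" unfolding J_def
     using prdV[OF fV[OF abP(1)] fV[OF abP(2)]] cardprd[OF fV[OF abP(1)] fV[OF abP(2)]] by auto
    show "f (a * b) \<in> J" unfolding J_def fm[OF abP] by (rule prdI) auto
    fix z assume z: "z \<in> P"
    have "cm (a * b) z = cm a z * cm b z" by (rule cl(1)) (use abP z in auto)
    thus "cm (a * b) z \<in> J" unfolding J_def using ab z by (auto simp: B_def intro: prdI)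
   qed
  qed
  have one: "1 \<in> B"
  proof -
   have "cm 1 y = 1" for y :: gp by (simp add: cm_def)
   thus ?thesis using grpD(2)[OF gP] grpD(2)[OF cI(1)[OF fV[OF grpD(2)[OF gP]]]] by (simp add: B_def)
  qed
  have pw: "b ^ i \<in> B" if "b \<in> B" for b i by (induction i) (use that one mul in auto)
  show ?thesis
  proof (rule grpI)
   show "finite B" using grpD(1)[OF gP] by (simp add: B_def)
   fix b assume b: "b \<in> B"
   hence bP: "b \<in> P" by (simp add: B_def)
   have "b * b ^ (od b - 1) = 1" using od(1,2)[OF gP bP] by (metis Suc_diff_1 power_Suc)
   hence "inverse b = b ^ (od b - 1)" by (rule inv_unique)
   thus "inverse b \<in> B" using pw[OF b] by simp
  qed (use one mul in auto)
 qed
 have nB: "nml B N" unfolding nml_def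
 proof (intro conjI ballI gB gN)
  show "B \<subseteq> N" using PN by (auto simp: B_def)
  fix n b assume n: "n \<in> N" and b: "b \<in> B"
  show "cj n b \<in> B" unfolding B_def
  proof (intro CollectI conjI ballI)
   show "cj n b \<in> P" using nmlD(4)[OF P(1) n] b by (simp add: B_def)
   fix y assume "y \<in> P"
   hence "cm b (cj (inverse n) y) \<in> cyc (f b)" using b niv[OF n] by (simp add: B_def)
   thus "cm (cj n b) y \<in> cyc (f (cj n b))" unfolding ciy[OF refl] by (rule cjc)
  qed
 qed
 have step: "inverse x * cj n x \<in> B" if n: "n \<in> N" and x: "x \<in> P" "f x \<noteq> 1" for n x
 proof -
  define x' where "x' = cj n x"
  have x': "x' \<in> P" unfolding x'_def by (rule nmlD(4)[OF P(1) n x(1)])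
  \<comment> \<open>The exponent c serves for x and for its conjugate x', since f and commutators
    are compatible with conjugation by n; so it cancels in the commutator of x^-1 x' with z.\<close>
  obtain c where c: "\<And>y. y \<in> P \<Longrightarrow> cm x y * inverse (f y ^ c) \<in> cyc (f x)" using E2[OF x] by blast
  define J where "J = prd (cyc (f x)) (cyc (f x'))"
  show ?thesis unfolding x'_def[symmetric]
  proof (rule BI[of _ J])
   show ixP: "inverse x * x' \<in> P" using grpD(3,4)[OF gP] x(1) x' by blast
   show J: "grp J" "J \<subseteq> V" "card J < p ^ 3" unfolding J_def
    using prdV[OF fV[OF x(1)] fV[OF x']] cardprd[OF fV[OF x(1)] fV[OF x']] by auto
   have JI: "cyc (f x) \<subseteq> J" "cyc (f x') \<subseteq> J"
    unfolding J_def using prd_sub1 prd_sub2 cI(1)[OF fV[OF x(1)]] cI(1)[OF fV[OF x']] by blast+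
   have "f x \<in> J" "f x' \<in> J" using JI cyc_self by blast+
   thus "f (inverse x * x') \<in> J"
    using grpD(3)[OF J(1) grpD(4)[OF J(1)]] fm[OF grpD(4)[OF gP x(1)] x'] ghomD(4)[OF fh x(1)] by simp
   fix z assume z: "z \<in> P"
   define y where "y = cj (inverse n) z"
   have y: "y \<in> P" unfolding y_def by (rule niv[OF n z])
   define u where "u = cm x y * inverse (f y ^ c)"
   have "cm x y = u * f y ^ c" by (simp add: u_def mult.assoc)
   hence e': "cm x' z = cj n u * f z ^ c"
    by (simp add: ciy[OF x'_def] flip: y_def) (simp add: cj_mult cj_pow y_def flip: fcj)
   have uJ: "cj n u \<in> J" using cjc[of u x n] c[OF y] JI(2) by (auto simp: u_def x'_def)
   define s where "s = cm x z * inverse (f z ^ c)"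
   have e: "cm x z = s * f z ^ c" by (simp add: s_def mult.assoc)
   have sJ: "s \<in> J" using c[OF z] JI(1) by (auto simp: s_def)
   have "cm (inverse x) z = inverse (cm x z)"
   proof -
    have "cm x z * cm (inverse x) z = cm (x * inverse x) z"
     by (rule cl(1)[symmetric]) (use x(1) z grpD(4)[OF gP] in auto)
    hence "cm x z * cm (inverse x) z = 1" by (simp add: cm_def)
    thus ?thesis by (simp add: mult_eq_one_iff)
   qed
   moreover have "cm (inverse x * x') z = cm (inverse x) z * cm x' z" by (rule cl(1)) (use x(1) x' z grpD(4)[OF gP] in auto)
   ultimately have "cm (inverse x * x') z = inverse (f z ^ c) * (inverse s * cj n u) * f z ^ c"
    using e e' by (simp add: inv_mult mult.assoc)
   also have "\<dots> = inverse s * cj n u"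
   proof -
    have "inverse s * cj n u \<in> P" using sJ uJ J VP grpD(3,4)[OF J(1)] by blast
    hence "inverse (f z ^ c) * (inverse s * cj n u) = (inverse s * cj n u) * inverse (f z ^ c)"
     using Vc[OF grpD(4)[OF gV grpD(5)[OF gV fV[OF z]]]] by blast
    thus ?thesis by (simp add: mult.assoc)
   qed
   finally show "cm (inverse x * x') z \<in> J" using grpD(3,4)[OF J(1)] sJ uJ by simp
  qed
 qed
 have "B = P"
 proof (rule H[OF nB])
  show "B \<subseteq> P" by (auto simp: B_def)
  fix n x assume n: "n \<in> N" and x: "x \<in> P"
  show "inverse x * cj n x \<in> B"
  proof (cases "f x = 1")
   case True
   \<comment> \<open>An element of the kernel of f becomes one outside the kernel after
     multiplication by \<open>w0\<close>.\<close>
   note z = w0[folded f_def]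
   have "f (x * w0) \<noteq> 1" using True fm[OF x z(1)] z(2) by simp
   hence "inverse (x * w0) * cj n (x * w0) \<in> B" using step[OF n grpD(3)[OF gP x z(1)]] by blast
   moreover have "inverse (x * w0) * cj n (x * w0) = cj (inverse w0) (inverse x * cj n x) * (inverse w0 * cj n w0)"
    by (simp add: cj_def gsimps)
   ultimately have "cj (inverse w0) (inverse x * cj n x) \<in> B"
    using grp_cancel(2)[OF gB step[OF n z]] by simp
   hence "cj w0 (cj (inverse w0) (inverse x * cj n x)) \<in> B" using nmlD(4)[OF nB] z(1) PN by blast
   thus ?thesis by simp
  qed (use step[OF n x] in blast)
 qed
 \<comment> \<open>The commutator of b and y now lies both in \<open>cyc (f b)\<close> and in
   \<open>cyc (f y)\<close>, which meet trivially for generic y.\<close>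
 have "ab P" unfolding ab_def
 proof
  fix b assume b: "b \<in> P"
  have sm: "card (cyc (f b)) < p ^ 3"
   using cardI[OF fV[OF b]] power_strict_increasing[of 1 3 p] p2 by auto
  have "P \<subseteq> cz P {b}"
  proof (rule GEN[OF cI[OF fV[OF b]] sm grp_cz[OF gP]])
   fix y assume y: "y \<in> P" "f y \<notin> cyc (f b)"
   have c1: "cm b y \<in> cyc (f b)" using b y(1) \<open>B = P\<close> by (auto simp: B_def)
   have "cm y b \<in> cyc (f y)" using b y(1) \<open>B = P\<close> by (auto simp: B_def)
   hence c2: "cm b y \<in> cyc (f y)" using grpD(4)[OF cI(1)[OF fV[OF y(1)]]] cm_inverse by metis
   have "cm b y = 1"
   proof (rule ccontr)
    assume "cm b y \<noteq> 1"
    hence "f y \<in> cyc (cm b y)" using icyc[OF c2 _ fV[OF y(1)]] c1 cI(2)[OF fV[OF b]] by blast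
    thus False using y(2) cyc_least[OF cI(1)[OF fV[OF b]] c1] by blast
   qed
   thus "y \<in> cz P {b}" using y(1) by (simp add: cz_def cm_eq_one)
  qed
  thus "\<forall>y\<in>P. b * y = y * b" by (auto simp: cz_def)
 qed
 thus False using nab by blast
qed

text \<open>Divide by a normal subgroup of \<open>N\<close> in \<open>P\<close> of largest order
  with non-abelian quotient. Every non-trivial normal subgroup inside the image of \<open>P\<close>
  then contains the derived subgroup of that image. Applied to the centre, and to the elements of
  order p in the derived subgroup, this yields the hypotheses of
  \<open>class_two_abelian\<close>.\<close>

lemma abelian_of_focal:
 fixes N :: "gp set"
 assumes N: "Good N" and P: "nml P N" "syl p P N" and p: "prime p" "odd p"
  and H: "\<And>B. nml B N \<Longrightarrow> B \<subseteq> P \<Longrightarrow> (\<And>n x. n \<in> N \<Longrightarrow> x \<in> P \<Longrightarrow> inverse x * cj n x \<in> B) \<Longrightarrow> B = P"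
 shows "ab P"
proof (rule ccontr)
 assume nab: "\<not> ab P"
 note gP = nmlD(1)[OF P(1)] and PN = nmlD(3)[OF P(1)] and gN = nmlD(2)[OF P(1)]
 define Q where "Q D \<longleftrightarrow> nml D N \<and> D \<subseteq> P \<and> \<not> der P \<subseteq> D" for D
 have "der P \<noteq> {1}" using der_one nab by blast
 hence "\<not> der P \<subseteq> {1}" using grpD(2)[OF grp_der[OF gP]] by blast
 hence Q1: "Q {1}" using nml_one[OF gN] grpD(2)[OF gP] by (simp add: Q_def)
 have bd: "\<forall>D. Q D \<longrightarrow> card D < Suc (card P)" using card_mono[OF grpD(1)[OF gP]] by (auto simp: Q_def less_Suc_eq_le)
 have "\<exists>D. Q D \<and> (\<forall>D'. Q D' \<longrightarrow> card D' \<le> card D)" by (rule ex_has_greatest_nat[where f=card, OF Q1 bd])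
 then obtain D where D: "Q D" "\<And>D'. Q D' \<Longrightarrow> card D' \<le> card D" by blast
 have nD: "nml D N" "D \<subseteq> P" "\<not> der P \<subseteq> D" using D(1) by (auto simp: Q_def)
 obtain f :: "gp \<Rightarrow> gp" where f: "ghom f N" "ker f N = D" using quotient_exists[OF nD(1)] by blast
 define N1 where "N1 = f ` N" define P1 where "P1 = f ` P"
 have N1: "Good N1" "grp N1" unfolding N1_def using Good_img[OF N f(1)] grp_img[OF f(1)] by blast+
 have nP1: "nml P1 N1" unfolding P1_def N1_def by (rule nml_img[OF f(1) P(1)])
 have sP1: "syl p P1 N1" unfolding P1_def N1_def by (rule syl_img[OF f(1) P(2) p(1)])
 have dP1: "der P1 = f ` der P" unfolding P1_def by (rule der_img[OF f(1) gP PN])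
 note gP1 = nmlD(1)[OF nP1] and pP1 = sylD(2)[OF sP1]
 have pre: "pre f N M \<subseteq> P" if "M \<subseteq> P1" for M
 proof -
  have "pre f N M \<subseteq> pre f N (f ` P)" using that by (auto simp: pre_def P1_def)
  also have "\<dots> = prd D P" using prd_eq_pre[OF f(1) gP PN] f(2) by simp
  also have "\<dots> \<subseteq> P" by (rule prd_least[OF nD(2) _ gP]) simp
  finally show ?thesis .
 qed
 have preD: "D \<subseteq> pre f N M" "nml (pre f N M) N" if M: "nml M N1" for M
 proof -
  show "D \<subseteq> pre f N M" using grpD(2)[OF nmlD(1)[OF M]] unfolding f(2)[symmetric] by (auto simp: pre_def ker_def)
  show "nml (pre f N M) N" by (rule nml_pre[OF f(1)]) (use M N1_def in simp)
 qed
 have small: "der P1 \<subseteq> M" if M: "nml M N1" "M \<subseteq> P1" "M \<noteq> {1}" for M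
 proof (rule ccontr)
  assume nd: "\<not> der P1 \<subseteq> M"
  hence "\<not> der P \<subseteq> pre f N M" unfolding dP1 by (auto simp: pre_def)
  hence "Q (pre f N M)" unfolding Q_def using preD(2)[OF M(1)] pre[OF M(2)] by blast
  hence c: "card (pre f N M) \<le> card D" by (rule D(2))
  have "D = pre f N M" by (rule subgroup_eq_card[OF nmlD(1)[OF preD(2)[OF M(1)]] preD(1)[OF M(1)] c])
  hence one: "f x = 1" if "x \<in> pre f N M" for x using that unfolding f(2)[symmetric] by (auto simp: ker_def)
  have im: "f ` pre f N M = M" by (rule img_pre) (use M(2) nmlD(3)[OF nP1] N1_def in blast)
  have "M \<subseteq> {1}" by (subst im[symmetric]) (rule image_subsetI, simp add: one)
  thus False using M(3) grpD(2)[OF nmlD(1)[OF M(1)]] by blast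
 qed
 have dn1: "der P1 \<noteq> {1}"
 proof
  assume d1: "der P1 = {1}"
  have "der P \<subseteq> ker f N" unfolding ker_def using d1 dP1 der_sub[OF gP] PN by auto
  thus False using nD(3) f(2) by simp
 qed
 define Z where "Z = cz P1 P1"
 have nZ: "nml Z N1" unfolding nml_def Z_def
 proof (intro conjI ballI N1(2) grp_cz[OF gP1])
  show "cz P1 P1 \<subseteq> N1" using cz_sub nmlD(3)[OF nP1] by blast
  fix g n assume g: "g \<in> N1" and n: "n \<in> cz P1 P1"
  have "cj g n \<in> cj g ` cz P1 P1" using n by (rule imageI)
  thus "cj g n \<in> cz P1 P1" unfolding cj_cz nmlD(5)[OF nP1 g] .
 qed
 have "Z \<noteq> {1}"
 proof -
  have "P1 \<noteq> {1}" using dn1 der_ab[OF gP1] by (auto simp: ab_def)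
  then obtain z where "z \<in> P1" "z \<noteq> 1" "\<forall>g\<in>P1. g * z = z * g"
   using pgr_normal_meets_center[OF pP1 p(1) nml_refl[OF gP1]] by blast
  hence "z \<in> Z" "z \<noteq> 1" by (simp_all add: Z_def cz_def)
  thus ?thesis by blast
 qed
 hence dZ: "der P1 \<subseteq> Z" using small[OF nZ] cz_sub[of P1 P1] by (simp add: Z_def)
 have gd: "grp (der P1)" "der P1 \<subseteq> P1" using grp_der[OF gP1] der_sub[OF gP1] .
 have abd: "ab (der P1)" using dZ gd(2) unfolding ab_def Z_def cz_def by blast
 note O = Om[OF gd(1) abd, where p=p]
 have "nml (Om p (der P1)) N1" unfolding nml_def
 proof (intro conjI ballI N1(2) O(1))
  show "Om p (der P1) \<subseteq> N1" using O(2) gd(2) nmlD(3)[OF nP1] by blast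
  fix g n assume g: "g \<in> N1" and n: "n \<in> Om p (der P1)"
  have "n \<in> der P1" using n O(2) by blast
  thus "cj g n \<in> Om p (der P1)" by (intro Om_cj[OF n] nmlD(4)[OF nml_der[OF nP1] g])
 qed
 moreover have "Om p (der P1) \<noteq> {1}" using Om_nontriv[OF pgr_sub[OF pP1 p(1) gd] p(1) dn1] by blast
 ultimately have dO: "der P1 \<subseteq> Om p (der P1)" using small O(2) gd(2) by blast
 have "ab P1"
 proof (rule class_two_abelian[OF N1(1) nP1 sP1 p])
  fix x y assume xy: "x \<in> P1" "y \<in> P1"
  show "cm x y \<in> cz P1 P1" using cm_in_der[OF xy] dZ by (auto simp: Z_def)
  show "cm x y ^ p = 1" using cm_in_der[OF xy] dO O(4) by blast
 next
  fix B assume B: "nml B N1" "B \<subseteq> P1" "\<And>n x. n \<in> N1 \<Longrightarrow> x \<in> P1 \<Longrightarrow> inverse x * cj n x \<in> B"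
  have "pre f N B = P"
  proof (rule H[OF preD(2)[OF B(1)] pre[OF B(2)]])
   fix n x assume n: "n \<in> N" and x: "x \<in> P"
   have xN: "x \<in> N" and cN: "cj n x \<in> N" using x PN nmlD(4)[OF P(1) n x] by blast+
   have "f (inverse x * cj n x) = inverse (f x) * cj (f n) (f x)"
    using ghomD(2)[OF f(1) grpD(4)[OF gN xN] cN] ghomD(4)[OF f(1) xN] ghomD(6)[OF f(1) n xN] by simp
   moreover have "inverse (f x) * cj (f n) (f x) \<in> B" using B(3)[of "f n" "f x"] n x by (simp add: N1_def P1_def)
   ultimately show "inverse x * cj n x \<in> pre f N B" using grpD(3,4)[OF gN] xN cN by (simp add: pre_def)
  qed
  hence "f ` P = B" using img_pre[of B f N] B(2) nmlD(3)[OF nP1] by (simp add: N1_def)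
  thus "B = P1" by (simp add: P1_def)
 qed
 thus False using dn1 der_ab[OF gP1] by blast
qed

section \<open>Transfer\<close>

lemma comm_group_rec: assumes "grp A" "ab A" shows "comm_group (rec A)"
 by (rule group.group_comm_groupI[OF group_rec[OF assms(1)]]) (use abD[OF assms(2)] in simp)

lemma lcs_shift: assumes "grp L" "g \<in> L" shows "bij_betw ((`) ((*) g)) (lcs L H) (lcs L H)"
proof (rule bij_betwI[where g = "(`) ((*) (inverse g))"])
 note cl = lcs_closed[OF assms(1)]
 show "(`) ((*) g) \<in> lcs L H \<rightarrow> lcs L H" using cl[OF assms(2)] by blast
 show "(`) ((*) (inverse g)) \<in> lcs L H \<rightarrow> lcs L H" using cl[OF grpD(4)[OF assms]] by blast
qed (simp_all add: image_image)

definition rep :: "'a set \<Rightarrow> 'a" where "rep c = (SOME x. x \<in> c)"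

lemma rep: assumes "grp L" "grp H" "H \<subseteq> L" "c \<in> lcs L H"
 shows "rep c \<in> L" "c = (*) (rep c) ` H"
proof -
 obtain x where x: "x \<in> L" "c = (*) x ` H" using assms(4) by (auto simp: lcs_def)
 have "x \<in> c" using x(2) grpD(2)[OF assms(2)] image_eqI[of x "(*) x" 1] by simp
 hence "rep c \<in> c" unfolding rep_def by (rule someI)
 then obtain h where h: "h \<in> H" "rep c = x * h" using x(2) by blast
 show "rep c \<in> L" unfolding h(2) by (rule grpD(3)[OF assms(1) x(1) subsetD[OF assms(3) h(1)]])
 have "(*) x ` H = (*) (rep c) ` H" unfolding coset_eq_iff[OF assms(2)] h(2) using h(1) by simp
 thus "c = (*) (rep c) ` H" using x(2) by simp
qed

text \<open>The factor of the transfer at the coset c: t of the element of P by which x carries the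
  representative of c to that of x c, up to order.\<close>

definition tau :: "('a::group_mult \<Rightarrow> 'b::group_mult) \<Rightarrow> 'a \<Rightarrow> 'a set \<Rightarrow> 'b" where
 "tau t x c = t (inverse (rep ((*) x ` c)) * x * rep c)"

context
 fixes L :: "'a::group_mult set" and P :: "'a set" and t :: "'a \<Rightarrow> 'b::group_mult" and A :: "'b set"
 assumes L: "grp L" and P: "grp P" "P \<subseteq> L" and t: "ghom t P" "t ` P \<subseteq> A" and A: "grp A" "ab A"
begin

interpretation A: comm_group "rec A" by (rule comm_group_rec[OF A])

lemma transfer_factor: assumes "x \<in> L" "c \<in> lcs L P"
 shows "inverse (rep ((*) x ` c)) * x * rep c \<in> P" "tau t x c \<in> A"
proof -
 note r = rep[OF L P assms(2)]
 have "(*) x ` c \<in> lcs L P" using lcs_shift[OF L assms(1), of P] assms(2) by (auto simp: bij_betw_def)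
 note r' = rep[OF L P this]
 have "(*) (rep ((*) x ` c)) ` P = (*) x ` c" using r'(2) by simp
 also have "\<dots> = (*) x ` (*) (rep c) ` P" using r(2) by simp
 also have "\<dots> = (*) (x * rep c) ` P" by (simp add: image_image mult.assoc)
 finally show "inverse (rep ((*) x ` c)) * x * rep c \<in> P" unfolding coset_eq_iff[OF P(1)] by (simp add: mult.assoc)
 thus "tau t x c \<in> A" unfolding tau_def using t(2) by blast
qed

text \<open>The factor of x y at c is the factor of x at y c times that of y at c, and c -> y c
  permutes the cosets.\<close>

lemma transfer_hom: "ghom (\<lambda>x. finprod (rec A) (tau t x) (lcs L P)) L"
 "(\<lambda>x. finprod (rec A) (tau t x) (lcs L P)) ` L \<subseteq> A"
proof -
 have Pi: "tau t x \<in> lcs L P \<rightarrow> carrier (rec A)" if "x \<in> L" for x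
  unfolding rec_simps by (rule funcsetI) (rule transfer_factor(2)[OF that])
 show "(\<lambda>x. finprod (rec A) (tau t x) (lcs L P)) ` L \<subseteq> A"
  using A.finprod_closed[OF Pi, unfolded rec_simps] by (rule image_subsetI)
 show "ghom (\<lambda>x. finprod (rec A) (tau t x) (lcs L P)) L" unfolding ghom_def
 proof (intro conjI ballI L)
  fix x y assume xy: "x \<in> L" "y \<in> L"
  note sh = lcs_shift[OF L xy(2), of P, unfolded bij_betw_def]
  have Pi': "(\<lambda>c. tau t x ((*) y ` c)) \<in> lcs L P \<rightarrow> carrier (rec A)" using Pi[OF xy(1)] sh by auto
  have e: "finprod (rec A) (tau t x) (lcs L P) = finprod (rec A) (\<lambda>c. tau t x ((*) y ` c)) (lcs L P)"
   using A.finprod_reindex[of "tau t x" "(`) ((*) y)" "lcs L P"] Pi[OF xy(1)] sh by simp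
  have "finprod (rec A) (tau t (x * y)) (lcs L P) =
   finprod (rec A) (\<lambda>c. tau t x ((*) y ` c) \<otimes>\<^bsub>rec A\<^esub> tau t y c) (lcs L P)"
  proof (rule A.finprod_cong'[OF refl])
   show "(\<lambda>c. tau t x ((*) y ` c) \<otimes>\<^bsub>rec A\<^esub> tau t y c) \<in> lcs L P \<rightarrow> carrier (rec A)"
    using Pi' Pi[OF xy(2)] A.m_closed by (auto simp: Pi_iff)
   fix c assume c: "c \<in> lcs L P"
   hence c': "(*) y ` c \<in> lcs L P" using sh by blast
   have i: "(*) (x * y) ` c = (*) x ` (*) y ` c" by (simp add: image_image mult.assoc)
   have "tau t (x * y) c = t ((inverse (rep ((*) x ` (*) y ` c)) * x * rep ((*) y ` c)) * (inverse (rep ((*) y ` c)) * y * rep c))"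
    unfolding tau_def i by (simp add: mult.assoc)
   thus "tau t (x * y) c = tau t x ((*) y ` c) \<otimes>\<^bsub>rec A\<^esub> tau t y c"
    using ghomD(2)[OF t(1) transfer_factor(1)[OF xy(1) c'] transfer_factor(1)[OF xy(2) c]] by (simp add: tau_def)
  qed
  thus "finprod (rec A) (tau t (x * y)) (lcs L P) = finprod (rec A) (tau t x) (lcs L P) * finprod (rec A) (tau t y) (lcs L P)"
   using A.finprod_multf[OF Pi' Pi[OF xy(2)]] e by simp
 qed
qed

text \<open>If \<open>t\<close> does not distinguish powers of \<open>x\<close> from their conjugates in \<open>P\<close>, each orbit of \<open>x\<close> on the
 cosets contributes \<open>t x\<close> to the power of its length.\<close>

lemma transfer_power:
 assumes x: "x \<in> P" and stab: "\<And>k g. g \<in> L \<Longrightarrow> cj g (x ^ k) \<in> P \<Longrightarrow> t (cj g (x ^ k)) = t (x ^ k)"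
 shows "finprod (rec A) (tau t x) (lcs L P) = t x ^ card (lcs L P)"
proof -
 have xL: "x \<in> L" using x P(2) by blast
 define s where "s j c = (*) (x ^ j) ` c" for j and c :: "'a set"
 have s0: "s 0 c = c" and sS: "(*) x ` s j c = s (Suc j) c" for j c
  by (simp_all add: s_def image_image mult.assoc)
 have sadd: "s i (s j c) = s (i + j) c" for i j c by (simp add: s_def image_image power_add mult.assoc)
 have inj: "s i c = s i d \<Longrightarrow> c = d" for i c d
 proof -
  assume "s i c = s i d"
  hence "(*) (inverse (x ^ i)) ` s i c = (*) (inverse (x ^ i)) ` s i d" by simp
  thus "c = d" by (simp add: s_def image_image)
 qed
 have fin: "finite (lcs L P)" by (rule finite_lcs[OF L])
 have "finprod (rec A) (tau t x) S = t x ^ card S" if "S \<subseteq> lcs L P" "\<forall>c\<in>S. (*) x ` c \<in> S" for S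
  using finite_subset[OF that(1) fin] that
 proof (induction S rule: finite_psubset_induct)
  case (psubset S)
  have Pi: "tau t x \<in> S \<rightarrow> carrier (rec A)" using transfer_factor(2)[OF xL] psubset.prems(1) by auto
  show ?case
  proof (cases "S = {}")
   case False
   then obtain c where c: "c \<in> S" by blast
   have sc: "s j c \<in> S" for j by (induction j) (use c psubset.prems(2) in "auto simp: s0 simp flip: sS")
   have "s (card L) c = c" using pow_card(1)[OF L xL] by (simp add: s_def)
   hence ex: "\<exists>k. k > 0 \<and> s k c = c" using grpD(8)[OF L] by blast
   define k where "k = (LEAST k. k > 0 \<and> s k c = c)"
   have k: "k > 0" "s k c = c" using LeastI_ex[OF ex] unfolding k_def by blast+
   have kmin: "s i c \<noteq> c" if "0 < i" "i < k" for i using not_less_Least[of i] that unfolding k_def by blast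
   have injk: "inj_on (\<lambda>j. s j c) {..<k}"
   proof (rule linorder_inj_onI)
    fix i j assume ij: "i < j" "i \<in> {..<k}" "j \<in> {..<k}"
    show "s i c \<noteq> s j c"
    proof
     assume "s i c = s j c"
     hence "s i c = s i (s (j - i) c)" using ij(1) by (simp add: sadd)
     hence "s (j - i) c = c" using inj by blast
     thus False using kmin[of "j - i"] ij by simp linarith
    qed
   qed auto
   define K where "K = (\<lambda>j. s j c) ` {..<k}"
   have OS: "K \<subseteq> S" using sc by (auto simp: K_def)
   have cO: "card K = k" unfolding K_def using card_image[OF injk] by simp
   have scl: "s j c \<in> lcs L P" for j using sc psubset.prems(1) by blast
   note cl = scl[of 0, unfolded s0]
   \<comment> \<open>Along an orbit the representatives cancel between consecutive factors, so the
     partial products telescope.\<close>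
   have part: "inverse (rep (s n c)) * x ^ n * rep c \<in> P \<and>
     finprod (rec A) (\<lambda>j. tau t x (s j c)) {..<n} = t (inverse (rep (s n c)) * x ^ n * rep c)" for n
   proof (induction n)
    case 0
    show ?case using grpD(2)[OF P(1)] ghomD(3)[OF t(1)] by (simp add: s0)
   next
    case (Suc n)
    define h where "h = inverse (rep (s (Suc n) c)) * x * rep (s n c)"
    have hP: "h \<in> P" and th: "tau t x (s n c) = t h"
     using transfer_factor(1)[OF xL scl, of n] by (simp_all add: h_def sS tau_def)
    have e: "inverse (rep (s (Suc n) c)) * x ^ Suc n * rep c = h * (inverse (rep (s n c)) * x ^ n * rep c)"
     by (simp add: h_def mult.assoc)
    have "finprod (rec A) (\<lambda>j. tau t x (s j c)) {..<Suc n} = tau t x (s n c) * finprod (rec A) (\<lambda>j. tau t x (s j c)) {..<n}"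
     unfolding lessThan_Suc by (subst A.finprod_insert) (use transfer_factor(2)[OF xL scl] in auto)
    thus ?case unfolding e th using Suc ghomD(2)[OF t(1) hP] grpD(3)[OF P(1) hP] by simp
   qed
   have e: "inverse (rep (s k c)) * x ^ k * rep c = cj (inverse (rep c)) (x ^ k)" using k(2) by (simp add: cj_def)
   have "finprod (rec A) (tau t x) K = finprod (rec A) (\<lambda>j. tau t x (s j c)) {..<k}" unfolding K_def
    by (rule A.finprod_reindex[OF _ injk]) (use transfer_factor(2)[OF xL scl] in auto)
   also have "\<dots> = t (cj (inverse (rep c)) (x ^ k))" using part[of k] unfolding e by blast
   also have "\<dots> = t (x ^ k)"
    using stab[OF grpD(4)[OF L rep(1)[OF L P cl]]] part[of k] unfolding e by blast
   also have "\<dots> = t x ^ k" using ghomD(5)[OF t(1) x] .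
   finally have fO: "finprod (rec A) (tau t x) K = t x ^ k" .
   have psub: "S - K \<subset> S" using k(1) OS c by (auto simp: K_def)
   have "\<forall>d\<in>S - K. (*) x ` d \<in> S - K"
   proof
    fix d assume d: "d \<in> S - K"
    have "(*) x ` d \<notin> K"
    proof
     assume "(*) x ` d \<in> K"
     then obtain j where j: "j < k" "s 1 d = s j c" by (auto simp: K_def s_def)
     show False
     proof (cases j)
      case 0
      hence "s 1 d = s 1 (s (k - 1) c)" using j(2) k by (simp add: sadd s0)
      hence "d = s (k - 1) c" by (rule inj)
      thus False using d k(1) by (auto simp: K_def)
     next
      case (Suc i)
      hence "s 1 d = s 1 (s i c)" using j(2) by (simp add: sadd)
      hence "d = s i c" by (rule inj)
      thus False using d j(1) Suc by (auto simp: K_def)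
     qed
    qed
    thus "(*) x ` d \<in> S - K" using psubset.prems(2) d by blast
   qed
   hence IH: "finprod (rec A) (tau t x) (S - K) = t x ^ card (S - K)"
    using psubset.IH[OF psub] psubset.prems(1) by blast
   have fins: "finite K" "finite (S - K)" using psubset.hyps OS finite_subset by auto
   have "finprod (rec A) (tau t x) (K \<union> (S - K)) = t x ^ k * t x ^ card (S - K)"
    by (subst A.finprod_Un_disjoint[OF fins]) (use Pi OS fO IH in auto)
   moreover have "K \<union> (S - K) = S" using OS by blast
   moreover have "k + card (S - K) = card S" using card_Diff_subset[OF fins(1) OS] card_mono[OF psubset.hyps OS] cO by simp
   ultimately show ?thesis by (simp flip: power_add)
  qed simp
 qed
 moreover have "\<forall>c\<in>lcs L P. (*) x ` c \<in> lcs L P" using lcs_shift[OF L xL, of P] by (auto simp: bij_betw_def)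
 ultimately show ?thesis by blast
qed

end

section \<open>Structure of the Sylow subgroups of the minimal counterexample\<close>

context minimal_counterexample
begin

lemma abelian_hom_trivial:
 fixes t :: "gp \<Rightarrow> 'b::group_mult"
 assumes t: "ghom t G" "ab (t ` G)" and x: "x \<in> G" shows "t x = 1"
proof -
 have "t ` G = t ` der G" using perfect by simp
 also have "\<dots> = der (t ` G)" using der_img[OF t(1) grp_G] by simp
 also have "\<dots> = {1}" by (rule der_ab[OF grp_img[OF t(1)] t(2)])
 finally show ?thesis using x by blast
qed

text \<open>Fusion in \<open>P\<close> is controlled by its normalizer, so the transfer sends x to t
  x to the power |G:P|. As \<open>G\<close> is perfect this is 1, and the index is prime to the
  order of x.\<close>

lemma stable_hom_trivial:
 fixes t :: "gp \<Rightarrow> gp"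
 assumes p: "prime p" and P: "syl p P G" and t: "ghom t P" "ab (t ` P)" and x: "x \<in> P"
  and inv: "\<And>n k. n \<in> nz G P \<Longrightarrow> t (cj n (x ^ k)) = t (x ^ k)"
 shows "t x = 1"
proof -
 note gP = sylD(3)[OF P] and PG = sylD(4)[OF P]
 define A where "A = t ` P"
 have A: "grp A" "ab A" "t ` P \<subseteq> A" unfolding A_def using grp_img[OF t(1)] t(2) by blast+
 have stab: "t (cj g (x ^ k)) = t (x ^ k)" if g: "g \<in> G" and c: "cj g (x ^ k) \<in> P" for g k
 proof (cases "x ^ k = 1")
  case False
  define y where "y = x ^ k"
  \<comment> \<open>\<open>P\<close> and its conjugate by g^-1 both contain y, so they are conjugate
    by some c centralizing y, and then g c normalizes \<open>P\<close>.\<close>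
  have P2: "syl p (cj (inverse g) ` P) G" by (rule syl_cj_in[OF P grpD(4)[OF grp_G g]])
  have "y \<in> cj (inverse g) ` P" by (rule image_eqI[OF _ c]) (simp add: y_def)
  moreover have "y \<in> P" "y \<noteq> 1" using grpD(5)[OF gP x] False by (simp_all add: y_def)
  ultimately obtain c where c: "c \<in> cz G {y}" "cj (inverse g) ` P = cj c ` P"
   using sylow_conj_centralizer[OF p _ _ P P2, of "{y}"] by blast
  have cG: "c \<in> G" "c * y = y * c" using c(1) by (auto simp: cz_def)
  have "cj g ` (cj (inverse g) ` P) = cj g ` (cj c ` P)" using c(2) by simp
  hence "cj (g * c) ` P = P" by (simp add: cj_img_comp)
  hence "g * c \<in> nz G P" using grpD(3)[OF grp_G g cG(1)] by (simp add: nz_def)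
  hence "t (cj (g * c) y) = t y" unfolding y_def by (rule inv)
  moreover have "cj (g * c) y = cj g y" using cG(2) by (metis cj_cj cj_eq_iff)
  ultimately show ?thesis by (simp add: y_def)
 qed simp
 note tr = transfer_hom[OF grp_G gP PG t(1) A(3,1,2)]
 have "finprod (rec A) (tau t x) (lcs G P) = 1"
  using abelian_hom_trivial[OF tr(1) ab_sub[OF A(2) tr(2)]] x PG by blast
 moreover have "finprod (rec A) (tau t x) (lcs G P) = t x ^ card (lcs G P)"
  by (rule transfer_power[OF grp_G gP PG t(1) A(3,1,2) x stab])
 ultimately have e1: "t x ^ card (lcs G P) = 1" by simp
 have e2: "t x ^ card P = 1" using pow_card(1)[OF gP x] ghomD(5)[OF t(1) x, of "card P"] ghomD(3)[OF t(1)] by simp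
 obtain k where "card P = p ^ k" using sylD(2)[OF P] by (auto simp: pgr_def)
 hence "coprime (card (lcs G P)) (card P)"
  using sylD(5)[OF P] p by (simp add: prime_imp_coprime coprime_commute)
 thus ?thesis using pow_coprime_one[OF A(1) _ e1 e2] x by (simp add: A_def)
qed

context
 fixes p :: nat and P :: "gp set"
 assumes p: "prime p" "p dvd card G" and P: "syl p P G"
begin

lemma sylow_nontriv: "P \<noteq> {1}" by (rule syl_nontriv[OF P p])

lemma sylow_normalizer: "grp (nz G P)" "nz G P \<subset> G" "Good (nz G P)" "solv (nz G P)" "nml P (nz G P)" "syl p P (nz G P)"
proof -
 note gP = sylD(3)[OF P] and PG = sylD(4)[OF P]
 show a: "grp (nz G P)" "nz G P \<subset> G" "Good (nz G P)" "solv (nz G P)"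
  by (rule proper_nz[OF gP PG sylow_nontriv pgr_proper[OF sylD(2)[OF P] p(1)]])+
 show "nml P (nz G P)" by (rule nml_nz[OF gP grp_G PG])
 show "syl p P (nz G P)" by (rule syl_sub[OF P a(1) nz_self[OF gP PG] nz_sub])
qed

text \<open>In the quotient of the normalizer by a subgroup \<open>B\<close> as in
  \<open>abelian_of_focal\<close>, the image of \<open>P\<close> is centralized by that of the
  normalizer, hence abelian. Transfer then makes the quotient map trivial on
  \<open>P\<close>.\<close>

lemma sylow_abelian: "ab P"
proof (rule abelian_of_focal[OF sylow_normalizer(3,5,6) p(1) odd_prime[OF p]])
 note gP = sylD(3)[OF P] and PG = sylD(4)[OF P]
 fix B assume B: "nml B (nz G P)" "B \<subseteq> P" and inv: "\<And>n x. n \<in> nz G P \<Longrightarrow> x \<in> P \<Longrightarrow> inverse x * cj n x \<in> B"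
 define N where "N = nz G P"
 have PN: "P \<subseteq> N" unfolding N_def by (rule nz_self[OF gP PG])
 obtain f :: "gp \<Rightarrow> gp" where f: "ghom f N" "ker f N = B" using quotient_exists[OF B(1)] unfolding N_def by blast
 have fi: "f (cj n x) = f x" if n: "n \<in> N" and x: "x \<in> P" for n x
 proof -
  have "cj n x \<in> P" using n x nz_D unfolding N_def by blast
  moreover have "inverse x * cj n x \<in> ker f N" using inv[of n x] n x f(2) by (simp add: N_def)
  ultimately have "f x = f (cj n x)" using ghom_eq_iff[OF f(1), of x "cj n x"] x PN by blast
  thus ?thesis by (rule sym)
 qed
 have "ab (f ` P)" unfolding ab_def
 proof (intro ballI)
  fix u v assume "u \<in> f ` P" "v \<in> f ` P"
  then obtain a b where ab: "a \<in> P" "b \<in> P" "u = f a" "v = f b" by blast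
  have "a \<in> N" "b \<in> N" using ab PN by blast+
  hence "cj u v = v" using fi[of a b] ghomD(6)[OF f(1), of a b] ab by simp
  thus "u * v = v * u" by (simp add: cj_eq_iff)
 qed
 hence "f x = 1" if "x \<in> P" for x
  using stable_hom_trivial[OF p(1) P ghom_sub[OF f(1) gP PN] _ that] fi grpD(5)[OF gP that] by (simp add: N_def)
 hence "P \<subseteq> ker f N" using PN by (auto simp: ker_def)
 thus "B = P" using B(2) f(2) by blast
qed

text \<open>Transfer into \<open>P\<close> itself, with the identity as homomorphism.\<close>

lemma sylow_centralizer_normalizer: "P \<inter> cz G (nz G P) = {1}"
proof -
 note gP = sylD(3)[OF P]
 have id: "ghom id P" "id ` P = P" using gP by (simp_all add: ghom_def)
 have "x = 1" if x: "x \<in> P \<inter> cz G (nz G P)" for x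
 proof -
  have "cj n x = x" if "n \<in> nz G P" for n using x that by (auto simp: cz_def cj_eq_iff)
  hence "id x = 1" using x sylow_abelian by (intro stable_hom_trivial[OF p(1) P id(1)]) (simp_all add: cj_pow)
  thus ?thesis by simp
 qed
 thus ?thesis using grpD(2)[OF gP] grpD(2)[OF grp_cz[OF grp_G]] by blast
qed

text \<open>With rank at most two \<open>P\<close> would be central in its normalizer, the situation
  of Burnside's transfer theorem.\<close>

lemma sylow_rank_three: "p ^ 3 \<le> card (Om p P)"
proof (rule ccontr)
 assume "\<not> p ^ 3 \<le> card (Om p P)"
 hence small: "card (Om p P) < p ^ 3" by simp
 note gP = sylD(3)[OF P] and PG = sylD(4)[OF P]
 define N where "N = nz G P"
 have N: "grp N" "N \<subseteq> G" "Good N" "nml P N" "syl p P N" using sylow_normalizer unfolding N_def by auto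
 note PN = sylD(4)[OF N(5)]
 have Qc: "Q \<subseteq> cz N P" if "syl p Q N" for Q
  using syl_normal_unique[OF N(5,4) p(1) that] PN sylow_abelian by (auto simp: cz_def ab_def)
 have "cz N P = N" by (rule small_rank_central[OF N(3,4) sylD(2)[OF P] p(1) sylow_abelian small Qc])
 have "P \<subseteq> cz G (nz G P)"
 proof
  fix x assume x: "x \<in> P"
  have "n * x = x * n" if "n \<in> N" for n
  proof -
   have "n \<in> cz N P" using that \<open>cz N P = N\<close> by simp
   thus ?thesis using x by (simp add: cz_def)
  qed
  thus "x \<in> cz G (nz G P)" using x PG unfolding N_def[symmetric] by (auto simp: cz_def)
 qed
 hence "P = {1}" using sylow_centralizer_normalizer by blast
 thus False using sylow_nontriv by blast
qed

end

end

section \<open>Signalizers\<close>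

definition inv_by :: "'a::group_mult set \<Rightarrow> 'a set \<Rightarrow> bool" where
 "inv_by P Y \<longleftrightarrow> (\<forall>x\<in>P. \<forall>y\<in>Y. cj x y \<in> Y)"

lemma inv_byD: "inv_by P Y \<Longrightarrow> x \<in> P \<Longrightarrow> y \<in> Y \<Longrightarrow> cj x y \<in> Y"
 by (simp add: inv_by_def)

lemma inv_by_Int: "inv_by P A \<Longrightarrow> inv_by P B \<Longrightarrow> inv_by P (A \<inter> B)"
 by (simp add: inv_by_def)

lemma inv_by_nml: "nml N L \<Longrightarrow> P \<subseteq> L \<Longrightarrow> inv_by P N"
 unfolding inv_by_def nml_def by blast

lemma inv_by_img: assumes "inv_by P Y" "finite Y" "x \<in> P" shows "cj x ` Y = Y"
 by (rule endo_inj_surj[OF assms(2) _ inj_cj]) (use assms(1,3) in "auto simp: inv_by_def")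

lemma inv_by_cj: assumes "grp L" "c \<in> cz L P" "inv_by P Y" shows "inv_by P (cj c ` Y)"
 unfolding inv_by_def
proof (intro ballI)
 fix x z assume x: "x \<in> P" and "z \<in> cj c ` Y"
 then obtain y where y: "y \<in> Y" "z = cj c y" by blast
 have "c * x = x * c" using assms(2) x by (simp add: cz_def)
 hence "cj x z = cj c (cj x y)" by (simp add: y(2) cj_cj)
 thus "cj x z \<in> cj c ` Y" using inv_byD[OF assms(3) x y(1)] by simp
qed

lemma inv_by_cz: assumes "inv_by P Y" "\<And>x d. x \<in> P \<Longrightarrow> d \<in> D \<Longrightarrow> cj x d = d" shows "inv_by P (cz Y D)"
 unfolding inv_by_def
proof (intro ballI)
 fix x y assume xy: "x \<in> P" "y \<in> cz Y D"
 have "cj x y * d = d * cj x y" if d: "d \<in> D" for d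
 proof -
  have "y * d = d * y" using xy(2) d by (simp add: cz_def)
  hence "cj x (y * d) = cj x (d * y)" by simp
  thus ?thesis using assms(2)[OF xy(1) d] by (simp add: cj_mult)
 qed
 thus "cj x y \<in> cz Y D" using xy inv_byD[OF assms(1)] by (simp add: cz_def)
qed

lemma transporter:
 assumes K: "grp K" "x \<in> K" shows "{a \<in> K. cj a ` R = cj x ` R} = (*) x ` nz K R"
proof (rule Set.set_eqI, rule iffI)
 fix a assume a: "a \<in> {a \<in> K. cj a ` R = cj x ` R}"
 hence "cj (inverse x) ` (cj a ` R) = cj (inverse x) ` (cj x ` R)" by simp
 hence "inverse x * a \<in> nz K R" using a grpD(3)[OF K(1) grpD(4)[OF K]] by (simp add: nz_def cj_img_comp)
 thus "a \<in> (*) x ` nz K R" by (rule rev_image_eqI) simp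
next
 fix a assume "a \<in> (*) x ` nz K R"
 then obtain n where n: "n \<in> K" "cj n ` R = R" "a = x * n" by (auto simp: nz_def)
 thus "a \<in> {a \<in> K. cj a ` R = cj x ` R}" using grpD(3)[OF K n(1)] by (simp flip: cj_img_comp)
qed

context
 fixes P K :: "'a::group_mult set" and p :: nat
 assumes P: "pgr p P" "prime p" and K: "grp K" "\<not> p dvd card K" "inv_by P K"
begin

lemma cj_img_K: "x \<in> P \<Longrightarrow> cj x ` K = K"
 by (rule inv_by_img[OF K(3) grpD(1)[OF K(1)]])

text \<open>The number of Sylow q-subgroups of \<open>K\<close> divides |K|, so it is prime to p and
  \<open>P\<close> fixes one of them.\<close>

lemma invariant_sylow_ex: assumes q: "prime q" shows "\<exists>R. syl q R K \<and> inv_by P R"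
proof -
 obtain R0 where R0: "syl q R0 K" using syl_exists[OF K(1) q] by blast
 define S where "S = {R. syl q R K}"
 have S: "S = (\<lambda>x. cj x ` R0) ` K"
 proof (rule Set.set_eqI, rule iffI)
  fix R assume "R \<in> S"
  then obtain x where "x \<in> K" "R = cj x ` R0" using syl_conj[OF R0 _ q, of R] by (auto simp: S_def)
  thus "R \<in> (\<lambda>x. cj x ` R0) ` K" by (rule rev_image_eqI)
 qed (use syl_cj_in[OF R0] in "auto simp: S_def")
 have "card K = card S * card (nz K R0)" unfolding S
 proof (rule card_fibres[OF grpD(1)[OF K(1)]])
  fix R assume "R \<in> (\<lambda>x. cj x ` R0) ` K"
  then obtain x where x: "x \<in> K" "R = cj x ` R0" by blast
  have "{a \<in> K. cj a ` R0 = R} = (*) x ` nz K R0" unfolding x(2) by (rule transporter[OF K(1) x(1)])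
  thus "card {a \<in> K. cj a ` R0 = R} = card (nz K R0)" by simp
 qed
 hence nd: "\<not> p dvd card S" using K(2) by auto
 have fin: "finite S" unfolding S using grpD(1)[OF K(1)] by simp
 have "\<exists>R\<in>S. \<forall>g\<in>P. cj g ` R = R"
 proof (rule pgr_fixpoint[OF P fin _ _ _ nd])
  fix g R assume gR: "g \<in> P" "R \<in> S"
  hence "syl q (cj g ` R) (cj g ` K)" using syl_cj by (auto simp: S_def)
  thus "cj g ` R \<in> S" using cj_img_K[OF gR(1)] by (simp add: S_def)
 qed (simp_all add: cj_img_comp)
 then obtain R where R: "syl q R K" "\<And>g. g \<in> P \<Longrightarrow> cj g ` R = R" by (auto simp: S_def)
 have "inv_by P R" unfolding inv_by_def using R(2) by blast
 thus ?thesis using R(1) by blast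
qed

text \<open>The elements of \<open>K\<close> carrying one Sylow subgroup to the other form a coset
  of a normalizer, of size prime to p, on which \<open>P\<close> acts by conjugation; a fixed
  element centralizes \<open>P\<close>.\<close>

lemma invariant_sylow_conj:
 assumes q: "prime q" and R: "syl q R1 K" "inv_by P R1" "syl q R2 K" "inv_by P R2"
 shows "\<exists>c\<in>cz K P. R2 = cj c ` R1"
proof -
 note g1 = sylD(3)[OF R(1)] and g2 = sylD(3)[OF R(3)]
 obtain x where x: "x \<in> K" "R2 = cj x ` R1" using syl_conj[OF R(1,3) q] by blast
 define S where "S = {k \<in> K. cj k ` R1 = R2}"
 have S: "S = (*) x ` nz K R1" unfolding S_def x(2) by (rule transporter[OF K(1) x(1)])
 have "card S dvd card K" unfolding S using lagrange_dvd[OF K(1) grp_nz[OF K(1)] nz_sub] by simp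
 hence nd: "\<not> p dvd card S" using K(2) dvd_trans by blast
 have fin: "finite S" using grpD(1)[OF K(1)] by (simp add: S_def)
 have "\<exists>k\<in>S. \<forall>g\<in>P. cj g k = k"
 proof (rule pgr_fixpoint[OF P fin _ _ _ nd])
  fix g k assume g: "g \<in> P" and k: "k \<in> S"
  have gi: "inverse g \<in> P" by (rule grpD(4)[OF pgr_grp[OF P(1)] g])
  have "cj (cj g k) ` R1 = cj g ` (cj k ` (cj (inverse g) ` R1))" by (simp only: cj_img_comp) (simp add: cj_def[of g k] mult.assoc)
  also have "\<dots> = R2" using k inv_by_img[OF R(2) grpD(1)[OF g1] gi] inv_by_img[OF R(4) grpD(1)[OF g2] g] by (simp add: S_def)
  finally show "cj g k \<in> S" using inv_byD[OF K(3) g] k by (simp add: S_def)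
 qed (simp_all add: cj_cj)
 then obtain k where k: "k \<in> S" "\<And>g. g \<in> P \<Longrightarrow> cj g k = k" by blast
 have "k * g = g * k" if "g \<in> P" for g using k(2)[OF that] by (simp add: cj_eq_iff)
 hence "k \<in> cz K P" using k(1) by (simp add: cz_def S_def)
 thus ?thesis using k(1) by (auto simp: S_def)
qed

end

text \<open>Take a maximal invariant q-subgroup B of \<open>K\<close> above \<open>A\<close>. Its
  normalizer in \<open>K\<close> has an invariant Sylow q-subgroup, which is B by maximality; as
  normalizers grow in q-groups, B is a Sylow subgroup of \<open>K\<close>.\<close>

lemma invariant_sylow:
 assumes P: "pgr p P" "prime p" and K: "grp K" "\<not> p dvd card K" "inv_by P K"
  and q: "prime q" and A: "pgr q A" "A \<subseteq> K" "inv_by P A"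
 shows "\<exists>R. syl q R K \<and> inv_by P R \<and> A \<subseteq> R"
proof -
 define Q where "Q B \<longleftrightarrow> pgr q B \<and> B \<subseteq> K \<and> inv_by P B \<and> A \<subseteq> B" for B
 have QA: "Q A" using A by (simp add: Q_def)
 have "\<forall>B. Q B \<longrightarrow> card B < Suc (card K)" using card_mono[OF grpD(1)[OF K(1)]] by (auto simp: Q_def less_Suc_eq_le)
 hence "\<exists>B. Q B \<and> (\<forall>B'. Q B' \<longrightarrow> card B' \<le> card B)" by (rule ex_has_greatest_nat[where P=Q and f=card, OF QA])
 then obtain B where B: "Q B" "\<And>B'. Q B' \<Longrightarrow> card B' \<le> card B" by blast
 have pB: "pgr q B" "B \<subseteq> K" "inv_by P B" "A \<subseteq> B" using B(1) by (auto simp: Q_def)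
 note gB = pgr_grp[OF pB(1)]
 define N where "N = nz K B"
 have gN: "grp N" "N \<subseteq> K" unfolding N_def by (rule grp_nz[OF K(1)], rule nz_sub)
 have nB: "nml B N" unfolding N_def by (rule nml_nz[OF gB K(1) pB(2)])
 have invN: "inv_by P N" unfolding inv_by_def
 proof (intro ballI)
  fix x n assume x: "x \<in> P" and n: "n \<in> N"
  have xi: "inverse x \<in> P" by (rule grpD(4)[OF pgr_grp[OF P(1)] x])
  have "cj (cj x n) ` B = cj x ` (cj n ` (cj (inverse x) ` B))" by (simp only: cj_img_comp) (simp add: cj_def[of x n] mult.assoc)
  also have "\<dots> = B"
   using inv_by_img[OF pB(3) grpD(1)[OF gB] xi] inv_by_img[OF pB(3) grpD(1)[OF gB] x] nmlD(5)[OF nB n] by simp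
  finally show "cj x n \<in> N" using inv_byD[OF K(3) x] n gN(2) by (auto simp: N_def nz_def)
 qed
 have nd: "\<not> p dvd card N" using lagrange_dvd[OF K(1) gN] K(2) dvd_trans by blast
 obtain R where R: "syl q R N" "inv_by P R" using invariant_sylow_ex[OF P gN(1) nd invN q] by blast
 have BR: "B \<subseteq> R"
 proof -
  obtain x where x: "x \<in> N" "B \<subseteq> cj x ` R" using syl_contains_conj[OF R(1) q pB(1) nmlD(3)[OF nB]] by blast
  have "cj (inverse x) ` B \<subseteq> cj (inverse x) ` (cj x ` R)" using x(2) by (rule image_mono)
  thus ?thesis using nmlD(5)[OF nB grpD(4)[OF gN(1) x(1)]] by simp
 qed
 have "Q R" using sylD(2,4)[OF R(1)] gN(2) R(2) BR pB(4) by (auto simp: Q_def)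
 hence "R = B" using subgroup_eq_card[OF sylD(3)[OF R(1)] BR] B(2) by simp
 hence sB: "syl q B N" using R(1) by simp
 obtain S where S: "syl q S K" "B \<subseteq> S" using syl_extends[OF K(1) q pB(1,2)] by blast
 have "B = S"
 proof (rule ccontr)
  assume "B \<noteq> S"
  hence gr: "B \<subset> nz S B" using pgr_nz_grows[OF sylD(2)[OF S(1)] q gB] S(2) by blast
  have SN: "nz S B \<subseteq> N" using sylD(4)[OF S(1)] by (auto simp: N_def nz_def)
  have "pgr q (nz S B)" by (rule pgr_sub[OF sylD(2)[OF S(1)] q grp_nz[OF sylD(3)[OF S(1)]] nz_sub])
  thus False using syl_max[OF sB q _ _ SN] gr by blast
 qed
 thus ?thesis using S pB by blast
qed

text \<open>The centralizer D of the Fitting subgroup of \<open>K\<close> has its Sylow subgroups in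
  the cores, so \<open>U\<close> centralizes D. For y in \<open>K\<close> and w in \<open>U\<close>
  the element y^-1 (w y w^-1) centralizes every core, hence lies in D. So the coset y D is invariant
  and has a fixed point; as D is fixed, so is y.\<close>

lemma coprime_fitting:
 fixes K :: "'a::group_mult set"
 assumes U: "pgr p U" "prime p" and K: "solv K" "\<not> p dvd card K" "inv_by U K"
  and F: "\<And>t v x. prime t \<Longrightarrow> v \<in> U \<Longrightarrow> x \<in> core {t} K \<Longrightarrow> v * x = x * v"
  and v: "v \<in> U" and y: "y \<in> K"
 shows "v * y = y * v"
proof -
 have gK: "grp K" using solv_grp[OF K(1)] .
 have gU: "grp U" using pgr_grp[OF U(1)] .
 define D where "D = {x \<in> K. \<forall>t. prime t \<longrightarrow> (\<forall>y\<in>core {t} K. x * y = y * x)}"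
 note fit = fitting[OF K(1), folded D_def]
 note gD = nmlD(1)[OF fit(1)] and DK = nmlD(3)[OF fit(1)]
 have nd: "\<not> p dvd card D" using lagrange_dvd[OF gK gD DK] K(2) dvd_trans by blast
 have DU: "cz D U = D"
 proof (rule all_sylow[OF gD grp_cz[OF gD] cz_sub])
  fix t :: nat assume t: "prime t"
  obtain T where T: "syl t T D" using syl_exists[OF gD t] by blast
  have "T \<subseteq> cz D U"
  proof
   fix x assume x: "x \<in> T"
   have xD: "x \<in> D" using x sylD(4)[OF T] by blast
   obtain n where n: "od x = t ^ n" using pgr_od[OF sylD(2)[OF T] t x] .
   have "x ^ (t ^ n) = 1" using od(2)[OF gD xD] n by simp
   hence "x \<in> core {t} K" by (rule fit(3)[OF t xD])
   thus "x \<in> cz D U" using F[OF t _ \<open>x \<in> core {t} K\<close>] xD by (simp add: cz_def)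
  qed
  thus "\<exists>P. syl t P D \<and> P \<subseteq> cz D U" using T by blast
 qed
 have UD: "cj w d = d" if "w \<in> U" "d \<in> D" for w d
 proof -
  have "d \<in> cz D U" using that(2) DU by simp
  thus ?thesis using that(1) by (simp add: cz_def cj_eq_iff)
 qed
 have "inverse y * cj w y \<in> D" if w: "w \<in> U" for w
  unfolding D_def
 proof (intro CollectI conjI allI impI ballI)
  have "cj w y \<in> K" by (rule inv_byD[OF K(3) w y])
  thus "inverse y * cj w y \<in> K" using grpD(3)[OF gK grpD(4)[OF gK y]] by blast
  fix t :: nat and f assume t: "prime t" and f: "f \<in> core {t} K"
  have wf: "cj w g = g" if "g \<in> core {t} K" for g using F[OF t w that] by (simp add: cj_eq_iff)
  have wif: "cj (inverse w) f = f" using F[OF t grpD(4)[OF gU w] f] by (simp add: cj_eq_iff)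
  have "cj (inverse y * cj w y) f = cj (inverse y) (cj w (cj y (cj (inverse w) f)))"
   by (simp add: cj_cj) (simp add: cj_def gsimps)
  also have "\<dots> = f" using wif wf[OF nmlD(4)[OF core(1)[OF gK] y f]] by simp
  finally show "inverse y * cj w y * f = f * (inverse y * cj w y)" by (simp add: cj_eq_iff)
 qed
 then obtain n where n: "n \<in> D" "\<And>b. b \<in> U \<Longrightarrow> b * (y * n) = (y * n) * b"
  using coset_fixpoint[OF U gD nd, of y] UD by fastforce
 have "cj v (y * n) = y * n" using n(2)[OF v] by (simp add: cj_eq_iff)
 hence "cj v y = y" using UD[OF v n(1)] by (simp add: cj_mult)
 thus ?thesis by (simp add: cj_eq_iff)
qed

section \<open>Maximal invariant q-subgroups and the first uniqueness theorem\<close>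

context minimal_counterexample
begin

definition maximal :: "gp set \<Rightarrow> bool" where
 "maximal M \<longleftrightarrow> grp M \<and> M \<subset> G \<and> (\<forall>L. grp L \<longrightarrow> M \<subseteq> L \<longrightarrow> L \<subset> G \<longrightarrow> L = M)"

lemma proper_cz: assumes "a \<in> A" "a \<noteq> 1" "A \<subseteq> G" shows "grp (cz G A)" "cz G A \<subset> G" "Good (cz G A)" "solv (cz G A)"
proof -
 show g: "grp (cz G A)" by (rule grp_cz[OF grp_G])
 have aG: "a \<in> G" using assms by blast
 have "cz G A \<noteq> G"
 proof
  assume e: "cz G A = G"
  have c: "x * a = a * x" if "x \<in> G" for x
  proof -
   have "x \<in> cz G A" using that e by simp
   thus ?thesis using assms(1) by (simp add: cz_def)
  qed
  define Z where "Z = cz G G"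
  have aZ: "a \<in> Z" using c aG by (simp add: Z_def cz_def)
  have "nml Z G" unfolding Z_def by (rule nml_cz[OF nml_refl[OF grp_G]])
  hence "Z = G" using simple aZ assms(2) by blast
  hence "ab G" unfolding ab_def Z_def cz_def by blast
  thus False using not_ab by blast
 qed
 thus s: "cz G A \<subset> G" using cz_sub[of G A] by blast
 show "Good (cz G A)" by (rule Good_sub[OF Good_G g cz_sub])
 show "solv (cz G A)" by (rule proper_solv[OF g s])
qed

context
 fixes p :: nat and P :: "gp set"
 assumes p: "prime p" "p dvd card G" and P: "syl p P G"
begin

lemma grp_P: "grp P" and P_sub: "P \<subseteq> G" and pgr_P: "pgr p P"
 using sylD[OF P] by auto

lemma in_core:
 assumes H: "grp H" "H \<subset> G" "P \<subseteq> H" and Y: "grp Y" "Y \<subseteq> H" "\<not> p dvd card Y" "inv_by P Y"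
 shows "Y \<subseteq> core (- {p}) H"
proof -
 have HG: "H \<subseteq> G" using H(2) by blast
 show ?thesis
  by (rule p_length_one(3)[OF Good_sub[OF Good_G H(1) HG] proper_solv[OF H(1,2)] p(1) syl_sub[OF P H(1,3) HG] Y(1-3) inv_byD[OF Y(4)]])
qed

definition mq :: "nat \<Rightarrow> gp set \<Rightarrow> bool" where
 "mq q Q \<longleftrightarrow> pgr q Q \<and> Q \<subseteq> G \<and> inv_by P Q \<and> (\<forall>R. pgr q R \<longrightarrow> R \<subseteq> G \<longrightarrow> inv_by P R \<longrightarrow> Q \<subseteq> R \<longrightarrow> R = Q)"

lemma mq_extend: assumes "pgr q A" "A \<subseteq> G" "inv_by P A" shows "\<exists>Q. mq q Q \<and> A \<subseteq> Q"
proof -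
 define S where "S B \<longleftrightarrow> pgr q B \<and> B \<subseteq> G \<and> inv_by P B \<and> A \<subseteq> B" for B
 have SA: "S A" using assms by (simp add: S_def)
 have "\<forall>B. S B \<longrightarrow> card B < Suc (card G)" using card_mono[OF grpD(1)[OF grp_G]] by (auto simp: S_def less_Suc_eq_le)
 hence "\<exists>B. S B \<and> (\<forall>B'. S B' \<longrightarrow> card B' \<le> card B)" by (rule ex_has_greatest_nat[where P=S and f=card, OF SA])
 then obtain B where B: "S B" "\<And>B'. S B' \<Longrightarrow> card B' \<le> card B" by blast
 have "R = B" if R: "pgr q R" "R \<subseteq> G" "inv_by P R" "B \<subseteq> R" for R
 proof -
  have "S R" using R B(1) by (auto simp: S_def)
  thus ?thesis using subgroup_eq_card[OF pgr_grp[OF R(1)] R(4)] B(2) by simp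
 qed
 hence "mq q B" using B(1) by (simp add: mq_def S_def)
 thus ?thesis using B(1) by (auto simp: S_def)
qed

lemma mq_cj: assumes "mq q Q" "c \<in> cz G P" shows "mq q (cj c ` Q)"
proof -
 have cG: "c \<in> G" using assms(2) cz_sub by blast
 have ci: "inverse c \<in> cz G P" by (rule grpD(4)[OF grp_cz[OF grp_G] assms(2)])
 have m: "pgr q Q" "Q \<subseteq> G" "inv_by P Q" "\<And>R. pgr q R \<Longrightarrow> R \<subseteq> G \<Longrightarrow> inv_by P R \<Longrightarrow> Q \<subseteq> R \<Longrightarrow> R = Q"
  using assms(1) by (auto simp: mq_def)
 have sub: "cj d ` R \<subseteq> G" if "d \<in> G" "R \<subseteq> G" for d R using image_mono[OF that(2), of "cj d"] cj_img_grp[OF grp_G that(1)] by simp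
 show ?thesis unfolding mq_def
 proof (intro conjI allI impI)
  show "pgr q (cj c ` Q)" "cj c ` Q \<subseteq> G" "inv_by P (cj c ` Q)"
   using pgr_cj[OF m(1)] sub[OF cG m(2)] inv_by_cj[OF grp_G assms(2) m(3)] .
  fix R assume R: "pgr q R" "R \<subseteq> G" "inv_by P R" "cj c ` Q \<subseteq> R"
  have "Q \<subseteq> cj (inverse c) ` R" using image_mono[OF R(4), of "cj (inverse c)"] by simp
  hence "cj (inverse c) ` R = Q"
   by (rule m(4)[OF pgr_cj[OF R(1)] sub[OF grpD(4)[OF grp_G cG] R(2)] inv_by_cj[OF grp_G ci R(3)]])
  thus "R = cj c ` Q" by (metis cj_img_cancel(2))
 qed
qed

lemma Om_P: "grp (Om p P)" "ab (Om p P)" "Om p P \<subseteq> P" "x \<in> Om p P \<Longrightarrow> x ^ p = 1"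
 using Om[OF grp_P sylow_abelian[OF p P], where p=p] by auto

text \<open>Thompson's transitivity theorem, by upward induction on D = Q1 \<inter> Q2. It suffices
  to find a proper H containing \<open>P\<close> in which both groups have more than |D| elements:
  the intersections with H lie in O_p'(H) by p-length one, and invariant Sylow subgroups there are
  conjugate under the centralizer of \<open>P\<close>. For D non-trivial H is the normalizer of
  D.\<close>

lemma transitivity:
 assumes q: "prime q" "q \<noteq> p" and Q: "mq q Q1" "mq q Q2"
 shows "\<exists>c\<in>cz G P. Q2 = cj c ` Q1"
 using Q
proof (induction "card G - card (Q1 \<inter> Q2)" arbitrary: Q1 Q2 rule: less_induct)
 case less
 have m1: "pgr q Q1" "Q1 \<subseteq> G" "inv_by P Q1" "\<And>R. pgr q R \<Longrightarrow> R \<subseteq> G \<Longrightarrow> inv_by P R \<Longrightarrow> Q1 \<subseteq> R \<Longrightarrow> R = Q1"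
  and m2: "pgr q Q2" "Q2 \<subseteq> G" "inv_by P Q2" "\<And>R. pgr q R \<Longrightarrow> R \<subseteq> G \<Longrightarrow> inv_by P R \<Longrightarrow> Q2 \<subseteq> R \<Longrightarrow> R = Q2"
  using less.prems by (auto simp: mq_def)
 show ?case
 proof (cases "Q1 = Q2")
  case True
  thus ?thesis using grpD(2)[OF grp_cz[OF grp_G]] by (intro bexI[of _ 1]) auto
 next
  case False
  define D where "D = Q1 \<inter> Q2"
  note g1 = pgr_grp[OF m1(1)] and g2 = pgr_grp[OF m2(1)]
  have gD: "grp D" "D \<subseteq> G" unfolding D_def using grp_Int[OF g1 g2] m1(2) by blast+
  have D1: "D \<subset> Q1" and D2: "D \<subset> Q2" unfolding D_def using False m1(4)[OF m2(1-3)] m2(4)[OF m1(1-3)] by blast+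
  have iD: "inv_by P D" unfolding D_def by (rule inv_by_Int[OF m1(3) m2(3)])
  have card1: "1 < card Y" if "grp Y" "y \<in> Y" "y \<noteq> 1" for Y and y :: gp
   using grp_card_one[OF that(1)] grpD(8)[OF that(1)] that(2,3) by (metis One_nat_def Suc_lessI singletonD)
  have "\<exists>H. grp H \<and> H \<subset> G \<and> P \<subseteq> H \<and> card D < card (Q1 \<inter> H) \<and> card D < card (Q2 \<inter> H)"
  proof (cases "D = {1}")
   case False
   have pD: "pgr q D" by (rule pgr_sub[OF m1(1) q(1) gD(1)]) (use D1 in blast)
   note H = proper_nz[OF gD False pgr_proper[OF pD q(1)]]
   have "P \<subseteq> nz G D"
   proof
    fix x assume "x \<in> P"
    thus "x \<in> nz G D" using P_sub inv_byD[OF iD] by (intro nzI[OF grpD(1)[OF gD(1)]]) auto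
   qed
   moreover have "D \<subset> nz Q1 D" "D \<subset> nz Q2 D"
    using pgr_nz_grows[OF m1(1) q(1) gD(1) D1] pgr_nz_grows[OF m2(1) q(1) gD(1) D2] .
   moreover have "nz Q1 D = Q1 \<inter> nz G D" "nz Q2 D = Q2 \<inter> nz G D" using m1(2) m2(2) by (auto simp: nz_def)
   ultimately have "card D < card (Q1 \<inter> nz G D)" "card D < card (Q2 \<inter> nz G D)"
    using psubset_card_mono[of "Q1 \<inter> nz G D" D] psubset_card_mono[of "Q2 \<inter> nz G D" D] grpD(1)[OF g1] grpD(1)[OF g2] by auto
   thus ?thesis using H \<open>P \<subseteq> nz G D\<close> by blast
  next
   case True
   have Y: "solv Q" "\<not> p dvd card Q" if "pgr q Q" for Q
    using pgr_solv[OF that q(1)] pgr_coprime_dvd[OF that q(1) p(1)] q(2) by auto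
   note O = Om_P
   have inv1: "cj e y \<in> Q1" if "e \<in> Om p P" "y \<in> Q1" for e y using inv_byD[OF m1(3)] O(3) that by blast
   have inv2: "cj e y \<in> Q2" if "e \<in> Om p P" "y \<in> Q2" for e y using inv_byD[OF m2(3)] O(3) that by blast
   \<comment> \<open>Rank three gives independent d and e that centralize a common non-trivial y in
     Q1. Some non-trivial a in the group they generate centralizes a non-trivial z in Q2, and the
     centralizer of a serves as H.\<close>
   have "\<not> (\<Union>d\<in>Om p P - {1}. \<Union>e\<in>Om p P - cyc d. cz Q1 {d, e}) \<subseteq> {1}"
   proof
    assume s: "(\<Union>d\<in>Om p P - {1}. \<Union>e\<in>Om p P - cyc d. cz Q1 {d, e}) \<subseteq> {1}"
    have "Q1 \<subseteq> gen (\<Union>d\<in>Om p P - {1}. \<Union>e\<in>Om p P - cyc d. cz Q1 {d, e})"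
     by (rule coprime_generation_rank_three[OF Y[OF m1(1)] p(1) O(1,2,4) sylow_rank_three[OF p P] inv1])
    also have "\<dots> \<subseteq> {1}" by (rule gen_sub[OF s grp_one])
    finally show False using D1 True by blast
   qed
   then obtain d e y where de: "d \<in> Om p P" "d \<noteq> 1" "e \<in> Om p P" "e \<notin> cyc d" "y \<in> cz Q1 {d, e}" "y \<noteq> 1" by blast
   have "\<not> (\<Union>a\<in>prd (cyc d) (cyc e) - {1}. cz Q2 {a}) \<subseteq> {1}"
   proof
    assume s: "(\<Union>a\<in>prd (cyc d) (cyc e) - {1}. cz Q2 {a}) \<subseteq> {1}"
    have "Q2 \<subseteq> gen (\<Union>a\<in>prd (cyc d) (cyc e) - {1}. cz Q2 {a})"
     by (rule coprime_generation[OF Y[OF m2(1)] p(1) O(1) de(1,3) O(4)[OF de(1)] O(4)[OF de(3)] de(2,4)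
      abD[OF O(2) de(1,3)] inv2[OF de(1)] inv2[OF de(3)]])
    also have "\<dots> \<subseteq> {1}" by (rule gen_sub[OF s grp_one])
    finally show False using D2 True by blast
   qed
   then obtain a z where a: "a \<in> prd (cyc d) (cyc e)" "a \<noteq> 1" "z \<in> cz Q2 {a}" "z \<noteq> 1" by blast
   have aO: "a \<in> Om p P" using a(1) prd_least[OF grp_cyc(2)[OF O(1) de(1)] grp_cyc(2)[OF O(1) de(3)] O(1)] by blast
   have aP: "a \<in> P" "a \<in> G" using aO O(3) P_sub by blast+
   have "{a} \<subseteq> G" using aP(2) by simp
   note H = proper_cz[of a "{a}", OF singletonI a(2) this]
   have "P \<subseteq> cz G {a}" using abD[OF sylow_abelian[OF p P] _ aP(1)] P_sub by (auto simp: cz_def)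
   moreover have "y \<in> Q1 \<inter> cz G {a}"
   proof -
    obtain i j where ij: "a = d ^ i * e ^ j" using a(1) by (auto simp: prd_iff cyc_def)
    have "cj y d = d" "cj y e = e" using de(5) by (auto simp: cz_def cj_eq_iff)
    hence "cj y a = a" by (simp add: ij cj_mult cj_pow)
    thus ?thesis using de(5) m1(2) by (auto simp: cz_def cj_eq_iff)
   qed
   hence "1 < card (Q1 \<inter> cz G {a})" by (rule card1[OF grp_Int[OF g1 H(1)] _ de(6)])
   moreover have "z \<in> Q2 \<inter> cz G {a}" using a(3) m2(2) by (auto simp: cz_def)
   hence "1 < card (Q2 \<inter> cz G {a})" by (rule card1[OF grp_Int[OF g2 H(1)] _ a(4)])
   ultimately show ?thesis using H(1,2) True by auto
  qed
  then obtain H where H: "grp H" "H \<subset> G" "P \<subseteq> H" "card D < card (Q1 \<inter> H)" "card D < card (Q2 \<inter> H)" by blast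
  define K where "K = core (- {p}) H"
  have nK: "nml K H" "pig (- {p}) K" unfolding K_def using core(1,2)[OF H(1)] by blast+
  have K: "grp K" "\<not> p dvd card K" "inv_by P K" "K \<subseteq> G"
   using nK p(1) inv_by_nml[OF nK(1) H(3)] nmlD(1,3)[OF nK(1)] H(2) by (auto simp: pig_compl)
  have iH: "inv_by P H" unfolding inv_by_def using grpD(6)[OF H(1)] H(3) by blast
  have A: "pgr q (Q \<inter> H)" "Q \<inter> H \<subseteq> K" "inv_by P (Q \<inter> H)" if Q: "pgr q Q" "inv_by P Q" for Q
  proof -
   have gQH: "grp (Q \<inter> H)" by (rule grp_Int[OF pgr_grp[OF Q(1)] H(1)])
   show pq: "pgr q (Q \<inter> H)" by (rule pgr_sub[OF Q(1) q(1) gQH]) simp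
   show i: "inv_by P (Q \<inter> H)" by (rule inv_by_Int[OF Q(2) iH])
   have "\<not> p dvd card (Q \<inter> H)" using pgr_coprime_dvd[OF pq q(1) p(1)] q(2) by simp
   thus "Q \<inter> H \<subseteq> K" unfolding K_def by (intro in_core[OF H(1-3) gQH]) (use i in auto)
  qed
  obtain R1 where R1: "syl q R1 K" "inv_by P R1" "Q1 \<inter> H \<subseteq> R1"
   using invariant_sylow[OF pgr_P p(1) K(1-3) q(1) A[OF m1(1,3)]] by blast
  obtain R2 where R2: "syl q R2 K" "inv_by P R2" "Q2 \<inter> H \<subseteq> R2"
   using invariant_sylow[OF pgr_P p(1) K(1-3) q(1) A[OF m2(1,3)]] by blast
  obtain c where c: "c \<in> cz K P" "R2 = cj c ` R1"
   using invariant_sylow_conj[OF pgr_P p(1) K(1-3) q(1) R1(1,2) R2(1,2)] by blast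
  have cG: "c \<in> cz G P" using c(1) K(4) by (auto simp: cz_def)
  obtain Q3 where Q3: "mq q Q3" "R1 \<subseteq> Q3" using mq_extend[OF sylD(2)[OF R1(1)] _ R1(2)] sylD(4)[OF R1(1)] K(4) by blast
  have dec: "card G - card (Q \<inter> R) < card G - card (Q1 \<inter> Q2)" if Q: "mq q Q" and B: "B \<subseteq> Q \<inter> R" "card D < card B" for Q R B
  proof -
   have Qp: "pgr q Q" "Q \<subseteq> G" using Q by (auto simp: mq_def)
   have f: "finite (Q \<inter> R)" using grpD(1)[OF pgr_grp[OF Qp(1)]] by blast
   have "card B \<le> card (Q \<inter> R)" by (rule card_mono[OF f B(1)])
   moreover have "card (Q \<inter> R) \<le> card G" by (rule card_mono[OF grpD(1)[OF grp_G]]) (use Qp(2) in blast)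
   ultimately show ?thesis using B(2) unfolding D_def by linarith
  qed
  have s1: "Q1 \<inter> H \<subseteq> Q1 \<inter> Q3" using R1(3) Q3(2) by blast
  obtain c1 where c1: "c1 \<in> cz G P" "Q3 = cj c1 ` Q1"
   using less.hyps[OF dec[OF less.prems(1) s1 H(4)] less.prems(1) Q3(1)] by blast
  define Q4 where "Q4 = cj c ` Q3"
  have Q4: "mq q Q4" unfolding Q4_def by (rule mq_cj[OF Q3(1) cG])
  have "R2 \<subseteq> Q4" unfolding c(2) Q4_def by (rule image_mono[OF Q3(2)])
  hence s2: "Q2 \<inter> H \<subseteq> Q4 \<inter> Q2" using R2(3) by blast
  obtain c2 where c2: "c2 \<in> cz G P" "Q2 = cj c2 ` Q4"
   using less.hyps[OF dec[OF Q4 s2 H(5)] Q4 less.prems(2)] by blast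
  have "Q2 = cj (c2 * (c * c1)) ` Q1" unfolding c2(2) Q4_def c1(2) by (simp only: cj_img_comp)
  moreover have "c2 * (c * c1) \<in> cz G P" using grpD(3)[OF grp_cz[OF grp_G]] c1(1) c2(1) cG by simp
  ultimately show ?thesis by blast
 qed
qed

text \<open>The subgroups O_p'(C_G(u)), for u non-trivial in U = O_p(M), all turn out to be the same
  group T, which contains every proper p'-subgroup invariant under \<open>P\<close>. Then O_p'(L)
  and N_G(P) lie in \<open>M\<close>, and L = O_p'(L) N_L(P).\<close>

lemma sylow_uniqueness:
 assumes M: "maximal M" and UP: "core {p} M \<subseteq> P"
  and ab: "a \<in> core {p} M" "b \<in> core {p} M" "a ^ p = 1" "b ^ p = 1" "a \<noteq> 1" "b \<notin> cyc a"
 shows "P \<subseteq> M" "grp L \<Longrightarrow> P \<subseteq> L \<Longrightarrow> L \<subset> G \<Longrightarrow> L \<subseteq> M"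
proof -
 have gM: "grp M" "M \<subset> G" "\<And>L. grp L \<Longrightarrow> M \<subseteq> L \<Longrightarrow> L \<subset> G \<Longrightarrow> L = M" using M by (auto simp: maximal_def)
 have MG: "M \<subseteq> G" using gM(2) by blast
 define U where "U = core {p} M"
 have nU: "nml U M" "pgr p U" unfolding U_def pgr_iff_pig[OF p(1)] using core(1,2)[OF gM(1)] by blast+
 note gU = nmlD(1)[OF nU(1)]
 have abU: "a \<in> U" "b \<in> U" and UP: "U \<subseteq> P" using ab UP by (auto simp: U_def)
 have UG: "U \<subseteq> G" using UP P_sub by blast
 have U1: "U \<noteq> {1}" using abU(1) ab(5) by blast
 note aP = sylow_abelian[OF p P]
 have nzU: "nz G U = M"
  by (rule gM(3)[OF proper_nz(1)[OF gU UG U1 pgr_proper[OF nU(2) p(1)]] _ proper_nz(2)[OF gU UG U1 pgr_proper[OF nU(2) p(1)]]])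
   (use nml_iff_nz[OF gU gM(1) nmlD(3)[OF nU(1)]] nU(1) MG in "auto simp: nz_def")
 have czM: "cz G U \<subseteq> M" using cz_sub_nz[of G U] nzU by simp
 have "P \<subseteq> cz G U" using abD[OF aP] UP P_sub by (auto simp: cz_def)
 thus PM: "P \<subseteq> M" using czM by blast
 define th where "th u = core (- {p}) (cz G {u})" for u
 have C: "grp (cz G {u})" "cz G {u} \<subset> G" "P \<subseteq> cz G {u}" if u: "u \<in> U - {1}" for u
 proof -
  have uG: "{u} \<subseteq> G" and u1: "u \<noteq> 1" using u UG by auto
  show "grp (cz G {u})" "cz G {u} \<subset> G" by (rule proper_cz(1,2)[OF singletonI u1 uG])+
  show "P \<subseteq> cz G {u}" using abD[OF aP] u UP P_sub by (auto simp: cz_def)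
 qed
 have th: "nml (th u) (cz G {u})" "grp (th u)" "\<not> p dvd card (th u)" "inv_by P (th u)" "th u \<subseteq> cz G {u}" "solv (th u)"
  if u: "u \<in> U - {1}" for u
 proof -
  show n: "nml (th u) (cz G {u})" unfolding th_def by (rule core(1)[OF C(1)[OF u]])
  show g: "grp (th u)" "th u \<subseteq> cz G {u}" using nmlD(1,3)[OF n] .
  have "pig (- {p}) (th u)" unfolding th_def by (rule core(2)[OF C(1)[OF u]])
  thus "\<not> p dvd card (th u)" using p(1) by (simp add: pig_compl)
  show "inv_by P (th u)" by (rule inv_by_nml[OF n C(3)[OF u]])
  show "solv (th u)" by (rule proper_solv[OF g(1)]) (use g(2) C(2)[OF u] in blast)
 qed
 have abs: "Y \<subseteq> th u" if "u \<in> U - {1}" "grp Y" "Y \<subseteq> cz G {u}" "\<not> p dvd card Y" "inv_by P Y" for u Y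
  unfolding th_def by (rule in_core[OF C[OF that(1)] that(2-5)])
 have thcj: "cj m ` th u = th (cj m u)" if "m \<in> M" for m u
  using cj_img_grp[OF grp_G] that MG unfolding th_def cj_core cj_cz by auto
 \<comment> \<open>By transitivity all the subgroups \<open>core {t} (th w)\<close> lie in one
   maximal invariant t-subgroup, so they generate a t-group S. \<open>M\<close> permutes them and is
   thus the normalizer of S, and the normal subgroups U and S of coprime orders commute.\<close>
 have cent: "v * x = x * v" if t: "prime t" and u: "u \<in> U - {1}" and v: "v \<in> U" and x: "x \<in> core {t} (th u)" for t u v x
 proof (cases "t = p")
  case True
  have pc: "pgr p (core {p} (th u))" using core(2)[OF th(2)[OF u]] pgr_iff_pig[OF p(1)] by blast
  have "card (core {p} (th u)) dvd card (th u)" by (rule lagrange_dvd[OF th(2)[OF u] pgr_grp[OF pc] core_sub[OF th(2)[OF u]]])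
  hence "core {p} (th u) = {1}" using pgr_dvd[OF pc] th(3)[OF u] dvd_trans by blast
  thus ?thesis using x True by simp
 next
  case False
  have ct: "nml (core {t} (th w)) (cz G {w})" "pgr t (core {t} (th w))" "core {t} (th w) \<subseteq> G" if w: "w \<in> U - {1}" for w
  proof -
   show n: "nml (core {t} (th w)) (cz G {w})" by (rule nml_core_nml[OF th(1)[OF w]])
   show "pgr t (core {t} (th w))" using core(2)[OF th(2)[OF w]] pgr_iff_pig[OF t] by blast
   show "core {t} (th w) \<subseteq> G" using nmlD(3)[OF n] C(2)[OF w] by blast
  qed
  obtain R where R: "mq t R" using mq_extend[OF pgr_one, of t] grpD(2)[OF grp_G] by (auto simp: inv_by_def)
  have inR: "core {t} (th w) \<subseteq> R" if w: "w \<in> U - {1}" for w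
  proof -
   obtain R' where R': "mq t R'" "core {t} (th w) \<subseteq> R'" using mq_extend[OF ct(2,3)[OF w] inv_by_nml[OF ct(1)[OF w] C(3)[OF w]]] by blast
   obtain c where c: "c \<in> cz G P" "R = cj c ` R'" using transitivity[OF t False R'(1) R] by blast
   have "c \<in> cz G {w}" using c(1) w UP by (auto simp: cz_def)
   hence "cj c ` core {t} (th w) = core {t} (th w)" by (rule nmlD(5)[OF ct(1)[OF w]])
   thus ?thesis using image_mono[OF R'(2), of "cj c"] c(2) by simp
  qed
  define A where "A = (\<Union>w\<in>U - {1}. core {t} (th w))"
  define S where "S = gen A"
  have Rp: "pgr t R" "R \<subseteq> G" using R by (auto simp: mq_def)
  have AR: "A \<subseteq> R" using inR by (auto simp: A_def)
  have AG: "A \<subseteq> G" using AR Rp(2) by blast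
  have gS: "grp S" "S \<subseteq> R" unfolding S_def using grp_gen[OF AR pgr_grp[OF Rp(1)]] gen_sub[OF AR pgr_grp[OF Rp(1)]] .
  have pS: "pgr t S" by (rule pgr_sub[OF Rp(1) t gS])
  have SG: "S \<subseteq> G" using gS(2) Rp(2) by blast
  have xS: "x \<in> S" using x u gen_inc[of A] by (auto simp: S_def A_def)
  have MS: "M \<subseteq> nz G S"
  proof
   fix m assume m: "m \<in> M"
   show "m \<in> nz G S"
   proof (rule nzI[OF grpD(1)[OF gS(1)]])
    show "m \<in> G" using m MG by blast
    fix s assume s: "s \<in> S"
    show "cj m s \<in> S" unfolding S_def
    proof (rule gen_cj_closed[OF AG grp_G _ s[unfolded S_def]])
     fix y assume "y \<in> A"
     then obtain w where w: "w \<in> U - {1}" "y \<in> core {t} (th w)" by (auto simp: A_def)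
     have "cj m y \<in> cj m ` core {t} (th w)" using w(2) by (rule imageI)
     hence "cj m y \<in> core {t} (th (cj m w))" unfolding cj_core thcj[OF m] .
     moreover have "cj m w \<in> U - {1}" using w(1) nmlD(4)[OF nU(1) m] by auto
     ultimately have "cj m y \<in> A" by (auto simp: A_def)
     thus "cj m y \<in> gen A" using gen_inc[of A] by (rule subsetD[rotated])
    qed
   qed
  qed
  show ?thesis
  proof (cases "S = {1}")
   case True thus ?thesis using xS by simp
  next
   case False
   note pn = proper_nz[OF gS(1) SG False pgr_proper[OF pS t]]
   have "nz G S = M" by (rule gM(3)[OF pn(1) MS pn(2)])
   hence nS: "nml S M" using nml_nz[OF gS(1) grp_G SG] by simp
   have "pig (- {p}) S" using pgr_coprime_dvd[OF pS t p(1)] \<open>t \<noteq> p\<close> gS(1) by (simp add: pig_compl)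
   hence "U \<inter> S = {1}" by (rule pgr_pig_Int[OF nU(2) p(1)])
   thus ?thesis by (rule nml_commute[OF nU(1) nS _ v xS])
  qed
 qed
 have thU: "th u \<subseteq> cz G U" if u: "u \<in> U - {1}" for u
 proof
  fix y assume y: "y \<in> th u"
  have iU: "inv_by U (th u)" using th(4)[OF u] UP unfolding inv_by_def by blast
  have "v * y = y * v" if v: "v \<in> U" for v
   by (rule coprime_fitting[OF nU(2) p(1) th(6,3)[OF u] iU cent[OF _ u] v y])
  thus "y \<in> cz G U" using y th(5)[OF u] by (auto simp: cz_def)
 qed
 have th_eq: "th u \<subseteq> th w" if "u \<in> U - {1}" "w \<in> U - {1}" for u w
  by (rule abs[OF that(2) th(2)[OF that(1)] _ th(3,4)[OF that(1)]]) (use thU[OF that(1)] that(2) in "auto simp: cz_def")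
 have aU: "a \<in> U - {1}" using abU(1) ab(5) by simp
 define T where "T = th a"
 note T = th[OF aU, folded T_def]
 \<comment> \<open>\<open>Y\<close> is generated by centralizers of non-trivial elements d of U;
   each of these lies in \<open>th d\<close>, which is contained in T.\<close>
 have big: "Y \<subseteq> T" if Y: "grp Y" "Y \<subset> G" "\<not> p dvd card Y" "inv_by P Y" for Y
 proof -
  have "Y \<subseteq> gen (\<Union>d\<in>prd (cyc a) (cyc b) - {1}. cz Y {d})"
   by (rule coprime_generation[OF proper_solv[OF Y(1,2)] Y(3) p(1) gU abU ab(3-6) abD[OF ab_sub[OF aP UP] abU]])
    (use inv_byD[OF Y(4)] abU UP in blast)+
  also have "\<dots> \<subseteq> T"
  proof (rule gen_sub[OF UN_least T(2)])
   fix d assume d: "d \<in> prd (cyc a) (cyc b) - {1}"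
   have dU: "d \<in> U - {1}" using d prd_least[OF cyc_least[OF gU abU(1)] cyc_least[OF gU abU(2)] gU] by blast
   have "cz Y {d} \<subseteq> th d"
   proof (rule abs[OF dU grp_cz[OF Y(1)]])
    show "cz Y {d} \<subseteq> cz G {d}" using Y(2) by (intro cz_mono) auto
    show "\<not> p dvd card (cz Y {d})" using lagrange_dvd[OF Y(1) grp_cz[OF Y(1)] cz_sub] Y(3) dvd_trans by blast
    show "inv_by P (cz Y {d})"
    proof (rule inv_by_cz[OF Y(4)])
     fix x e assume "x \<in> P" "e \<in> {d}"
     thus "cj x e = e" using abD[OF aP, of x d] dU UP by (auto simp: cj_eq_iff)
    qed
   qed
   thus "cz Y {d} \<subseteq> T" using th_eq[OF dU aU] by (simp add: T_def)
  qed
  finally show ?thesis .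
 qed
 have TM: "T \<subseteq> M" using thU[OF aU] czM by (simp add: T_def)
 \<comment> \<open>If T is trivial, \<open>P\<close> is normal in \<open>M\<close> by
   \<open>sylow_normal\<close>. Otherwise \<open>M\<close> is the normalizer of T, and elements
   normalizing \<open>P\<close> preserve T because T contains every proper invariant
   p'-subgroup.\<close>
 have NM: "nz G P \<subseteq> M"
 proof (cases "T = {1}")
  case True
  have "core (- {p}) M \<subseteq> T"
  proof (rule big[OF grp_core[OF gM(1)]])
   show "core (- {p}) M \<subset> G" using core_sub[OF gM(1)] gM(2) by blast
   show "\<not> p dvd card (core (- {p}) M)" using core(2)[OF gM(1), of "- {p}"] p(1) by (simp add: pig_compl)
   show "inv_by P (core (- {p}) M)" by (rule inv_by_nml[OF core(1)[OF gM(1)] PM])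
  qed
  hence c1: "core (- {p}) M = {1}" using True grpD(2)[OF grp_core[OF gM(1)]] by blast
  have "nml P M"
   by (rule sylow_normal[OF Good_sub[OF Good_G gM(1) MG] proper_solv[OF gM(1,2)] p(1) c1 syl_sub[OF P gM(1) PM MG]])
  hence "nz M P = M" using nml_iff_nz[OF grp_P gM(1) PM] by simp
  hence "M \<subseteq> nz G P" using MG by (auto simp: nz_def)
  thus ?thesis using gM(3)[OF sylow_normalizer(1)[OF p P] _ sylow_normalizer(2)[OF p P]] by simp
 next
  case False
  have TG: "T \<subset> G" using TM gM(2) by blast
  have img: "n \<in> nz G T" if n: "n \<in> G" "cj n ` T \<subseteq> T" for n
   by (rule nzI[OF grpD(1)[OF T(2)] n(1)]) (use n(2) in blast)
  have "M \<subseteq> nz G T"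
  proof
   fix m assume m: "m \<in> M"
   have "cj m a \<in> U - {1}" using aU nmlD(4)[OF nU(1) m] by auto
   hence "cj m ` T \<subseteq> T" using thcj[OF m, of a] th_eq[OF _ aU] by (simp add: T_def)
   thus "m \<in> nz G T" using img m MG by blast
  qed
  hence e: "nz G T = M" using gM(3)[OF proper_nz(1) _ proper_nz(2)] T(2) TG False by blast
  show ?thesis
  proof
   fix n assume n: "n \<in> nz G P"
   have nG: "n \<in> G" and nP: "cj n ` P = P" using n by (auto simp: nz_def)
   have "cj n ` T \<subseteq> T"
   proof (rule big[OF grp_cj[OF T(2)]])
    have "cj n ` T \<subseteq> cj n ` G" using TG by blast
    hence "cj n ` T \<subseteq> G" using cj_img_grp[OF grp_G nG] by simp
    moreover have "card (cj n ` T) < card G" using psubset_card_mono[OF grpD(1)[OF grp_G] TG] by simp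
    ultimately show "cj n ` T \<subset> G" by auto
    show "\<not> p dvd card (cj n ` T)" using T(3) by simp
    show "inv_by P (cj n ` T)" unfolding inv_by_def
    proof (intro ballI)
     fix x z assume x: "x \<in> P" and "z \<in> cj n ` T"
     then obtain y where y: "y \<in> T" "z = cj n y" by blast
     obtain x' where x': "x' \<in> P" "x = cj n x'" using x nP by blast
     have "cj x z = cj n (cj x' y)" unfolding y(2) x'(2) by (simp add: cj_cj) (simp add: cj_def gsimps)
     thus "cj x z \<in> cj n ` T" using inv_byD[OF T(4) x'(1) y(1)] by simp
    qed
   qed
   thus "n \<in> M" using img[OF nG] e by simp
  qed
 qed
 assume L: "grp L" "P \<subseteq> L" "L \<subset> G"
 have LG: "L \<subseteq> G" using L(3) by blast
 define K where "K = core (- {p}) L"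
 have "K \<subseteq> T"
 proof (rule big)
  show "grp K" unfolding K_def by (rule grp_core[OF L(1)])
  show "K \<subset> G" using core_sub[OF L(1)] L(3) unfolding K_def by blast
  show "\<not> p dvd card K" using core(2)[OF L(1), of "- {p}"] p(1) by (simp add: pig_compl K_def)
  show "inv_by P K" unfolding K_def by (rule inv_by_nml[OF core(1)[OF L(1)] L(2)])
 qed
 moreover have "nz L P \<subseteq> M" using NM LG by (auto simp: nz_def)
 moreover have "L = prd K (nz L P)" unfolding K_def
  by (rule p_length_one(2)[OF Good_sub[OF Good_G L(1) LG] proper_solv[OF L(1,3)] p(1) syl_sub[OF P L(1,2) LG]])
 ultimately show "L \<subseteq> M" using prd_least[OF _ _ gM(1)] TM by blast
qed

end

end

section \<open>Uniqueness of maximal subgroups\<close>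

lemma independent_elements:
 assumes E: "grp E" "\<And>x. x \<in> E \<Longrightarrow> x ^ p = 1" "prime p" "p < card E"
 shows "\<exists>a\<in>E. \<exists>b\<in>E. a \<noteq> 1 \<and> b \<notin> cyc a"
proof -
 have "1 < card E" using E(4) prime_gt_1_nat[OF E(3)] by linarith
 hence "E \<noteq> {1}" by auto
 then obtain a where a: "a \<in> E" "a \<noteq> 1" using grpD(2)[OF E(1)] by blast
 have "card (cyc a) = p" using card_cyc_prime[OF E(1) a E(2)[OF a(1)] E(3)] .
 hence "\<not> E \<subseteq> cyc a" using card_mono[OF grpD(1)[OF grp_cyc(1)[OF E(1) a(1)]], of E] E(4) by auto
 thus ?thesis using a by blast
qed

lemma prime_less_cube: "prime p \<Longrightarrow> p < p ^ 3" for p :: nat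
 using power_strict_increasing[of 1 3 p] prime_gt_1_nat[of p] by simp

context minimal_counterexample
begin

text \<open>Let R be a Sylow p-subgroup of \<open>L\<close> above \<open>A\<close> and S one of
  \<open>G\<close> above R. S is conjugate to \<open>P\<close> by an element centralizing
  \<open>A\<close>, which lies in \<open>M\<close>, so uniqueness for \<open>P\<close> also gives
  N_G(R) inside \<open>M\<close>. The group O_p'(L) is generated by centralizers of elements of
  \<open>A\<close>, which lie in \<open>M\<close>, and L = O_p'(L) N_L(R).\<close>

lemma uniqueness_noncyclic:
 assumes p: "prime p" "p dvd card G" and P: "syl p P G" and M: "grp M"
  and uniq: "\<And>L. grp L \<Longrightarrow> P \<subseteq> L \<Longrightarrow> L \<subset> G \<Longrightarrow> L \<subseteq> M"
  and A: "grp A" "A \<subseteq> P" and ab: "a \<in> A" "b \<in> A" "a ^ p = 1" "b ^ p = 1" "a \<noteq> 1" "b \<notin> cyc a"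
  and L: "grp L" "A \<subseteq> L" "L \<subset> G"
 shows "L \<subseteq> M"
proof -
 have aP: "ab P" by (rule sylow_abelian[OF p P])
 have PG: "P \<subseteq> G" by (rule sylD(4)[OF P])
 have LG: "L \<subseteq> G" using L(3) by blast
 have cM: "cz G D \<subseteq> M" if D: "d \<in> D" "d \<noteq> 1" "D \<subseteq> P" for d D
 proof -
  have DG: "D \<subseteq> G" using D(3) PG by blast
  have "P \<subseteq> cz G D" using abD[OF aP] D(3) PG by (auto simp: cz_def)
  thus ?thesis by (rule uniq[OF proper_cz(1)[OF D(1,2) DG] _ proper_cz(2)[OF D(1,2) DG]])
 qed
 have pA: "pgr p A" by (rule pgr_sub[OF sylD(2)[OF P] p(1) A])
 obtain R where R: "syl p R L" "A \<subseteq> R" using syl_extends[OF L(1) p(1) pA L(2)] by blast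
 note gR = sylD(3)[OF R(1)]
 have RG: "R \<subseteq> G" using sylD(4)[OF R(1)] LG by blast
 obtain S where S: "syl p S G" "R \<subseteq> S" using syl_extends[OF grp_G p(1) sylD(2)[OF R(1)] RG] by blast
 have A1: "A \<noteq> {1}" "A \<noteq> {}" "R \<noteq> {1}" using ab(1,5) R(2) by auto
 obtain c where c: "c \<in> cz G A" "S = cj c ` P" using sylow_conj_centralizer[OF p(1) A1(1,2) P S(1) A(2)] R(2) S(2) by blast
 have cG: "c \<in> G" and cMm: "c \<in> M" using c(1) cz_sub[of G A] cM[OF ab(1,5) A(2)] by blast+
 note pn = proper_nz[OF gR RG A1(3) pgr_proper[OF sylD(2)[OF R(1)] p(1)]]
 have nM: "nz G R \<subseteq> M"
 proof -
  have SN: "S \<subseteq> nz G R"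
  proof
   fix s assume s: "s \<in> S"
   show "s \<in> nz G R"
   proof (rule nzI[OF grpD(1)[OF gR]])
    show "s \<in> G" using s sylD(4)[OF S(1)] by blast
    fix r assume r: "r \<in> R"
    have "s * r = r * s" by (rule abD[OF sylow_abelian[OF p S(1)] s]) (use r S(2) in blast)
    hence "cj s r = r" by (simp add: cj_eq_iff)
    thus "cj s r \<in> R" using r by simp
   qed
  qed
  define N where "N = cj (inverse c) ` nz G R"
  have "P \<subseteq> N" unfolding N_def using image_mono[OF SN, of "cj (inverse c)"] c(2) by simp
  moreover have "grp N" unfolding N_def by (rule grp_cj[OF pn(1)])
  moreover have "N \<subset> G"
  proof -
   have "N \<subseteq> G" unfolding N_def using image_mono[OF nz_sub[of G R], of "cj (inverse c)"] cj_img_grp[OF grp_G grpD(4)[OF grp_G cG]] by simp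
   moreover have "card N < card G" unfolding N_def using psubset_card_mono[OF grpD(1)[OF grp_G] pn(2)] by simp
   ultimately show ?thesis by auto
  qed
  ultimately have "N \<subseteq> M" using uniq by blast
  hence "cj c ` N \<subseteq> cj c ` M" by (rule image_mono)
  thus ?thesis using cj_img_grp[OF M cMm] by (simp add: N_def)
 qed
 define Y where "Y = core (- {p}) L"
 have gY: "grp Y" "Y \<subseteq> L" unfolding Y_def by (rule grp_core[OF L(1)], rule core_sub[OF L(1)])
 have "Y \<subseteq> gen (\<Union>d\<in>prd (cyc a) (cyc b) - {1}. cz Y {d})"
 proof (rule coprime_generation[OF _ _ p(1) A(1) ab abD[OF ab_sub[OF aP A(2)] ab(1,2)]])
  show "solv Y" by (rule proper_solv[OF gY(1)]) (use gY(2) L(3) in blast)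
  show "\<not> p dvd card Y" using core(2)[OF L(1), of "- {p}"] p(1) by (simp add: pig_compl Y_def)
  fix y assume y: "y \<in> Y"
  show "cj a y \<in> Y" "cj b y \<in> Y" unfolding Y_def
   using nmlD(4)[OF core(1)[OF L(1)]] ab(1,2) L(2) y unfolding Y_def by blast+
 qed
 also have "\<dots> \<subseteq> M"
 proof (rule gen_sub[OF UN_least M])
  fix d assume d: "d \<in> prd (cyc a) (cyc b) - {1}"
  hence "d \<in> A" using prd_least[OF cyc_least[OF A(1) ab(1)] cyc_least[OF A(1) ab(2)] A(1)] by blast
  hence "cz G {d} \<subseteq> M" using cM[of d "{d}"] d A(2) by blast
  moreover have "cz Y {d} \<subseteq> cz G {d}" using gY(2) LG by (intro cz_mono) auto
  ultimately show "cz Y {d} \<subseteq> M" by blast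
 qed
 finally have YM: "Y \<subseteq> M" .
 have "nz L R \<subseteq> M" using nM LG by (auto simp: nz_def)
 moreover have "L = prd Y (nz L R)" unfolding Y_def
  by (rule p_length_one(2)[OF Good_sub[OF Good_G L(1) LG] proper_solv[OF L(1,3)] p(1) R(1)])
 ultimately show ?thesis using prd_least[OF YM _ M] by blast
qed

lemma maximal_extend: assumes "grp H" "H \<subset> G" shows "\<exists>M. maximal M \<and> H \<subseteq> M"
proof -
 define Q where "Q B \<longleftrightarrow> grp B \<and> B \<subset> G \<and> H \<subseteq> B" for B
 have QH: "Q H" using assms by (simp add: Q_def)
 have "\<forall>B. Q B \<longrightarrow> card B < card G" using psubset_card_mono[OF grpD(1)[OF grp_G]] by (simp add: Q_def)
 hence "\<exists>B. Q B \<and> (\<forall>B'. Q B' \<longrightarrow> card B' \<le> card B)" by (rule ex_has_greatest_nat[where P=Q and f=card, OF QH])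
 then obtain B where B: "Q B" "\<And>B'. Q B' \<Longrightarrow> card B' \<le> card B" by blast
 have "maximal B" unfolding maximal_def
 proof (intro conjI allI impI)
  show "grp B" "B \<subset> G" using B(1) by (auto simp: Q_def)
  fix L assume L: "grp L" "B \<subseteq> L" "L \<subset> G"
  hence "Q L" using B(1) by (auto simp: Q_def)
  thus "L = B" using subgroup_eq_card[OF L(1,2)] B(2) by simp
 qed
 thus ?thesis using B(1) by (auto simp: Q_def)
qed

lemma maximalD: assumes "maximal M" shows "grp M" "M \<subset> G" "M \<subseteq> G" "grp L \<Longrightarrow> M \<subseteq> L \<Longrightarrow> L \<subset> G \<Longrightarrow> L = M"
 using assms by (auto simp: maximal_def)

text \<open>Take M maximal above N_G(P). If \<open>P\<close> centralizes O_p'(M), then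
  \<open>P\<close> is normal in M and \<open>sylow_uniqueness\<close> applies directly. Otherwise
  \<open>P\<close> acts non-trivially on O_t(M) for some prime t different from p; uniqueness at t
  then places the centralizers of enough elements of \<open>P\<close> inside M.\<close>

lemma unique_maximal_ex:
 assumes p: "prime p" "p dvd card G" and P: "syl p P G"
 shows "\<exists>M. maximal M \<and> P \<subseteq> M \<and> (\<forall>L. grp L \<longrightarrow> P \<subseteq> L \<longrightarrow> L \<subset> G \<longrightarrow> L \<subseteq> M)"
proof -
 note gP = sylD(3)[OF P] and PG = sylD(4)[OF P] and pP = sylD(2)[OF P]
 have aP: "ab P" by (rule sylow_abelian[OF p P])
 note O = Om[OF gP aP, where p=p]
 obtain M where M: "maximal M" "nz G P \<subseteq> M" using maximal_extend[OF sylow_normalizer(1,2)[OF p P]] by blast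
 note mM = maximalD[OF M(1)]
 have PM: "P \<subseteq> M" using M(2) nz_self[OF gP PG] by blast
 define K where "K = core (- {p}) M"
 have nK: "nml K M" "pig (- {p}) K" unfolding K_def using core(1,2)[OF mM(1)] by blast+
 have ndK: "\<not> p dvd card K" using nK(2) p(1) by (simp add: pig_compl)
 have sM: "syl p P M" by (rule syl_sub[OF P mM(1) PM mM(3)])
 have "P \<subseteq> L \<Longrightarrow> L \<subseteq> M" if L: "grp L" "L \<subset> G" for L
 proof (cases "\<forall>x\<in>P. \<forall>k\<in>K. x * k = k * x")
  case True
  have "K \<subseteq> nz M P"
  proof
   fix k assume k: "k \<in> K"
   show "k \<in> nz M P"
   proof (rule nzI[OF grpD(1)[OF gP]])
    show "k \<in> M" using k nmlD(3)[OF nK(1)] by blast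
    fix x assume x: "x \<in> P"
    hence "cj k x = x" using True k by (simp add: cj_eq_iff)
    thus "cj k x \<in> P" using x by simp
   qed
  qed
  hence "prd K (nz M P) \<subseteq> nz M P" using prd_least[OF _ subset_refl grp_nz[OF mM(1)]] by blast
  moreover have "M = prd K (nz M P)" unfolding K_def
   by (rule p_length_one(2)[OF Good_sub[OF Good_G mM(1,3)] proper_solv[OF mM(1,2)] p(1) sM])
  ultimately have "nz M P = M" using nz_sub[of M P] by blast
  hence nP: "nml P M" using nml_iff_nz[OF gP mM(1) PM] by simp
  have c1: "P \<subseteq> core {p} M" using core(3)[OF mM(1) nP] pP pgr_iff_pig[OF p(1)] by blast
  have "pgr p (core {p} M)" using core(2)[OF mM(1)] pgr_iff_pig[OF p(1)] by blast
  hence c: "core {p} M = P" by (rule syl_max[OF sM p(1) _ c1 core_sub[OF mM(1)]])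
  have "p < card (Om p P)" using sylow_rank_three[OF p P] prime_less_cube[OF p(1)] by linarith
  then obtain a b where ab: "a \<in> Om p P" "b \<in> Om p P" "a \<noteq> 1" "b \<notin> cyc a"
   using independent_elements[OF O(1,4) p(1)] by blast
  assume "P \<subseteq> L"
  thus "L \<subseteq> M"
   using sylow_uniqueness(2)[OF p P M(1), of a b L] ab O(2,4) L c by blast
 next
  case False
  then obtain x k where xk: "x \<in> P" "k \<in> K" "x * k \<noteq> k * x" by blast
  have sK: "solv K" by (rule proper_solv[OF nmlD(1)[OF nK(1)]]) (use nmlD(3)[OF nK(1)] mM(2) in blast)
  have "\<not> (\<forall>t v y. prime t \<longrightarrow> v \<in> P \<longrightarrow> y \<in> core {t} K \<longrightarrow> v * y = y * v)"
  proof
   assume all: "\<forall>t v y. prime t \<longrightarrow> v \<in> P \<longrightarrow> y \<in> core {t} K \<longrightarrow> v * y = y * v"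
   have "x * k = k * x"
    by (rule coprime_fitting[OF pP p(1) sK ndK inv_by_nml[OF nK(1) PM] _ xk(1,2)]) (use all in blast)
   thus False using xk(3) by simp
  qed
  then obtain t v y where t: "prime t" and v: "v \<in> P" and y: "y \<in> core {t} K" "v * y \<noteq> y * v" by blast
  have gK: "grp K" using nmlD(1)[OF nK(1)] .
  have pcK: "pgr t (core {t} K)" using core(2)[OF gK] pgr_iff_pig[OF t] by blast
  have "core {t} K \<noteq> {1}" using y by auto
  hence "t dvd card (core {t} K)" by (rule pgr_dvd[OF pcK])
  hence tK: "t dvd card K" using lagrange_dvd[OF gK pgr_grp[OF pcK] core_sub[OF gK]] dvd_trans by blast
  hence tp: "t \<noteq> p" using ndK by blast
  have KG: "K \<subseteq> G" using nmlD(3)[OF nK(1)] mM(3) by blast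
  have tG: "t dvd card G" using tK lagrange_dvd[OF grp_G gK KG] dvd_trans by blast
  define V where "V = core {t} M"
  have nV: "nml V M" "pgr t V" unfolding V_def using core(1,2)[OF mM(1)] pgr_iff_pig[OF t] by blast+
  have VG: "V \<subseteq> G" using nmlD(3)[OF nV(1)] mM(3) by blast
  have yV: "y \<in> V" using y(1) core_nml_sub[OF nK(1), of "{t}"] by (auto simp: V_def)
  obtain R where R: "syl t R G" "V \<subseteq> R" using syl_extends[OF grp_G t nV(2) VG] by blast
  have aV: "ab V" by (rule ab_sub[OF sylow_abelian[OF t tG R(1)] R(2)])
  \<comment> \<open>A smallest invariant subgroup of V not centralized by \<open>P\<close> is used.
    By \<open>small_rank_centralized\<close> its rank is at least three, so uniqueness at t applies
    to it.\<close>
  define Q where "Q W \<longleftrightarrow> grp W \<and> W \<subseteq> V \<and> inv_by P W \<and> \<not> (\<forall>x\<in>P. \<forall>w\<in>W. x * w = w * x)" for W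
  have QV: "Q V" unfolding Q_def using nmlD(1)[OF nV(1)] inv_by_nml[OF nV(1) PM] v yV y(2) by blast
  obtain W where W: "Q W" "\<And>W'. Q W' \<Longrightarrow> card W \<le> card W'"
   by (rule min_card_obtain[where P=Q, OF QV]) (rule that)
  have gW: "grp W" "W \<subseteq> V" "inv_by P W" and ncW: "\<not> (\<forall>x\<in>P. \<forall>w\<in>W. x * w = w * x)" using W(1) by (auto simp: Q_def)
  have pW: "pgr t W" by (rule pgr_sub[OF nV(2) t gW(1,2)])
  have aW: "ab W" by (rule ab_sub[OF aV gW(2)])
  have WG: "W \<subseteq> G" using gW(2) VG by blast
  note OW = Om[OF gW(1) aW, where p=t]
  have "t ^ 3 \<le> card (Om t W)"
  proof (rule ccontr)
   assume "\<not> t ^ 3 \<le> card (Om t W)"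
   hence s: "card (Om t W) < t ^ 3" by simp
   have "P \<subseteq> nz G W"
   proof
    fix x assume x: "x \<in> P"
    thus "x \<in> nz G W" using PG inv_byD[OF gW(3) x] by (intro nzI[OF grpD(1)[OF gW(1)]]) auto
   qed
   hence "P \<subseteq> cz G W" by (rule small_rank_centralized[OF Good_G pW t WG aW s pP p(1) tp[symmetric]])
   thus False using ncW by (auto simp: cz_def)
  qed
  hence "t < card (Om t W)" using prime_less_cube[OF t] by linarith
  then obtain a b where ab: "a \<in> Om t W" "b \<in> Om t W" "a \<noteq> 1" "b \<notin> cyc a"
   using independent_elements[OF OW(1,4) t] by blast
  have abW: "a \<in> W" "b \<in> W" "a ^ t = 1" "b ^ t = 1" using ab(1,2) OW(2,4) by blast+
  have RM: "L \<subseteq> M" if "grp L" "R \<subseteq> L" "L \<subset> G" for L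
   by (rule sylow_uniqueness(2)[OF t tG R(1) M(1), of a b]) (use abW ab gW(2) R(2) that V_def in auto)
  have WM: "L \<subseteq> M" if "grp L" "W \<subseteq> L" "L \<subset> G" for L
   by (rule uniqueness_noncyclic[OF t tG R(1) mM(1) RM gW(1) _ abW ab(3,4) that]) (use gW(2) R(2) in auto)
  \<comment> \<open>If no such f centralized \<open>W\<close>, each \<open>cz W {f}\<close> would by
    minimality be centralized by \<open>P\<close>, and these subgroups generate
    \<open>W\<close>.\<close>
  have D: "\<exists>f\<in>prd (cyc d) (cyc e) - {1}. cz G {f} \<subseteq> M" if de: "d \<in> Om p P" "e \<in> Om p P" "d \<noteq> 1" "e \<notin> cyc d" for d e
  proof -
   have fP: "f \<in> P" if "f \<in> prd (cyc d) (cyc e) - {1}" for f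
    using prd_least[OF cyc_least[OF O(1) de(1)] cyc_least[OF O(1) de(2)] O(1)] O(2) that by blast
   have "\<exists>f\<in>prd (cyc d) (cyc e) - {1}. cz W {f} = W"
   proof (rule ccontr)
    assume no: "\<not> (\<exists>f\<in>prd (cyc d) (cyc e) - {1}. cz W {f} = W)"
    have "W \<subseteq> gen (\<Union>f\<in>prd (cyc d) (cyc e) - {1}. cz W {f})"
    proof (rule coprime_generation[OF pgr_solv[OF pW t] _ p(1) O(1) de(1,2) O(4)[OF de(1)] O(4)[OF de(2)] de(3,4) abD[OF O(3) de(1,2)]])
     show "\<not> p dvd card W" using pgr_coprime_dvd[OF pW t p(1)] tp by simp
     fix w assume "w \<in> W"
     thus "cj d w \<in> W" "cj e w \<in> W" using inv_byD[OF gW(3)] de(1,2) O(2) by blast+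
    qed
    also have "\<dots> \<subseteq> cz W P"
    proof (rule gen_sub[OF UN_least grp_cz[OF gW(1)]])
     fix f assume f: "f \<in> prd (cyc d) (cyc e) - {1}"
     have "inv_by P (cz W {f})"
     proof (rule inv_by_cz[OF gW(3)])
      fix x e assume "x \<in> P" "e \<in> {f}"
      thus "cj x e = e" using abD[OF aP, of x f] fP[OF f] by (auto simp: cj_eq_iff)
     qed
     moreover have "cz W {f} \<subset> W" using no f cz_sub[of W "{f}"] by blast
     hence "card (cz W {f}) < card W" by (rule psubset_card_mono[OF grpD(1)[OF gW(1)]])
     hence "\<not> Q (cz W {f})" using W(2)[of "cz W {f}"] by linarith
     ultimately have "\<forall>x\<in>P. \<forall>w\<in>cz W {f}. x * w = w * x"
      unfolding Q_def using grp_cz[OF gW(1), of "{f}"] cz_sub[of W "{f}"] gW(2) by blast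
     thus "cz W {f} \<subseteq> cz W P" using cz_sub[of W "{f}"] by (auto simp: cz_def)
    qed
    finally show False using ncW by (auto simp: cz_def)
   qed
   then obtain f where f: "f \<in> prd (cyc d) (cyc e) - {1}" "cz W {f} = W" by blast
   have fG: "{f} \<subseteq> G" and f1: "f \<noteq> 1" using fP[OF f(1)] PG f(1) by auto
   have "cz W {f} \<subseteq> cz G {f}" using WG by (intro cz_mono) auto
   hence "cz G {f} \<subseteq> M" using WM[OF proper_cz(1)[OF singletonI f1 fG] _ proper_cz(2)[OF singletonI f1 fG]] f(2) by simp
   thus ?thesis using f(1) by blast
  qed
  assume PL: "P \<subseteq> L"
  have LG: "L \<subseteq> G" using L(2) by blast
  define Y where "Y = core (- {p}) L"
  have gY: "grp Y" "Y \<subseteq> L" unfolding Y_def by (rule grp_core[OF L(1)], rule core_sub[OF L(1)])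
  have sY: "solv Y" by (rule proper_solv[OF gY(1)]) (use gY(2) L(2) in blast)
  have ndY: "\<not> p dvd card Y" using core(2)[OF L(1), of "- {p}"] p(1) by (simp add: pig_compl Y_def)
  have "Y \<subseteq> gen (\<Union>d\<in>Om p P - {1}. \<Union>e\<in>Om p P - cyc d. cz Y {d, e})"
  proof (rule coprime_generation_rank_three[OF sY ndY p(1) O(1,3,4) sylow_rank_three[OF p P]])
   fix e y assume "e \<in> Om p P" "y \<in> Y"
   thus "cj e y \<in> Y" unfolding Y_def using nmlD(4)[OF core(1)[OF L(1)]] O(2) PL by blast
  qed
  also have "\<dots> \<subseteq> M"
  proof (rule gen_sub[OF _ mM(1)], intro UN_least)
   fix d e assume d: "d \<in> Om p P - {1}" and e: "e \<in> Om p P - cyc d"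
   then obtain f where f: "f \<in> prd (cyc d) (cyc e) - {1}" "cz G {f} \<subseteq> M" using D[of d e] by blast
   obtain i j where ij: "f = d ^ i * e ^ j" using f(1) by (auto simp: prd_iff cyc_def)
   have "cz Y {d, e} \<subseteq> cz G {f}"
   proof
    fix y assume y: "y \<in> cz Y {d, e}"
    hence "cj y d = d" "cj y e = e" by (auto simp: cz_def cj_eq_iff)
    hence "cj y f = f" by (simp add: ij cj_mult cj_pow)
    thus "y \<in> cz G {f}" using y gY(2) LG by (auto simp: cz_def cj_eq_iff)
   qed
   thus "cz Y {d, e} \<subseteq> M" using f(2) by blast
  qed
  finally have YM: "Y \<subseteq> M" .
  have "nz L P \<subseteq> M" using M(2) LG by (auto simp: nz_def)
  moreover have "L = prd Y (nz L P)" unfolding Y_def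
   by (rule p_length_one(2)[OF Good_sub[OF Good_G L(1) LG] proper_solv[OF L] p(1) syl_sub[OF P L(1) PL LG]])
  ultimately show "L \<subseteq> M" using prd_least[OF YM _ mM(1)] by blast
 qed
 thus ?thesis using M(1) PM by blast
qed

section \<open>The maximal subgroup attached to a non-trivial p-subgroup\<close>

definition Mx :: "gp set \<Rightarrow> gp set" where "Mx P = (THE M. maximal M \<and> P \<subseteq> M)"

lemma Mx:
 assumes p: "prime p" "p dvd card G" and P: "syl p P G"
 shows "maximal (Mx P)" "P \<subseteq> Mx P" "grp L \<Longrightarrow> P \<subseteq> L \<Longrightarrow> L \<subset> G \<Longrightarrow> L \<subseteq> Mx P"
  "maximal M \<Longrightarrow> P \<subseteq> M \<Longrightarrow> Mx P = M"
proof -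
 obtain M where M: "maximal M" "P \<subseteq> M" "\<forall>L. grp L \<longrightarrow> P \<subseteq> L \<longrightarrow> L \<subset> G \<longrightarrow> L \<subseteq> M"
  using unique_maximal_ex[OF p P] by blast
 have u: "M' = M" if "maximal M'" "P \<subseteq> M'" for M'
  using maximalD(4)[OF that(1) maximalD(1)[OF M(1)] _ maximalD(2)[OF M(1)]] maximalD(1,2)[OF that(1)] that(2) M(3) by blast
 have e: "Mx P = M" unfolding Mx_def by (rule the_equality) (use M(1,2) u in blast)+
 show "maximal (Mx P)" "P \<subseteq> Mx P" "grp L \<Longrightarrow> P \<subseteq> L \<Longrightarrow> L \<subset> G \<Longrightarrow> L \<subseteq> Mx P" using e M by auto
 show "maximal M' \<Longrightarrow> P \<subseteq> M' \<Longrightarrow> Mx P = M'" for M' using e u by blast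
qed

lemma cj_proper: assumes "g \<in> G" "H \<subset> G" shows "cj g ` H \<subset> G"
proof -
 have "cj g ` H \<subseteq> G" using image_mono[of H G "cj g"] assms cj_img_grp[OF grp_G assms(1)] by auto
 moreover have "card (cj g ` H) < card G" using psubset_card_mono[OF grpD(1)[OF grp_G] assms(2)] by simp
 ultimately show ?thesis by auto
qed

lemma maximal_cj: assumes "maximal M" "g \<in> G" shows "maximal (cj g ` M)"
 unfolding maximal_def
proof (intro conjI allI impI)
 note m = maximalD[OF assms(1)]
 show "grp (cj g ` M)" "cj g ` M \<subset> G" using grp_cj[OF m(1)] cj_proper[OF assms(2) m(2)] .
 fix L assume L: "grp L" "cj g ` M \<subseteq> L" "L \<subset> G"
 have "M \<subseteq> cj (inverse g) ` L" using image_mono[OF L(2), of "cj (inverse g)"] by simp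
 hence "cj (inverse g) ` L = M"
  by (rule m(4)[OF grp_cj[OF L(1)] _ cj_proper[OF grpD(4)[OF grp_G assms(2)] L(3)]])
 thus "L = cj g ` M" by (metis cj_img_cancel(2))
qed

lemma Mx_cj: assumes p: "prime p" "p dvd card G" "syl p P G" "g \<in> G" shows "Mx (cj g ` P) = cj g ` Mx P"
 by (rule Mx(4)[OF p(1,2) syl_cj_in[OF p(3,4)] maximal_cj[OF Mx(1)[OF p(1-3)] p(4)] image_mono[OF Mx(2)[OF p(1-3)]]])

definition omg :: "nat \<Rightarrow> gp set \<Rightarrow> gp set" where
 "omg p A = Mx (SOME P. syl p P G \<and> A \<subseteq> P)"

context
 fixes p :: nat and A :: "gp set"
 assumes p: "prime p" and A: "pgr p A" "A \<subseteq> G" "A \<noteq> {1}"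
begin

lemma p_dvd: "p dvd card G"
 using pgr_dvd[OF A(1,3)] lagrange_dvd[OF grp_G pgr_grp[OF A(1)] A(2)] dvd_trans by blast

text \<open>Two Sylow subgroups above \<open>A\<close> are conjugate under the centralizer of
  \<open>A\<close>, which lies in \<open>Mx P\<close>; so the choice made in \<open>omg\<close> does
  not matter.\<close>

lemma omg_eq: assumes P: "syl p P G" "A \<subseteq> P" shows "omg p A = Mx P"
proof -
 define S where "S = (SOME P. syl p P G \<and> A \<subseteq> P)"
 have "syl p S G \<and> A \<subseteq> S" unfolding S_def by (rule someI[of _ P]) (use P in blast)
 hence S: "syl p S G" "A \<subseteq> S" by blast+
 note gA = pgr_grp[OF A(1)]
 have "A \<noteq> {}" using grpD(9)[OF gA] .
 then obtain c where c: "c \<in> cz G A" "S = cj c ` P" using sylow_conj_centralizer[OF p A(3) _ P(1) S(1) P(2) S(2)] by blast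
 obtain a where a: "a \<in> A" "a \<noteq> 1" using A(3) \<open>A \<noteq> {}\<close> by blast
 have "P \<subseteq> cz G A" using abD[OF sylow_abelian[OF p p_dvd P(1)]] P(2) sylD(4)[OF P(1)] by (auto simp: cz_def)
 hence "cz G A \<subseteq> Mx P" by (rule Mx(3)[OF p p_dvd P(1) proper_cz(1)[OF a A(2)] _ proper_cz(2)[OF a A(2)]])
 hence "c \<in> Mx P" using c(1) by blast
 hence "cj c ` Mx P = Mx P" by (rule cj_img_grp[OF maximalD(1)[OF Mx(1)[OF p p_dvd P(1)]]])
 moreover have "c \<in> G" using c(1) cz_sub by blast
 ultimately show ?thesis using Mx_cj[OF p p_dvd P(1), of c] c(2) unfolding omg_def S_def[symmetric] by simp
qed

lemma omg_sylow: obtains P where "syl p P G" "A \<subseteq> P" "omg p A = Mx P" "p dvd card G"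
 using syl_extends[OF grp_G p A(1,2)] omg_eq p_dvd by blast

lemma omg_maximal: "maximal (omg p A)"
 using omg_sylow Mx(1)[OF p] by metis

lemma omg_nz: "nz G A \<subseteq> omg p A"
proof -
 obtain P where P: "syl p P G" "A \<subseteq> P" "omg p A = Mx P" "p dvd card G" by (rule omg_sylow)
 note pn = proper_nz[OF pgr_grp[OF A(1)] A(2,3) pgr_proper[OF A(1) p]]
 have "P \<subseteq> cz G A" using abD[OF sylow_abelian[OF p P(4,1)]] P(2) sylD(4)[OF P(1)] by (auto simp: cz_def)
 hence "P \<subseteq> nz G A" using cz_sub_nz by blast
 thus ?thesis unfolding P(3) by (rule Mx(3)[OF p P(4,1) pn(1) _ pn(2)])
qed

lemma omg_cj: assumes g: "g \<in> G" shows "omg p (cj g ` A) = cj g ` omg p A"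
proof -
 obtain P where P: "syl p P G" "A \<subseteq> P" "omg p A = Mx P" "p dvd card G" by (rule omg_sylow)
 have "cj g ` A \<noteq> {1}"
 proof
  assume "cj g ` A = {1}"
  hence "card A = 1" using card_cj[of g A] by simp
  thus False using grp_card_one[OF pgr_grp[OF A(1)]] A(3) by blast
 qed
 moreover have "cj g ` A \<subseteq> G" using image_mono[OF A(2), of "cj g"] cj_img_grp[OF grp_G g] by simp
 ultimately have "omg p (cj g ` A) = Mx (cj g ` P)"
  using minimal_counterexample.omg_eq[OF minimal_counterexample_axioms p pgr_cj[OF A(1)] _ _ syl_cj_in[OF P(1) g] image_mono[OF P(2)]] by blast
 thus ?thesis using Mx_cj[OF p P(4,1) g] P(3) by simp
qed

end

lemma omg_mono:
 assumes "prime p" "pgr p B" "B \<subseteq> G" "grp A" "A \<subseteq> B" "A \<noteq> {1}" shows "omg p A = omg p B"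
proof -
 have B1: "B \<noteq> {1}" using assms(4-6) grpD(2)[OF assms(4)] by blast
 obtain P where P: "syl p P G" "B \<subseteq> P" "omg p B = Mx P" by (rule omg_sylow[OF assms(1-3) B1])
 have "omg p A = Mx P"
  by (rule omg_eq[OF assms(1) pgr_sub[OF assms(2,1,4,5)] _ assms(6) P(1)]) (use assms(3,5) P(2) in auto)
 thus ?thesis using P(3) by simp
qed

text \<open>Inside \<open>Mx P\<close> the group \<open>A\<close> is conjugate to a subgroup of
  \<open>P\<close>, by an element of \<open>Mx P\<close>.\<close>

lemma omg_in_Mx:
 assumes p: "prime p" "p dvd card G" "syl p P G" and A: "pgr p A" "A \<subseteq> Mx P" "A \<noteq> {1}" shows "omg p A = Mx P"
proof -
 note m = maximalD[OF Mx(1)[OF p]]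
 obtain x where x: "x \<in> Mx P" "A \<subseteq> cj x ` P"
  using syl_contains_conj[OF syl_sub[OF p(3) m(1) Mx(2)[OF p] m(3)] p(1) A(1,2)] by blast
 have xG: "x \<in> G" using x(1) m(3) by blast
 have "omg p A = Mx (cj x ` P)" by (rule omg_eq[OF p(1) A(1) _ A(3) syl_cj_in[OF p(3) xG] x(2)]) (use A(2) m(3) in blast)
 thus ?thesis using Mx_cj[OF p xG] cj_img_grp[OF m(1) x(1)] by simp
qed

lemma omg_noncyclic:
 assumes p: "prime p" and L: "grp L" "L \<subset> G"
  and ab: "a \<in> L" "b \<in> L" "a ^ p = 1" "b ^ p = 1" "a \<noteq> 1" "b \<notin> cyc a" "a * b = b * a"
 shows "L \<subseteq> omg p (cyc a)"
proof -
 have gc: "grp (cyc a)" "grp (cyc b)" "cyc a \<subseteq> L" "cyc b \<subseteq> L" using grp_cyc[OF L(1)] ab(1,2) by blast+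
 have comm: "u * w = w * u" if uw: "u \<in> cyc a" "w \<in> cyc b" for u w
 proof -
  obtain i j where "u = a ^ i" "w = b ^ j" using uw by (auto simp: cyc_def)
  thus ?thesis using power_commuting_commutes[OF power_commuting_commutes[OF ab(7)[symmetric], of j, symmetric], of i] by simp
 qed
 define A where "A = prd (cyc a) (cyc b)"
 have gA: "grp A" unfolding A_def by (rule grp_prd_comm[OF gc(1,2) comm])
 have pc: "pgr p (cyc x)" if "x \<in> L" "x ^ p = 1" for x using pgr_cyc[OF L(1) that(1), of p 1] that(2) p by simp
 have pA: "pgr p A"
  using pig_prd[of "{p}" "cyc a" "cyc b"] pc ab(1-4) gA unfolding pgr_iff_pig[OF p] A_def by blast
 have sub: "cyc a \<subseteq> A" "cyc b \<subseteq> A" "A \<subseteq> L"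
  unfolding A_def using prd_sub1[OF gc(1,2)] prd_sub2[OF gc(1,2)] prd_least[OF gc(3,4) L(1)] .
 have AG: "A \<subseteq> G" using sub(3) L(2) by blast
 have abA: "a \<in> A" "b \<in> A" using sub cyc_self by blast+
 have A1: "A \<noteq> {1}" using abA(1) ab(5) by blast
 have c1: "cyc a \<noteq> {1}" using cyc_self[of a] ab(5) by (metis singletonD)
 obtain P where P: "syl p P G" "A \<subseteq> P" "omg p A = Mx P" "p dvd card G" by (rule omg_sylow[OF p pA AG A1])
 have "L \<subseteq> Mx P"
  by (rule uniqueness_noncyclic[OF p P(4,1) maximalD(1)[OF Mx(1)[OF p P(4,1)]] Mx(3)[OF p P(4,1)] gA P(2) abA ab(3-6) L(1) sub(3) L(2)])
 thus ?thesis using omg_mono[OF p pA AG gc(1) sub(1) c1] P(3) by simp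
qed

end

section \<open>Factorizations\<close>

lemma card_Om:
 assumes "grp A" "ab A" shows "card A = card ((\<lambda>x. x ^ t) ` A) * card (Om t A)" "grp ((\<lambda>x. x ^ t) ` A)"
proof -
 have h: "ghom (\<lambda>x. x ^ t) A" unfolding ghom_def using assms(1) abD[OF assms(2)] by (blast intro: pow_mult_commuting)
 have "A \<inter> ker (\<lambda>x. x ^ t) A = Om t A" by (auto simp: ker_def Om_def)
 thus "card A = card ((\<lambda>x. x ^ t) ` A) * card (Om t A)" using card_img[OF h assms(1)] by simp
 show "grp ((\<lambda>x. x ^ t) ` A)" by (rule grp_img[OF h])
qed

text \<open>Ranks of factors at most add up: the t-th power map compares each group with its
  \<open>Om\<close>, and the t-th powers of \<open>A\<close> and of \<open>B\<close> meet inside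
  \<open>A \<inter> B\<close>.\<close>

lemma card_Om_prd:
 assumes T: "grp T" "ab T" and AB: "grp A" "grp B" "T = prd A B"
  and c: "card (Om t A) \<le> t" "card (Om t B) \<le> t"
 shows "card (Om t T) \<le> t * t"
proof -
 let ?f = "\<lambda>x::'a. x ^ t"
 have sub: "A \<subseteq> T" "B \<subseteq> T" unfolding AB(3) using prd_sub1[OF AB(1,2)] prd_sub2[OF AB(1,2)] .
 have ab: "ab A" "ab B" using ab_sub[OF T(2)] sub by blast+
 note a = card_Om[OF AB(1) ab(1), of t] and b = card_Om[OF AB(2) ab(2), of t] and tt = card_Om[OF T, of t]
 define y where "y = card (prd (?f ` A) (?f ` B))"
 have "prd (?f ` A) (?f ` B) \<subseteq> ?f ` T" by (rule prd_least[OF _ _ tt(2)]) (use sub in auto)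
 hence y: "y \<le> card (?f ` T)" unfolding y_def using card_mono grpD(1)[OF tt(2)] by blast
 have j: "card (?f ` A \<inter> ?f ` B) \<le> card (A \<inter> B)"
 proof (rule card_mono)
  show "finite (A \<inter> B)" using grpD(1)[OF AB(1)] by blast
  show "?f ` A \<inter> ?f ` B \<subseteq> A \<inter> B" using grpD(5)[OF AB(1)] grpD(5)[OF AB(2)] by auto
 qed
 have "card T * card (A \<inter> B) = card A * card B" using card_prd[OF AB(1,2)] AB(3) by simp
 also have "\<dots> \<le> (card (?f ` A) * t) * (card (?f ` B) * t)"
  using a(1) b(1) c by (metis mult_le_mono mult_le_mono2)
 also have "\<dots> = t * t * (y * card (?f ` A \<inter> ?f ` B))" using card_prd[OF a(2) b(2)] unfolding y_def by (simp add: ac_simps)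
 also have "\<dots> \<le> t * t * (card (?f ` T) * card (A \<inter> B))" by (intro mult_le_mono2 mult_le_mono y j)
 finally have "card (?f ` T) * card (Om t T) * card (A \<inter> B) \<le> card (?f ` T) * (t * t) * card (A \<inter> B)"
  unfolding tt(1) by (simp only: ac_simps)
 moreover have "card (A \<inter> B) > 0" by (rule grpD(8)[OF grp_Int[OF AB(1,2)]])
 ultimately have "card (?f ` T) * card (Om t T) \<le> card (?f ` T) * (t * t)" by simp
 thus ?thesis using grpD(8)[OF tt(2)] by simp
qed

text \<open>Some s = k h brings a Sylow subgroup of \<open>K\<close> and one of \<open>H\<close>
  into a common Sylow subgroup of \<open>S\<close>; splitting s moves each only within its own
  factor. The product has full order because the intersection is a t-subgroup of
  \<open>H \<inter> K\<close> and |S| |H \<inter> K| = |H| |K|.\<close>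

lemma sylow_prd:
 assumes S: "grp S" "prd H K = S" and H: "grp H" and K: "grp K" and t: "prime t"
 obtains T A B where "syl t T S" "grp A" "grp B" "A \<subseteq> H" "B \<subseteq> K" "T = prd A B"
proof -
 have HS: "H \<subseteq> S" and KS: "K \<subseteq> S" using prd_sub1[OF H K] prd_sub2[OF H K] S(2) by auto
 have comm: "prd H K = prd K H" using grp_prd_iff[OF H K] S by simp
 obtain A0 where A0: "syl t A0 H" using syl_exists[OF H t] by blast
 obtain B0 where B0: "syl t B0 K" using syl_exists[OF K t] by blast
 have A0S: "A0 \<subseteq> S" and B0S: "B0 \<subseteq> S" using sylD(4)[OF A0] sylD(4)[OF B0] HS KS by blast+
 obtain T0 where T0: "syl t T0 S" "A0 \<subseteq> T0" using syl_extends[OF S(1) t sylD(2)[OF A0] A0S] by blast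
 obtain s where s: "s \<in> S" "B0 \<subseteq> cj s ` T0" using syl_contains_conj[OF T0(1) t sylD(2)[OF B0] B0S] by blast
 obtain k h where kh: "k \<in> K" "h \<in> H" "s = k * h" using s(1) S(2) comm by (auto simp: prd_iff)
 define T where "T = cj h ` T0" define A where "A = cj h ` A0" define B where "B = cj (inverse k) ` B0"
 have T: "syl t T S" unfolding T_def by (rule syl_cj_in[OF T0(1)]) (use kh HS in blast)
 have A: "syl t A H" unfolding A_def by (rule syl_cj_in[OF A0 kh(2)])
 have B: "syl t B K" unfolding B_def by (rule syl_cj_in[OF B0 grpD(4)[OF K kh(1)]])
 have AT: "A \<subseteq> T" unfolding A_def T_def by (rule image_mono[OF T0(2)])
 have "B \<subseteq> cj (inverse k) ` (cj s ` T0)" unfolding B_def by (rule image_mono[OF s(2)])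
 hence BT: "B \<subseteq> T" by (simp add: T_def kh(3) cj_img_comp)
 note gA = sylD(3)[OF A] and gB = sylD(3)[OF B] and gT = sylD(3)[OF T]
 have le: "prd A B \<subseteq> T" by (rule prd_least[OF AT BT gT])
 have gI: "grp (H \<inter> K)" by (rule grp_Int[OF H K])
 have pI: "pgr t (A \<inter> B)" by (rule pgr_sub[OF sylD(2)[OF A] t grp_Int[OF gA gB]]) simp
 have "A \<inter> B \<subseteq> H \<inter> K" using sylD(4)[OF A] sylD(4)[OF B] by blast
 then obtain C where C: "syl t C (H \<inter> K)" "A \<inter> B \<subseteq> C" using syl_extends[OF gI t pI] by blast
 have "card T * card (A \<inter> B) \<le> card T * card C"
  using card_mono[OF grpD(1)[OF sylD(3)[OF C(1)]] C(2)] by simp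
 also have "\<dots> = t ^ multiplicity t (card S * card (H \<inter> K))"
  using syl_card[OF T t] syl_card[OF C(1) t] grpD(8)[OF S(1)] grpD(8)[OF gI] t
  by (simp add: prime_elem_multiplicity_mult_distrib power_add)
 also have "card S * card (H \<inter> K) = card H * card K" using card_prd[OF H K] S(2) by simp
 also have "t ^ multiplicity t (card H * card K) = card A * card B"
  using syl_card[OF A t] syl_card[OF B t] grpD(8)[OF H] grpD(8)[OF K] t
  by (simp add: prime_elem_multiplicity_mult_distrib power_add)
 also have "\<dots> = card (prd A B) * card (A \<inter> B)" using card_prd[OF gA gB] by simp
 finally have "card T \<le> card (prd A B)" using grpD(8)[OF pgr_grp[OF pI]] by simp
 hence "prd A B = T" by (rule subgroup_eq_card[OF gT le])
 thus ?thesis using that[OF T gA gB sylD(4)[OF A] sylD(4)[OF B]] by simp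
qed

text \<open>An odd index greater than 1 is at least 3. Every factor 3 in the averaging stems from
  this or from three disjoint sets of equal size.\<close>

lemma proper_third: assumes "grp L" "grp H" "H \<subset> L" "odd (card L)" shows "3 * card H \<le> card L"
proof -
 have l: "card L = card (lcs L H) * card H" using lagrange assms(1-3) by blast
 have "card (lcs L H) \<noteq> 1"
  using l psubset_card_mono[OF grpD(1)[OF assms(1)] assms(3)] by auto
 moreover have "odd (card (lcs L H))" using l assms(4) by auto
 ultimately have "3 \<le> card (lcs L H)" by presburger
 thus ?thesis unfolding l by (rule mult_le_mono1)
qed

context minimal_counterexample
begin

definition Lam :: "gp set set" where "Lam = {H \<in> subs G. H \<noteq> {1} \<and> H \<noteq> G}"
definition lp :: "gp set \<Rightarrow> nat" where "lp H = (LEAST p. prime p \<and> core {p} H \<noteq> {1})"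

text \<open>Only a definite choice matters: the least prime singles out a non-trivial primary part of the Fitting
 subgroup of \<open>H\<close>, and \<open>om H\<close> is the maximal subgroup attached to it.\<close>

definition om :: "gp set \<Rightarrow> gp set" where "om H = omg (lp H) (core {lp H} H)"

lemma LamD: assumes "H \<in> Lam"
 shows "grp H" "H \<subset> G" "H \<subseteq> G" "prime (lp H)" "pgr (lp H) (core {lp H} H)" "core {lp H} H \<subseteq> H"
  "core {lp H} H \<subseteq> G" "core {lp H} H \<noteq> {1}"
proof -
 show H: "grp H" "H \<subset> G" "H \<subseteq> G" using assms by (auto simp: Lam_def subs_def)
 have H1: "H \<noteq> {1}" using assms by (auto simp: Lam_def)
 have "\<exists>p. prime p \<and> core {p} H \<noteq> {1}" by (rule core_nontriv[OF proper_solv[OF H(1,2)] H1])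
 hence "prime (lp H) \<and> core {lp H} H \<noteq> {1}" unfolding lp_def by (rule LeastI_ex)
 thus p: "prime (lp H)" "core {lp H} H \<noteq> {1}" by auto
 show "pgr (lp H) (core {lp H} H)" using core(2)[OF H(1)] pgr_iff_pig[OF p(1)] by blast
 show "core {lp H} H \<subseteq> H" by (rule core_sub[OF H(1)])
 thus "core {lp H} H \<subseteq> G" using H(3) by blast
qed

lemma Lam_cj: assumes "H \<in> Lam" "g \<in> G" shows "cj g ` H \<in> Lam"
proof -
 have "card H \<noteq> 1" using assms(1) grp_card_one[OF LamD(1)[OF assms(1)]] by (auto simp: Lam_def)
 hence "cj g ` H \<noteq> {1}" by (metis card_cj is_singletonI is_singleton_altdef)
 thus ?thesis using grp_cj[OF LamD(1)[OF assms(1)]] cj_proper[OF assms(2) LamD(2)[OF assms(1)]] by (auto simp: Lam_def subs_def)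
qed

lemma om: assumes H: "H \<in> Lam"
 shows "maximal (om H)" "nz G (core {lp H} H) \<subseteq> om H" "H \<subseteq> om H" "g \<in> G \<Longrightarrow> om (cj g ` H) = cj g ` om H"
proof -
 note h = LamD[OF H]
 show "maximal (om H)" unfolding om_def by (rule omg_maximal[OF h(4,5,7,8)])
 show n: "nz G (core {lp H} H) \<subseteq> om H" unfolding om_def by (rule omg_nz[OF h(4,5,7,8)])
 have "nz H (core {lp H} H) = H" using nml_iff_nz[OF pgr_grp[OF h(5)] h(1,6)] core(1)[OF h(1)] by simp
 moreover have "nz H (core {lp H} H) \<subseteq> nz G (core {lp H} H)" using h(3) by (auto simp: nz_def)
 ultimately show "H \<subseteq> om H" using n by simp
 assume g: "g \<in> G"
 have "core {p} (cj g ` H) = {1} \<longleftrightarrow> core {p} H = {1}" for p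
  using grp_card_one[OF grp_core[OF h(1)]] grp_card_one[OF grp_core[OF grp_cj[OF h(1)]]] card_cj cj_core by metis
 hence "lp (cj g ` H) = lp H" by (simp add: lp_def)
 thus "om (cj g ` H) = cj g ` om H" unfolding om_def cj_core[symmetric] using omg_cj[OF h(4,5,7,8) g] by simp
qed

lemma pgr_abelian: assumes "prime t" "pgr t A" "A \<subseteq> G" shows "ab A"
proof (cases "A = {1}")
 case False
 obtain P where "syl t P G" "A \<subseteq> P" "t dvd card G" by (rule omg_sylow[OF assms False]) 
 thus ?thesis using sylow_abelian[OF assms(1)] ab_sub by blast
qed (simp add: ab_def)

text \<open>Rank at most two for all primes makes every \<open>core {t} S\<close> central, so
  \<open>S\<close> coincides with \<open>cz_cores S\<close>, which is abelian.\<close>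

lemma small_sylows_abelian:
 assumes S: "grp S" "S \<subset> G" and small: "\<And>t. prime t \<Longrightarrow> \<exists>T. syl t T S \<and> card (Om t T) < t ^ 3"
 shows "ab S"
proof -
 have SG: "S \<subseteq> G" using S(2) by blast
 have c: "cz S (core {t} S) = S" if t: "prime t" for t
 proof -
  define A where "A = core {t} S"
  have A: "nml A S" "pgr t A" unfolding A_def using core(1,2)[OF S(1)] pgr_iff_pig[OF t] by blast+
  have insyl: "A \<subseteq> T" if T: "syl t T S" for T
  proof -
   obtain x where x: "x \<in> S" "A \<subseteq> cj x ` T" using syl_contains_conj[OF T t A(2) nmlD(3)[OF A(1)]] by blast
   thus ?thesis using image_mono[OF x(2), of "cj (inverse x)"] nmlD(5)[OF A(1) grpD(4)[OF S(1) x(1)]] by simp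
  qed
  obtain T where T: "syl t T S" "card (Om t T) < t ^ 3" using small[OF t] by blast
  have "Om t A \<subseteq> Om t T" using insyl[OF T(1)] by (auto simp: Om_def)
  moreover have "finite (Om t T)" using grpD(1)[OF sylD(3)[OF T(1)]] by (simp add: Om_def)
  ultimately have s: "card (Om t A) < t ^ 3" using card_mono[of "Om t T" "Om t A"] T(2) by linarith
  have aS: "ab R" "R \<subseteq> S" if "syl t R S" for R
   using pgr_abelian[OF t sylD(2)[OF that]] sylD(4)[OF that] SG by auto
  have Rc: "R \<subseteq> cz S A" if R: "syl t R S" for R using insyl[OF R] aS[OF R] unfolding cz_def ab_def by blast
  show ?thesis unfolding A_def[symmetric]
   by (rule small_rank_central[OF Good_sub[OF Good_G S(1) SG] A t ab_sub[OF aS(1)[OF T(1)] insyl[OF T(1)]] s Rc])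
 qed
 define D where "D = cz_cores S"
 have "ab D" unfolding D_def by (rule fitting(2)[OF proper_solv[OF S]])
 moreover have "x \<in> D" if x: "x \<in> S" for x
  unfolding D_def
 proof (intro CollectI conjI allI impI ballI x)
  fix p :: nat and y assume p: "prime p" and y: "y \<in> core {p} S"
  have "x \<in> cz S (core {p} S)" using c[OF p] x by simp
  thus "x * y = y * x" using y by (simp add: cz_def)
 qed
 ultimately show ?thesis by (auto simp: ab_def)
qed

text \<open>All proper subgroups containing two independent commuting elements of order t lie in one
  maximal subgroup, and \<open>om H\<close> contains such elements. So \<open>om H\<close> can be
  computed from t instead of \<open>lp H\<close>.\<close>

lemma om_noncyclic:
 assumes H: "H \<in> Lam" and t: "prime t" and A: "grp A" "A \<subseteq> H" "ab A" "t < card (Om t A)"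
 shows "\<exists>B. pgr t B \<and> B \<noteq> {1} \<and> B \<subseteq> G \<and> om H = omg t B" "grp L \<Longrightarrow> L \<subset> G \<Longrightarrow> H \<subseteq> L \<Longrightarrow> L \<subseteq> om H"
proof -
 note O = Om[OF A(1,3), where p=t] and h = LamD[OF H]
 obtain a b where ab: "a \<in> Om t A" "b \<in> Om t A" "a \<noteq> 1" "b \<notin> cyc a"
  using independent_elements[OF O(1,4) t A(4)] by blast
 have aH: "a \<in> H" "b \<in> H" using ab(1,2) O(2) A(2) by blast+
 have aL: "L \<subseteq> omg t (cyc a)" if "grp L" "L \<subset> G" "H \<subseteq> L" for L
  by (rule omg_noncyclic[OF t that(1,2) _ _ O(4)[OF ab(1)] O(4)[OF ab(2)] ab(3,4) abD[OF O(3) ab(1,2)]]) (use aH that(3) in blast)+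
 have ca: "pgr t (cyc a)" "cyc a \<noteq> {1}" "cyc a \<subseteq> G"
  using pgr_cyc[OF h(1) aH(1), of t 1] O(4)[OF ab(1)] t cyc_self[of a] ab(3) grp_cyc(2)[OF h(1) aH(1)] h(3) by (simp, metis singletonD, blast)
 note m = maximalD[OF om(1)[OF H]] and m' = maximalD[OF omg_maximal[OF t ca(1,3,2)]]
 have e: "om H = omg t (cyc a)" using m(4)[OF m'(1) aL[OF m(1,2) om(3)[OF H]] m'(2)] by simp
 show "\<exists>B. pgr t B \<and> B \<noteq> {1} \<and> B \<subseteq> G \<and> om H = omg t B" using ca e by blast
 show "grp L \<Longrightarrow> L \<subset> G \<Longrightarrow> H \<subseteq> L \<Longrightarrow> L \<subseteq> om H" unfolding e by (rule aL)
qed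

lemma large_factor:
 assumes t: "prime t" and T: "pgr t T" "T \<subseteq> G" "t ^ 3 \<le> card (Om t T)" and AB: "grp A" "grp B" "T = prd A B"
 shows "ab A" "ab B" "t < card (Om t A) \<or> t < card (Om t B)"
proof -
 have gT: "grp T" "ab T" using pgr_grp[OF T(1)] pgr_abelian[OF t T(1,2)] .
 show "ab A" "ab B" using ab_sub[OF gT(2)] prd_sub1[OF AB(1,2)] prd_sub2[OF AB(1,2)] AB(3) by auto
 have "t * t < t ^ 3" using power_strict_increasing[of 2 3 t] prime_gt_1_nat[OF t] by (simp add: power2_eq_square)
 thus "t < card (Om t A) \<or> t < card (Om t B)" using card_Om_prd[OF gT AB, of t] T(3) by linarith
qed

text \<open>The product S is a proper subgroup. If its Sylow subgroups have rank at most two, S is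
  abelian and \<open>K\<close> normalizes the core of \<open>H\<close>. Otherwise a Sylow subgroup
  of rank at least three is a product of subgroups of \<open>H\<close> and \<open>K\<close>, one of
  them noncyclic, and that one confines S to its maximal subgroup.\<close>

lemma permuting_pair:
 assumes H: "H \<in> Lam" and K: "K \<in> Lam" and perm: "prd H K = prd K H" and ne: "prd H K \<noteq> G"
 shows "K \<subseteq> om H \<or> H \<subseteq> om K"
proof -
 note h = LamD[OF H] and k = LamD[OF K]
 define S where "S = prd H K"
 have gS: "grp S" unfolding S_def using grp_prd_iff[OF h(1) k(1)] perm by simp
 have HS: "H \<subseteq> S" "K \<subseteq> S" unfolding S_def using prd_sub1[OF h(1) k(1)] prd_sub2[OF h(1) k(1)] .
 have SG: "S \<subset> G" using prd_least[OF h(3) k(3) grp_G] ne by (auto simp: S_def)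
 show ?thesis
 proof (cases "\<forall>t. prime t \<longrightarrow> (\<exists>T. syl t T S \<and> card (Om t T) < t ^ 3)")
  case True
  hence a: "ab S" by (intro small_sylows_abelian[OF gS SG]) blast
  have "K \<subseteq> nz G (core {lp H} H)"
  proof
   fix x assume x: "x \<in> K"
   show "x \<in> nz G (core {lp H} H)"
   proof (rule nzI[OF grpD(1)[OF pgr_grp[OF h(5)]]])
    show "x \<in> G" using x k(3) by blast
    fix y assume y: "y \<in> core {lp H} H"
    have "x * y = y * x" by (rule abD[OF a]) (use x y HS h(6) in blast)+
    hence "cj x y = y" by (simp add: cj_eq_iff)
    thus "cj x y \<in> core {lp H} H" using y by simp
   qed
  qed
  thus ?thesis using om(2)[OF H] by blast
 next
  case False
  then obtain t where t: "prime t" "\<And>T. syl t T S \<Longrightarrow> t ^ 3 \<le> card (Om t T)" by (auto simp: not_less)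
  obtain T A B where T: "syl t T S" "grp A" "grp B" "A \<subseteq> H" "B \<subseteq> K" "T = prd A B"
   by (rule sylow_prd[OF gS S_def[symmetric] h(1) k(1) t(1)])
  have TG: "T \<subseteq> G" using sylD(4)[OF T(1)] SG by blast
  note l = large_factor[OF t(1) sylD(2)[OF T(1)] TG t(2)[OF T(1)] T(2,3,6)]
  show ?thesis
   using l(3) om_noncyclic(2)[OF H t(1) T(2,4) l(1) _ gS SG HS(1)] om_noncyclic(2)[OF K t(1) T(3,5) l(2) _ gS SG HS(2)] HS by blast
 qed
qed

section \<open>Counting permuting pairs\<close>

abbreviation "pcj H K \<equiv> {g \<in> G. prd H (cj g ` K) = prd (cj g ` K) H}"

text \<open>Conjugating the second component by a fixed g permutes \<open>R\<close>, so averaging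
  over g turns the bound for each pair into a bound for the number of permuting pairs.\<close>

lemma count_permuting:
 assumes R: "R \<subseteq> Lam \<times> Lam" "\<And>H K g. (H, K) \<in> R \<Longrightarrow> g \<in> G \<Longrightarrow> (H, cj g ` K) \<in> R"
  and per: "\<And>H K. (H, K) \<in> R \<Longrightarrow> 3 * card (pcj H K) \<le> d * card G"
 shows "3 * card {(H, K) \<in> R. prd H K = prd K H} \<le> d * card R"
proof -
 define Q where "Q = {(H, K) \<in> R. prd H K = prd K H}"
 define f where "f g x = (fst x, cj g ` snd x)" for g and x :: "gp set \<times> gp set"
 have fin: "finite R" using finite_subset[OF R(1)] finite_subs[OF grp_G] by (simp add: Lam_def)
 have fG: "finite G" by (rule grpD(1)[OF grp_G])
 have QR: "Q \<subseteq> R" by (auto simp: Q_def)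
 have fR: "f g x \<in> R" if "g \<in> G" "x \<in> R" for g x using R(2)[of "fst x" "snd x" g] that by (simp add: f_def)
 have img: "card {x \<in> R. f g x \<in> Q} = card Q" if g: "g \<in> G" for g
 proof (rule bij_betw_same_card[where f="f g"], rule bij_betwI[where g="f (inverse g)"])
  show "f g \<in> {x \<in> R. f g x \<in> Q} \<rightarrow> Q" by blast
  show "f (inverse g) \<in> Q \<rightarrow> {x \<in> R. f g x \<in> Q}"
   using fR[OF grpD(4)[OF grp_G g]] QR by (auto simp: f_def)
 qed (auto simp: f_def)
 have "card G * card Q = (\<Sum>g\<in>G. \<Sum>x\<in>R. if f g x \<in> Q then 1 else 0)"
  using img fin by (simp add: sum.If_cases Int_def)
 also have "\<dots> = (\<Sum>x\<in>R. \<Sum>g\<in>G. if f g x \<in> Q then 1 else 0)" by (rule sum.swap)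
 also have "\<dots> = (\<Sum>x\<in>R. card {g \<in> G. f g x \<in> Q})" using fG by (simp add: sum.If_cases Int_def)
 finally have "3 * (card G * card Q) = (\<Sum>x\<in>R. 3 * card {g \<in> G. f g x \<in> Q})" by (simp add: sum_distrib_left)
 also have "\<dots> \<le> (\<Sum>x\<in>R. d * card G)"
 proof (rule sum_mono)
  fix x assume x: "x \<in> R"
  have "{g \<in> G. f g x \<in> Q} = {g \<in> G. prd (fst x) (cj g ` snd x) = prd (cj g ` snd x) (fst x)}"
   using fR[OF _ x] by (auto simp: Q_def f_def)
  thus "3 * card {g \<in> G. f g x \<in> Q} \<le> d * card G" using per[of "fst x" "snd x"] x by simp
 qed
 finally have "card G * (3 * card Q) \<le> card G * (d * card R)" by (simp add: ac_simps)
 thus ?thesis using grpD(8)[OF grp_G] by (simp add: Q_def)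
qed

definition same :: "gp set \<Rightarrow> gp set \<Rightarrow> bool" where
 "same H K \<longleftrightarrow> (\<exists>y\<in>G. om K = cj y ` om H)"

lemma same_sym: "same H K \<Longrightarrow> same K H"
 unfolding same_def using grpD(4)[OF grp_G] by (metis cj_img_cancel(1))

lemma same_trans: "same H K \<Longrightarrow> same K L \<Longrightarrow> same H L"
 unfolding same_def using grpD(3)[OF grp_G] by (metis cj_img_comp)

lemma same_cj: assumes "K \<in> Lam" "g \<in> G" shows "same K (cj g ` K)"
 unfolding same_def using om(4)[OF assms] assms(2) by blast

lemma omg_conj:
 assumes t: "prime t" and A: "pgr t A" "A \<subseteq> G" "A \<noteq> {1}" and B: "pgr t B" "B \<subseteq> G" "B \<noteq> {1}"
 shows "\<exists>y\<in>G. omg t B = cj y ` omg t A"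
proof -
 obtain P where P: "syl t P G" "omg t A = Mx P" "t dvd card G" by (rule omg_sylow[OF t A])
 obtain S where S: "syl t S G" "omg t B = Mx S" by (rule omg_sylow[OF t B])
 obtain y where "y \<in> G" "S = cj y ` P" using syl_conj[OF P(1) S(1) t] by blast
 thus ?thesis using Mx_cj[OF t P(3,1)] P(2) S(2) by blast
qed

lemma omg_conj_in:
 assumes t: "prime t" and A: "pgr t A" "A \<subseteq> G" "A \<noteq> {1}" and B: "pgr t B" "B \<noteq> {1}" "B \<subseteq> cj y ` omg t A" and y: "y \<in> G"
 shows "omg t B = cj y ` omg t A"
proof -
 obtain P where P: "syl t P G" "omg t A = Mx P" "t dvd card G" by (rule omg_sylow[OF t A])
 have e: "Mx (cj y ` P) = cj y ` omg t A" using Mx_cj[OF t P(3,1) y] P(2) by simp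
 show ?thesis using omg_in_Mx[OF t P(3) syl_cj_in[OF P(1) y] B(1) _ B(2)] B(3) e by simp
qed

text \<open>Write x^-1 = a (x b x^-1) with a and b in \<open>M\<close>. Then a x b = 1, so x lies in
  \<open>M\<close> and the product is only \<open>M\<close>.\<close>

lemma prd_conj_proper:
 assumes M: "maximal M" and x: "x \<in> G" shows "prd M (cj x ` M) \<noteq> G"
proof
 note m = maximalD[OF M]
 assume e: "prd M (cj x ` M) = G"
 have "inverse x \<in> G" using grpD(4)[OF grp_G x] .
 then obtain a b where ab: "a \<in> M" "b \<in> M" "inverse x = a * cj x b" unfolding e[symmetric] by (auto simp: prd_iff)
 hence "1 * inverse x = (a * x * b) * inverse x" by (simp add: cj_def mult.assoc)
 hence "a * x * b = 1" unfolding right_cancel by (rule sym)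
 hence "inverse a = x * b" using inv_unique[of a "x * b"] by (simp add: mult.assoc)
 hence "x = inverse a * inverse b" by (simp add: mult.assoc)
 hence "x \<in> M" using grpD(3,4)[OF m(1)] ab by simp
 hence "prd M (cj x ` M) \<subseteq> M" using prd_least[OF subset_refl _ m(1)] cj_img_grp[OF m(1)] by simp
 thus False using e m(2) by blast
qed

text \<open>Let M = \<open>om H\<close>, and let x be such that the conjugate of \<open>K\<close> by
  g has maximal subgroup x M x^-1. If the pair permutes, one of the two subgroups lies in the
  maximal subgroup of the other, which forces M = x M x^-1 and x in M. So at most |M| elements g are
  possible.\<close>

lemma same_count:
 assumes H: "H \<in> Lam" and K: "K \<in> Lam" and s: "same H K"
 shows "3 * card (pcj H K) \<le> card G"
proof -
 define M where "M = om H"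
 note m = maximalD[OF om(1)[OF H], folded M_def] and h = LamD[OF H]
 obtain y where y: "y \<in> G" "om K = cj y ` M" using s by (auto simp: same_def M_def)
 have "(\<lambda>g. g * y) ` pcj H K \<subseteq> M"
 proof (rule image_subsetI)
  fix g assume "g \<in> pcj H K"
  hence g: "g \<in> G" and pm: "prd H (cj g ` K) = prd (cj g ` K) H" by auto
  define x where "x = g * y" define J where "J = cj g ` K"
  have x: "x \<in> G" unfolding x_def by (rule grpD(3)[OF grp_G g y(1)])
  have J: "J \<in> Lam" unfolding J_def by (rule Lam_cj[OF K g])
  note j = LamD[OF J]
  have oJ: "om J = cj x ` M" unfolding J_def om(4)[OF K g] y(2) x_def by (rule cj_img_comp)
  have "prd H J \<subseteq> prd M (cj x ` M)" using om(3)[OF H] om(3)[OF J] oJ unfolding M_def prd_def by (intro image_mono) auto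
  moreover have "prd M (cj x ` M) \<subseteq> G" using prd_least[OF m(3) _ grp_G] maximalD(3)[OF om(1)[OF J]] oJ by simp
  ultimately have "prd H J \<noteq> G" using prd_conj_proper[OF om(1)[OF H] x] unfolding M_def by blast
  hence "J \<subseteq> M \<or> H \<subseteq> cj x ` M" using permuting_pair[OF H J] pm oJ unfolding J_def M_def by auto
  hence "M = cj x ` M"
  proof
   assume JM: "J \<subseteq> M"
   have e: "cj (inverse x) ` omg (lp J) (core {lp J} J) = M" using oJ by (simp add: om_def)
   have "omg (lp J) (core {lp J} J) = cj (inverse x) ` omg (lp J) (core {lp J} J)"
    by (rule omg_conj_in[OF j(4,5,7,8) j(5,8) _ grpD(4)[OF grp_G x]]) (unfold e, use JM j(6) in blast)
   thus ?thesis using oJ e by (simp add: om_def)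
  next
   assume HM: "H \<subseteq> cj x ` M"
   have "omg (lp H) (core {lp H} H) = cj x ` omg (lp H) (core {lp H} H)"
    by (rule omg_conj_in[OF h(4,5,7,8) h(5,8) _ x]) (use HM h(6) in "auto simp: M_def om_def")
   thus ?thesis by (simp add: M_def om_def)
  qed
  hence "x \<in> nz G M" using x by (simp add: nz_def)
  moreover have "M \<noteq> {1}" using om(3)[OF H] h(1) H grpD(2)[OF h(1)] unfolding M_def Lam_def by blast
  hence "nz G M = M" using m(4)[OF proper_nz(1) nz_self[OF m(1,3)] proper_nz(2)] m by blast
  ultimately show "g * y \<in> M" by (simp add: x_def)
 qed
 hence "card ((\<lambda>g. g * y) ` pcj H K) \<le> card M" by (rule card_mono[OF grpD(1)[OF m(1)]])
 hence "card (pcj H K) \<le> card M" by (subst (asm) card_image) (simp_all add: inj_on_def)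
 thus ?thesis using proper_third[OF grp_G m(1,2) odd_order] by linarith
qed

text \<open>Three independent commuting conjugates of \<open>z\<close>: at most one of them lies in a given conjugate of \<open>M\<close>.\<close>

lemma conjugates_in_maximal:
 assumes M: "maximal M" and q: "prime q" and z: "z \<in> G" "z \<noteq> 1" "z ^ q = 1"
  and nc: "\<not> (\<exists>y\<in>G. M = cj y ` omg q (cyc z))"
 shows "3 * card {g \<in> G. cj g z \<in> M} \<le> card G"
proof -
 note m = maximalD[OF M]
 have cz: "pgr q (cyc z)" "cyc z \<subseteq> G" "cyc z \<noteq> {1}"
  using pgr_cyc[OF grp_G z(1), of q 1] z(3) q grp_cyc(2)[OF grp_G z(1)] cyc_self[of z] z(2) by (simp, blast, metis singletonD)
 obtain Z where Z: "syl q Z G" "cyc z \<subseteq> Z" "q dvd card G" by (rule omg_sylow[OF q cz])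
 have zZ: "z \<in> Z" using Z(2) cyc_self by blast
 \<comment> \<open>Transfer provides an n normalizing Z that moves z; the three conjugates are z and
   its images under n and n^2.\<close>
 have "z \<notin> cz G (nz G Z)" using sylow_centralizer_normalizer[OF q Z(3,1)] zZ z(2) by blast
 then obtain n where n: "n \<in> nz G Z" "z * n \<noteq> n * z" using z(1) by (auto simp: cz_def)
 have nG: "n \<in> G" using n(1) nz_sub by blast
 note aZ = sylow_abelian[OF q Z(3,1)]
 have nz_cyc: "cj k z = z" if k: "k \<in> G" "cj k z \<in> cyc z" for k
 proof -
  have "k \<in> nz G (cyc z)"
  proof (rule nzI[OF grpD(1)[OF pgr_grp[OF cz(1)]] k(1)])
   fix a assume "a \<in> cyc z"
   then obtain i where "a = z ^ i" by (auto simp: cyc_def)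
   thus "cj k a \<in> cyc z" using grpD(5)[OF pgr_grp[OF cz(1)] k(2)] by (simp add: cj_pow)
  qed
  hence "k \<in> cz G (cyc z)"
   using normalizer_prime_order[OF Good_G pgr_grp[OF cz(1)] cz(2) card_cyc_prime[OF grp_G z q] q] by simp
  thus ?thesis by (simp add: cz_def cj_eq_iff)
 qed
 have i1: "cj n z \<notin> cyc z" using nz_cyc[OF nG] n(2) by (auto simp: cj_eq_iff)
 \<comment> \<open>As \<open>G\<close> has odd order, n is a power of n^2, so n^2 moves z as
   well.\<close>
 have i2: "cj (n * n) z \<notin> cyc z"
 proof
  assume "cj (n * n) z \<in> cyc z"
  hence "cj (n * n) z = z" by (rule nz_cyc[OF grpD(3)[OF grp_G nG nG]])
  hence nn: "n * n \<in> cz G {z}" using grpD(3)[OF grp_G nG nG] by (simp add: cz_def cj_eq_iff)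
  have "odd (od n)" using pow_card(2)[OF grp_G nG] odd_order dvd_trans by blast
  then obtain j where j: "od n = Suc (2 * j)" by (metis oddE Suc_eq_plus1)
  have "(n * n) ^ Suc j = n ^ Suc (od n)" unfolding j power2_eq_square[symmetric] power_mult[symmetric] by simp
  hence "n = (n * n) ^ Suc j" using od(2)[OF grp_G nG] by simp
  hence "n \<in> cz G {z}" using grpD(5)[OF grp_cz[OF grp_G] nn] by metis
  thus False using n(2) by (auto simp: cz_def)
 qed
 have cjZ: "cj n w \<in> Z" if "w \<in> Z" for w using nz_D[OF n(1) that] .
 \<comment> \<open>If one g carried two independent conjugates into \<open>M\<close>, the noncyclic
   group they generate would force \<open>M\<close> to be a conjugate of
   \<open>omg q (cyc z)\<close>.\<close>
 have two: False if a: "a \<in> Z" "a ^ q = 1" "\<exists>k\<in>G. a = cj k z" and b: "b \<in> Z" "b ^ q = 1" "b \<notin> cyc a"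
  and g: "g \<in> G" "cj g a \<in> M" "cj g b \<in> M" for a b g
 proof -
  obtain k where k: "k \<in> G" "a = cj k z" using a(3) by blast
  have "cj g b \<notin> cyc (cj g a)" using b(3) by (auto simp: cyc_def simp flip: cj_pow)
  moreover have "cj g a \<noteq> 1" using k(2) z(2) by simp
  moreover have "cj g a * cj g b = cj g b * cj g a" using abD[OF aZ a(1) b(1)] by (simp flip: cj_mult)
  moreover have "cj g a ^ q = 1" "cj g b ^ q = 1" using a(2) b(2) by (simp_all flip: cj_pow)
  ultimately have "M \<subseteq> omg q (cyc (cj g a))" using omg_noncyclic[OF q m(1,2) g(2,3)] by blast
  moreover have "cyc (cj g a) = cj (g * k) ` cyc z" unfolding k(2) cj_cj by (simp add: cyc_def image_image cj_pow)
  ultimately have le: "M \<subseteq> cj (g * k) ` omg q (cyc z)" using omg_cj[OF q cz grpD(3)[OF grp_G g(1) k(1)]] by simp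
  have gk: "g * k \<in> G" by (rule grpD(3)[OF grp_G g(1) k(1)])
  note m' = maximalD[OF maximal_cj[OF omg_maximal[OF q cz] gk]]
  show False using m(4)[OF m'(1) le m'(2)] nc gk by blast
 qed
 define T where "T a = {g \<in> G. cj g a \<in> M}" for a
 have fT: "finite (T a)" for a using grpD(1)[OF grp_G] by (simp add: T_def)
 have shift: "card (T (cj k z)) = card (T z)" if k: "k \<in> G" for k
 proof (rule bij_betw_same_card[where f="\<lambda>g. g * k"], rule bij_betwI[where g="\<lambda>g. g * inverse k"])
  show "(\<lambda>g. g * k) \<in> T (cj k z) \<rightarrow> T z" using grpD(3)[OF grp_G _ k] by (auto simp: T_def cj_cj)
  show "(\<lambda>g. g * inverse k) \<in> T z \<rightarrow> T (cj k z)" using grpD(3)[OF grp_G _ grpD(4)[OF grp_G k]] by (auto simp: T_def cj_cj mult.assoc)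
 qed (simp_all add: mult.assoc)
 define z1 where "z1 = cj n z" define z2 where "z2 = cj (n * n) z"
 have zz: "z1 \<in> Z" "z2 \<in> Z" "z1 ^ q = 1" "z2 ^ q = 1"
  using cjZ[OF zZ] cjZ[OF cjZ[OF zZ]] z(3) by (simp_all add: z1_def z2_def cj_cj flip: cj_pow)
 have i3: "z2 \<notin> cyc z1"
 proof
  assume "z2 \<in> cyc z1"
  then obtain i where "cj n (cj n z) = cj n (z ^ i)" by (auto simp: z1_def z2_def cyc_def cj_cj cj_pow)
  thus False using i1 by simp
 qed
 have k: "\<exists>k\<in>G. z = cj k z" "\<exists>k\<in>G. z1 = cj k z" using grpD(2)[OF grp_G] nG by (auto simp: z1_def intro: bexI[of _ 1])
 have "T z \<inter> T z1 = {}" "T z \<inter> T z2 = {}" "T z1 \<inter> T z2 = {}"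
  using two[OF zZ z(3) k(1) zz(1,3) i1[folded z1_def]] two[OF zZ z(3) k(1) zz(2,4) i2[folded z2_def]] two[OF zz(1,3) k(2) zz(2,4) i3]
  unfolding T_def by blast+
 hence "card (T z \<union> T z1 \<union> T z2) = card (T z) + card (T z1) + card (T z2)"
  using fT by (simp add: card_Un_disjoint Int_Un_distrib2)
 moreover have "card (T z \<union> T z1 \<union> T z2) \<le> card G" by (rule card_mono[OF grpD(1)[OF grp_G]]) (auto simp: T_def)
 ultimately show ?thesis using shift[OF nG] shift[OF grpD(3)[OF grp_G nG nG]] by (simp add: T_def z1_def z2_def)
qed

text \<open>An element z of prime order in the core defining \<open>om K\<close> already determines
  \<open>om K\<close>, and a conjugate of \<open>K\<close> inside \<open>om H\<close> brings a
  conjugate of z with it.\<close>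

lemma different_count_half:
 assumes H: "H \<in> Lam" and K: "K \<in> Lam" and d: "\<not> same K H"
 shows "3 * card {g \<in> G. cj g ` K \<subseteq> om H} \<le> card G"
proof -
 note k = LamD[OF K]
 obtain z where z: "z \<in> core {lp K} K" "z \<noteq> 1" "z ^ lp K = 1" using pgr_order_p[OF k(5,4,8)] by blast
 have zG: "z \<in> G" using z(1) k(7) by blast
 note gc = grp_cyc(1,2)[OF pgr_grp[OF k(5)] z(1)]
 have "cyc z \<noteq> {1}" using cyc_self[of z] z(2) by (metis singletonD)
 hence o: "omg (lp K) (cyc z) = om K" unfolding om_def by (rule omg_mono[OF k(4,5,7) gc])
 have "{g \<in> G. cj g ` K \<subseteq> om H} \<subseteq> {g \<in> G. cj g z \<in> om H}" using z(1) k(6) by blast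
 hence "card {g \<in> G. cj g ` K \<subseteq> om H} \<le> card {g \<in> G. cj g z \<in> om H}" using grpD(1)[OF grp_G] by (intro card_mono) auto
 moreover have "3 * card {g \<in> G. cj g z \<in> om H} \<le> card G"
  by (rule conjugates_in_maximal[OF om(1)[OF H] k(4) zG z(2,3)]) (use d o in "simp add: same_def")
 ultimately show ?thesis by linarith
qed

text \<open>A permuting pair places one subgroup in the maximal subgroup of the other, and each of
  the two possibilities accounts for at most a third of \<open>G\<close>; inversion of g exchanges
  their roles.\<close>

lemma different_count:
 assumes H: "H \<in> Lam" and K: "K \<in> Lam" and d: "\<not> same H K" and nf: "\<And>A B. A \<in> Lam \<Longrightarrow> B \<in> Lam \<Longrightarrow> prd A B \<noteq> G"
 shows "3 * card (pcj H K) \<le> 2 * card G"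
proof -
 define T1 where "T1 = {g \<in> G. cj g ` K \<subseteq> om H}"
 define T2 where "T2 = {g \<in> G. cj g ` H \<subseteq> om K}"
 have fin: "finite T1" "finite T2" using grpD(1)[OF grp_G] by (auto simp: T1_def T2_def)
 have "pcj H K \<subseteq> T1 \<union> inverse ` T2"
 proof
  fix g assume "g \<in> pcj H K"
  hence g: "g \<in> G" and pm: "prd H (cj g ` K) = prd (cj g ` K) H" by auto
  have J: "cj g ` K \<in> Lam" by (rule Lam_cj[OF K g])
  have "cj g ` K \<subseteq> om H \<or> H \<subseteq> cj g ` om K" using permuting_pair[OF H J pm nf[OF H J]] om(4)[OF K g] by simp
  thus "g \<in> T1 \<union> inverse ` T2"
  proof
   assume "H \<subseteq> cj g ` om K"
   hence "cj (inverse g) ` H \<subseteq> om K" using image_mono[of H "cj g ` om K" "cj (inverse g)"] by simp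
   hence "inverse g \<in> T2" using grpD(4)[OF grp_G g] by (simp add: T2_def)
   thus ?thesis by (intro UnI2 image_eqI[of _ _ "inverse g"]) auto
  qed (use g in "simp add: T1_def")
 qed
 hence "card (pcj H K) \<le> card (T1 \<union> inverse ` T2)" using fin by (intro card_mono) auto
 also have "\<dots> \<le> card T1 + card T2" using card_Un_le[of T1 "inverse ` T2"] card_image_le[OF fin(2), of inverse] by linarith
 finally show ?thesis
  using different_count_half[OF H K] different_count_half[OF K H d] d same_sym[of K H] unfolding T1_def T2_def by fastforce
qed

text \<open>For t = \<open>lp J\<close> a Sylow t-subgroup of \<open>G\<close> has rank at least
  three and splits along the factorization, so \<open>H\<close> or \<open>K\<close> contains a
  noncyclic t-subgroup. Its \<open>om\<close> is then attached to a t-subgroup, and all such maximal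
  subgroups are conjugate to \<open>om J\<close>.\<close>

lemma factorization_classes:
 assumes H: "H \<in> Lam" and K: "K \<in> Lam" and f: "prd H K = G" and J: "J \<in> Lam" shows "same H J \<or> same K J"
proof -
 note h = LamD[OF H] and k = LamD[OF K] and j = LamD[OF J]
 define t where "t = lp J"
 note t = j(4)[folded t_def]
 have td: "t dvd card G" unfolding t_def by (rule p_dvd[OF j(4,5,7,8)])
 obtain T A B where T: "syl t T G" "grp A" "grp B" "A \<subseteq> H" "B \<subseteq> K" "T = prd A B"
  by (rule sylow_prd[OF grp_G f h(1) k(1) t])
 note l = large_factor[OF t sylD(2)[OF T(1)] sylD(4)[OF T(1)] sylow_rank_three[OF t td T(1)] T(2,3,6)]
 have "same E J" if E: "E \<in> Lam" "\<exists>C. pgr t C \<and> C \<noteq> {1} \<and> C \<subseteq> G \<and> om E = omg t C" for E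
 proof -
  obtain C where C: "pgr t C" "C \<noteq> {1}" "C \<subseteq> G" "om E = omg t C" using E(2) by blast
  show ?thesis using omg_conj[OF t C(1,3,2) j(5,7,8)[folded t_def]] C(4) by (simp add: same_def om_def[of J] t_def)
 qed
 note sm = this
 show ?thesis using l(3)
 proof
  assume "t < card (Om t A)" thus ?thesis using sm[OF H om_noncyclic(1)[OF H t T(2,4) l(1)]] by simp
 next
  assume "t < card (Om t B)" thus ?thesis using sm[OF K om_noncyclic(1)[OF K t T(3,5) l(2)]] by simp
 qed
qed

text \<open>At least n^2/3 of the pairs do not permute. Without a factorization at most a third of
  the pairs inside a class and two thirds of the others permute. With one there are at most two
  classes, so at least half of all pairs lie inside a class, and two thirds of these fail to
  permute.\<close>

theorem contradiction: False
proof -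
 define n where "n = card Lam"
 define Rs where "Rs = {(H, K). H \<in> Lam \<and> K \<in> Lam \<and> same H K}"
 define Rd where "Rd = {(H, K). H \<in> Lam \<and> K \<in> Lam \<and> \<not> same H K}"
 define Ps where "Ps = {(H, K) \<in> Rs. prd H K = prd K H}"
 define Pd where "Pd = {(H, K) \<in> Rd. prd H K = prd K H}"
 define NP where "NP = {(H, K). H \<in> Lam \<and> K \<in> Lam \<and> prd H K \<noteq> prd K H}"
 have fL: "finite Lam" using finite_subs[OF grp_G] by (simp add: Lam_def)
 have e: "Lam \<times> Lam = Rs \<union> Rd" "Rs \<inter> Rd = {}" "Lam \<times> Lam = Ps \<union> Pd \<union> NP" by (auto simp: Rs_def Rd_def Ps_def Pd_def NP_def)
 have fin: "finite Rs" "finite Rd" using e(1) fL by (metis finite_Un finite_cartesian_product)+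
 have cR: "n * n = card Rs + card Rd"
  using card_Un_disjoint[OF fin e(2)] e(1) by (simp add: n_def flip: card_cartesian_product)
 have cN: "n * n \<le> card Ps + card Pd + card NP"
  using card_Un_le[of "Ps \<union> Pd" NP] card_Un_le[of Ps Pd] e(3) unfolding n_def card_cartesian_product[symmetric] by simp
 have ps: "3 * card Ps \<le> 1 * card Rs" unfolding Ps_def
  by (rule count_permuting) (auto simp: Rs_def intro: Lam_cj same_trans same_cj same_count)
 have np: "n * n \<le> 3 * card NP"
 proof (cases "\<exists>H\<in>Lam. \<exists>K\<in>Lam. prd H K = G")
  case False
  have "3 * card Pd \<le> 2 * card Rd" unfolding Pd_def
  proof (rule count_permuting)
   fix H K g assume r: "(H, K) \<in> Rd" "g \<in> G"
   hence "H \<in> Lam" "K \<in> Lam" "\<not> same H K" by (auto simp: Rd_def)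
   thus "(H, cj g ` K) \<in> Rd" using Lam_cj[of K g] same_trans[of H "cj g ` K" K] same_sym[OF same_cj[of K g]] r(2) by (auto simp: Rd_def)
  qed (use different_count False in "auto simp: Rd_def")
  thus ?thesis using ps cR cN by linarith
 next
  case True
  then obtain H K where HK: "H \<in> Lam" "K \<in> Lam" "prd H K = G" by blast
  define C where "C = {J \<in> Lam. same H J}"
  define c where "c = card C" define c' where "c' = card (Lam - C)"
  have CL: "C \<subseteq> Lam" by (auto simp: C_def)
  have cc: "n = c + c'" unfolding n_def c_def c'_def using card_Un_disjoint[of C "Lam - C"] CL fL finite_subset[OF CL fL] by (simp add: Un_absorb1)
  have "C \<times> C \<union> (Lam - C) \<times> (Lam - C) \<subseteq> Rs"
   using factorization_classes[OF HK] same_trans same_sym unfolding C_def Rs_def by blast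
  hence "card (C \<times> C \<union> (Lam - C) \<times> (Lam - C)) \<le> card Rs" by (rule card_mono[OF fin(1)])
  also have "card (C \<times> C \<union> (Lam - C) \<times> (Lam - C)) = c * c + c' * c'"
   using fL finite_subset[OF CL fL] by (subst card_Un_disjoint) (auto simp: card_cartesian_product c_def c'_def)
  finally have cs: "c * c + c' * c' \<le> card Rs" .
  have "n * n \<le> 2 * (c * c + c' * c')"
  proof -
   have "0 \<le> (int c - int c') * (int c - int c')" by simp
   hence "int (n * n) \<le> int (2 * (c * c + c' * c'))" unfolding cc by (simp add: algebra_simps)
   thus ?thesis by linarith
  qed
  hence "n * n \<le> 2 * card Rs" using mult_le_mono2[OF cs, of 2] by (rule le_trans)
  moreover have "card Pd \<le> card Rd" unfolding Pd_def by (rule card_mono[OF fin(2)]) auto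
  ultimately show ?thesis using ps cR cN by linarith
 qed
 have NPs: "NP \<subseteq> subs G \<times> subs G" by (auto simp: NP_def Lam_def)
 have "25 * card NP < 2 * (card (subs G))\<^sup>2"
  by (rule dense_nonpermuting[OF Good_dense[OF Good_G] grp_G NPs]) (auto simp: NP_def)
 moreover have "card (subs G) \<le> n + 2"
 proof -
  have "subs G \<subseteq> Lam \<union> {{1}, G}" by (auto simp: Lam_def)
  hence "card (subs G) \<le> card (Lam \<union> {{1}, G})" using fL by (intro card_mono) auto
  also have "\<dots> \<le> n + card {{1}, G}" unfolding n_def by (rule card_Un_le)
  also have "card {{1}, G} \<le> 2" by (simp add: card_insert_if)
  finally show ?thesis by simp
 qed
 hence "(card (subs G))\<^sup>2 \<le> (n + 2) * (n + 2)" using power_mono[of "card (subs G)" "n + 2" 2] by (simp add: power2_eq_square)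
 ultimately have "25 * (n * n) < 6 * ((n + 2) * (n + 2))" using np by linarith
 \<comment> \<open>For n = 2 the quantities 25 n^2 and 6 (n + 2)^2 are 100 and 96, and the gap grows
   with n; so two proper non-trivial subgroups suffice to absorb {1} and \<open>G\<close>.\<close>
 moreover have "2 \<le> n"
 proof -
  have "card G \<noteq> 1" using grp_card_one[OF grp_G] G_nontriv by simp
  then obtain p where p: "prime p" "p dvd card G" using prime_factor_nat by blast
  obtain P where P: "syl p P G" using syl_exists[OF grp_G p(1)] by blast
  note gP = sylD(3)[OF P]
  have "p ^ 3 \<le> card P" using sylow_rank_three[OF p P] card_mono[OF grpD(1)[OF gP], of "Om p P"] by (auto simp: Om_def)
  hence pc: "p < card P" using prime_less_cube[OF p(1)] by linarith
  obtain x where x: "x \<in> P" "x \<noteq> 1" "x ^ p = 1" using pgr_order_p[OF sylD(2)[OF P] p(1) sylow_nontriv[OF p P]] by blast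
  have "card (cyc x) = p" by (rule card_cyc_prime[OF gP x p(1)])
  hence "cyc x \<noteq> P" "cyc x \<noteq> G" "cyc x \<noteq> {1}"
   using pc card_mono[OF grpD(1)[OF grp_G] sylD(4)[OF P]] prime_gt_1_nat[OF p(1)] by auto
  hence "{P, cyc x} \<subseteq> Lam" "P \<noteq> cyc x"
   using gP sylD(4)[OF P] grp_cyc[OF gP x(1)] sylow_nontriv[OF p P] pgr_proper[OF sylD(2)[OF P] p(1)] by (auto simp: Lam_def subs_def)
  thus ?thesis unfolding n_def using card_mono[OF fL, of "{P, cyc x}"] by simp
 qed
 then obtain i where "n = i + 2" by (metis add.commute le_Suc_ex)
 ultimately show False by (simp add: algebra_simps)
qed

end

section \<open>Good groups are solvable\<close>

text \<open>A perfect subgroup of least order, divided by a proper normal subgroup of largest order,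
  is a minimal counterexample.\<close>

lemma Good_solv:
 assumes L: "Good L" shows "solv L"
proof (rule ccontr)
 assume ns: "\<not> solv L"
 have gL: "grp L" by (rule Good_grp[OF L])
 define Q where "Q K \<longleftrightarrow> grp K \<and> K \<subseteq> L \<and> der K = K \<and> K \<noteq> {1}" for K
 obtain K0 where Q0: "Q K0" using ns gL unfolding solv_def Q_def by blast
 obtain K where K: "Q K" "\<And>K'. Q K' \<Longrightarrow> card K \<le> card K'"
  by (rule min_card_obtain[where P=Q, OF Q0]) (rule that)
 have k: "grp K" "K \<subseteq> L" "der K = K" "K \<noteq> {1}" using K(1) by (auto simp: Q_def)
 have sub_solv: "solv H" if H: "grp H" "H \<subset> K" for H
  unfolding solv_def
 proof (intro conjI allI impI H(1))
  fix M assume M: "grp M" "M \<subseteq> H" "der M = M"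
  show "M = {1}"
  proof (rule ccontr)
   assume "M \<noteq> {1}"
   hence "Q M" unfolding Q_def using M H(2) k(2) by blast
   hence "card K \<le> card M" by (rule K(2))
   moreover have "M \<subset> K" using M(2) H(2) by blast
   hence "card M < card K" by (rule psubset_card_mono[OF grpD(1)[OF k(1)]])
   ultimately show False by simp
  qed
 qed
 define S where "S N \<longleftrightarrow> nml N K \<and> N \<noteq> K" for N
 have S1: "S {1}" unfolding S_def using nml_one[OF k(1)] k(4) by blast
 have "\<forall>N. S N \<longrightarrow> card N < Suc (card K)"
  unfolding S_def using card_mono[OF grpD(1)[OF k(1)]] nmlD(3) by (auto simp: less_Suc_eq_le)
 hence "\<exists>N. S N \<and> (\<forall>N'. S N' \<longrightarrow> card N' \<le> card N)" by (rule ex_has_greatest_nat[where P=S and f=card, OF S1])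
 then obtain N where N: "S N" "\<And>N'. S N' \<Longrightarrow> card N' \<le> card N" by blast
 have nN: "nml N K" "N \<noteq> K" using N(1) by (auto simp: S_def)
 obtain f :: "gp \<Rightarrow> gp" where f: "ghom f K" "ker f K = N" using quotient_exists[OF nN(1)] by blast
 have full: "M = f ` K" if "K \<subseteq> pre f K M" "M \<subseteq> f ` K" for M using that by (auto simp: pre_def)
 have "minimal_counterexample (f ` K)"
 proof
  show "Good (f ` K)" by (rule Good_img[OF Good_sub[OF L k(1,2)] f(1)])
  show "f ` K \<noteq> {1}"
  proof
   assume e: "f ` K = {1}"
   have "K \<subseteq> ker f K" unfolding ker_def using e by blast
   thus False using f(2) nN nmlD(3)[OF nN(1)] by blast
  qed
  show "der (f ` K) = f ` K" using der_img[OF f(1) k(1) subset_refl] k(3) by simp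
  fix M assume M: "nml M (f ` K)"
  have n: "nml (pre f K M) K" by (rule nml_pre[OF f(1) M])
  have sub: "N \<subseteq> pre f K M" unfolding f(2)[symmetric] using grpD(2)[OF nmlD(1)[OF M]] by (auto simp: ker_def pre_def)
  show "M = {1} \<or> M = f ` K"
  proof (cases "pre f K M = K")
   case True thus ?thesis using full nmlD(3)[OF M] by simp
  next
   case False
   hence "card (pre f K M) \<le> card N" using N(2) n by (simp add: S_def)
   hence "N = pre f K M" by (rule subgroup_eq_card[OF nmlD(1)[OF n] sub])
   hence "f x = 1" if "x \<in> pre f K M" for x using that unfolding f(2)[symmetric] by (auto simp: ker_def)
   hence "f ` pre f K M \<subseteq> {1}" by (intro image_subsetI) simp
   thus ?thesis using img_pre[OF nmlD(3)[OF M]] grpD(2)[OF nmlD(1)[OF M]] by auto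
  qed
 next
  fix H assume H: "grp H" "H \<subset> f ` K"
  have g: "grp (pre f K H)" by (rule grp_pre[OF f(1) H(1)])
  have "pre f K H \<noteq> K" using full[of H] H(2) by auto
  hence s: "solv (pre f K H)" using sub_solv[OF g] pre_sub[of f K H] by blast
  have "H \<subseteq> f ` K" using H(2) by blast
  thus "solv H" using solv_img[OF ghom_sub[OF f(1) g pre_sub] s] img_pre by metis
 qed
 thus False by (rule minimal_counterexample.contradiction)
qed

section \<open>Transfer to the group record\<close>

lemma sd_iso:
 assumes F: "group F" and F': "group F'" and h: "h \<in> iso F F'" shows "sd F = sd F'"
proof -
 interpret F: group F by (rule F)
 interpret F': group F' by (rule F')
 have hom: "group_hom F F' h" using F F' h by (simp add: group_hom_def group_hom_axioms_def iso_def)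
 have bij: "bij_betw h (carrier F) (carrier F')" using h by (simp add: iso_def)
 define g where "g = inv_into (carrier F) h"
 have "g \<in> iso F' F" unfolding g_def by (rule F.iso_set_sym[OF h])
 hence hom': "group_hom F' F g" using F F' by (simp add: group_hom_def group_hom_axioms_def iso_def)
 have hg: "h (g y) = y" if "y \<in> carrier F'" for y using bij that unfolding g_def by (simp add: bij_betw_inv_into_right)
 define S where "S = subgroups_of F"
 have SC: "H \<subseteq> carrier F" if "H \<in> S" for H using that subgroup.subset by (auto simp: S_def subgroups_of_def)
 have im: "(`) h ` S = subgroups_of F'"
 proof
  show "(`) h ` S \<subseteq> subgroups_of F'"
   using group_hom.subgroup_img_is_subgroup[OF hom] by (auto simp: S_def subgroups_of_def)
  show "subgroups_of F' \<subseteq> (`) h ` S"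
  proof
   fix K assume "K \<in> subgroups_of F'"
   hence K: "subgroup K F'" by (simp add: subgroups_of_def)
   have "g ` K \<in> S" using group_hom.subgroup_img_is_subgroup[OF hom' K] by (simp add: S_def subgroups_of_def)
   moreover have "h ` g ` K = K" using hg subgroup.subset[OF K] by (force simp: image_image)
   ultimately show "K \<in> (`) h ` S" by (metis imageI)
  qed
 qed
 have ii: "inj_on h (carrier F)" using bij by (simp add: bij_betw_def)
 have inj: "inj_on ((`) h) S" using inj_on_image_eq_iff[OF ii SC SC] by (auto simp: inj_on_def)
 have sm: "h ` (H <#>\<^bsub>F\<^esub> K) = h ` H <#>\<^bsub>F'\<^esub> h ` K" "H <#>\<^bsub>F\<^esub> K \<subseteq> carrier F" if "H \<in> S" "K \<in> S" for H K
 proof -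
  have C: "H \<subseteq> carrier F" "K \<subseteq> carrier F" using SC that by blast+
  thus "H <#>\<^bsub>F\<^esub> K \<subseteq> carrier F" by (rule F.set_mult_closed)
  have "h (x \<otimes>\<^bsub>F\<^esub> y) = h x \<otimes>\<^bsub>F'\<^esub> h y" if "x \<in> H" "y \<in> K" for x y
   using group_hom.hom_mult[OF hom] C that by blast
  thus "h ` (H <#>\<^bsub>F\<^esub> K) = h ` H <#>\<^bsub>F'\<^esub> h ` K" by (simp add: set_mult_def image_UN)
 qed
 have eq: "h ` H <#>\<^bsub>F'\<^esub> h ` K = h ` K <#>\<^bsub>F'\<^esub> h ` H \<longleftrightarrow> H <#>\<^bsub>F\<^esub> K = K <#>\<^bsub>F\<^esub> H" if "H \<in> S" "K \<in> S" for H K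
  unfolding sm(1)[OF that, symmetric] sm(1)[OF that(2,1), symmetric]
  by (rule inj_on_image_eq_iff[OF ii sm(2)[OF that] sm(2)[OF that(2,1)]])
 define P where "P = {(H, K). H \<in> S \<and> K \<in> S \<and> H <#>\<^bsub>F\<^esub> K = K <#>\<^bsub>F\<^esub> H}"
 have "{(H, K). H \<in> subgroups_of F' \<and> K \<in> subgroups_of F' \<and> H <#>\<^bsub>F'\<^esub> K = K <#>\<^bsub>F'\<^esub> H}
   = map_prod ((`) h) ((`) h) ` P"
  unfolding im[symmetric]
 proof (intro equalityI subsetI)
  fix x assume "x \<in> {(H, K). H \<in> (`) h ` S \<and> K \<in> (`) h ` S \<and> H <#>\<^bsub>F'\<^esub> K = K <#>\<^bsub>F'\<^esub> H}"
  then obtain H K where "x = (h ` H, h ` K)" "H \<in> S" "K \<in> S" "h ` H <#>\<^bsub>F'\<^esub> h ` K = h ` K <#>\<^bsub>F'\<^esub> h ` H" by blast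
  thus "x \<in> map_prod ((`) h) ((`) h) ` P" by (intro image_eqI[of _ _ "(H, K)"]) (simp_all add: P_def eq)
 next
  fix x assume "x \<in> map_prod ((`) h) ((`) h) ` P"
  then obtain H K where "x = (h ` H, h ` K)" "H \<in> S" "K \<in> S" "H <#>\<^bsub>F\<^esub> K = K <#>\<^bsub>F\<^esub> H" by (auto simp: P_def)
  thus "x \<in> {(H, K). H \<in> (`) h ` S \<and> K \<in> (`) h ` S \<and> H <#>\<^bsub>F'\<^esub> K = K <#>\<^bsub>F'\<^esub> H}" by (simp add: eq)
 qed
 moreover have "inj_on (map_prod ((`) h) ((`) h)) P"
  by (rule inj_on_subset[OF map_prod_inj_on[OF inj inj]]) (auto simp: P_def)
 moreover have "card (subgroups_of F') = card S" unfolding im[symmetric] by (rule card_image[OF inj])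
 ultimately show ?thesis unfolding sd_def by (simp add: card_image P_def S_def)
qed

lemma sd_rec: assumes "grp L" shows "sd (rec L) = real (card (pp L)) / (real (card (subs L)))\<^sup>2"
proof -
 have "subgroups_of (rec L) = subs L" using subgroup_rec[OF assms] by (auto simp: subgroups_of_def subs_def)
 moreover have "A <#>\<^bsub>rec L\<^esub> B = prd A B" for A B by (auto simp: set_mult_def prd_def)
 ultimately show ?thesis by (simp add: sd_def pp_def)
qed

lemma dense_sd: assumes "grp L" "sd (rec L) > 23/25" shows "dense L"
proof -
 have "L \<in> subs L" using assms(1) by (simp add: subs_def)
 hence c: "0 < card (subs L)" using finite_subs[OF assms(1)] by (auto simp: card_gt_0_iff)
 hence "23 / 25 * (real (card (subs L)))\<^sup>2 < real (card (pp L))"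
  using assms by (simp add: sd_rec less_divide_eq)
 hence "real (23 * (card (subs L))\<^sup>2) < real (25 * card (pp L))" by simp
 thus ?thesis unfolding dense_def by (simp only: of_nat_less_iff)
qed

text \<open>Induction along the derived series, which descends strictly because no non-trivial
  subgroup is perfect; at each step the two descriptions of the derived subgroup are
  identified.\<close>

lemma solv_solvable_seq:
 assumes A: "solv A" and D: "grp D" "D \<subseteq> A" shows "solvable_seq (rec A) D"
 using D
proof (induction "card D" arbitrary: D rule: less_induct)
 case less
 have gA: "grp A" by (rule solv_grp[OF A])
 interpret R: group "rec A" by (rule group_rec[OF gA])
 show ?case
 proof (cases "D = {1}")
  case True thus ?thesis using solvable_seq.unity[of "rec A"] by simp
 next
  case False
  have sD: "subgroup D (rec A)" using subgroup_rec[OF gA] less.prems by blast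
  have DA: "D \<subseteq> carrier (rec A)" using less.prems by simp
  have e: "derived_set (rec A) D = (\<Union>x\<in>D. \<Union>y\<in>D. {cm x y})"
  proof (intro SUP_cong refl)
   fix x y assume "x \<in> D" "y \<in> D"
   hence "x \<in> A" "y \<in> A" using less.prems(2) by blast+
   thus "{x \<otimes>\<^bsub>rec A\<^esub> y \<otimes>\<^bsub>rec A\<^esub> inv\<^bsub>rec A\<^esub> x \<otimes>\<^bsub>rec A\<^esub> inv\<^bsub>rec A\<^esub> y} = {cm x y}"
    by (simp add: cm_def inv_rec[OF gA])
  qed
  have gd: "grp (der D)" "der D \<subset> D" using grp_der[OF less.prems(1)] solv_der[OF A less.prems False] .
  have "subgroup (der D) (rec A)" using subgroup_rec[OF gA] gd less.prems(2) by blast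
  hence "derived (rec A) D \<subseteq> der D" unfolding derived_def
   unfolding e by (rule R.generate_subgroup_incl[rotated]) (use cm_in_der in blast)
  moreover have "der D \<subseteq> derived (rec A) D"
  proof (rule der_least)
   show "grp (derived (rec A) D)" using R.derived_is_subgroup[OF DA] subgroup_rec[OF gA] by blast
   fix x y assume "x \<in> D" "y \<in> D"
   thus "cm x y \<in> derived (rec A) D" unfolding derived_def e by (intro generate.incl) blast
  qed
  ultimately have "derived (rec A) D = der D" by (rule equalityI)
  moreover have "solvable_seq (rec A) (der D)"
   by (rule less.hyps[OF psubset_card_mono[OF grpD(1)[OF less.prems(1)] gd(2)] gd(1)]) (use gd(2) less.prems(2) in blast)
  ultimately show ?thesis using R.augment_solvable_seq[OF sD] by simp
 qed
qed

text \<open>Sections are indexed by pairs of subsets of the carrier, so their degrees form a finite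
  set and \<open>Min\<close> is a genuine lower bound.\<close>

lemma sd_star_le:
 assumes "finite (carrier G)" "F \<in> sections G" shows "sd_star G \<le> sd F"
proof -
 have "sections G \<subseteq> (\<lambda>(H, N). (G\<lparr>carrier := H\<rparr>) Mod N) ` (Pow (carrier G) \<times> Pow (carrier G))"
 proof
  fix F assume "F \<in> sections G"
  then obtain H N where HN: "F = (G\<lparr>carrier := H\<rparr>) Mod N" "subgroup H G" "N \<lhd> (G\<lparr>carrier := H\<rparr>)" by (auto simp: sections_def)
  have "N \<subseteq> H" using subgroup.subset[OF normal_imp_subgroup[OF HN(3)]] by simp
  thus "F \<in> (\<lambda>(H, N). (G\<lparr>carrier := H\<rparr>) Mod N) ` (Pow (carrier G) \<times> Pow (carrier G))"
   using HN(1) subgroup.subset[OF HN(2)] by (intro image_eqI[of _ _ "(H, N)"]) auto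
 qed
 hence "finite (sections G)" by (rule finite_subset) (use assms(1) in simp)
 thus ?thesis unfolding sd_star_def using assms(2) by simp
qed

theorem theorem2:
 fixes G :: "('a, 'b) monoid_scheme"
 assumes "group G" and "finite (carrier G)" and "sd_star G > 23/25"
 shows "solvable G"
proof -
 interpret G: group G by (rule assms(1))
 obtain i :: "'a \<Rightarrow> gp" where i: "inj_on i (carrier G)"
  "\<And>x y. x \<in> carrier G \<Longrightarrow> y \<in> carrier G \<Longrightarrow> i (x \<otimes>\<^bsub>G\<^esub> y) = i x * i y"
  using cayley[OF assms(1,2)] by blast
 have i1: "i \<one>\<^bsub>G\<^esub> = 1" using i(2)[of "\<one>\<^bsub>G\<^esub>" "\<one>\<^bsub>G\<^esub>"] right_cancel[of "i \<one>\<^bsub>G\<^esub>" "i \<one>\<^bsub>G\<^esub>" 1] by simp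
 have iinv: "inverse (i x) = i (inv\<^bsub>G\<^esub> x)" if "x \<in> carrier G" for x
  using i(2)[OF that G.inv_closed[OF that]] G.r_inv[OF that] i1 by (intro inv_unique) simp
 define A where "A = i ` carrier G"
 have gA: "grp A"
 proof (rule grpI)
  show "finite A" using assms(2) by (simp add: A_def)
  show "1 \<in> A" unfolding A_def using i1 G.one_closed by (metis imageI)
  show "x * y \<in> A" if "x \<in> A" "y \<in> A" for x y
   using that i(2)[symmetric] G.m_closed by (auto simp: A_def)
  show "inverse x \<in> A" if "x \<in> A" for x using that iinv G.inv_closed by (auto simp: A_def)
 qed
 have "Good A" unfolding Good_def
 proof (intro conjI allI impI gA)
  fix H :: "gp set" and f :: "gp \<Rightarrow> gp"
  assume H: "grp H" "H \<subseteq> A" "ghom f H"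
  \<comment> \<open>The subgroup of \<open>G\<close> corresponding to \<open>H\<close>. Its quotient
    by the kernel of f \<circ> i is a section of \<open>G\<close>, isomorphic to the image of
    \<open>H\<close> under f.\<close>
  define H' where "H' = {x \<in> carrier G. i x \<in> H}"
  define G' where "G' = G\<lparr>carrier := H'\<rparr>"
  have sH: "subgroup H' G"
  proof (rule subgroup.intro)
   show "H' \<subseteq> carrier G" by (auto simp: H'_def)
   show "x \<otimes>\<^bsub>G\<^esub> y \<in> H'" if "x \<in> H'" "y \<in> H'" for x y
    using that i(2) grpD(3)[OF H(1)] by (simp add: H'_def)
   show "\<one>\<^bsub>G\<^esub> \<in> H'" using i1 grpD(2)[OF H(1)] by (simp add: H'_def)
   show "inv\<^bsub>G\<^esub> x \<in> H'" if "x \<in> H'" for x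
    using that grpD(4)[OF H(1)] by (simp add: H'_def flip: iinv)
  qed
  have gG': "group G'" unfolding G'_def by (rule G.subgroup_imp_group[OF sH])
  have gf: "grp (f ` H)" by (rule grp_img[OF H(3)])
  have "i ` H' = H" using H(2) by (auto simp: H'_def A_def)
  hence "f ` i ` H' = f ` H" by (rule arg_cong)
  moreover have "carrier G' = H'" by (simp add: G'_def)
  ultimately have im: "(f \<circ> i) ` carrier G' = carrier (rec (f ` H))" by (simp only: image_comp rec_simps)
  have gh: "group_hom G' (rec (f ` H)) (f \<circ> i)"
   unfolding group_hom_def group_hom_axioms_def
  proof (intro conjI gG' group_rec[OF gf])
   show "f \<circ> i \<in> hom G' (rec (f ` H))" unfolding hom_def
    using i(2) ghomD(2)[OF H(3)] by (auto simp: G'_def H'_def)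
  qed
  define N where "N = kernel G' (rec (f ` H)) (f \<circ> i)"
  have nN: "N \<lhd> G'" unfolding N_def by (rule group_hom.normal_kernel[OF gh])
  have iso: "(\<lambda>C. the_elem ((f \<circ> i) ` C)) \<in> iso (G' Mod N) (rec (f ` H))"
   unfolding N_def by (rule group_hom.FactGroup_iso_set[OF gh im])
  have "G' Mod N \<in> sections G" using sH nN unfolding sections_def G'_def by blast
  hence "sd (G' Mod N) > 23/25" using sd_star_le[OF assms(2)] assms(3) by fastforce
  hence "sd (rec (f ` H)) > 23/25" using sd_iso[OF normal.factorgroup_is_group[OF nN] group_rec[OF gf] iso] by simp
  thus "dense (f ` H)" by (rule dense_sd[OF gf])
 qed
 hence "solvable_seq (rec A) A" by (intro solv_solvable_seq[OF Good_solv gA subset_refl])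
 moreover have "group_hom G (rec A) i"
  using assms(1) group_rec[OF gA] i(2) by (auto simp: group_hom_def group_hom_axioms_def hom_def A_def)
 ultimately show ?thesis
  unfolding solvable_def using group_hom.solvable_img_imp_solvable[OF _ G.subgroup_self i(1)] by (simp add: A_def)
qed

end
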